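(* The following square of functors commutes (up to natural isomorphism): the composite $$\mathrm{Set}^{\Delta^{\mathrm{op}}}\xrightarrow{\ \mathbb{Z}[-]\ }\mathrm{Coalg}(\mathrm{Ab}^{\Delta^{\mathrm{op}}},\otimes)\xrightarrow{\ \mathrm{cobar}_\otimes\circ\rho^*\circ\mathrm{dec}^*_\otimes\ }\mathrm{Alg}(\mathrm{Ab}^{\Delta^{\mathrm{op}}}_{/\mathbb{Z}},\otimes)$$ is isomorphic to the composite $$\mathrm{Set}^{\Delta^{\mathrm{op}}}\xrightarrow{\ \mathrm{cobar}\circ\rho^*\circ\mathrm{dec}^*\ }\mathrm{Mon}^{\Delta^{\mathrm{op}}}\xrightarrow{\ \mathbb{Z}[-]\ }\mathrm{Alg}(\mathrm{Ab}^{\Delta^{\mathrm{op}}}_{/\mathbb{Z}},\otimes),$$ where in the first composite the classical cobar construction with respect to $(\mathrm{Ab}^{\Delta^{\mathrm{op}}}_{/\mathbb{Z}},\otimes)\to\mathcal{O}$ and in the second the one with respect to $(\mathrm{Set}^{\Delta^{\mathrm{op}}},\times)\to\mathcal{O}$ is used.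
   Context: $\otimes$ on $\mathrm{Ab}^{\Delta^{\mathrm{op}}}$ is the point-wise tensor product of simplicial abelian groups; $\mathrm{Alg}(\mathrm{Ab}^{\Delta^{\mathrm{op}}}_{/\mathbb{Z}},\otimes)$ is the category of augmented simplicial rings. $\mathbb{Z}[-]$ is the free abelian group functor applied point-wise; $\mathbb{Z}[X]$ is a coalgebra by the diagonal, $\mathbb{Z}[M]$ for a simplicial monoid $M$ is the monoid ring with its augmentation. $[n]\ast[m]=[n+m+1]$ and $[n]\ast'[m]=[n+m]$ denote concatenation without/with identification of the adjacent endpoints; $\Delta_{\mathrm{act}}\subset\Delta$ is the subcategory of endpoint-preserving maps. $(\mathrm{dec}^*X)_{[a],[b]}=X_{[a]\ast[b]}$. For a monoidal category $(\mathcal{D},\otimes)$ let $\mathcal{B}$ be the category of families $(B_{[n]})_{n\ge0}$ in $\mathcal{D}$, contravariant on $\Delta_{\mathrm{act}}$, with natural coassociative maps $B_{[n]\ast'[m]}\to B_{[n]}\otimes B_{[m]}$ and counit $B_{[0]}\to1$. The classical bar construction $\mathrm{bar}:\mathrm{Alg}(\mathcal{D})\to\mathcal{B}$ sends $R$ to $[n]\mapsto R^{\otimes n}$, with active maps acting by multiplications and insertion of units and canonical isomorphisms as comultiplications; $\mathrm{cobar}$ is its left adjoint. Given a simplicial object $A$ in $\mathcal{D}$ with natural coassociative maps $A_{[n]\ast[m]}\to A_{[n]}\otimes A_{[m]}$ and counits $A_{[n]}\to1$, $\rho^*A\in\mathcal{B}$ is its restriction to $\Delta_{\mathrm{act}}$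 with comultiplications precomposed with the canonical degeneracy $A_{[n]\ast'[m]}\to A_{[n]\ast[m]}$. These are applied with $\mathcal{D}=(\mathrm{Set}^{\Delta^{\mathrm{op}}},\times)$ and $\mathcal{D}=(\mathrm{Ab}^{\Delta^{\mathrm{op}}}_{/\mathbb Z},\otimes)$ to bisimplicial objects regarded as simplicial objects in the second variable $[b]$ with values in $\mathcal{D}$ (variable $[a]$); everything is point-wise in $[a]$. For a simplicial set $X$, $\mathrm{dec}^*X$ carries the maps $X_{[a]\ast[b]\ast[b']}\to X_{[a]\ast[b]}\times X_{[a]\ast[b']}$ given by faces. For $C\in\mathrm{Coalg}(\mathrm{Ab}^{\Delta^{\mathrm{op}}},\otimes)$, $\mathrm{dec}^*_\otimes C$ is the bisimplicial abelian group $C_{[a]\ast[b]}$ with the maps $C_{[a]\ast[b]\ast[b']}\to C_{[a]\ast[b]\ast[b']}\otimes C_{[a]\ast[b]\ast[b']}\to C_{[a]\ast[b]}\otimes C_{[a]\ast[b']}$ (comultiplication followed by faces) and the counit of $C$; the latter also provides the augmentations to $\mathbb{Z}$. *)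

theory Defs
  imports "HOL-Algebra.Free_Abelian_Groups"
begin

section \<open>Categories, functors, adjunctions\<close>

record ('o, 'm) cat =
  Obj :: "'o set"
  Arr :: "'m set"
  Dom :: "'m \<Rightarrow> 'o"
  Cod :: "'m \<Rightarrow> 'o"
  Idt :: "'o \<Rightarrow> 'm"
  Cmp :: "'m \<Rightarrow> 'm \<Rightarrow> 'm"  \<comment> \<open>\<open>Cmp C g f\<close> is \<open>g\<close> after \<open>f\<close>\<close>

definition Hom :: "('o, 'm, 'z) cat_scheme \<Rightarrow> 'o \<Rightarrow> 'o \<Rightarrow> 'm set" where
  "Hom C X Y = {f \<in> Arr C. Dom C f = X \<and> Cod C f = Y}"

text \<open>All categories below are built from objects with structure: an arrow is a triple
  \<open>(X, f, Y)\<close> of source, underlying map and target, where \<open>f\<close> ranges over the set \<open>H X Y\<close>;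
  \<open>i X\<close> is the underlying map of the identity and \<open>c X g f\<close> that of the composite of
  \<open>f\<close> (with source \<open>X\<close>) and \<open>g\<close>.\<close>

definition struct_cat ::
  "'o set \<Rightarrow> ('o \<Rightarrow> 'o \<Rightarrow> 'f set) \<Rightarrow> ('o \<Rightarrow> 'f) \<Rightarrow> ('o \<Rightarrow> 'f \<Rightarrow> 'f \<Rightarrow> 'f) \<Rightarrow> ('o, 'o \<times> 'f \<times> 'o) cat"
where
  "struct_cat Ob H i c =
    \<lparr>Obj = Ob,
     Arr = {(X, f, Y). X \<in> Ob \<and> Y \<in> Ob \<and> f \<in> H X Y},
     Dom = (\<lambda>(X, f, Y). X),
     Cod = (\<lambda>(X, f, Y). Y),
     Idt = (\<lambda>X. (X, i X, X)),
     Cmp = (\<lambda>(Y, g, Z) (X, f, Y'). (X, c X g f, Z))\<rparr>"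

definition op_cat :: "('o, 'm, 'z) cat_scheme \<Rightarrow> ('o, 'm) cat" where
  "op_cat C = \<lparr>Obj = Obj C, Arr = Arr C, Dom = Cod C, Cod = Dom C, Idt = Idt C,
     Cmp = (\<lambda>g f. Cmp C f g)\<rparr>"

definition inverse_arrows :: "('o, 'm, 'z) cat_scheme \<Rightarrow> 'm \<Rightarrow> 'm \<Rightarrow> bool" where
  "inverse_arrows C f g \<longleftrightarrow>
     f \<in> Arr C \<and> g \<in> Hom C (Cod C f) (Dom C f) \<and>
     Cmp C g f = Idt C (Dom C f) \<and> Cmp C f g = Idt C (Cod C f)"

definition iso_arr :: "('o, 'm, 'z) cat_scheme \<Rightarrow> 'm \<Rightarrow> bool" where
  "iso_arr C f \<longleftrightarrow> (\<exists>g. inverse_arrows C f g)"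

definition inv_arr :: "('o, 'm, 'z) cat_scheme \<Rightarrow> 'm \<Rightarrow> 'm" where
  "inv_arr C f = (THE g. inverse_arrows C f g)"

record ('o, 'm, 'p, 'n) fctr =
  fo :: "'o \<Rightarrow> 'p"
  fa :: "'m \<Rightarrow> 'n"

definition is_functor ::
  "('o, 'm, 'y) cat_scheme \<Rightarrow> ('p, 'n, 'z) cat_scheme \<Rightarrow> ('o, 'm, 'p, 'n) fctr \<Rightarrow> bool" where
  "is_functor C D F \<longleftrightarrow>
     (\<forall>X\<in>Obj C. fo F X \<in> Obj D \<and> fa F (Idt C X) = Idt D (fo F X)) \<and>
     (\<forall>f\<in>Arr C. fa F f \<in> Hom D (fo F (Dom C f)) (fo F (Cod C f))) \<and>
     (\<forall>f\<in>Arr C. \<forall>g\<in>Arr C. Dom C g = Cod C f \<longrightarrow>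
        fa F (Cmp C g f) = Cmp D (fa F g) (fa F f))"

definition fcomp ::
  "('p, 'n, 'q, 'l) fctr \<Rightarrow> ('o, 'm, 'p, 'n) fctr \<Rightarrow> ('o, 'm, 'q, 'l) fctr"  (infixr "\<circ>\<^sub>F" 55) where
  "G \<circ>\<^sub>F F = \<lparr>fo = (\<lambda>X. fo G (fo F X)), fa = (\<lambda>f. fa G (fa F f))\<rparr>"

definition nat_trans ::
  "('o, 'm, 'y) cat_scheme \<Rightarrow> ('p, 'n, 'z) cat_scheme \<Rightarrow>
   ('o, 'm, 'p, 'n) fctr \<Rightarrow> ('o, 'm, 'p, 'n) fctr \<Rightarrow> ('o \<Rightarrow> 'n) \<Rightarrow> bool" where
  "nat_trans C D F G t \<longleftrightarrow>
     (\<forall>X\<in>Obj C. t X \<in> Hom D (fo F X) (fo G X)) \<and>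
     (\<forall>f\<in>Arr C. Cmp D (t (Cod C f)) (fa F f) = Cmp D (fa G f) (t (Dom C f)))"

definition naturally_isomorphic ::
  "('o, 'm, 'y) cat_scheme \<Rightarrow> ('p, 'n, 'z) cat_scheme \<Rightarrow>
   ('o, 'm, 'p, 'n) fctr \<Rightarrow> ('o, 'm, 'p, 'n) fctr \<Rightarrow> bool" where
  "naturally_isomorphic C D F G \<longleftrightarrow>
     is_functor C D F \<and> is_functor C D G \<and>
     (\<exists>t. nat_trans C D F G t \<and> (\<forall>X\<in>Obj C. iso_arr D (t X)))"

definition left_adjoint ::
  "('o, 'm, 'y) cat_scheme \<Rightarrow> ('p, 'n, 'z) cat_scheme \<Rightarrow>
   ('o, 'm, 'p, 'n) fctr \<Rightarrow> ('p, 'n, 'o, 'm) fctr \<Rightarrow> bool" where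
  "left_adjoint C D L U \<longleftrightarrow>
     is_functor C D L \<and> is_functor D C U \<and>
     (\<exists>\<Phi>. (\<forall>X\<in>Obj C. \<forall>Y\<in>Obj D. bij_betw (\<Phi> X Y) (Hom D (fo L X) Y) (Hom C X (fo U Y))) \<and>
        (\<forall>f\<in>Arr C. \<forall>g\<in>Arr D. \<forall>h\<in>Hom D (fo L (Cod C f)) (Dom D g).
           \<Phi> (Dom C f) (Cod D g) (Cmp D g (Cmp D h (fa L f))) =
           Cmp C (fa U g) (Cmp C (\<Phi> (Cod C f) (Dom D g) h) f)))"


section \<open>Monoidal categories\<close>

record ('o, 'm) moncat = "('o, 'm) cat" +
  Ten :: "'o \<Rightarrow> 'o \<Rightarrow> 'o"
  TenA :: "'m \<Rightarrow> 'm \<Rightarrow> 'm"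
  One :: 'o
  Assoc :: "'o \<Rightarrow> 'o \<Rightarrow> 'o \<Rightarrow> 'm"  \<comment> \<open>\<open>(X \<otimes> Y) \<otimes> Z \<rightarrow> X \<otimes> (Y \<otimes> Z)\<close>\<close>
  Lun :: "'o \<Rightarrow> 'm"  \<comment> \<open>\<open>1 \<otimes> X \<rightarrow> X\<close>\<close>
  Run :: "'o \<Rightarrow> 'm"  \<comment> \<open>\<open>X \<otimes> 1 \<rightarrow> X\<close>\<close>

definition mk_moncat ::
  "('o, 'm) cat \<Rightarrow> ('o \<Rightarrow> 'o \<Rightarrow> 'o) \<Rightarrow> ('m \<Rightarrow> 'm \<Rightarrow> 'm) \<Rightarrow> 'o \<Rightarrow>
   ('o \<Rightarrow> 'o \<Rightarrow> 'o \<Rightarrow> 'm) \<Rightarrow> ('o \<Rightarrow> 'm) \<Rightarrow> ('o \<Rightarrow> 'm) \<Rightarrow> ('o, 'm) moncat" where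
  "mk_moncat C ten tenA u as l r = cat.extend C (moncat.fields ten tenA u as l r)"

subsection \<open>Algebras\<close>

record ('o, 'm) alg =
  acar :: 'o
  amul :: 'm
  aone :: 'm

type_synonym ('o, 'm) alg_arr = "('o, 'm) alg \<times> 'm \<times> ('o, 'm) alg"

definition is_alg :: "('o, 'm) moncat \<Rightarrow> ('o, 'm) alg \<Rightarrow> bool" where
  "is_alg D R \<longleftrightarrow>
     (let A = acar R; \<mu> = amul R; \<eta> = aone R; idA = Idt D A in
      A \<in> Obj D \<and> \<mu> \<in> Hom D (Ten D A A) A \<and> \<eta> \<in> Hom D (One D) A \<and>
      Cmp D \<mu> (TenA D \<mu> idA) = Cmp D \<mu> (Cmp D (TenA D idA \<mu>) (Assoc D A A A)) \<and>
      Cmp D \<mu> (TenA D \<eta> idA) = Lun D A \<and>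
      Cmp D \<mu> (TenA D idA \<eta>) = Run D A)"

definition Alg :: "('o, 'm) moncat \<Rightarrow> (('o, 'm) alg, ('o, 'm) alg_arr) cat" where
  "Alg D = struct_cat {R. is_alg D R}
     (\<lambda>R S. {f \<in> Hom D (acar R) (acar S).
        Cmp D f (amul R) = Cmp D (amul S) (TenA D f f) \<and> Cmp D f (aone R) = aone S})
     (\<lambda>R. Idt D (acar R)) (\<lambda>_. Cmp D)"

subsection \<open>Coalgebras\<close>

record ('o, 'm) coalg =
  ccar :: 'o
  cmul :: 'm
  cone :: 'm

type_synonym ('o, 'm) coalg_arr = "('o, 'm) coalg \<times> 'm \<times> ('o, 'm) coalg"

definition is_coalg :: "('o, 'm) moncat \<Rightarrow> ('o, 'm) coalg \<Rightarrow> bool" where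
  "is_coalg D K \<longleftrightarrow>
     (let A = ccar K; \<delta> = cmul K; \<epsilon> = cone K; idA = Idt D A in
      A \<in> Obj D \<and> \<delta> \<in> Hom D A (Ten D A A) \<and> \<epsilon> \<in> Hom D A (One D) \<and>
      Cmp D (Assoc D A A A) (Cmp D (TenA D \<delta> idA) \<delta>) = Cmp D (TenA D idA \<delta>) \<delta> \<and>
      Cmp D (Lun D A) (Cmp D (TenA D \<epsilon> idA) \<delta>) = idA \<and>
      Cmp D (Run D A) (Cmp D (TenA D idA \<epsilon>) \<delta>) = idA)"

definition Coalg :: "('o, 'm) moncat \<Rightarrow> (('o, 'm) coalg, ('o, 'm) coalg_arr) cat" where
  "Coalg D = struct_cat {K. is_coalg D K}
     (\<lambda>K L. {f \<in> Hom D (ccar K) (ccar L).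
        Cmp D (cmul L) f = Cmp D (TenA D f f) (cmul K) \<and> Cmp D (cone L) f = cone K})
     (\<lambda>K. Idt D (ccar K)) (\<lambda>_. Cmp D)"

subsection \<open>The slice over the unit object\<close>

type_synonym ('o, 'm) aug = "'o \<times> 'm"
type_synonym ('o, 'm) aug_arr = "('o, 'm) aug \<times> 'm \<times> ('o, 'm) aug"

definition aug_ten :: "('o, 'm) moncat \<Rightarrow> ('o, 'm) aug \<Rightarrow> ('o, 'm) aug \<Rightarrow> ('o, 'm) aug" where
  "aug_ten D A B = (Ten D (fst A) (fst B), Cmp D (Lun D (One D)) (TenA D (snd A) (snd B)))"

definition aug_one :: "('o, 'm) moncat \<Rightarrow> ('o, 'm) aug" where
  "aug_one D = (One D, Idt D (One D))"

definition Over_One :: "('o, 'm) moncat \<Rightarrow> (('o, 'm) aug, ('o, 'm) aug_arr) moncat" where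
  "Over_One D = mk_moncat
     (struct_cat {(X, e). X \<in> Obj D \<and> e \<in> Hom D X (One D)}
        (\<lambda>(X, e) (Y, e'). {f \<in> Hom D X Y. Cmp D e' f = e})
        (\<lambda>A. Idt D (fst A)) (\<lambda>_. Cmp D))
     (aug_ten D)
     (\<lambda>(A, f, A') (B, g, B'). (aug_ten D A B, TenA D f g, aug_ten D A' B'))
     (aug_one D)
     (\<lambda>A B C. (aug_ten D (aug_ten D A B) C, Assoc D (fst A) (fst B) (fst C),
                aug_ten D A (aug_ten D B C)))
     (\<lambda>A. (aug_ten D (aug_one D) A, Lun D (fst A), A))
     (\<lambda>A. (aug_ten D A (aug_one D), Run D (fst A), A))"


section \<open>The simplex category\<close>

type_synonym darr = "nat \<times> (nat \<Rightarrow> nat) \<times> nat"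

text \<open>The object \<open>n\<close> is the ordinal \<open>[n] = {0, \<dots>, n}\<close>.\<close>

definition Delta :: "(nat, darr) cat" where
  "Delta = struct_cat UNIV
     (\<lambda>n m. {\<theta> \<in> {..n} \<rightarrow>\<^sub>E {..m}. mono_on {..n} \<theta>})
     (\<lambda>n. \<lambda>i\<in>{..n}. i) (\<lambda>n g f. compose {..n} g f)"

definition Delta_act :: "(nat, darr) cat" where
  "Delta_act = struct_cat UNIV
     (\<lambda>n m. {\<theta> \<in> {..n} \<rightarrow>\<^sub>E {..m}. mono_on {..n} \<theta> \<and> \<theta> 0 = 0 \<and> \<theta> n = m})
     (\<lambda>n. \<lambda>i\<in>{..n}. i) (\<lambda>n g f. compose {..n} g f)"

text \<open>The effect on arrows of \<open>[n] * [m] = [n + m + 1]\<close>, and on endpoint-preserving arrows of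
  \<open>[n] *' [m] = [n + m]\<close>.\<close>

definition join :: "darr \<Rightarrow> darr \<Rightarrow> darr" where
  "join = (\<lambda>(n, \<alpha>, n') (m, \<beta>, m').
     (n + m + 1,
      \<lambda>i\<in>{..n + m + 1}. if i \<le> n then \<alpha> i else n' + 1 + \<beta> (i - (n + 1)),
      n' + m' + 1))"

definition join_act :: "darr \<Rightarrow> darr \<Rightarrow> darr" where
  "join_act = (\<lambda>(n, \<alpha>, n') (m, \<beta>, m').
     (n + m, \<lambda>i\<in>{..n + m}. if i \<le> n then \<alpha> i else n' + \<beta> (i - n), n' + m'))"

definition join_inl :: "nat \<Rightarrow> nat \<Rightarrow> darr" where  \<comment> \<open>\<open>[n] \<rightarrow> [n] * [m]\<close>\<close>
  "join_inl n m = (n, \<lambda>i\<in>{..n}. i, n + m + 1)"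

definition join_inr :: "nat \<Rightarrow> nat \<Rightarrow> darr" where  \<comment> \<open>\<open>[m] \<rightarrow> [n] * [m]\<close>\<close>
  "join_inr n m = (m, \<lambda>i\<in>{..m}. n + 1 + i, n + m + 1)"

definition join_collapse :: "nat \<Rightarrow> nat \<Rightarrow> darr" where
  \<comment> \<open>\<open>[n] * [m] \<rightarrow> [n] *' [m]\<close>, identifying the two adjacent endpoints\<close>
  "join_collapse n m = (n + m + 1, \<lambda>i\<in>{..n + m + 1}. if i \<le> n then i else i - 1, n + m)"


section \<open>Simplicial objects\<close>

type_synonym ('o, 'm) simp = "(nat, darr, 'o, 'm) fctr"
type_synonym ('o, 'm) simp_arr = "('o, 'm) simp \<times> (nat \<Rightarrow> 'm) \<times> ('o, 'm) simp"

definition simp_ten :: "('o, 'm) moncat \<Rightarrow> ('o, 'm) simp \<Rightarrow> ('o, 'm) simp \<Rightarrow> ('o, 'm) simp" where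
  "simp_ten D X Y = \<lparr>fo = (\<lambda>n. Ten D (fo X n) (fo Y n)), fa = (\<lambda>\<alpha>. TenA D (fa X \<alpha>) (fa Y \<alpha>))\<rparr>"

definition simp_one :: "('o, 'm) moncat \<Rightarrow> ('o, 'm) simp" where
  "simp_one D = \<lparr>fo = (\<lambda>_. One D), fa = (\<lambda>_. Idt D (One D))\<rparr>"

definition Simp :: "('o, 'm) moncat \<Rightarrow> (('o, 'm) simp, ('o, 'm) simp_arr) moncat" where
  "Simp D = mk_moncat
     (struct_cat {X. is_functor (op_cat Delta) D X}
        (\<lambda>X Y. {t. nat_trans (op_cat Delta) D X Y t})
        (\<lambda>X n. Idt D (fo X n)) (\<lambda>_ s t n. Cmp D (s n) (t n)))
     (simp_ten D)
     (\<lambda>(X, s, X') (Y, t, Y'). (simp_ten D X Y, \<lambda>n. TenA D (s n) (t n), simp_ten D X' Y'))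
     (simp_one D)
     (\<lambda>X Y Z. (simp_ten D (simp_ten D X Y) Z, \<lambda>n. Assoc D (fo X n) (fo Y n) (fo Z n),
                simp_ten D X (simp_ten D Y Z)))
     (\<lambda>X. (simp_ten D (simp_one D) X, \<lambda>n. Lun D (fo X n), X))
     (\<lambda>X. (simp_ten D X (simp_one D), \<lambda>n. Run D (fo X n), X))"

definition simp_map ::
  "('o, 'm, 'p, 'n) fctr \<Rightarrow> (('o, 'm) simp, ('o, 'm) simp_arr, ('p, 'n) simp, ('p, 'n) simp_arr) fctr"
where
  "simp_map G = \<lparr>fo = (\<lambda>X. G \<circ>\<^sub>F X), fa = (\<lambda>(X, t, Y). (G \<circ>\<^sub>F X, \<lambda>n. fa G (t n), G \<circ>\<^sub>F Y))\<rparr>"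


section \<open>The bar construction\<close>

subsection \<open>The category \<open>\<B>\<close>\<close>

record ('o, 'm) bob =
  bfun :: "('o, 'm) simp"
  bmul :: "nat \<Rightarrow> nat \<Rightarrow> 'm"  \<comment> \<open>\<open>bmul B n m : B\<^sub>n\<^sub>+\<^sub>m \<rightarrow> B\<^sub>n \<otimes> B\<^sub>m\<close>\<close>
  bone :: 'm  \<comment> \<open>\<open>B\<^sub>0 \<rightarrow> 1\<close>\<close>

type_synonym ('o, 'm) bob_arr = "('o, 'm) bob \<times> (nat \<Rightarrow> 'm) \<times> ('o, 'm) bob"

definition is_bob :: "('o, 'm) moncat \<Rightarrow> ('o, 'm) bob \<Rightarrow> bool" where
  "is_bob D B \<longleftrightarrow>
     (let F = bfun B; \<delta> = bmul B; \<epsilon> = bone B; idF = (\<lambda>n. Idt D (fo F n)) in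
      is_functor (op_cat Delta_act) D F \<and>
      (\<forall>n m. \<delta> n m \<in> Hom D (fo F (n + m)) (Ten D (fo F n) (fo F m))) \<and>
      \<epsilon> \<in> Hom D (fo F 0) (One D) \<and>
      (\<forall>\<alpha>\<in>Arr Delta_act. \<forall>\<beta>\<in>Arr Delta_act.
         Cmp D (\<delta> (Dom Delta_act \<alpha>) (Dom Delta_act \<beta>)) (fa F (join_act \<alpha> \<beta>)) =
         Cmp D (TenA D (fa F \<alpha>) (fa F \<beta>)) (\<delta> (Cod Delta_act \<alpha>) (Cod Delta_act \<beta>))) \<and>
      (\<forall>n m k.
         Cmp D (Assoc D (fo F n) (fo F m) (fo F k))
           (Cmp D (TenA D (\<delta> n m) (idF k)) (\<delta> (n + m) k)) =
         Cmp D (TenA D (idF n) (\<delta> m k)) (\<delta> n (m + k))) \<and>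
      (\<forall>n. Cmp D (Lun D (fo F n)) (Cmp D (TenA D \<epsilon> (idF n)) (\<delta> 0 n)) = idF n) \<and>
      (\<forall>n. Cmp D (Run D (fo F n)) (Cmp D (TenA D (idF n) \<epsilon>) (\<delta> n 0)) = idF n))"

definition Bcat :: "('o, 'm) moncat \<Rightarrow> (('o, 'm) bob, ('o, 'm) bob_arr) cat" where
  "Bcat D = struct_cat {B. is_bob D B}
     (\<lambda>B C. {t. nat_trans (op_cat Delta_act) D (bfun B) (bfun C) t \<and>
        (\<forall>n m. Cmp D (bmul C n m) (t (n + m)) = Cmp D (TenA D (t n) (t m)) (bmul B n m)) \<and>
        Cmp D (bone C) (t 0) = bone B})
     (\<lambda>B n. Idt D (fo (bfun B) n)) (\<lambda>_ s t n. Cmp D (s n) (t n))"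

subsection \<open>The functor \<open>bar\<close>\<close>

primrec tpow :: "('o, 'm) moncat \<Rightarrow> 'o \<Rightarrow> nat \<Rightarrow> 'o" where
  "tpow D A 0 = One D"
| "tpow D A (Suc n) = Ten D A (tpow D A n)"

primrec tpow_arr :: "('o, 'm) moncat \<Rightarrow> 'm \<Rightarrow> nat \<Rightarrow> 'm" where
  "tpow_arr D f 0 = Idt D (One D)"
| "tpow_arr D f (Suc n) = TenA D f (tpow_arr D f n)"

text \<open>The canonical isomorphism \<open>A\<^sup>n\<^sup>+\<^sup>m \<rightarrow> A\<^sup>n \<otimes> A\<^sup>m\<close>.\<close>

primrec tpow_split :: "('o, 'm) moncat \<Rightarrow> 'o \<Rightarrow> nat \<Rightarrow> nat \<Rightarrow> 'm" where
  "tpow_split D A 0 m = inv_arr D (Lun D (tpow D A m))"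
| "tpow_split D A (Suc n) m =
     Cmp D (inv_arr D (Assoc D A (tpow D A n) (tpow D A m))) (TenA D (Idt D A) (tpow_split D A n m))"

text \<open>The iterated multiplication \<open>R\<^sup>n \<rightarrow> R\<close>, which for \<open>n = 0\<close> is the unit.\<close>

primrec alg_prod :: "('o, 'm) moncat \<Rightarrow> ('o, 'm) alg \<Rightarrow> nat \<Rightarrow> 'm" where
  "alg_prod D R 0 = aone R"
| "alg_prod D R (Suc n) = Cmp D (amul R) (TenA D (Idt D (acar R)) (alg_prod D R n))"

text \<open>\<open>bar_act D R n m \<theta> : R\<^sup>m \<rightarrow> R\<^sup>n\<close> for an endpoint-preserving \<open>\<theta> : [n] \<rightarrow> [m]\<close>; its \<open>i\<close>-th factor
  multiplies the factors \<open>\<theta> (i - 1) + 1, \<dots>, \<theta> i\<close> of \<open>R\<^sup>m\<close>. If \<open>n = 0\<close> then \<open>m = 0\<close>.\<close>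

primrec bar_act :: "('o, 'm) moncat \<Rightarrow> ('o, 'm) alg \<Rightarrow> nat \<Rightarrow> nat \<Rightarrow> (nat \<Rightarrow> nat) \<Rightarrow> 'm" where
  "bar_act D R 0 = (\<lambda>m \<theta>. Idt D (One D))"
| "bar_act D R (Suc n) = (\<lambda>m \<theta>.
     Cmp D (TenA D (alg_prod D R (\<theta> 1)) (bar_act D R n (m - \<theta> 1) (\<lambda>i. \<theta> (Suc i) - \<theta> 1)))
       (tpow_split D (acar R) (\<theta> 1) (m - \<theta> 1)))"

definition bar_ob :: "('o, 'm) moncat \<Rightarrow> ('o, 'm) alg \<Rightarrow> ('o, 'm) bob" where
  "bar_ob D R =
    \<lparr>bfun = \<lparr>fo = tpow D (acar R), fa = (\<lambda>(n, \<theta>, m). bar_act D R n m \<theta>)\<rparr>,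
     bmul = tpow_split D (acar R),
     bone = Idt D (One D)\<rparr>"

definition bar ::
  "('o, 'm) moncat \<Rightarrow> (('o, 'm) alg, ('o, 'm) alg_arr, ('o, 'm) bob, ('o, 'm) bob_arr) fctr" where
  "bar D = \<lparr>fo = bar_ob D, fa = (\<lambda>(R, f, S). (bar_ob D R, tpow_arr D f, bar_ob D S))\<rparr>"

text \<open>\<open>cobar\<close> is the left adjoint of \<open>bar\<close>, determined up to natural isomorphism. Since a map
  \<open>B \<rightarrow> bar R\<close> is determined by its component \<open>B\<^sub>1 \<rightarrow> R\<close>, it can be realised as the quotient of the free
  algebra on \<open>B\<^sub>1\<close> by the relations coming from \<open>[1] \<rightarrow> [2]\<close> and \<open>[1] \<rightarrow> [0]\<close>.\<close>

abbreviation is_cobar ::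
  "('o, 'm) moncat \<Rightarrow> (('o, 'm) bob, ('o, 'm) bob_arr, ('o, 'm) alg, ('o, 'm) alg_arr) fctr \<Rightarrow> bool"
where
  "is_cobar D L \<equiv> left_adjoint (Bcat D) (Alg D) L (bar D)"

subsection \<open>The functor \<open>\<rho>\<^sup>*\<close>\<close>

record ('o, 'm) scob =
  sfun :: "('o, 'm) simp"
  smul :: "nat \<Rightarrow> nat \<Rightarrow> 'm"  \<comment> \<open>\<open>smul A n m : A\<^sub>n\<^sub>*\<^sub>m \<rightarrow> A\<^sub>n \<otimes> A\<^sub>m\<close>\<close>
  sone :: "nat \<Rightarrow> 'm"  \<comment> \<open>\<open>sone A n : A\<^sub>n \<rightarrow> 1\<close>\<close>

type_synonym ('o, 'm) scob_arr = "('o, 'm) scob \<times> (nat \<Rightarrow> 'm) \<times> ('o, 'm) scob"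

text \<open>Restriction to \<open>Delta_act\<close> leaves the underlying functor unchanged as a term, since
  \<open>Delta_act\<close> is a subcategory of \<open>Delta\<close>.\<close>

definition rho_ob :: "('o, 'm) moncat \<Rightarrow> ('o, 'm) scob \<Rightarrow> ('o, 'm) bob" where
  "rho_ob D A =
    \<lparr>bfun = sfun A,
     bmul = (\<lambda>n m. Cmp D (smul A n m) (fa (sfun A) (join_collapse n m))),
     bone = sone A 0\<rparr>"

definition rho ::
  "('o, 'm) moncat \<Rightarrow> (('o, 'm) scob, ('o, 'm) scob_arr, ('o, 'm) bob, ('o, 'm) bob_arr) fctr" where
  "rho D = \<lparr>fo = rho_ob D, fa = (\<lambda>(A, t, A'). (rho_ob D A, t, rho_ob D A'))\<rparr>"


section \<open>Sets and abelian groups\<close>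

text \<open>The universe is an infinite type \<open>'u\<close>: sets are the subsets of \<open>'u\<close>, and abelian groups have
  a carrier in \<open>'u\<close>; up to isomorphism these are the sets and abelian groups of cardinality
  at most that of \<open>'u\<close>. Products, tensor products and free abelian groups of such
  objects are first built in another type, again with cardinality at most that of \<open>'u\<close>, and
  then transported into \<open>'u\<close> along the chosen injection \<open>emb S\<close>. The free monoids and tensor
  algebras needed for cobar respect this bound as well.\<close>

definition emb :: "'a set \<Rightarrow> 'a \<Rightarrow> 'u" where
  "emb S = (SOME f. inj_on f S)"

subsection \<open>Sets with the cartesian product\<close>

type_synonym 'u set_arr = "'u set \<times> ('u \<Rightarrow> 'u) \<times> 'u set"

definition pr :: "'u \<Rightarrow> 'u \<Rightarrow> 'u" where
  "pr x y = emb UNIV (x, y)"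

definition pr1 :: "'u \<Rightarrow> 'u" where
  "pr1 z = (THE x. \<exists>y. z = pr x y)"

definition pr2 :: "'u \<Rightarrow> 'u" where
  "pr2 z = (THE y. \<exists>x. z = pr x y)"

definition pt :: 'u where
  "pt = emb UNIV ()"

definition set_prod :: "'u set \<Rightarrow> 'u set \<Rightarrow> 'u set" where
  "set_prod X Y = {pr x y |x y. x \<in> X \<and> y \<in> Y}"

definition Sets :: "('u set, 'u set_arr) moncat" where
  "Sets = mk_moncat
     (struct_cat UNIV (\<lambda>X Y. X \<rightarrow>\<^sub>E Y) (\<lambda>X. \<lambda>x\<in>X. x) (\<lambda>X g f. compose X g f))
     set_prod
     (\<lambda>(X, f, X') (Y, g, Y').
        (set_prod X Y, \<lambda>z\<in>set_prod X Y. pr (f (pr1 z)) (g (pr2 z)), set_prod X' Y'))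
     {pt}
     (\<lambda>X Y Z. (set_prod (set_prod X Y) Z,
        \<lambda>z\<in>set_prod (set_prod X Y) Z. pr (pr1 (pr1 z)) (pr (pr2 (pr1 z)) (pr2 z)),
        set_prod X (set_prod Y Z)))
     (\<lambda>X. (set_prod {pt} X, \<lambda>z\<in>set_prod {pt} X. pr2 z, X))
     (\<lambda>X. (set_prod X {pt}, \<lambda>z\<in>set_prod X {pt}. pr1 z, X))"

subsection \<open>Abelian groups with the tensor product\<close>

type_synonym 'u ab_arr = "'u monoid \<times> ('u \<Rightarrow> 'u) \<times> 'u monoid"

definition trans_el :: "'a monoid \<Rightarrow> 'a \<Rightarrow> 'u" where
  "trans_el G = emb (carrier G)"

definition trans_group :: "'a monoid \<Rightarrow> 'u monoid" where
  "trans_group G =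
    (let e = trans_el G; d = inv_into (carrier G) (trans_el G) in
     \<lparr>carrier = e ` carrier G, monoid.mult = (\<lambda>x y. e (d x \<otimes>\<^bsub>G\<^esub> d y)), one = e \<one>\<^bsub>G\<^esub>\<rparr>)"

definition the_hom :: "'u monoid \<Rightarrow> 'u monoid \<Rightarrow> (('u \<Rightarrow> 'u) \<Rightarrow> bool) \<Rightarrow> 'u ab_arr" where
  "the_hom A B P = (A, THE h. h \<in> hom A B \<and> h \<in> extensional (carrier A) \<and> P h, B)"

definition bilin_rels :: "'u monoid \<Rightarrow> 'u monoid \<Rightarrow> ('u \<times> 'u \<Rightarrow>\<^sub>0 int) set" where
  "bilin_rels A B =
     {frag_of (a \<otimes>\<^bsub>A\<^esub> a', b) - frag_of (a, b) - frag_of (a', b) |a a' b.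
        a \<in> carrier A \<and> a' \<in> carrier A \<and> b \<in> carrier B} \<union>
     {frag_of (a, b \<otimes>\<^bsub>B\<^esub> b') - frag_of (a, b) - frag_of (a, b') |a b b'.
        a \<in> carrier A \<and> b \<in> carrier B \<and> b' \<in> carrier B}"

definition bilin_subgroup :: "'u monoid \<Rightarrow> 'u monoid \<Rightarrow> ('u \<times> 'u \<Rightarrow>\<^sub>0 int) set" where
  "bilin_subgroup A B =
     generate (free_Abelian_group (carrier A \<times> carrier B)) (bilin_rels A B)"

definition raw_tensor :: "'u monoid \<Rightarrow> 'u monoid \<Rightarrow> ('u \<times> 'u \<Rightarrow>\<^sub>0 int) set monoid" where
  "raw_tensor A B = free_Abelian_group (carrier A \<times> carrier B) Mod bilin_subgroup A B"

definition tensor :: "'u monoid \<Rightarrow> 'u monoid \<Rightarrow> 'u monoid" where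
  "tensor A B = trans_group (raw_tensor A B)"

definition tens :: "'u monoid \<Rightarrow> 'u monoid \<Rightarrow> 'u \<Rightarrow> 'u \<Rightarrow> 'u" where  \<comment> \<open>the element \<open>a \<otimes> b\<close>\<close>
  "tens A B a b = trans_el (raw_tensor A B)
     (bilin_subgroup A B #>\<^bsub>free_Abelian_group (carrier A \<times> carrier B)\<^esub> frag_of (a, b))"

definition ZZ :: "'u monoid" where
  "ZZ = trans_group integer_group"

definition zz :: "int \<Rightarrow> 'u" where
  "zz = trans_el integer_group"

definition Ab :: "('u monoid, 'u ab_arr) moncat" where
  "Ab = mk_moncat
     (struct_cat {A. comm_group A}
        (\<lambda>A B. {f \<in> hom A B. f \<in> extensional (carrier A)})
        (\<lambda>A. \<lambda>a\<in>carrier A. a) (\<lambda>A g f. compose (carrier A) g f))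
     tensor
     (\<lambda>(A, f, A') (B, g, B'). the_hom (tensor A B) (tensor A' B')
        (\<lambda>h. \<forall>a\<in>carrier A. \<forall>b\<in>carrier B. h (tens A B a b) = tens A' B' (f a) (g b)))
     ZZ
     (\<lambda>A B C. the_hom (tensor (tensor A B) C) (tensor A (tensor B C))
        (\<lambda>h. \<forall>a\<in>carrier A. \<forall>b\<in>carrier B. \<forall>c\<in>carrier C.
           h (tens (tensor A B) C (tens A B a b) c) = tens A (tensor B C) a (tens B C b c)))
     (\<lambda>A. the_hom (tensor ZZ A) A
        (\<lambda>h. \<forall>k::int. \<forall>a\<in>carrier A. h (tens ZZ A (zz k) a) = a [^]\<^bsub>A\<^esub> k))
     (\<lambda>A. the_hom (tensor A ZZ) A
        (\<lambda>h. \<forall>a\<in>carrier A. \<forall>k::int. h (tens A ZZ a (zz k)) = a [^]\<^bsub>A\<^esub> k))"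

subsection \<open>Free abelian groups\<close>

definition Zfree :: "'u set \<Rightarrow> 'u monoid" where
  "Zfree X = trans_group (free_Abelian_group X)"

definition zgen :: "'u set \<Rightarrow> 'u \<Rightarrow> 'u" where  \<comment> \<open>the basis element of \<open>x\<close> in \<open>\<int>[X]\<close>\<close>
  "zgen X x = trans_el (free_Abelian_group X) (frag_of x)"

definition Zfree_fun :: "('u set, 'u set_arr, 'u monoid, 'u ab_arr) fctr" where
  "Zfree_fun = \<lparr>fo = Zfree,
     fa = (\<lambda>(X, f, Y). the_hom (Zfree X) (Zfree Y) (\<lambda>h. \<forall>x\<in>X. h (zgen X x) = zgen Y (f x)))\<rparr>"

definition Zaug :: "'u set \<Rightarrow> 'u ab_arr" where
  "Zaug X = the_hom (Zfree X) ZZ (\<lambda>h. \<forall>x\<in>X. h (zgen X x) = zz 1)"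

definition Zdiag :: "'u set \<Rightarrow> 'u ab_arr" where
  "Zdiag X = the_hom (Zfree X) (tensor (Zfree X) (Zfree X))
     (\<lambda>h. \<forall>x\<in>X. h (zgen X x) = tens (Zfree X) (Zfree X) (zgen X x) (zgen X x))"

text \<open>The multiplication and unit of the monoid ring of a monoid with underlying set \<open>X\<close>,
  multiplication \<open>m : X \<times> X \<rightarrow> X\<close> and unit \<open>u : {pt} \<rightarrow> X\<close>.\<close>

definition Zmul :: "'u set \<Rightarrow> 'u set_arr \<Rightarrow> 'u ab_arr" where
  "Zmul X m = the_hom (tensor (Zfree X) (Zfree X)) (Zfree X)
     (\<lambda>h. \<forall>x\<in>X. \<forall>y\<in>X. h (tens (Zfree X) (Zfree X) (zgen X x) (zgen X y)) =
        zgen X (fst (snd m) (pr x y)))"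

definition Zunit :: "'u set \<Rightarrow> 'u set_arr \<Rightarrow> 'u ab_arr" where
  "Zunit X u = the_hom ZZ (Zfree X) (\<lambda>h. h (zz 1) = zgen X (fst (snd u) pt))"


section \<open>Simplicial sets and simplicial abelian groups\<close>

type_synonym 'u sset = "('u set, 'u set_arr) simp"
type_synonym 'u sset_arr = "('u set, 'u set_arr) simp_arr"
type_synonym 'u sab = "('u monoid, 'u ab_arr) simp"
type_synonym 'u sab_arr = "('u monoid, 'u ab_arr) simp_arr"
type_synonym 'u asab = "('u sab, 'u sab_arr) aug"
type_synonym 'u asab_arr = "('u sab, 'u sab_arr) aug_arr"

abbreviation SSet :: "('u sset, 'u sset_arr) moncat" where
  "SSet \<equiv> Simp Sets"

abbreviation SAb :: "('u sab, 'u sab_arr) moncat" where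
  "SAb \<equiv> Simp Ab"

abbreviation SAbZ :: "('u asab, 'u asab_arr) moncat" where  \<comment> \<open>\<open>1\<close> is the constant object \<open>\<int>\<close>\<close>
  "SAbZ \<equiv> Over_One SAb"

subsection \<open>The functors \<open>\<int>[-]\<close>\<close>

abbreviation Zs :: "'u sset \<Rightarrow> 'u sab" where
  "Zs \<equiv> fo (simp_map Zfree_fun)"

abbreviation Zs_arr :: "'u sset_arr \<Rightarrow> 'u sab_arr" where
  "Zs_arr \<equiv> fa (simp_map Zfree_fun)"

definition Zs_aug :: "'u sset \<Rightarrow> 'u sab_arr" where
  "Zs_aug X = (Zs X, \<lambda>n. Zaug (fo X n), One SAb)"

definition Zcoalg_ob :: "'u sset \<Rightarrow> ('u sab, 'u sab_arr) coalg" where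
  "Zcoalg_ob X = \<lparr>ccar = Zs X,
     cmul = (Zs X, \<lambda>n. Zdiag (fo X n), Ten SAb (Zs X) (Zs X)),
     cone = Zs_aug X\<rparr>"

definition Zcoalg ::
  "('u sset, 'u sset_arr, ('u sab, 'u sab_arr) coalg, ('u sab, 'u sab_arr) coalg_arr) fctr" where
  "Zcoalg = \<lparr>fo = Zcoalg_ob,
     fa = (\<lambda>f. (Zcoalg_ob (Dom SSet f), Zs_arr f, Zcoalg_ob (Cod SSet f)))\<rparr>"

text \<open>Simplicial monoids are the monoid objects in simplicial sets, i.e. the objects of \<open>Alg SSet\<close>.\<close>

definition Zalg_ob :: "('u sset, 'u sset_arr) alg \<Rightarrow> ('u asab, 'u asab_arr) alg" where
  "Zalg_ob M =
    (let X = acar M; A = (Zs X, Zs_aug X) in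
     \<lparr>acar = A,
      amul = (Ten SAbZ A A,
        (Ten SAb (Zs X) (Zs X), \<lambda>n. Zmul (fo X n) (fst (snd (amul M)) n), Zs X), A),
      aone = (One SAbZ, (One SAb, \<lambda>n. Zunit (fo X n) (fst (snd (aone M)) n), Zs X), A)\<rparr>)"

definition Zalg ::
  "(('u sset, 'u sset_arr) alg, ('u sset, 'u sset_arr) alg_arr,
    ('u asab, 'u asab_arr) alg, ('u asab, 'u asab_arr) alg_arr) fctr" where
  "Zalg = \<lparr>fo = Zalg_ob,
     fa = (\<lambda>(M, f, N). (Zalg_ob M, (acar (Zalg_ob M), Zs_arr f, acar (Zalg_ob N)), Zalg_ob N))\<rparr>"

subsection \<open>The functors \<open>dec\<^sup>*\<close>\<close>

text \<open>For a simplicial object \<open>X\<close>, \<open>dec X\<close> is the bisimplicial object \<open>X\<^bsub>[a]*[b]\<^esub>\<close> as a simplicial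
  object in the variable \<open>b\<close> with values in simplicial objects in the variable \<open>a\<close>.\<close>

definition dec_col :: "('o, 'm) simp \<Rightarrow> nat \<Rightarrow> ('o, 'm) simp" where
  "dec_col X b = \<lparr>fo = (\<lambda>a. fo X (a + b + 1)), fa = (\<lambda>\<alpha>. fa X (join \<alpha> (Idt Delta b)))\<rparr>"

definition dec :: "('o, 'm) simp \<Rightarrow> (('o, 'm) simp, ('o, 'm) simp_arr) simp" where
  "dec X = \<lparr>fo = dec_col X,
     fa = (\<lambda>\<beta>. (dec_col X (Cod Delta \<beta>), \<lambda>a. fa X (join (Idt Delta a) \<beta>), dec_col X (Dom Delta \<beta>)))\<rparr>"

text \<open>The map \<open>X\<^bsub>[a]*[b]*[b']\<^esub> \<rightarrow> X\<^bsub>[a]*[b]\<^esub> \<times> X\<^bsub>[a]*[b']\<^esub>\<close> induced by the inclusions of \<open>[b]\<close> and \<open>[b']\<close>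
  in \<open>[b]*[b']\<close>.\<close>

definition set_pair :: "'u set_arr \<Rightarrow> 'u set_arr \<Rightarrow> 'u set_arr" where
  "set_pair = (\<lambda>(X, f, Y) (X', g, Z). (X, \<lambda>x\<in>X. pr (f x) (g x), set_prod Y Z))"

definition dec_set_ob :: "'u sset \<Rightarrow> ('u sset, 'u sset_arr) scob" where
  "dec_set_ob X =
    \<lparr>sfun = dec X,
     smul = (\<lambda>b b'. (dec_col X (b + b' + 1),
        \<lambda>a. set_pair (fa X (join (Idt Delta a) (join_inl b b')))
                      (fa X (join (Idt Delta a) (join_inr b b'))),
        Ten SSet (dec_col X b) (dec_col X b'))),
     sone = (\<lambda>b. (dec_col X b, \<lambda>a. (fo X (a + b + 1), \<lambda>x\<in>fo X (a + b + 1). pt, {pt}), One SSet))\<rparr>"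

definition dec_set ::
  "('u sset, 'u sset_arr, ('u sset, 'u sset_arr) scob, ('u sset, 'u sset_arr) scob_arr) fctr" where
  "dec_set = \<lparr>fo = dec_set_ob,
     fa = (\<lambda>(X, t, Y). (dec_set_ob X,
        \<lambda>b. (dec_col X b, \<lambda>a. t (a + b + 1), dec_col Y b), dec_set_ob Y))\<rparr>"

definition dec_ten_col :: "('u sab, 'u sab_arr) coalg \<Rightarrow> nat \<Rightarrow> 'u asab" where
  "dec_ten_col K b = (dec_col (ccar K) b,
     (dec_col (ccar K) b, \<lambda>a. fst (snd (cone K)) (a + b + 1), One SAb))"

definition dec_ten_ob :: "('u sab, 'u sab_arr) coalg \<Rightarrow> ('u asab, 'u asab_arr) scob" where
  "dec_ten_ob K =
    (let X = ccar K; Q = dec_ten_col K in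
     \<lparr>sfun = \<lparr>fo = Q, fa = (\<lambda>\<beta>. (Q (Cod Delta \<beta>), fa (dec X) \<beta>, Q (Dom Delta \<beta>)))\<rparr>,
      smul = (\<lambda>b b'. (Q (b + b' + 1),
        (dec_col X (b + b' + 1),
         \<lambda>a. Cmp Ab (TenA Ab (fa X (join (Idt Delta a) (join_inl b b')))
                              (fa X (join (Idt Delta a) (join_inr b b'))))
                    (fst (snd (cmul K)) (a + (b + b' + 1) + 1)),
         Ten SAb (dec_col X b) (dec_col X b')),
        Ten SAbZ (Q b) (Q b'))),
      sone = (\<lambda>b. (Q b, snd (Q b), One SAbZ))\<rparr>)"

definition dec_ten ::
  "(('u sab, 'u sab_arr) coalg, ('u sab, 'u sab_arr) coalg_arr,
    ('u asab, 'u asab_arr) scob, ('u asab, 'u asab_arr) scob_arr) fctr" where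
  "dec_ten = \<lparr>fo = dec_ten_ob,
     fa = (\<lambda>(K, (X, t, Y), L). (dec_ten_ob K,
        \<lambda>b. (dec_ten_col K b, (dec_col X b, \<lambda>a. t (a + b + 1), dec_col Y b), dec_ten_col L b),
        dec_ten_ob L))\<rparr>"

end

theory Submission
  imports Defs
begin

text \<open>
  A morphism from a family \<open>B\<close> to the bar construction of \<open>R\<close> is determined by its
  component \<open>\<phi> : B\<^sub>1 \<rightarrow> R\<close>, and the components that arise are the twisting maps: those with
  \<open>\<phi> d = \<mu> (\<phi> \<otimes> \<phi>) \<delta>\<close> for the active map \<open>d : B\<^sub>2 \<rightarrow> B\<^sub>1\<close> and \<open>\<phi> s = \<eta> \<epsilon>\<close> for \<open>s : B\<^sub>0 \<rightarrow> B\<^sub>1\<close>.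
  So \<open>cobar B\<close> represents the twisting maps out of \<open>B\<close>.  The functor \<open>\<int>[-]\<close> from simplicial sets to
  augmented simplicial abelian groups has the right adjoint \<open>U(A,e) = {x. e x = 1}\<close>, which turns
  augmented rings into monoids, and under this adjunction the twisting maps \<open>\<int>[X\<^bsub>[a] * [1]\<^esub>] \<rightarrow> R\<close>
  are the twisting maps \<open>X\<^bsub>[a] * [1]\<^esub> \<rightarrow> U R\<close>.  Both composites therefore represent the functor of
  twisting maps from \<open>dec X\<close> to \<open>U R\<close>, and the Yoneda lemma makes them isomorphic.
\<close>

section \<open>Categories and representing families of bijections\<close>

lemma HomI: "f \<in> Arr C \<Longrightarrow> Dom C f = X \<Longrightarrow> Cod C f = Y \<Longrightarrow> f \<in> Hom C X Y"
  by (simp add: Hom_def)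

lemma HomD:
  assumes "f \<in> Hom C X Y"
  shows "f \<in> Arr C" "Dom C f = X" "Cod C f = Y"
  using assms by (simp_all add: Hom_def)

lemma Arr_Hom: "f \<in> Arr C \<Longrightarrow> f \<in> Hom C (Dom C f) (Cod C f)"
  by (simp add: Hom_def)

locale category =
  fixes C :: "('o, 'm, 'z) cat_scheme"
  assumes Idt: "X \<in> Obj C \<Longrightarrow> Idt C X \<in> Hom C X X"
    and Cmp: "f \<in> Hom C X Y \<Longrightarrow> g \<in> Hom C Y Z \<Longrightarrow> Cmp C g f \<in> Hom C X Z"
    and assoc: "f \<in> Hom C X Y \<Longrightarrow> g \<in> Hom C Y Z \<Longrightarrow> h \<in> Hom C Z W \<Longrightarrow>
       Cmp C (Cmp C h g) f = Cmp C h (Cmp C g f)"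
    and left: "f \<in> Hom C X Y \<Longrightarrow> Cmp C (Idt C Y) f = f"
    and right: "f \<in> Hom C X Y \<Longrightarrow> Cmp C f (Idt C X) = f"
    and Hom_Obj: "f \<in> Hom C X Y \<Longrightarrow> X \<in> Obj C \<and> Y \<in> Obj C"
begin

lemma Idt_simps [simp]:
  assumes "X \<in> Obj C"
  shows "Idt C X \<in> Arr C" "Dom C (Idt C X) = X" "Cod C (Idt C X) = X"
  using Idt[OF assms] by (simp_all add: Hom_def)

lemma Cmp_simps [simp]:
  assumes "f \<in> Arr C" "g \<in> Arr C" "Dom C g = Cod C f"
  shows "Cmp C g f \<in> Arr C" "Dom C (Cmp C g f) = Dom C f" "Cod C (Cmp C g f) = Cod C g"
  using Cmp[of f "Dom C f" "Cod C f" g "Cod C g"] assms by (simp_all add: Hom_def)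

lemma Cmp_assoc [simp]:
  assumes "f \<in> Arr C" "g \<in> Arr C" "h \<in> Arr C" "Dom C g = Cod C f" "Dom C h = Cod C g"
  shows "Cmp C (Cmp C h g) f = Cmp C h (Cmp C g f)"
  using assoc[of f "Dom C f" "Cod C f" g "Cod C g" h "Cod C h"] assms by (simp add: Hom_def)

lemma Cmp_Idt_left [simp]: "f \<in> Arr C \<Longrightarrow> Cod C f = X \<Longrightarrow> Cmp C (Idt C X) f = f"
  using left[of f "Dom C f" "Cod C f"] by (simp add: Hom_def)

lemma Cmp_Idt_right [simp]: "f \<in> Arr C \<Longrightarrow> Dom C f = X \<Longrightarrow> Cmp C f (Idt C X) = f"
  using right[of f "Dom C f" "Cod C f"] by (simp add: Hom_def)

lemma Arr_Obj [simp]: "f \<in> Arr C \<Longrightarrow> Dom C f \<in> Obj C" "f \<in> Arr C \<Longrightarrow> Cod C f \<in> Obj C"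
  using Hom_Obj[of f "Dom C f" "Cod C f"] by (simp_all add: Hom_def)

lemma inverse_arrows_unique:
  assumes "inverse_arrows C f g" "inverse_arrows C f h"
  shows "g = h"
proof -
  note * = assms[unfolded inverse_arrows_def Hom_def, simplified]
  have "g = Cmp C g (Cmp C f h)" using * by simp
  also have "\<dots> = Cmp C (Cmp C g f) h" using * by (subst Cmp_assoc) auto
  also have "\<dots> = h" using * by simp
  finally show ?thesis .
qed

lemma inv_arr_eq: "inverse_arrows C f g \<Longrightarrow> inv_arr C f = g"
  unfolding inv_arr_def by (rule the_equality) (auto intro: inverse_arrows_unique)

lemma inverse_arrows_inv_arr: "iso_arr C f \<Longrightarrow> inverse_arrows C f (inv_arr C f)"
  unfolding iso_arr_def using inv_arr_eq by auto

lemma inv_arr_simps [simp]: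
  assumes "iso_arr C f"
  shows "f \<in> Arr C" "inv_arr C f \<in> Arr C" "Dom C (inv_arr C f) = Cod C f" "Cod C (inv_arr C f) = Dom C f"
    "Cmp C (inv_arr C f) f = Idt C (Dom C f)" "Cmp C f (inv_arr C f) = Idt C (Cod C f)"
  using inverse_arrows_inv_arr[OF assms] by (simp_all add: inverse_arrows_def Hom_def)

lemma inv_arr_cancel [simp]:
  assumes "iso_arr C f" "h \<in> Arr C" "Cod C h = Dom C f"
  shows "Cmp C (inv_arr C f) (Cmp C f h) = h"
  using assms Cmp_assoc[of h f "inv_arr C f"] by simp

lemma inv_arr_cancel' [simp]:
  assumes "iso_arr C f" "h \<in> Arr C" "Cod C h = Cod C f"
  shows "Cmp C f (Cmp C (inv_arr C f) h) = h"
  using assms Cmp_assoc[of h "inv_arr C f" f] by simp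

lemma iso_arr_left_cancel:
  assumes "iso_arr C f" "g \<in> Arr C" "h \<in> Arr C" "Cod C g = Dom C f" "Cod C h = Dom C f"
    and "Cmp C f g = Cmp C f h"
  shows "g = h"
  using assms by (metis inv_arr_cancel)

end

lemma struct_cat_simps [simp]:
  "Obj (struct_cat Ob H i c) = Ob"
  "(X, f, Y) \<in> Arr (struct_cat Ob H i c) \<longleftrightarrow> X \<in> Ob \<and> Y \<in> Ob \<and> f \<in> H X Y"
  "Dom (struct_cat Ob H i c) (X, f, Y) = X"
  "Cod (struct_cat Ob H i c) (X, f, Y) = Y"
  "Idt (struct_cat Ob H i c) X = (X, i X, X)"
  "Cmp (struct_cat Ob H i c) (Y, g, Z) (X, f, Y') = (X, c X g f, Z)"
  "F \<in> Hom (struct_cat Ob H i c) X Y \<longleftrightarrow> (\<exists>f. F = (X, f, Y) \<and> X \<in> Ob \<and> Y \<in> Ob \<and> f \<in> H X Y)"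
  by (auto simp: struct_cat_def Hom_def)

lemma category_struct_cat:
  assumes "\<And>X. X \<in> Ob \<Longrightarrow> i X \<in> H X X"
    and "\<And>X Y Z f g. X \<in> Ob \<Longrightarrow> Y \<in> Ob \<Longrightarrow> Z \<in> Ob \<Longrightarrow> f \<in> H X Y \<Longrightarrow> g \<in> H Y Z \<Longrightarrow> c X g f \<in> H X Z"
    and "\<And>X Y Z W f g h. X \<in> Ob \<Longrightarrow> Y \<in> Ob \<Longrightarrow> Z \<in> Ob \<Longrightarrow> W \<in> Ob \<Longrightarrow>
      f \<in> H X Y \<Longrightarrow> g \<in> H Y Z \<Longrightarrow> h \<in> H Z W \<Longrightarrow> c X (c Y h g) f = c X h (c X g f)"
    and "\<And>X Y f. X \<in> Ob \<Longrightarrow> Y \<in> Ob \<Longrightarrow> f \<in> H X Y \<Longrightarrow> c X (i Y) f = f"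
    and "\<And>X Y f. X \<in> Ob \<Longrightarrow> Y \<in> Ob \<Longrightarrow> f \<in> H X Y \<Longrightarrow> c X f (i X) = f"
  shows "category (struct_cat Ob H i c)"
  by unfold_locales (auto simp: assms)

lemma mk_moncat_simps [simp]:
  "Obj (mk_moncat C ten tenA u as l r) = Obj C"
  "Arr (mk_moncat C ten tenA u as l r) = Arr C"
  "Dom (mk_moncat C ten tenA u as l r) = Dom C"
  "Cod (mk_moncat C ten tenA u as l r) = Cod C"
  "Idt (mk_moncat C ten tenA u as l r) = Idt C"
  "Cmp (mk_moncat C ten tenA u as l r) = Cmp C"
  "Ten (mk_moncat C ten tenA u as l r) = ten"
  "TenA (mk_moncat C ten tenA u as l r) = tenA"
  "One (mk_moncat C ten tenA u as l r) = u"
  "Assoc (mk_moncat C ten tenA u as l r) = as"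
  "Lun (mk_moncat C ten tenA u as l r) = l"
  "Run (mk_moncat C ten tenA u as l r) = r"
  by (simp_all add: mk_moncat_def cat.defs moncat.defs)

lemma Hom_mk_moncat [simp]: "Hom (mk_moncat C ten tenA u as l r) = Hom C"
  by (intro ext) (simp add: Hom_def)

lemma category_mk_moncat [simp]: "category (mk_moncat C ten tenA u as l r) = category C"
  by (simp add: category_def)

lemma inverse_arrows_mk_moncat [simp]:
  "inverse_arrows (mk_moncat C ten tenA u as l r) = inverse_arrows C"
  by (intro ext) (simp add: inverse_arrows_def)

lemma op_cat_simps [simp]:
  "Obj (op_cat C) = Obj C" "Arr (op_cat C) = Arr C" "Dom (op_cat C) = Cod C" "Cod (op_cat C) = Dom C"
  "Idt (op_cat C) = Idt C" "Cmp (op_cat C) g f = Cmp C f g"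
  by (simp_all add: op_cat_def)

lemma functorD:
  assumes "is_functor C D F"
  shows "X \<in> Obj C \<Longrightarrow> fo F X \<in> Obj D"
    and "X \<in> Obj C \<Longrightarrow> fa F (Idt C X) = Idt D (fo F X)"
    and "f \<in> Arr C \<Longrightarrow> fa F f \<in> Arr D"
    and "f \<in> Arr C \<Longrightarrow> Dom D (fa F f) = fo F (Dom C f)"
    and "f \<in> Arr C \<Longrightarrow> Cod D (fa F f) = fo F (Cod C f)"
    and "f \<in> Arr C \<Longrightarrow> g \<in> Arr C \<Longrightarrow> Dom C g = Cod C f \<Longrightarrow>
      fa F (Cmp C g f) = Cmp D (fa F g) (fa F f)"
  using assms by (auto simp: is_functor_def Hom_def)

lemma functor_Hom:
  assumes "is_functor C D F" "f \<in> Hom C X Y"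
  shows "fa F f \<in> Hom D (fo F X) (fo F Y)"
  using assms by (auto simp: is_functor_def Hom_def)

lemma functorI:
  assumes "\<And>X. X \<in> Obj C \<Longrightarrow> fo F X \<in> Obj D"
    and "\<And>X. X \<in> Obj C \<Longrightarrow> fa F (Idt C X) = Idt D (fo F X)"
    and "\<And>f. f \<in> Arr C \<Longrightarrow> fa F f \<in> Hom D (fo F (Dom C f)) (fo F (Cod C f))"
    and "\<And>f g. f \<in> Arr C \<Longrightarrow> g \<in> Arr C \<Longrightarrow> Dom C g = Cod C f \<Longrightarrow>
      fa F (Cmp C g f) = Cmp D (fa F g) (fa F f)"
  shows "is_functor C D F"
  using assms by (simp add: is_functor_def)

lemma fcomp_simps [simp]: "fo (G \<circ>\<^sub>F F) X = fo G (fo F X)" "fa (G \<circ>\<^sub>F F) f = fa G (fa F f)"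
  by (simp_all add: fcomp_def)

lemma is_functor_fcomp:
  assumes "is_functor C D F" "is_functor D E G"
  shows "is_functor C E (G \<circ>\<^sub>F F)"
proof (rule functorI)
  fix f g assume "f \<in> Arr C" "g \<in> Arr C" "Dom C g = Cod C f"
  then show "fa (G \<circ>\<^sub>F F) (Cmp C g f) = Cmp E (fa (G \<circ>\<^sub>F F) g) (fa (G \<circ>\<^sub>F F) f)"
    using functorD[OF assms(1)] functorD(6)[OF assms(2)] by simp
next
  fix f assume "f \<in> Arr C"
  then show "fa (G \<circ>\<^sub>F F) f \<in> Hom E (fo (G \<circ>\<^sub>F F) (Dom C f)) (fo (G \<circ>\<^sub>F F) (Cod C f))"
    using functor_Hom[OF assms(2)] functor_Hom[OF assms(1)] by (simp add: Hom_def)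
qed (use functorD[OF assms(1)] functorD[OF assms(2)] in auto)

lemma nat_transD:
  assumes "nat_trans C D F G t"
  shows "X \<in> Obj C \<Longrightarrow> t X \<in> Arr D" "X \<in> Obj C \<Longrightarrow> Dom D (t X) = fo F X" "X \<in> Obj C \<Longrightarrow> Cod D (t X) = fo G X"
    "f \<in> Arr C \<Longrightarrow> Cmp D (t (Cod C f)) (fa F f) = Cmp D (fa G f) (t (Dom C f))"
  using assms by (auto simp: nat_trans_def Hom_def)

lemma nat_trans_Cmp:
  assumes "category D" "is_functor C D F" "is_functor C D G" "is_functor C D H"
    and t: "nat_trans C D F G t" and s: "nat_trans C D G H s"
    and Obj: "\<And>f. f \<in> Arr C \<Longrightarrow> Dom C f \<in> Obj C \<and> Cod C f \<in> Obj C"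
  shows "nat_trans C D F H (\<lambda>X. Cmp D (s X) (t X))"
proof -
  interpret D: category D by fact
  note [simp] = functorD(1,3-5)[OF assms(2)] functorD(1,3-5)[OF assms(3)] functorD(1,3-5)[OF assms(4)]
    nat_transD(1-3)[OF t] nat_transD(1-3)[OF s]
  show ?thesis unfolding nat_trans_def
  proof (intro conjI ballI)
    fix f assume f: "f \<in> Arr C"
    note [simp] = f conjunct1[OF Obj[OF f]] conjunct2[OF Obj[OF f]]
    have "Cmp D (Cmp D (s (Cod C f)) (t (Cod C f))) (fa F f) = Cmp D (Cmp D (s (Cod C f)) (fa G f)) (t (Dom C f))"
      using nat_transD(4)[OF t f] by simp
    then show "Cmp D (Cmp D (s (Cod C f)) (t (Cod C f))) (fa F f) = Cmp D (fa H f) (Cmp D (s (Dom C f)) (t (Dom C f)))"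
      using nat_transD(4)[OF s f] by simp
  qed (auto intro!: HomI)
qed

lemma nat_trans_Idt:
  assumes "category D" "is_functor C D F"
    and Obj: "\<And>f. f \<in> Arr C \<Longrightarrow> Dom C f \<in> Obj C \<and> Cod C f \<in> Obj C"
  shows "nat_trans C D F F (\<lambda>X. Idt D (fo F X))"
proof -
  interpret D: category D by fact
  note [simp] = functorD(1,3-5)[OF assms(2)]
  show ?thesis using Obj by (auto simp: nat_trans_def intro!: HomI)
qed

text \<open>\<open>\<Phi>\<close> exhibits \<open>P X R\<close>, on which \<open>f : X' \<rightarrow> X\<close> and \<open>g : R \<rightarrow> R'\<close> act by \<open>act f g\<close>, as the
  profunctor \<open>Hom (L X) R\<close>.\<close>

definition represents ::
  "('o, 'm, 'y) cat_scheme \<Rightarrow> ('p, 'n, 'z) cat_scheme \<Rightarrow> ('o, 'm, 'p, 'n) fctr \<Rightarrow>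
   ('o \<Rightarrow> 'p \<Rightarrow> 'q set) \<Rightarrow> ('m \<Rightarrow> 'n \<Rightarrow> 'q \<Rightarrow> 'q) \<Rightarrow> ('o \<Rightarrow> 'p \<Rightarrow> 'n \<Rightarrow> 'q) \<Rightarrow> bool" where
  "represents C E L P act \<Phi> \<longleftrightarrow>
     is_functor C E L \<and>
     (\<forall>X\<in>Obj C. \<forall>R\<in>Obj E. bij_betw (\<Phi> X R) (Hom E (fo L X) R) (P X R)) \<and>
     (\<forall>f\<in>Arr C. \<forall>g\<in>Arr E. \<forall>h\<in>Hom E (fo L (Cod C f)) (Dom E g).
        \<Phi> (Dom C f) (Cod E g) (Cmp E g (Cmp E h (fa L f))) = act f g (\<Phi> (Cod C f) (Dom E g) h))"

lemma represents_transfer: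
  assumes "represents C E L P act \<Phi>"
    and "\<And>X R. X \<in> Obj C \<Longrightarrow> R \<in> Obj E \<Longrightarrow> bij_betw (\<Psi> X R) (P X R) (Q X R)"
    and "\<And>f g p. f \<in> Arr C \<Longrightarrow> g \<in> Arr E \<Longrightarrow> p \<in> P (Cod C f) (Dom E g) \<Longrightarrow>
      \<Psi> (Dom C f) (Cod E g) (act f g p) = act' f g (\<Psi> (Cod C f) (Dom E g) p)"
    and "category C" "category E"
  shows "represents C E L Q act' (\<lambda>X R. \<Psi> X R \<circ> \<Phi> X R)"
proof -
  interpret C: category C by fact
  interpret E: category E by fact
  have *: "\<Phi> (Cod C f) (Dom E g) h \<in> P (Cod C f) (Dom E g)"
    if "f \<in> Arr C" "g \<in> Arr E" "h \<in> Hom E (fo L (Cod C f)) (Dom E g)" for f g h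
    using assms(1) that bspec[OF bij_betwE] unfolding represents_def by (metis C.Arr_Obj(2) E.Arr_Obj(1))
  show ?thesis
    unfolding represents_def
  proof (intro conjI ballI)
    show "bij_betw (\<Psi> X R \<circ> \<Phi> X R) (Hom E (fo L X) R) (Q X R)" if "X \<in> Obj C" "R \<in> Obj E" for X R
      using assms(1) that assms(2)[OF that] unfolding represents_def by (metis bij_betw_trans)
  qed (use assms(1,3) * in \<open>auto simp: represents_def\<close>)
qed

lemma naturally_isomorphic_if_represents:
  assumes 1: "represents C E L P act \<Phi>" and 2: "represents C E L' P act \<Phi>'"
    and "category C" "category E"
  shows "naturally_isomorphic C E L L'"
proof -
  interpret C: category C by fact
  interpret E: category E by fact
  note F = functorD[OF conjunct1[OF 1[unfolded represents_def]]]
  note F' = functorD[OF conjunct1[OF 2[unfolded represents_def]]]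
  note H = functor_Hom[OF conjunct1[OF 1[unfolded represents_def]]]
  note H' = functor_Hom[OF conjunct1[OF 2[unfolded represents_def]]]
  have bij: "bij_betw (\<Phi> X R) (Hom E (fo L X) R) (P X R)"
    and bij': "bij_betw (\<Phi>' X R) (Hom E (fo L' X) R) (P X R)" if "X \<in> Obj C" "R \<in> Obj E" for X R
    using 1 2 that by (auto simp: represents_def)
  have nat: "\<Phi> X R' (Cmp E g (Cmp E h (fa L f))) = act f g (\<Phi> Y R h)"
    if "f \<in> Hom C X Y" "g \<in> Hom E R R'" "h \<in> Hom E (fo L Y) R" for f g h X Y R R'
    using 1 that by (auto simp: represents_def Hom_def)
  have nat': "\<Phi>' X R' (Cmp E g (Cmp E h (fa L' f))) = act f g (\<Phi>' Y R h)"
    if "f \<in> Hom C X Y" "g \<in> Hom E R R'" "h \<in> Hom E (fo L' Y) R" for f g h X Y R R'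
    using 2 that by (auto simp: represents_def Hom_def)
  note post = nat[OF C.Idt] nat'[OF C.Idt]
  note pre = nat[OF _ E.Idt] nat'[OF _ E.Idt]
  have id: "Idt E (fo L X) \<in> Hom E (fo L X) (fo L X)" "Idt E (fo L' X) \<in> Hom E (fo L' X) (fo L' X)"
    if "X \<in> Obj C" for X
    using that F(1) F'(1) by (auto intro: E.Idt)
  have ex: "\<exists>t. t \<in> Hom E (fo L X) (fo L' X) \<and> \<Phi> X (fo L' X) t = \<Phi>' X (fo L' X) (Idt E (fo L' X))"
    if "X \<in> Obj C" for X
    using bij[OF that F'(1)[OF that]] bij'[OF that F'(1)[OF that]] id[OF that]
    unfolding bij_betw_def by (metis (no_types, lifting) image_iff)
  have ex': "\<exists>t. t \<in> Hom E (fo L' X) (fo L X) \<and> \<Phi>' X (fo L X) t = \<Phi> X (fo L X) (Idt E (fo L X))"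
    if "X \<in> Obj C" for X
    using bij[OF that F(1)[OF that]] bij'[OF that F(1)[OF that]] id[OF that]
    unfolding bij_betw_def by (metis (no_types, lifting) image_iff)
  obtain t where t: "\<And>X. X \<in> Obj C \<Longrightarrow> t X \<in> Hom E (fo L X) (fo L' X)"
     "\<And>X. X \<in> Obj C \<Longrightarrow> \<Phi> X (fo L' X) (t X) = \<Phi>' X (fo L' X) (Idt E (fo L' X))"
    using ex by metis
  obtain s where s: "\<And>X. X \<in> Obj C \<Longrightarrow> s X \<in> Hom E (fo L' X) (fo L X)"
     "\<And>X. X \<in> Obj C \<Longrightarrow> \<Phi>' X (fo L X) (s X) = \<Phi> X (fo L X) (Idt E (fo L X))"
    using ex' by metis
  have inj: "g = h" if "X \<in> Obj C" "g \<in> Hom E (fo L X) R" "h \<in> Hom E (fo L X) R" "\<Phi> X R g = \<Phi> X R h"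
    for g h X R
    using bij[OF that(1), of R] that E.Hom_Obj by (auto simp: bij_betw_def inj_on_def)
  have inj': "g = h" if "X \<in> Obj C" "g \<in> Hom E (fo L' X) R" "h \<in> Hom E (fo L' X) R" "\<Phi>' X R g = \<Phi>' X R h"
    for g h X R
    using bij'[OF that(1), of R] that E.Hom_Obj by (auto simp: bij_betw_def inj_on_def)
  have st: "Cmp E (s X) (t X) = Idt E (fo L X)" if X: "X \<in> Obj C" for X
  proof (rule inj[OF X])
    have "\<Phi> X (fo L X) (Cmp E (s X) (t X)) = act (Idt C X) (s X) (\<Phi> X (fo L' X) (t X))"
      using post(1)[OF X s(1)[OF X] t(1)[OF X]] F(1,2)[OF X] HomD[OF t(1)[OF X]] HomD[OF s(1)[OF X]]
      by simp
    also have "\<dots> = \<Phi>' X (fo L X) (s X)"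
      using post(2)[OF X s(1)[OF X] id(2)[OF X]] F'(1,2)[OF X] HomD[OF s(1)[OF X]] t(2)[OF X]
      by simp
    finally show "\<Phi> X (fo L X) (Cmp E (s X) (t X)) = \<Phi> X (fo L X) (Idt E (fo L X))" using s(2)[OF X] by simp
  qed (use id[OF X] E.Cmp[OF t(1)[OF X] s(1)[OF X]] in auto)
  have ts: "Cmp E (t X) (s X) = Idt E (fo L' X)" if X: "X \<in> Obj C" for X
  proof (rule inj'[OF X])
    have "\<Phi>' X (fo L' X) (Cmp E (t X) (s X)) = act (Idt C X) (t X) (\<Phi>' X (fo L X) (s X))"
      using post(2)[OF X t(1)[OF X] s(1)[OF X]] F'(1,2)[OF X] HomD[OF t(1)[OF X]] HomD[OF s(1)[OF X]]
      by simp
    also have "\<dots> = \<Phi> X (fo L' X) (t X)"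
      using post(1)[OF X t(1)[OF X] id(1)[OF X]] F(1,2)[OF X] HomD[OF t(1)[OF X]] s(2)[OF X]
      by simp
    finally show "\<Phi>' X (fo L' X) (Cmp E (t X) (s X)) = \<Phi>' X (fo L' X) (Idt E (fo L' X))"
      using t(2)[OF X] by simp
  qed (use id[OF X] E.Cmp[OF s(1)[OF X] t(1)[OF X]] in auto)
  have natt: "Cmp E (t (Cod C f)) (fa L f) = Cmp E (fa L' f) (t (Dom C f))" if f: "f \<in> Arr C" for f
  proof -
    define X Y where "X = Dom C f" and "Y = Cod C f"
    have fXY: "f \<in> Hom C X Y" and X: "X \<in> Obj C" and Y: "Y \<in> Obj C"
      using f by (simp_all add: X_def Y_def Arr_Hom)
    note tX = HomD[OF t(1)[OF X]] and tY = HomD[OF t(1)[OF Y]]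
    note Lf = HomD[OF H[OF fXY]] and L'f = HomD[OF H'[OF fXY]]
    have "Cmp E (t Y) (fa L f) = Cmp E (fa L' f) (t X)"
    proof (rule inj[OF X])
      have "\<Phi> X (fo L' Y) (Cmp E (t Y) (fa L f)) = act f (Idt E (fo L' Y)) (\<Phi> Y (fo L' Y) (t Y))"
        using pre(1)[OF fXY F'(1)[OF Y] t(1)[OF Y]] F'(1)[OF Y] tY Lf by simp
      also have "\<dots> = \<Phi>' X (fo L' Y) (fa L' f)"
        using pre(2)[OF fXY F'(1)[OF Y] id(2)[OF Y]] t(2)[OF Y] F'(1)[OF Y] L'f by simp
      also have "\<dots> = act (Idt C X) (fa L' f) (\<Phi> X (fo L' X) (t X))"
        using post(2)[OF X H'[OF fXY] id(2)[OF X]] t(2)[OF X] F'(1,2)[OF X] L'f by simp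
      also have "\<dots> = \<Phi> X (fo L' Y) (Cmp E (fa L' f) (t X))"
        using post(1)[OF X H'[OF fXY] t(1)[OF X]] F(1,2)[OF X] L'f tX by simp
      finally show "\<Phi> X (fo L' Y) (Cmp E (t Y) (fa L f)) = \<Phi> X (fo L' Y) (Cmp E (fa L' f) (t X))" .
    qed (use tX tY Lf L'f in \<open>auto intro!: HomI\<close>)
    then show ?thesis by (simp add: X_def Y_def)
  qed
  have "iso_arr E (t X)" if X: "X \<in> Obj C" for X
    unfolding iso_arr_def inverse_arrows_def
    using s(1)[OF X] HomD[OF t(1)[OF X]] st[OF X] ts[OF X] by auto
  then show ?thesis
    unfolding naturally_isomorphic_def nat_trans_def
    using 1 2 t(1) natt by (auto simp: represents_def)
qed

lemma represents_fcomp: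
  assumes "represents B E L P act \<Phi>" "is_functor C B V" "category C"
  shows "represents C E (L \<circ>\<^sub>F V) (\<lambda>X. P (fo V X)) (\<lambda>f. act (fa V f)) (\<lambda>X. \<Phi> (fo V X))"
proof -
  interpret C: category C by fact
  note [simp] = functorD(1,3-5)[OF assms(2)]
  have "is_functor B E L" using assms(1) by (simp add: represents_def)
  moreover have "\<Phi> (fo V (Dom C f)) (Cod E g) (Cmp E g (Cmp E h (fa L (fa V f)))) =
      act (fa V f) g (\<Phi> (fo V (Cod C f)) (Dom E g) h)"
    if "f \<in> Arr C" "g \<in> Arr E" "h \<in> Hom E (fo L (fo V (Cod C f))) (Dom E g)" for f g h
  proof -
    have "\<forall>f\<in>Arr B. \<forall>g\<in>Arr E. \<forall>h\<in>Hom E (fo L (Cod B f)) (Dom E g).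
        \<Phi> (Dom B f) (Cod E g) (Cmp E g (Cmp E h (fa L f))) = act f g (\<Phi> (Cod B f) (Dom E g) h)"
      using assms(1) by (simp add: represents_def)
    from this[rule_format, of "fa V f" g h] that show ?thesis by simp
  qed
  ultimately show ?thesis
    using assms(1,2) by (auto simp: represents_def intro: is_functor_fcomp)
qed

lemma represents_left_adjoint:
  assumes L: "represents C A L P act \<Phi>" and U: "is_functor E A U"
    and J: "represents A E J (\<lambda>M R. Hom A M (fo U R)) (\<lambda>f g k. Cmp A (fa U g) (Cmp A k f)) \<Psi>"
    and "category C" "category A" "category E"
  shows "represents C E (J \<circ>\<^sub>F L) (\<lambda>X R. P X (fo U R)) (\<lambda>f g. act f (fa U g))
    (\<lambda>X R h. \<Phi> X (fo U R) (\<Psi> (fo L X) R h))"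
proof -
  interpret C: category C by fact
  interpret A: category A by fact
  interpret E: category E by fact
  have FL: "is_functor C A L" and FJ: "is_functor A E J" using L J by (simp_all add: represents_def)
  have bij: "bij_betw (\<Psi> (fo L X) R) (Hom E (fo J (fo L X)) R) (Hom A (fo L X) (fo U R))"
    "bij_betw (\<Phi> X (fo U R)) (Hom A (fo L X) (fo U R)) (P X (fo U R))"
    if "X \<in> Obj C" "R \<in> Obj E" for X R
    using L J that functorD(1)[OF FL] functorD(1)[OF U] by (auto simp: represents_def)
  note [simp] = functorD(1,3-5)[OF FL] functorD(1,3-5)[OF U]
  have "\<Phi> (Dom C f) (fo U (Cod E g)) (\<Psi> (fo L (Dom C f)) (Cod E g) (Cmp E g (Cmp E h (fa J (fa L f))))) =
      act f (fa U g) (\<Phi> (Cod C f) (fo U (Dom E g)) (\<Psi> (fo L (Cod C f)) (Dom E g) h))"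
    if "f \<in> Arr C" "g \<in> Arr E" "h \<in> Hom E (fo J (fo L (Cod C f))) (Dom E g)" for f g h
  proof -
    have "\<forall>f\<in>Arr A. \<forall>g\<in>Arr E. \<forall>h\<in>Hom E (fo J (Cod A f)) (Dom E g).
        \<Psi> (Dom A f) (Cod E g) (Cmp E g (Cmp E h (fa J f))) = Cmp A (fa U g) (Cmp A (\<Psi> (Cod A f) (Dom E g) h) f)"
      using J by (simp add: represents_def)
    from this[rule_format, of "fa L f" g h] that
    have 1: "\<Psi> (fo L (Dom C f)) (Cod E g) (Cmp E g (Cmp E h (fa J (fa L f)))) =
      Cmp A (fa U g) (Cmp A (\<Psi> (fo L (Cod C f)) (Dom E g) h) (fa L f))" by simp
    have nat: "\<forall>f\<in>Arr C. \<forall>g\<in>Arr A. \<forall>h\<in>Hom A (fo L (Cod C f)) (Dom A g).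
        \<Phi> (Dom C f) (Cod A g) (Cmp A g (Cmp A h (fa L f))) = act f g (\<Phi> (Cod C f) (Dom A g) h)"
      using L by (simp add: represents_def)
    have "\<Psi> (fo L (Cod C f)) (Dom E g) h \<in> Hom A (fo L (Cod C f)) (fo U (Dom E g))"
      using bij(1)[of "Cod C f" "Dom E g"] that by (auto simp: bij_betw_def)
    then show ?thesis unfolding 1
      using nat[rule_format, of f "fa U g" "\<Psi> (fo L (Cod C f)) (Dom E g) h"] that by simp
  qed
  then show ?thesis
    using bij_betw_trans[OF bij] FL FJ by (auto simp: represents_def comp_def intro: is_functor_fcomp)
qed

section \<open>The bar construction and twisting maps\<close>

text \<open>A monoidal category whose coherence axioms are weakened to the two identities between
  canonical maps \<open>1 \<otimes> 1 \<rightarrow> 1\<close> and \<open>(1 \<otimes> 1) \<otimes> 1 \<rightarrow> 1\<close> that make its slice over \<open>1\<close> monoidal again.\<close>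

locale tensored_category = category D for D :: "('o, 'm) moncat" +
  assumes Ten_Obj [simp]: "X \<in> Obj D \<Longrightarrow> Y \<in> Obj D \<Longrightarrow> Ten D X Y \<in> Obj D"
    and One_Obj [simp]: "One D \<in> Obj D"
    and TenA_Hom: "f \<in> Hom D X Y \<Longrightarrow> g \<in> Hom D X' Y' \<Longrightarrow> TenA D f g \<in> Hom D (Ten D X X') (Ten D Y Y')"
    and TenA_Idt [simp]: "X \<in> Obj D \<Longrightarrow> Y \<in> Obj D \<Longrightarrow>
      TenA D (Idt D X) (Idt D Y) = Idt D (Ten D X Y)"
    and Cmp_TenA_TenA: "f \<in> Hom D X Y \<Longrightarrow> g \<in> Hom D Y Z \<Longrightarrow> f' \<in> Hom D X' Y' \<Longrightarrow> g' \<in> Hom D Y' Z' \<Longrightarrow>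
      Cmp D (TenA D g g') (TenA D f f') = TenA D (Cmp D g f) (Cmp D g' f')"
    and Assoc_Hom: "X \<in> Obj D \<Longrightarrow> Y \<in> Obj D \<Longrightarrow> Z \<in> Obj D \<Longrightarrow>
      Assoc D X Y Z \<in> Hom D (Ten D (Ten D X Y) Z) (Ten D X (Ten D Y Z))"
    and Assoc_iso [simp]: "X \<in> Obj D \<Longrightarrow> Y \<in> Obj D \<Longrightarrow> Z \<in> Obj D \<Longrightarrow> iso_arr D (Assoc D X Y Z)"
    and Assoc_nat: "f \<in> Hom D X X' \<Longrightarrow> g \<in> Hom D Y Y' \<Longrightarrow> h \<in> Hom D Z Z' \<Longrightarrow>
      Cmp D (Assoc D X' Y' Z') (TenA D (TenA D f g) h) = Cmp D (TenA D f (TenA D g h)) (Assoc D X Y Z)"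
    and Lun_Hom: "X \<in> Obj D \<Longrightarrow> Lun D X \<in> Hom D (Ten D (One D) X) X"
    and Lun_iso [simp]: "X \<in> Obj D \<Longrightarrow> iso_arr D (Lun D X)"
    and Lun_nat: "f \<in> Hom D X Y \<Longrightarrow> Cmp D (Lun D Y) (TenA D (Idt D (One D)) f) = Cmp D f (Lun D X)"
    and Run_Hom: "X \<in> Obj D \<Longrightarrow> Run D X \<in> Hom D (Ten D X (One D)) X"
    and Run_iso [simp]: "X \<in> Obj D \<Longrightarrow> iso_arr D (Run D X)"
    and Run_nat: "f \<in> Hom D X Y \<Longrightarrow> Cmp D (Run D Y) (TenA D f (Idt D (One D))) = Cmp D f (Run D X)"
    and Lun_One: "Lun D (One D) = Run D (One D)"
    and Lun_Assoc: "Cmp D (Lun D (One D)) (TenA D (Lun D (One D)) (Idt D (One D))) =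
      Cmp D (Lun D (One D)) (Cmp D (TenA D (Idt D (One D)) (Lun D (One D))) (Assoc D (One D) (One D) (One D)))"
begin

lemma canonical_simps [simp]:
  assumes "X \<in> Obj D"
  shows "Lun D X \<in> Arr D" "Dom D (Lun D X) = Ten D (One D) X" "Cod D (Lun D X) = X"
    "Run D X \<in> Arr D" "Dom D (Run D X) = Ten D X (One D)" "Cod D (Run D X) = X"
  using Lun_Hom[OF assms] Run_Hom[OF assms] by (simp_all add: Hom_def)

lemma Assoc_simps [simp]:
  assumes "X \<in> Obj D" "Y \<in> Obj D" "Z \<in> Obj D"
  shows "Assoc D X Y Z \<in> Arr D" "Dom D (Assoc D X Y Z) = Ten D (Ten D X Y) Z"
    "Cod D (Assoc D X Y Z) = Ten D X (Ten D Y Z)"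
  using Assoc_Hom[OF assms] by (simp_all add: Hom_def)

lemma TenA_simps [simp]:
  assumes "f \<in> Arr D" "g \<in> Arr D"
  shows "TenA D f g \<in> Arr D" "Dom D (TenA D f g) = Ten D (Dom D f) (Dom D g)"
    "Cod D (TenA D f g) = Ten D (Cod D f) (Cod D g)"
  using TenA_Hom[OF Arr_Hom[OF assms(1)] Arr_Hom[OF assms(2)]] by (simp_all add: Hom_def)

lemma TenA_Cmp [simp]:
  assumes "f \<in> Arr D" "g \<in> Arr D" "f' \<in> Arr D" "g' \<in> Arr D" "Dom D g = Cod D f" "Dom D g' = Cod D f'"
  shows "Cmp D (TenA D g g') (TenA D f f') = TenA D (Cmp D g f) (Cmp D g' f')"
  using assms by (intro Cmp_TenA_TenA[of _ "Dom D f" "Cod D f" _ "Cod D g" _ "Dom D f'" "Cod D f'" _ "Cod D g'"])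
    (simp_all add: Hom_def)

lemma TenA_Cmp_left [simp]:
  assumes "f \<in> Arr D" "g \<in> Arr D" "f' \<in> Arr D" "g' \<in> Arr D" "Dom D g = Cod D f" "Dom D g' = Cod D f'"
    and "k \<in> Arr D" "Cod D k = Ten D (Dom D f) (Dom D f')"
  shows "Cmp D (TenA D g g') (Cmp D (TenA D f f') k) = Cmp D (TenA D (Cmp D g f) (Cmp D g' f')) k"
  using assms by (subst Cmp_assoc[symmetric]) auto

lemma Assoc_natural:
  assumes "f \<in> Arr D" "g \<in> Arr D" "h \<in> Arr D"
  shows "Cmp D (Assoc D (Cod D f) (Cod D g) (Cod D h)) (TenA D (TenA D f g) h) =
    Cmp D (TenA D f (TenA D g h)) (Assoc D (Dom D f) (Dom D g) (Dom D h))"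
  using assms by (intro Assoc_nat Arr_Hom)

lemma Lun_natural:
  assumes "f \<in> Arr D"
  shows "Cmp D (Lun D (Cod D f)) (TenA D (Idt D (One D)) f) = Cmp D f (Lun D (Dom D f))"
  using assms by (intro Lun_nat Arr_Hom)

lemma Run_natural:
  assumes "f \<in> Arr D"
  shows "Cmp D (Run D (Cod D f)) (TenA D f (Idt D (One D))) = Cmp D f (Run D (Dom D f))"
  using assms by (intro Run_nat Arr_Hom)

lemma tpow_Obj [simp]: "A \<in> Obj D \<Longrightarrow> tpow D A n \<in> Obj D"
  by (induction n) auto

lemma tpow_arr_simps [simp]:
  assumes "f \<in> Arr D"
  shows "tpow_arr D f n \<in> Arr D" "Dom D (tpow_arr D f n) = tpow D (Dom D f) n"
    "Cod D (tpow_arr D f n) = tpow D (Cod D f) n"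
  using assms by (induction n) auto

lemma tpow_split_simps [simp]:
  assumes "A \<in> Obj D"
  shows "tpow_split D A n m \<in> Arr D" "Dom D (tpow_split D A n m) = tpow D A (n + m)"
    "Cod D (tpow_split D A n m) = Ten D (tpow D A n) (tpow D A m)"
  using assms by (induction n) auto

lemma is_algD:
  assumes "is_alg D R"
  shows "acar R \<in> Obj D" "amul R \<in> Arr D" "Dom D (amul R) = Ten D (acar R) (acar R)"
    "Cod D (amul R) = acar R" "aone R \<in> Arr D" "Dom D (aone R) = One D" "Cod D (aone R) = acar R"
    "Cmp D (amul R) (TenA D (amul R) (Idt D (acar R))) =
     Cmp D (amul R) (Cmp D (TenA D (Idt D (acar R)) (amul R)) (Assoc D (acar R) (acar R) (acar R)))"
    "Cmp D (amul R) (TenA D (aone R) (Idt D (acar R))) = Lun D (acar R)"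
    "Cmp D (amul R) (TenA D (Idt D (acar R)) (aone R)) = Run D (acar R)"
  using assms by (auto simp: is_alg_def Let_def Hom_def)

lemma alg_prod_simps [simp]:
  assumes "is_alg D R"
  shows "alg_prod D R n \<in> Arr D" "Dom D (alg_prod D R n) = tpow D (acar R) n"
    "Cod D (alg_prod D R n) = acar R"
  using is_algD[OF assms] by (induction n) auto

end

lemma is_bobD:
  assumes "is_bob D B"
  shows "is_functor (op_cat Delta_act) D (bfun B)"
    and "bmul B n m \<in> Hom D (fo (bfun B) (n + m)) (Ten D (fo (bfun B) n) (fo (bfun B) m))"
    and "bone B \<in> Hom D (fo (bfun B) 0) (One D)"
    and "\<alpha> \<in> Arr Delta_act \<Longrightarrow> \<beta> \<in> Arr Delta_act \<Longrightarrow>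
      Cmp D (bmul B (Dom Delta_act \<alpha>) (Dom Delta_act \<beta>)) (fa (bfun B) (join_act \<alpha> \<beta>)) =
      Cmp D (TenA D (fa (bfun B) \<alpha>) (fa (bfun B) \<beta>)) (bmul B (Cod Delta_act \<alpha>) (Cod Delta_act \<beta>))"
    and "Cmp D (Assoc D (fo (bfun B) n) (fo (bfun B) m) (fo (bfun B) k))
           (Cmp D (TenA D (bmul B n m) (Idt D (fo (bfun B) k))) (bmul B (n + m) k)) =
         Cmp D (TenA D (Idt D (fo (bfun B) n)) (bmul B m k)) (bmul B n (m + k))"
    and "Cmp D (Lun D (fo (bfun B) n)) (Cmp D (TenA D (bone B) (Idt D (fo (bfun B) n))) (bmul B 0 n)) =
      Idt D (fo (bfun B) n)"
    and "Cmp D (Run D (fo (bfun B) n)) (Cmp D (TenA D (Idt D (fo (bfun B) n)) (bone B)) (bmul B n 0)) =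
      Idt D (fo (bfun B) n)"
  using assms by (auto simp: is_bob_def Let_def)

lemma Delta_act_simps:
  "(n, \<theta>, m) \<in> Arr Delta_act \<longleftrightarrow> \<theta> \<in> {..n} \<rightarrow>\<^sub>E {..m} \<and> mono_on {..n} \<theta> \<and> \<theta> 0 = 0 \<and> \<theta> n = m"
  "Dom Delta_act (n, \<theta>, m) = n" "Cod Delta_act (n, \<theta>, m) = m"
  "Idt Delta_act n = (n, \<lambda>i\<in>{..n}. i, n)"
  "Cmp Delta_act (m, \<eta>, k) (n, \<theta>, m') = (n, compose {..n} \<eta> \<theta>, k)"
  "Obj Delta_act = UNIV"
  by (auto simp: Delta_act_def)

lemma Delta_act_Obj [simp]: "n \<in> Obj Delta_act"
  by (simp add: Delta_act_simps)

definition act_end :: "nat \<Rightarrow> darr" where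
  "act_end k = (1, \<lambda>i\<in>{..1}. if i = 0 then 0 else k, k)"

lemma act_end_arr [simp]:
  "act_end k \<in> Arr Delta_act" "Dom Delta_act (act_end k) = 1" "Cod Delta_act (act_end k) = k"
  by (auto simp: act_end_def Delta_act_simps mono_on_def)

lemma act_end_1: "act_end 1 = Idt Delta_act 1"
  by (auto simp: act_end_def Delta_act_simps restrict_def fun_eq_iff)

lemma join_act_arr:
  assumes "\<alpha> \<in> Arr Delta_act" "\<beta> \<in> Arr Delta_act"
  shows "join_act \<alpha> \<beta> \<in> Arr Delta_act"
    "Dom Delta_act (join_act \<alpha> \<beta>) = Dom Delta_act \<alpha> + Dom Delta_act \<beta>"
    "Cod Delta_act (join_act \<alpha> \<beta>) = Cod Delta_act \<alpha> + Cod Delta_act \<beta>"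
proof -
  obtain n f n' m g m' where *: "\<alpha> = (n, f, n')" "\<beta> = (m, g, m')" by (metis prod_cases3)
  note f = assms(1)[unfolded *(1) Delta_act_simps] and g = assms(2)[unfolded *(2) Delta_act_simps]
  have f_le: "f i \<le> n'" if "i \<le> n" for i using f that by (auto simp: mono_on_def)
  have g_le: "g i \<le> m'" if "i \<le> m" for i using g that by (auto simp: mono_on_def)
  have "mono_on {..n + m} (\<lambda>i\<in>{..n + m}. if i \<le> n then f i else n' + g (i - n))"
  proof (rule mono_onI)
    fix i j assume ij: "i \<in> {..n + m}" "j \<in> {..n + m}" "i \<le> j"
    have "f i \<le> f j" if "j \<le> n" using f ij that by (auto simp: mono_on_def)
    moreover have "g (i - n) \<le> g (j - n)" if "\<not> i \<le> n" using g ij that by (intro mono_onD[of "{..m}" g]) auto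
    ultimately show "(\<lambda>i\<in>{..n + m}. if i \<le> n then f i else n' + g (i - n)) i
      \<le> (\<lambda>i\<in>{..n + m}. if i \<le> n then f i else n' + g (i - n)) j"
      using ij f_le[of i] by auto
  qed
  moreover have "(\<lambda>i\<in>{..n + m}. if i \<le> n then f i else n' + g (i - n)) (n + m) = n' + m'"
    using f g by auto
  ultimately show "join_act \<alpha> \<beta> \<in> Arr Delta_act"
    using f_le g_le f g by (auto simp: * join_act_def Delta_act_simps trans_le_add1)
  show "Dom Delta_act (join_act \<alpha> \<beta>) = Dom Delta_act \<alpha> + Dom Delta_act \<beta>"
    "Cod Delta_act (join_act \<alpha> \<beta>) = Cod Delta_act \<alpha> + Cod Delta_act \<beta>"
    by (simp_all add: * join_act_def Delta_act_simps)
qed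

lemma act_end_Suc: "act_end (Suc k) = Cmp Delta_act (join_act (Idt Delta_act 1) (act_end k)) (act_end 2)"
  by (auto simp: act_end_def Delta_act_simps join_act_def compose_def fun_eq_iff restrict_def)

text \<open>What remains of \<open>\<theta>\<close> after its first step.\<close>

definition act_rest :: "nat \<Rightarrow> (nat \<Rightarrow> nat) \<Rightarrow> nat \<Rightarrow> darr" where
  "act_rest n \<theta> m = (n, \<lambda>i\<in>{..n}. \<theta> (Suc i) - \<theta> 1, m - \<theta> 1)"

lemma act_decompose:
  assumes "(Suc n, \<theta>, m) \<in> Arr Delta_act"
  shows "act_rest n \<theta> m \<in> Arr Delta_act" "\<theta> 1 \<le> m"
    "(Suc n, \<theta>, m) = join_act (act_end (\<theta> 1)) (act_rest n \<theta> m)"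
proof -
  note \<theta> = assms[unfolded Delta_act_simps]
  have mono: "\<theta> i \<le> \<theta> j" if "i \<le> j" "j \<le> Suc n" for i j
    using \<theta> that by (auto simp: mono_on_def)
  show "\<theta> 1 \<le> m" using mono[of 1 "Suc n"] \<theta> by auto
  show "act_rest n \<theta> m \<in> Arr Delta_act"
    unfolding act_rest_def Delta_act_simps
    using \<theta> mono[of _ "Suc n"] mono by (auto intro!: mono_onI diff_le_mono)
  have "\<theta> i = (\<lambda>i\<in>{..1 + n}. if i \<le> 1 then (\<lambda>i\<in>{..1}. if i = 0 then 0 else \<theta> 1) i else
      \<theta> 1 + (\<lambda>i\<in>{..n}. \<theta> (Suc i) - \<theta> 1) (i - 1)) i" for i
  proof (cases "i \<le> Suc n")
    case True
    consider "i = 0" | "i = 1" | j where "i = Suc j" "j \<noteq> 0" by (metis One_nat_def not0_implies_Suc)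
    then show ?thesis using True \<theta> mono[of 1 i] by cases auto
  next
    case False
    then show ?thesis using \<theta> by (auto simp: PiE_def extensional_def)
  qed
  then have *: "\<theta> = (\<lambda>i\<in>{..1 + n}. if i \<le> 1 then (\<lambda>i\<in>{..1}. if i = 0 then 0 else \<theta> 1) i else
      \<theta> 1 + (\<lambda>i\<in>{..n}. \<theta> (Suc i) - \<theta> 1) (i - 1))" (is "_ = ?t") by (rule ext)
  have "(Suc n, \<theta>, m) = (1 + n, \<theta>, \<theta> 1 + (m - \<theta> 1))"
    using \<open>\<theta> 1 \<le> m\<close> by simp
  also have "\<dots> = (1 + n, ?t, \<theta> 1 + (m - \<theta> 1))"
    by (rule arg_cong[OF *, of "\<lambda>t. (1 + n, t, \<theta> 1 + (m - \<theta> 1))"])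
  also have "\<dots> = join_act (act_end (\<theta> 1)) (act_rest n \<theta> m)"
    unfolding join_act_def act_end_def act_rest_def prod.case by (rule refl)
  finally show "(Suc n, \<theta>, m) = join_act (act_end (\<theta> 1)) (act_rest n \<theta> m)" .
qed

lemma bar_act_cong:
  "(\<And>i. 1 \<le> i \<Longrightarrow> i \<le> n \<Longrightarrow> \<theta> i = \<theta>' i) \<Longrightarrow> bar_act D R n m \<theta> = bar_act D R n m \<theta>'"
proof (induction n arbitrary: m \<theta> \<theta>')
  case (Suc n)
  have 1: "\<theta> 1 = \<theta>' 1" using Suc.prems by simp
  have 2: "bar_act D R n (m - \<theta>' 1) (\<lambda>i. \<theta> (Suc i) - \<theta>' 1) = bar_act D R n (m - \<theta>' 1) (\<lambda>i. \<theta>' (Suc i) - \<theta>' 1)"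
    using Suc.prems by (intro Suc.IH) auto
  show ?case by (simp only: bar_act.simps 1 2)
qed simp

lemma bar_act_Suc:
  "bar_act D R (Suc n) m \<theta> = Cmp D (TenA D (alg_prod D R (\<theta> 1))
     (bar_act D R n (m - \<theta> 1) (fst (snd (act_rest n \<theta> m))))) (tpow_split D (acar R) (\<theta> 1) (m - \<theta> 1))"
  unfolding bar_act.simps
  by (subst bar_act_cong[of n "\<lambda>i. \<theta> (Suc i) - \<theta> 1" "fst (snd (act_rest n \<theta> m))"]) (auto simp: act_rest_def)

lemma (in tensored_category) bar_act_simps:
  assumes "is_alg D R" "(n, \<theta>, m) \<in> Arr Delta_act"
  shows "bar_act D R n m \<theta> \<in> Arr D" "Dom D (bar_act D R n m \<theta>) = tpow D (acar R) m"
    "Cod D (bar_act D R n m \<theta>) = tpow D (acar R) n"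
proof -
  note [simp] = is_algD(1-7)[OF assms(1)] alg_prod_simps[OF assms(1)]
  have "bar_act D R n m \<theta> \<in> Arr D \<and> Dom D (bar_act D R n m \<theta>) = tpow D (acar R) m \<and>
    Cod D (bar_act D R n m \<theta>) = tpow D (acar R) n"
    using assms(2)
  proof (induction n arbitrary: m \<theta>)
    case 0
    then have "m = 0" unfolding Delta_act_simps by simp
    then show ?case by simp
  next
    case (Suc n)
    obtain \<psi> where \<psi>: "act_rest n \<theta> m = (n, \<psi>, m - \<theta> 1)" unfolding act_rest_def by blast
    then have "(n, \<psi>, m - \<theta> 1) \<in> Arr Delta_act"
      using act_decompose(1)[OF Suc.prems] by simp
    then show ?case
      unfolding bar_act_Suc \<psi> using Suc.IH act_decompose(2)[OF Suc.prems] by simp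
  qed
  then show "bar_act D R n m \<theta> \<in> Arr D" "Dom D (bar_act D R n m \<theta>) = tpow D (acar R) m"
    "Cod D (bar_act D R n m \<theta>) = tpow D (acar R) n" by auto
qed

definition twist :: "('o, 'm) moncat \<Rightarrow> ('o, 'm) bob \<Rightarrow> ('o, 'm) alg \<Rightarrow> 'm set" where
  "twist D B R = {\<phi> \<in> Hom D (fo (bfun B) 1) (acar R).
     Cmp D \<phi> (fa (bfun B) (act_end 2)) = Cmp D (amul R) (Cmp D (TenA D \<phi> \<phi>) (bmul B 1 1)) \<and>
     Cmp D \<phi> (fa (bfun B) (act_end 0)) = Cmp D (aone R) (bone B)}"

primrec twist_ext :: "('o, 'm) moncat \<Rightarrow> ('o, 'm) bob \<Rightarrow> 'm \<Rightarrow> nat \<Rightarrow> 'm" where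
  "twist_ext D B \<phi> 0 = bone B"
| "twist_ext D B \<phi> (Suc n) = Cmp D (TenA D \<phi> (twist_ext D B \<phi> n)) (bmul B 1 n)"

locale bob = tensored_category +
  fixes B :: "('a, 'b) bob"
  assumes B: "is_bob D B"
begin

abbreviation "F \<equiv> bfun B"

lemma F_Obj [simp]: "fo F n \<in> Obj D"
  using functorD(1)[OF is_bobD(1)[OF B]] by (simp add: Delta_act_simps)

lemma F_arr [simp]:
  assumes "\<alpha> \<in> Arr Delta_act"
  shows "fa F \<alpha> \<in> Arr D" "Dom D (fa F \<alpha>) = fo F (Cod Delta_act \<alpha>)" "Cod D (fa F \<alpha>) = fo F (Dom Delta_act \<alpha>)"
  using functorD(3-5)[OF is_bobD(1)[OF B]] assms by simp_all

lemma F_Cmp: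
  assumes "\<alpha> \<in> Arr Delta_act" "\<beta> \<in> Arr Delta_act" "Dom Delta_act \<beta> = Cod Delta_act \<alpha>"
  shows "fa F (Cmp Delta_act \<beta> \<alpha>) = Cmp D (fa F \<alpha>) (fa F \<beta>)"
  using functorD(6)[OF is_bobD(1)[OF B], of \<beta> \<alpha>] assms by simp

lemma F_Idt [simp]: "fa F (Idt Delta_act n) = Idt D (fo F n)"
  using functorD(2)[OF is_bobD(1)[OF B], of n] by (simp add: Delta_act_simps)

lemma bmul_simps [simp]: "bmul B n m \<in> Arr D" "Dom D (bmul B n m) = fo F (n + m)"
    "Cod D (bmul B n m) = Ten D (fo F n) (fo F m)"
  using is_bobD(2)[OF B] by (auto simp: Hom_def)

lemma bone_simps [simp]: "bone B \<in> Arr D" "Dom D (bone B) = fo F 0" "Cod D (bone B) = One D"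
  using is_bobD(3)[OF B] by (auto simp: Hom_def)

end

locale bob_to_bar = bob +
  fixes R :: "('a, 'b) alg"
  assumes R: "is_alg D R"
begin

lemmas [simp] = is_algD(1-7)[OF R] alg_prod_simps[OF R]

context
  fixes \<phi> assumes \<phi>: "\<phi> \<in> twist D B R"
begin

lemma twist_simps [simp]: "\<phi> \<in> Arr D" "Dom D \<phi> = fo F 1" "Cod D \<phi> = acar R"
  using \<phi> by (auto simp: twist_def Hom_def)

lemma twist_ext_simps [simp]: "twist_ext D B \<phi> n \<in> Arr D" "Dom D (twist_ext D B \<phi> n) = fo F n"
    "Cod D (twist_ext D B \<phi> n) = tpow D (acar R) n"
  by (induction n) (auto simp: twist_simps[unfolded One_nat_def])

lemma twist_ext_bmul:
  "Cmp D (TenA D (twist_ext D B \<phi> n) (twist_ext D B \<phi> m)) (bmul B n m) =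
   Cmp D (tpow_split D (acar R) n m) (twist_ext D B \<phi> (n + m))"
proof (induction n)
  case 0
  let ?t = "twist_ext D B \<phi> m"
  have "Cmp D (Lun D (tpow D (acar R) m)) (Cmp D (TenA D (bone B) ?t) (bmul B 0 m)) =
    Cmp D (Cmp D (Lun D (tpow D (acar R) m)) (TenA D (Idt D (One D)) ?t))
      (Cmp D (TenA D (bone B) (Idt D (fo F m))) (bmul B 0 m))"
    by simp
  also have "\<dots> = Cmp D ?t (Cmp D (Lun D (fo F m)) (Cmp D (TenA D (bone B) (Idt D (fo F m))) (bmul B 0 m)))"
    using Lun_natural[of ?t] by simp
  also have "\<dots> = ?t" unfolding is_bobD(6)[OF B] by simp
  finally have *: "Cmp D (Lun D (tpow D (acar R) m)) (Cmp D (TenA D (bone B) ?t) (bmul B 0 m)) = ?t" .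
  show ?case
    by (rule iso_arr_left_cancel[of "Lun D (tpow D (acar R) m)"]) (use * in simp_all)
next
  case (Suc n)
  let ?t = "twist_ext D B \<phi>" and ?A = "acar R"
  let ?\<alpha> = "Assoc D ?A (tpow D ?A n) (tpow D ?A m)"
  have "Cmp D ?\<alpha> (Cmp D (TenA D (?t (Suc n)) (?t m)) (bmul B (Suc n) m)) =
    Cmp D (Cmp D ?\<alpha> (TenA D (TenA D \<phi> (?t n)) (?t m)))
      (Cmp D (TenA D (bmul B 1 n) (Idt D (fo F m))) (bmul B (1 + n) m))"
    by simp
  also have "\<dots> = Cmp D (TenA D \<phi> (TenA D (?t n) (?t m)))
      (Cmp D (Assoc D (fo F 1) (fo F n) (fo F m)) (Cmp D (TenA D (bmul B 1 n) (Idt D (fo F m))) (bmul B (1 + n) m)))"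
    using Assoc_natural[of \<phi> "?t n" "?t m"] by simp
  also have "\<dots> = Cmp D (TenA D \<phi> (TenA D (?t n) (?t m)))
      (Cmp D (TenA D (Idt D (fo F 1)) (bmul B n m)) (bmul B 1 (n + m)))"
    by (simp only: is_bobD(5)[OF B])
  also have "\<dots> = Cmp D (TenA D \<phi> (Cmp D (TenA D (?t n) (?t m)) (bmul B n m))) (bmul B 1 (n + m))"
    by simp
  also have "\<dots> = Cmp D (TenA D \<phi> (Cmp D (tpow_split D (acar R) n m) (?t (n + m)))) (bmul B 1 (n + m))"
    by (simp only: Suc.IH)
  also have "\<dots> = Cmp D ?\<alpha> (Cmp D (tpow_split D (acar R) (Suc n) m) (?t (Suc n + m)))"
    by simp
  finally have *: "Cmp D ?\<alpha> (Cmp D (TenA D (?t (Suc n)) (?t m)) (bmul B (Suc n) m)) =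
    Cmp D ?\<alpha> (Cmp D (tpow_split D (acar R) (Suc n) m) (?t (Suc n + m)))" .
  show ?case
    by (rule iso_arr_left_cancel[of ?\<alpha>, OF _ _ _ _ _ *]) simp_all
qed

lemma twist_act_end:
  "Cmp D \<phi> (fa F (act_end k)) = Cmp D (alg_prod D R k) (twist_ext D B \<phi> k)"
proof (induction k)
  case 0
  then show ?case using \<phi> by (simp add: twist_def)
next
  case (Suc k)
  have J: "join_act (act_end 1) (act_end k) \<in> Arr Delta_act"
    "Dom Delta_act (join_act (act_end 1) (act_end k)) = 2"
    "Cod Delta_act (join_act (act_end 1) (act_end k)) = 1 + k"
    using join_act_arr[of "act_end 1" "act_end k"] by auto
  have "Cmp D \<phi> (fa F (act_end (Suc k))) = Cmp D \<phi>
      (Cmp D (fa F (act_end 2)) (fa F (join_act (act_end 1) (act_end k))))"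
    unfolding act_end_Suc act_end_1[symmetric] using J by (subst F_Cmp) auto
  also have "\<dots> = Cmp D (Cmp D \<phi> (fa F (act_end 2))) (fa F (join_act (act_end 1) (act_end k)))"
    using J by (subst Cmp_assoc) auto
  also have "\<dots> = Cmp D (amul R) (Cmp D (TenA D \<phi> \<phi>) (Cmp D (bmul B 1 1) (fa F (join_act (act_end 1) (act_end k)))))"
    using \<phi> J by (simp add: twist_def numeral_2_eq_2)
  also have "Cmp D (bmul B 1 1) (fa F (join_act (act_end 1) (act_end k))) =
      Cmp D (TenA D (Idt D (fo F 1)) (fa F (act_end k))) (bmul B 1 k)"
    using is_bobD(4)[OF B act_end_arr(1)[of 1] act_end_arr(1)[of k]]
    by (simp only: act_end_arr) (simp only: act_end_1 F_Idt)
  also have "Cmp D (TenA D \<phi> \<phi>) \<dots> = Cmp D (TenA D \<phi> (Cmp D \<phi> (fa F (act_end k)))) (bmul B 1 k)"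
    by simp
  also have "\<dots> = Cmp D (TenA D (Idt D (acar R)) (alg_prod D R k)) (twist_ext D B \<phi> (Suc k))"
    unfolding Suc.IH by simp
  finally show ?case by simp
qed

lemma twist_ext_natural:
  "(n, \<theta>, m) \<in> Arr Delta_act \<Longrightarrow>
   Cmp D (twist_ext D B \<phi> n) (fa F (n, \<theta>, m)) = Cmp D (bar_act D R n m \<theta>) (twist_ext D B \<phi> m)"
proof (induction n arbitrary: m \<theta>)
  case 0
  then have "(0, \<theta>, m) = Idt Delta_act 0" "m = 0" 
    by (auto simp: Delta_act_simps PiE_def extensional_def fun_eq_iff)
  then show ?case by (simp only: F_Idt) simp
next
  case (Suc n)
  let ?t = "twist_ext D B \<phi>" 
  define k where "k = \<theta> 1"
  define \<beta> where "\<beta> = act_rest n \<theta> m"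
  obtain \<psi> where \<psi>: "\<beta> = (n, \<psi>, m - k)" unfolding act_rest_def k_def \<beta>_def by blast
  have \<beta>: "\<beta> \<in> Arr Delta_act" "(Suc n, \<theta>, m) = join_act (act_end k) \<beta>"
    using act_decompose(1,3)[OF Suc.prems] unfolding \<beta>_def k_def .
  have \<beta>': "k + (m - k) = m" "Dom Delta_act \<beta> = n" "Cod Delta_act \<beta> = m - k"
    using act_decompose(2)[OF Suc.prems] unfolding k_def[symmetric] by (auto simp: \<psi> Delta_act_simps)
  have [simp]: "(n, \<psi>, m - k) \<in> Arr Delta_act" using \<beta>(1) \<psi> by simp
  have IH: "Cmp D (?t n) (fa F \<beta>) = Cmp D (bar_act D R n (m - k) \<psi>) (?t (m - k))"
    unfolding \<psi> by (rule Suc.IH) simp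
  note [simp] = bar_act_simps[OF R, of n \<psi> "m - k"]
  have J: "join_act (act_end k) \<beta> \<in> Arr Delta_act" "Dom Delta_act (join_act (act_end k) \<beta>) = Suc n"
    "Cod Delta_act (join_act (act_end k) \<beta>) = m"
    using join_act_arr[of "act_end k" \<beta>] \<beta>(1) \<beta>' by auto
  have "Cmp D (?t (Suc n)) (fa F (join_act (act_end k) \<beta>)) =
    Cmp D (TenA D \<phi> (?t n)) (Cmp D (bmul B 1 n) (fa F (join_act (act_end k) \<beta>)))"
    using J by simp
  also have "Cmp D (bmul B 1 n) (fa F (join_act (act_end k) \<beta>)) =
    Cmp D (TenA D (fa F (act_end k)) (fa F \<beta>)) (bmul B k (m - k))"
    using is_bobD(4)[OF B act_end_arr(1)[of k] \<beta>(1)] by (simp only: act_end_arr \<beta>')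
  also have "Cmp D (TenA D \<phi> (?t n)) \<dots> =
    Cmp D (TenA D (Cmp D \<phi> (fa F (act_end k))) (Cmp D (?t n) (fa F \<beta>))) (bmul B k (m - k))"
    using \<beta>(1) \<beta>' by simp
  also have "\<dots> = Cmp D (TenA D (alg_prod D R k) (bar_act D R n (m - k) \<psi>))
    (Cmp D (TenA D (?t k) (?t (m - k))) (bmul B k (m - k)))"
    unfolding IH twist_act_end by simp
  also have "\<dots> = Cmp D (bar_act D R (Suc n) m \<theta>) (?t m)"
    unfolding twist_ext_bmul \<beta>'(1) bar_act_Suc \<beta>_def[symmetric] k_def[symmetric] \<psi> using \<beta>'(1) by simp
  finally show ?case unfolding \<beta>(2) .
qed

lemma twist_ext_arr:
  assumes "is_bob D (bar_ob D R)"
  shows "(B, twist_ext D B \<phi>, bar_ob D R) \<in> Hom (Bcat D) B (bar_ob D R)"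
proof -
  have "nat_trans (op_cat Delta_act) D F (bfun (bar_ob D R)) (twist_ext D B \<phi>)"
    unfolding nat_trans_def
  proof (intro conjI ballI)
    fix \<alpha> assume "\<alpha> \<in> Arr (op_cat Delta_act)"
    moreover obtain n \<theta> m where "\<alpha> = (n, \<theta>, m)" by (metis prod_cases3)
    ultimately show "Cmp D (twist_ext D B \<phi> (Cod (op_cat Delta_act) \<alpha>)) (fa F \<alpha>) =
      Cmp D (fa (bfun (bar_ob D R)) \<alpha>) (twist_ext D B \<phi> (Dom (op_cat Delta_act) \<alpha>))"
      using twist_ext_natural by (simp add: bar_ob_def Delta_act_simps(2,3))
  qed (auto simp: bar_ob_def intro!: HomI)
  then show ?thesis
    using assms B twist_ext_bmul
    by (auto simp: Bcat_def bar_ob_def)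
qed

lemma Run_twist_ext: "Cmp D (Run D (acar R)) (twist_ext D B \<phi> 1) = \<phi>"
proof -
  have "Cmp D (Run D (acar R)) (twist_ext D B \<phi> 1) =
    Cmp D (Cmp D (Run D (acar R)) (TenA D \<phi> (Idt D (One D)))) (Cmp D (TenA D (Idt D (fo F 1)) (bone B)) (bmul B 1 0))"
    by simp
  also have "\<dots> = Cmp D \<phi> (Cmp D (Run D (fo F 1)) (Cmp D (TenA D (Idt D (fo F 1)) (bone B)) (bmul B 1 0)))"
    using Run_natural[of \<phi>] by simp
  also have "\<dots> = \<phi>" unfolding is_bobD(7)[OF B] by simp
  finally show ?thesis .
qed

end

context
  fixes \<tau> :: "nat \<Rightarrow> 'b"
  assumes \<tau>: "(B, \<tau>, bar_ob D R) \<in> Hom (Bcat D) B (bar_ob D R)"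
    and bar: "is_functor (Alg D) (Bcat D) (bar D)"
begin

lemma bar_bob: "is_bob D (bar_ob D R)"
  using \<tau> by (simp add: Bcat_def)

lemma bar_map_nat_trans: "nat_trans (op_cat Delta_act) D F (bfun (bar_ob D R)) \<tau>"
  using \<tau> by (simp add: Bcat_def)

lemma bar_map_simps [simp]: "\<tau> n \<in> Arr D" "Dom D (\<tau> n) = fo F n" "Cod D (\<tau> n) = tpow D (acar R) n"
  using bar_map_nat_trans by (auto simp: nat_trans_def Delta_act_simps bar_ob_def Hom_def)

lemma bar_map_natural:
  assumes "\<alpha> \<in> Arr Delta_act"
  shows "Cmp D (\<tau> (Dom Delta_act \<alpha>)) (fa F \<alpha>) =
    Cmp D (fa (bfun (bar_ob D R)) \<alpha>) (\<tau> (Cod Delta_act \<alpha>))"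
  using bar_map_nat_trans assms by (simp add: nat_trans_def)

lemma bar_map_bmul:
  "Cmp D (tpow_split D (acar R) n m) (\<tau> (n + m)) = Cmp D (TenA D (\<tau> n) (\<tau> m)) (bmul B n m)"
  using \<tau> by (simp add: Bcat_def bar_ob_def)

lemma bar_map_bone: "\<tau> 0 = bone B"
  using \<tau> bar_map_simps[of 0] by (auto simp: Bcat_def bar_ob_def)

lemma Run_tpow_split: "Cmp D (Run D (tpow D (acar R) k)) (tpow_split D (acar R) k 0) = Idt D (tpow D (acar R) k)"
  using is_bobD(7)[OF bar_bob, of k] by (simp add: bar_ob_def)

lemma alg_prod_1: "alg_prod D R 1 = Run D (acar R)"
  using is_algD(10)[OF R] by simp

lemma bar_act_Idt: "bar_act D R n n (\<lambda>i\<in>{..n}. i) = Idt D (tpow D (acar R) n)"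
  using functorD(2)[OF is_bobD(1)[OF bar_bob], of n] by (simp add: bar_ob_def Delta_act_simps)

lemma Run_tpow_split_1:
  "Cmp D (TenA D (Run D (acar R)) (Idt D (tpow D (acar R) n))) (tpow_split D (acar R) 1 n) =
   Idt D (tpow D (acar R) (Suc n))"
proof -
  have "act_rest n (\<lambda>i\<in>{..Suc n}. i) (Suc n) = (n, \<lambda>i\<in>{..n}. i, n)"
    by (auto simp: act_rest_def fun_eq_iff)
  then have "bar_act D R (Suc n) (Suc n) (\<lambda>i\<in>{..Suc n}. i) =
    Cmp D (TenA D (alg_prod D R 1) (bar_act D R n n (\<lambda>i\<in>{..n}. i))) (tpow_split D (acar R) 1 n)"
    unfolding bar_act_Suc by simp
  then show ?thesis
    unfolding bar_act_Idt alg_prod_1 by simp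
qed

definition "bar_twist = Cmp D (Run D (acar R)) (\<tau> 1)"

lemma bar_twist_simps [simp]:
  "bar_twist \<in> Arr D" "Dom D bar_twist = fo F 1" "Cod D bar_twist = acar R"
  by (simp_all add: bar_twist_def)

lemma bar_twist_act_end:
  "Cmp D bar_twist (fa F (act_end k)) = Cmp D (alg_prod D R k) (\<tau> k)"
proof -
  have "act_end k = (1, \<lambda>i\<in>{..1}. if i = 0 then 0 else k, k)" by (simp add: act_end_def)
  then have "fa (bfun (bar_ob D R)) (act_end k) =
      Cmp D (TenA D (alg_prod D R k) (Idt D (One D))) (tpow_split D (acar R) k 0)"
    by (simp add: bar_ob_def)
  then have "Cmp D (\<tau> 1) (fa F (act_end k)) =
      Cmp D (TenA D (alg_prod D R k) (Idt D (One D))) (Cmp D (tpow_split D (acar R) k 0) (\<tau> k))"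
    using bar_map_natural[of "act_end k"] by simp
  then have "Cmp D bar_twist (fa F (act_end k)) =
      Cmp D (Cmp D (Run D (acar R)) (TenA D (alg_prod D R k) (Idt D (One D))))
        (Cmp D (tpow_split D (acar R) k 0) (\<tau> k))"
    by (simp add: bar_twist_def)
  also have "\<dots> = Cmp D (alg_prod D R k) (Cmp D (Cmp D (Run D (tpow D (acar R) k)) (tpow_split D (acar R) k 0)) (\<tau> k))"
    using Run_natural[of "alg_prod D R k"] by simp
  also have "\<dots> = Cmp D (alg_prod D R k) (\<tau> k)"
    unfolding Run_tpow_split by simp
  finally show ?thesis .
qed

lemma bar_map_Suc: "\<tau> (Suc n) = Cmp D (TenA D bar_twist (\<tau> n)) (bmul B 1 n)"
proof -
  have "\<tau> (Suc n) = Cmp D (Cmp D (TenA D (Run D (acar R)) (Idt D (tpow D (acar R) n))) (tpow_split D (acar R) 1 n)) (\<tau> (1 + n))"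
    unfolding Run_tpow_split_1 by simp
  also have "\<dots> = Cmp D (TenA D (Run D (acar R)) (Idt D (tpow D (acar R) n)))
      (Cmp D (tpow_split D (acar R) 1 n) (\<tau> (1 + n)))"
    by (subst Cmp_assoc) auto
  also have "\<dots> = Cmp D (TenA D bar_twist (\<tau> n)) (bmul B 1 n)"
    unfolding bar_map_bmul by (simp add: bar_twist_def)
  finally show ?thesis .
qed

lemma twist_ext_bar_twist: "twist_ext D B bar_twist n = \<tau> n"
proof (induction n)
  case (Suc n)
  then show ?case using bar_map_Suc[of n] by simp
qed (simp add: bar_map_bone)

lemma bar_twist_in: "bar_twist \<in> twist D B R"
proof -
  have "Cmp D bar_twist (fa F (act_end 2)) =
      Cmp D (Cmp D (amul R) (TenA D (Idt D (acar R)) (alg_prod D R 1))) (\<tau> (Suc 1))"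
    unfolding bar_twist_act_end by (simp add: numeral_2_eq_2)
  also have "\<dots> = Cmp D (amul R) (Cmp D (TenA D bar_twist bar_twist) (bmul B 1 1))"
    unfolding bar_map_Suc alg_prod_1 by (simp add: bar_twist_def)
  finally show ?thesis
    using bar_twist_act_end[of 0] by (auto simp: twist_def bar_map_bone intro!: HomI)
qed

end

lemma bij_betw_twist:
  assumes bar: "is_functor (Alg D) (Bcat D) (bar D)" and bar_R: "is_bob D (bar_ob D R)"
  shows "bij_betw (\<lambda>t. Cmp D (Run D (acar R)) (fst (snd t) 1)) (Hom (Bcat D) B (bar_ob D R)) (twist D B R)"
proof (rule bij_betw_byWitness[where f' = "\<lambda>\<phi>. (B, twist_ext D B \<phi>, bar_ob D R)"])
  have *: "\<exists>\<tau>. t = (B, \<tau>, bar_ob D R)" if "t \<in> Hom (Bcat D) B (bar_ob D R)" for t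
    using that by (auto simp: Bcat_def)
  show "\<forall>t\<in>Hom (Bcat D) B (bar_ob D R).
      (B, twist_ext D B (Cmp D (Run D (acar R)) (fst (snd t) 1)), bar_ob D R) = t"
  proof
    fix t assume t: "t \<in> Hom (Bcat D) B (bar_ob D R)"
    then obtain \<tau> where \<tau>: "t = (B, \<tau>, bar_ob D R)" using * by blast
    show "(B, twist_ext D B (Cmp D (Run D (acar R)) (fst (snd t) 1)), bar_ob D R) = t"
      using twist_ext_bar_twist[OF t[unfolded \<tau>] bar] unfolding bar_twist_def[OF t[unfolded \<tau>] bar]
      by (simp add: \<tau> fun_eq_iff)
  qed
  show "\<forall>\<phi>\<in>twist D B R. Cmp D (Run D (acar R)) (fst (snd (B, twist_ext D B \<phi>, bar_ob D R)) 1) = \<phi>"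
    using Run_twist_ext by simp
  show "(\<lambda>t. Cmp D (Run D (acar R)) (fst (snd t) 1)) ` Hom (Bcat D) B (bar_ob D R) \<subseteq> twist D B R"
  proof (intro subsetI, elim imageE)
    fix t \<phi> assume \<phi>: "\<phi> = Cmp D (Run D (acar R)) (fst (snd t) 1)" and t: "t \<in> Hom (Bcat D) B (bar_ob D R)"
    then obtain \<tau> where \<tau>: "t = (B, \<tau>, bar_ob D R)" using * by blast
    show "\<phi> \<in> twist D B R"
      using bar_twist_in[OF t[unfolded \<tau>] bar] unfolding bar_twist_def[OF t[unfolded \<tau>] bar] by (simp add: \<tau> \<phi>)
  qed
  show "(\<lambda>\<phi>. (B, twist_ext D B \<phi>, bar_ob D R)) ` twist D B R \<subseteq> Hom (Bcat D) B (bar_ob D R)"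
    using twist_ext_arr[OF _ bar_R] by auto
qed

end

context tensored_category
begin

lemma category_Alg: "category (Alg D)"
  unfolding Alg_def
proof (rule category_struct_cat, goal_cases)
  case (2 X Y Z f g)
  then have R: "is_alg D X" "is_alg D Y" "is_alg D Z" by auto
  note [simp] = is_algD(1-7)[OF R(1)] is_algD(1-7)[OF R(2)] is_algD(1-7)[OF R(3)]
  have [simp]: "f \<in> Arr D" "Dom D f = acar X" "Cod D f = acar Y" "g \<in> Arr D" "Dom D g = acar Y" "Cod D g = acar Z"
    and f: "Cmp D f (amul X) = Cmp D (amul Y) (TenA D f f)" "Cmp D f (aone X) = aone Y"
    and g: "Cmp D g (amul Y) = Cmp D (amul Z) (TenA D g g)" "Cmp D g (aone Y) = aone Z"
    using 2 by (auto simp: Hom_def)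
  have "Cmp D g (Cmp D (amul Y) (TenA D f f)) = Cmp D (Cmp D g (amul Y)) (TenA D f f)" by simp
  also have "\<dots> = Cmp D (amul Z) (TenA D (Cmp D g f) (Cmp D g f))" unfolding g by simp
  finally show ?case by (auto simp: f g intro!: HomI)
qed (auto simp: is_algD Hom_def)

lemma category_Bcat: "category (Bcat D)"
  unfolding Bcat_def
proof (rule category_struct_cat, goal_cases)
  case (1 B)
  then interpret B: bob D B by unfold_locales simp
  show ?case 
    using 1 by (auto intro!: nat_trans_Idt category_axioms is_bobD)
next
  case (2 X Y Z f g)
  interpret X: bob D X using 2 by unfold_locales simp
  interpret Y: bob D Y using 2 by unfold_locales simp
  interpret Z: bob D Z using 2 by unfold_locales simp
  have f: "nat_trans (op_cat Delta_act) D (bfun X) (bfun Y) f" and g: "nat_trans (op_cat Delta_act) D (bfun Y) (bfun Z) g"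
    using 2 by auto
  note [simp] = nat_transD(1-3)[OF f, simplified] nat_transD(1-3)[OF g, simplified]
  have "Cmp D (bmul Z n m) (Cmp D (g (n + m)) (f (n + m))) =
      Cmp D (TenA D (Cmp D (g n) (f n)) (Cmp D (g m) (f m))) (bmul X n m)" for n m
  proof -
    have "Cmp D (bmul Z n m) (Cmp D (g (n + m)) (f (n + m))) = Cmp D (Cmp D (bmul Z n m) (g (n + m))) (f (n + m))"
      by simp
    also have "\<dots> = Cmp D (TenA D (g n) (g m)) (Cmp D (bmul Y n m) (f (n + m)))"
      using 2 by simp
    also have "\<dots> = Cmp D (TenA D (g n) (g m)) (Cmp D (TenA D (f n) (f m)) (bmul X n m))"
      using 2 by simp
    finally show ?thesis by simp
  qed
  moreover have "Cmp D (bone Z) (Cmp D (g 0) (f 0)) = bone X"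
  proof -
    have "Cmp D (bone Z) (Cmp D (g 0) (f 0)) = Cmp D (Cmp D (bone Z) (g 0)) (f 0)" by simp
    also have "\<dots> = bone X" using 2 by (simp del: Cmp_assoc)
    finally show ?thesis .
  qed
  moreover have "nat_trans (op_cat Delta_act) D (bfun X) (bfun Z) (\<lambda>n. Cmp D (g n) (f n))"
    using 2 by (intro nat_trans_Cmp[OF category_axioms _ _ _ f g] is_bobD) auto
  ultimately show ?case by simp
next
  case (3 X Y Z W f g h)
  then have *: "nat_trans (op_cat Delta_act) D (bfun X) (bfun Y) f"
    "nat_trans (op_cat Delta_act) D (bfun Y) (bfun Z) g" "nat_trans (op_cat Delta_act) D (bfun Z) (bfun W) h" by auto
  then show ?case
    using *[THEN nat_transD(1)] *[THEN nat_transD(2)] *[THEN nat_transD(3)] by simp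
next
  case (4 X Y f)
  then have *: "nat_trans (op_cat Delta_act) D (bfun X) (bfun Y) f" by auto
  then show ?case
    using *[THEN nat_transD(1)] *[THEN nat_transD(2)] *[THEN nat_transD(3)] by simp
next
  case (5 X Y f)
  then have *: "nat_trans (op_cat Delta_act) D (bfun X) (bfun Y) f" by auto
  then show ?case
    using *[THEN nat_transD(1)] *[THEN nat_transD(2)] *[THEN nat_transD(3)] by simp
qed

lemma represents_twist:
  assumes "is_cobar D L"
  shows "\<exists>\<Phi>. represents (Bcat D) (Alg D) L (twist D)
    (\<lambda>f g \<phi>. Cmp D (fst (snd g)) (Cmp D \<phi> (fst (snd f) 1))) \<Phi>"
proof -
  have bar: "is_functor (Alg D) (Bcat D) (bar D)" using assms by (simp add: left_adjoint_def)
  obtain \<Phi> where \<Phi>: "represents (Bcat D) (Alg D) L (\<lambda>B R. Hom (Bcat D) B (fo (bar D) R))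
      (\<lambda>f g p. Cmp (Bcat D) (fa (bar D) g) (Cmp (Bcat D) p f)) \<Phi>"
    using assms by (auto simp: left_adjoint_def represents_def)
  let ?\<Psi> = "\<lambda>B R t. Cmp D (Run D (acar R)) (fst (snd t) 1)"
  have "represents (Bcat D) (Alg D) L (twist D)
    (\<lambda>f g \<phi>. Cmp D (fst (snd g)) (Cmp D \<phi> (fst (snd f) 1))) (\<lambda>B R. ?\<Psi> B R \<circ> \<Phi> B R)"
  proof (rule represents_transfer[OF \<Phi> _ _ category_Bcat category_Alg])
    fix B R assume BR: "B \<in> Obj (Bcat D)" "R \<in> Obj (Alg D)"
    then interpret bob_to_bar D B R by unfold_locales (auto simp: Bcat_def Alg_def)
    show "bij_betw (?\<Psi> B R) (Hom (Bcat D) B (fo (bar D) R)) (twist D B R)"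
      using bij_betw_twist[OF bar] functorD(1)[OF bar BR(2)] by (simp add: bar_def Bcat_def)
  next
    fix f g p assume f: "f \<in> Arr (Bcat D)" and g: "g \<in> Arr (Alg D)"
      and p: "p \<in> Hom (Bcat D) (Cod (Bcat D) f) (fo (bar D) (Dom (Alg D) g))"
    obtain B f0 B' where f_eq: "f = (B, f0, B')" by (metis prod_cases3)
    obtain R g0 R' where g_eq: "g = (R, g0, R')" by (metis prod_cases3)
    obtain p0 where p_eq: "p = (B', p0, bar_ob D R)" using p by (auto simp: Bcat_def f_eq bar_def g_eq Alg_def)
    have f0: "nat_trans (op_cat Delta_act) D (bfun B) (bfun B') f0" using f by (simp add: f_eq Bcat_def)
    have p0: "nat_trans (op_cat Delta_act) D (bfun B') (bfun (bar_ob D R)) p0" using p by (simp add: f_eq p_eq Bcat_def)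
    have g0: "g0 \<in> Arr D" "Dom D g0 = acar R" "Cod D g0 = acar R'" using g by (simp_all add: g_eq Alg_def Hom_def)
    note [simp] = nat_transD(1-3)[OF f0, simplified] nat_transD(1-3)[OF p0, simplified] g0
      is_algD(1)[of R] is_algD(1)[of R']
    have R: "is_alg D R" "is_alg D R'" using g by (auto simp: g_eq Alg_def)
    have "Cmp D (Run D (acar R')) (Cmp D (TenA D g0 (Idt D (One D))) (Cmp D (p0 1) (f0 1))) =
      Cmp D (Cmp D (Run D (acar R')) (TenA D g0 (Idt D (One D)))) (Cmp D (p0 1) (f0 1))"
      using R by (simp add: bar_ob_def)
    also have "\<dots> = Cmp D g0 (Cmp D (Cmp D (Run D (acar R)) (p0 1)) (f0 1))"
      using Run_natural[of g0] R by (simp add: bar_ob_def)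
    finally show "?\<Psi> (Dom (Bcat D) f) (Cod (Alg D) g) (Cmp (Bcat D) (fa (bar D) g) (Cmp (Bcat D) p f)) =
      Cmp D (fst (snd g)) (Cmp D (?\<Psi> (Cod (Bcat D) f) (Dom (Alg D) g) p) (fst (snd f) 1))"
      by (simp add: f_eq g_eq p_eq bar_def Bcat_def Alg_def)
  qed
  then show ?thesis by blast
qed

end

section \<open>Simplicial objects and slices of tensored categories\<close>

lemma Delta_Obj [simp]: "n \<in> Obj Delta"
  by (simp add: Delta_def)

lemma Simp_simps:
  "X \<in> Obj (Simp D) \<longleftrightarrow> is_functor (op_cat Delta) D X"
  "F \<in> Hom (Simp D) X Y \<longleftrightarrow> (\<exists>t. F = (X, t, Y) \<and> is_functor (op_cat Delta) D X \<and>
     is_functor (op_cat Delta) D Y \<and> nat_trans (op_cat Delta) D X Y t)"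
  "(X, t, Y) \<in> Arr (Simp D) \<longleftrightarrow> is_functor (op_cat Delta) D X \<and>
     is_functor (op_cat Delta) D Y \<and> nat_trans (op_cat Delta) D X Y t"
  "Dom (Simp D) (X, t, Y) = X" "Cod (Simp D) (X, t, Y) = Y"
  "Idt (Simp D) X = (X, \<lambda>n. Idt D (fo X n), X)"
  "Cmp (Simp D) (Y, s, Z) (X, t, Y') = (X, \<lambda>n. Cmp D (s n) (t n), Z)"
  "Ten (Simp D) X Y = simp_ten D X Y"
  "TenA (Simp D) (X, t, X') (Y, s, Y') = (simp_ten D X Y, \<lambda>n. TenA D (t n) (s n), simp_ten D X' Y')"
  "One (Simp D) = simp_one D"
  "Assoc (Simp D) X Y Z = (simp_ten D (simp_ten D X Y) Z, \<lambda>n. Assoc D (fo X n) (fo Y n) (fo Z n),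
                simp_ten D X (simp_ten D Y Z))"
  "Lun (Simp D) X = (simp_ten D (simp_one D) X, \<lambda>n. Lun D (fo X n), X)"
  "Run (Simp D) X = (simp_ten D X (simp_one D), \<lambda>n. Run D (fo X n), X)"
  unfolding Simp_def by auto

lemma category_Simp:
  assumes "category D"
  shows "category (Simp D)"
  unfolding Simp_def category_mk_moncat
proof (rule category_struct_cat, goal_cases)
  interpret D: category D by fact
  {
    case (1 X)
    then show ?case using assms by (auto intro!: nat_trans_Idt)
  next
    case (2 X Y Z f g)
    then show ?case using assms nat_trans_Cmp[of D "op_cat Delta" X Y Z f g] by auto
  next
    case (3 X Y Z W f g h)
    then have *: "nat_trans (op_cat Delta) D X Y f" "nat_trans (op_cat Delta) D Y Z g"
      "nat_trans (op_cat Delta) D Z W h" by auto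
    show ?case
      using *[THEN nat_transD(1)] *[THEN nat_transD(2)] *[THEN nat_transD(3)] by simp
  next
    case (4 X Y f)
    then have *: "nat_trans (op_cat Delta) D X Y f" by auto
    show ?case
      using *[THEN nat_transD(1)] *[THEN nat_transD(2)] *[THEN nat_transD(3)] by simp
  next
    case (5 X Y f)
    then have *: "nat_trans (op_cat Delta) D X Y f" by auto
    show ?case
      using *[THEN nat_transD(1)] *[THEN nat_transD(2)] *[THEN nat_transD(3)] by simp
  }
qed

lemma nat_trans_inv_arr:
  assumes "category D" "is_functor C D F" "is_functor C D G" and t: "nat_trans C D F G t"
    and iso: "\<And>X. X \<in> Obj C \<Longrightarrow> iso_arr D (t X)"
    and Obj: "\<And>f. f \<in> Arr C \<Longrightarrow> Dom C f \<in> Obj C \<and> Cod C f \<in> Obj C"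
  shows "nat_trans C D G F (\<lambda>X. inv_arr D (t X))"
proof -
  interpret D: category D by fact
  note [simp] = functorD(1,3-5)[OF assms(2)] functorD(1,3-5)[OF assms(3)] nat_transD(1-3)[OF t] iso
  show ?thesis unfolding nat_trans_def
  proof (intro conjI ballI)
    fix f assume f: "f \<in> Arr C"
    note [simp] = f conjunct1[OF Obj[OF f]] conjunct2[OF Obj[OF f]]
    let ?i = "\<lambda>X. inv_arr D (t X)"
    have "Cmp D (?i (Cod C f)) (fa G f) =
        Cmp D (?i (Cod C f)) (Cmp D (Cmp D (fa G f) (t (Dom C f))) (?i (Dom C f)))" by simp
    also have "\<dots> = Cmp D (?i (Cod C f)) (Cmp D (Cmp D (t (Cod C f)) (fa F f)) (?i (Dom C f)))"
      by (simp only: nat_transD(4)[OF t f])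
    also have "\<dots> = Cmp D (fa F f) (?i (Dom C f))" by simp
    finally show "Cmp D (?i (Cod C f)) (fa G f) = Cmp D (fa F f) (?i (Dom C f))" .
  qed (auto intro!: HomI)
qed

lemma iso_arr_Simp:
  assumes "category D" "(X, t, Y) \<in> Arr (Simp D)" "\<And>n. iso_arr D (t n)"
  shows "iso_arr (Simp D) (X, t, Y)"
proof -
  interpret D: category D by fact
  have XY: "is_functor (op_cat Delta) D X" "is_functor (op_cat Delta) D Y"
    and t: "nat_trans (op_cat Delta) D X Y t" using assms(2) by (auto simp: Simp_simps)
  have "nat_trans (op_cat Delta) D Y X (\<lambda>n. inv_arr D (t n))"
    using XY t assms by (intro nat_trans_inv_arr) auto
  then have "inverse_arrows (Simp D) (X, t, Y) (Y, \<lambda>n. inv_arr D (t n), X)"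
    using assms XY nat_transD(2,3)[OF t] by (auto simp: inverse_arrows_def Simp_simps)
  then show ?thesis by (auto simp: iso_arr_def)
qed

lemma tensored_category_Simp:
  assumes "tensored_category D"
  shows "tensored_category (Simp D)"
proof -
  interpret D: tensored_category D by fact
  have ten: "is_functor (op_cat Delta) D (simp_ten D X Y)"
    if "is_functor (op_cat Delta) D X" "is_functor (op_cat Delta) D Y" for X Y
    using functorD[OF that(1)] functorD[OF that(2)]
    by (intro functorI) (auto simp: simp_ten_def intro!: HomI)
  have one: "is_functor (op_cat Delta) D (simp_one D)"
    by (intro functorI) (auto simp: simp_one_def intro!: HomI)
  have as: "nat_trans (op_cat Delta) D (simp_ten D (simp_ten D X Y) Z) (simp_ten D X (simp_ten D Y Z))
      (\<lambda>n. Assoc D (fo X n) (fo Y n) (fo Z n))"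
    if "is_functor (op_cat Delta) D X" "is_functor (op_cat Delta) D Y" "is_functor (op_cat Delta) D Z" for X Y Z
    unfolding nat_trans_def
  proof (intro conjI ballI)
    fix \<alpha> assume \<alpha>: "\<alpha> \<in> Arr (op_cat Delta)"
    then show "Cmp D (Assoc D (fo X (Cod (op_cat Delta) \<alpha>)) (fo Y (Cod (op_cat Delta) \<alpha>)) (fo Z (Cod (op_cat Delta) \<alpha>)))
        (fa (simp_ten D (simp_ten D X Y) Z) \<alpha>) = Cmp D (fa (simp_ten D X (simp_ten D Y Z)) \<alpha>)
        (Assoc D (fo X (Dom (op_cat Delta) \<alpha>)) (fo Y (Dom (op_cat Delta) \<alpha>)) (fo Z (Dom (op_cat Delta) \<alpha>)))"
      using D.Assoc_natural[of "fa X \<alpha>" "fa Y \<alpha>" "fa Z \<alpha>"] that[THEN functorD(3)] that[THEN functorD(4)] that[THEN functorD(5)]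
      by (simp add: simp_ten_def)
  qed (use that[THEN functorD(1)] in \<open>auto simp: simp_ten_def intro!: HomI\<close>)
  have lun: "nat_trans (op_cat Delta) D (simp_ten D (simp_one D) X) X (\<lambda>n. Lun D (fo X n))"
    if "is_functor (op_cat Delta) D X" for X
    unfolding nat_trans_def
  proof (intro conjI ballI)
    fix \<alpha> assume \<alpha>: "\<alpha> \<in> Arr (op_cat Delta)"
    then show "Cmp D (Lun D (fo X (Cod (op_cat Delta) \<alpha>))) (fa (simp_ten D (simp_one D) X) \<alpha>) =
        Cmp D (fa X \<alpha>) (Lun D (fo X (Dom (op_cat Delta) \<alpha>)))"
      using D.Lun_natural[of "fa X \<alpha>"] functorD(3-5)[OF that]
      by (simp add: simp_ten_def simp_one_def)
  qed (use that[THEN functorD(1)] in \<open>auto simp: simp_ten_def simp_one_def intro!: HomI\<close>)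
  have run: "nat_trans (op_cat Delta) D (simp_ten D X (simp_one D)) X (\<lambda>n. Run D (fo X n))"
    if "is_functor (op_cat Delta) D X" for X
    unfolding nat_trans_def
  proof (intro conjI ballI)
    fix \<alpha> assume \<alpha>: "\<alpha> \<in> Arr (op_cat Delta)"
    then show "Cmp D (Run D (fo X (Cod (op_cat Delta) \<alpha>))) (fa (simp_ten D X (simp_one D)) \<alpha>) =
        Cmp D (fa X \<alpha>) (Run D (fo X (Dom (op_cat Delta) \<alpha>)))"
      using D.Run_natural[of "fa X \<alpha>"] functorD(3-5)[OF that]
      by (simp add: simp_ten_def simp_one_def)
  qed (use that[THEN functorD(1)] in \<open>auto simp: simp_ten_def simp_one_def intro!: HomI\<close>)
  have tena: "nat_trans (op_cat Delta) D (simp_ten D X Y) (simp_ten D X' Y') (\<lambda>n. TenA D (t n) (s n))"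
    if XY: "is_functor (op_cat Delta) D X" "is_functor (op_cat Delta) D Y"
      "is_functor (op_cat Delta) D X'" "is_functor (op_cat Delta) D Y'"
      and t: "nat_trans (op_cat Delta) D X X' t" and s: "nat_trans (op_cat Delta) D Y Y' s"
    for X Y X' Y' t s
    using nat_transD[OF t] nat_transD[OF s]
      XY[THEN functorD(1)] XY[THEN functorD(3)] XY[THEN functorD(4)] XY[THEN functorD(5)]
    by (auto simp: nat_trans_def simp_ten_def intro!: HomI)
  interpret S: category "Simp D" by (rule category_Simp) (rule D.category_axioms)
  have isoI: "iso_arr (Simp D) (X, t, Y)" if "(X, t, Y) \<in> Arr (Simp D)" "\<And>n. iso_arr D (t n)" for X Y t
    using that by (rule iso_arr_Simp[OF D.category_axioms])
  show ?thesis
  proof (unfold_locales, goal_cases)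
    case (3 f X Y g X' Y')
    then show ?case by (auto simp: Simp_simps ten tena)
  next
    case (5 f X Y g Z f' X' Y' g' Z')
    then obtain k l k' l' where *: "f = (X, k, Y)" "g = (Y, l, Z)" "f' = (X', k', Y')" "g' = (Y', l', Z')"
      "nat_trans (op_cat Delta) D X Y k" "nat_trans (op_cat Delta) D Y Z l"
      "nat_trans (op_cat Delta) D X' Y' k'" "nat_trans (op_cat Delta) D Y' Z' l'"
      by (auto simp: Simp_simps)
    show ?case
      using *(5-8)[THEN nat_transD(1)] *(5-8)[THEN nat_transD(2)] *(5-8)[THEN nat_transD(3)]
      by (simp add: Simp_simps *(1-4) fun_eq_iff)
  next
    case (7 X Y Z)
    then show ?case using functorD(1)[of "op_cat Delta" D]
      by (simp add: Simp_simps) (rule isoI, auto simp: Simp_simps ten as)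
  next
    case (8 f X X' g Y Y' h Z Z')
    then obtain f' g' h' where *: "f = (X, f', X')" "g = (Y, g', Y')" "h = (Z, h', Z')"
      "nat_trans (op_cat Delta) D X X' f'" "nat_trans (op_cat Delta) D Y Y' g'" "nat_trans (op_cat Delta) D Z Z' h'"
      by (auto simp: Simp_simps)
    show ?case
      using D.Assoc_natural[of "f' _" "g' _" "h' _"] nat_transD(1-3)[OF *(4)] nat_transD(1-3)[OF *(5)]
        nat_transD(1-3)[OF *(6)]
      by (simp add: Simp_simps *(1-3) fun_eq_iff)
  next
    case (10 X)
    then show ?case using functorD(1)[of "op_cat Delta" D]
      by (simp add: Simp_simps) (rule isoI, auto simp: Simp_simps ten one lun)
  next
    case (11 f X Y)
    then obtain f' where *: "f = (X, f', Y)" "nat_trans (op_cat Delta) D X Y f'"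
      by (auto simp: Simp_simps)
    show ?case
      using D.Lun_natural[of "f' _"] nat_transD(1-3)[OF *(2)]
      by (simp add: Simp_simps *(1) fun_eq_iff simp_one_def)
  next
    case (13 X)
    then show ?case using functorD(1)[of "op_cat Delta" D]
      by (simp add: Simp_simps) (rule isoI, auto simp: Simp_simps ten one run)
  next
    case (14 f X Y)
    then obtain f' where *: "f = (X, f', Y)" "nat_trans (op_cat Delta) D X Y f'"
      by (auto simp: Simp_simps)
    show ?case
      using D.Run_natural[of "f' _"] nat_transD(1-3)[OF *(2)]
      by (simp add: Simp_simps *(1) fun_eq_iff simp_one_def)
  next
    case 15
    then show ?case by (simp add: Simp_simps D.Lun_One simp_one_def)
  next
    case 16
    then show ?case by (simp add: Simp_simps D.Lun_Assoc simp_one_def)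
  qed (auto simp: Simp_simps ten one as lun run functorD(1) simp_ten_def[THEN arg_cong, of fo])
qed

lemma Over_One_simps:
  "A \<in> Obj (Over_One D) \<longleftrightarrow> fst A \<in> Obj D \<and> snd A \<in> Hom D (fst A) (One D)"
  "F \<in> Hom (Over_One D) A B \<longleftrightarrow> (\<exists>f. F = (A, f, B) \<and> A \<in> Obj (Over_One D) \<and>
     B \<in> Obj (Over_One D) \<and> f \<in> Hom D (fst A) (fst B) \<and> Cmp D (snd B) f = snd A)"
  "(A, f, B) \<in> Arr (Over_One D) \<longleftrightarrow> A \<in> Obj (Over_One D) \<and>
     B \<in> Obj (Over_One D) \<and> f \<in> Hom D (fst A) (fst B) \<and> Cmp D (snd B) f = snd A"
  "Dom (Over_One D) (A, f, B) = A" "Cod (Over_One D) (A, f, B) = B"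
  "Idt (Over_One D) A = (A, Idt D (fst A), A)"
  "Cmp (Over_One D) (B, g, C) (A, f, B') = (A, Cmp D g f, C)"
  "Ten (Over_One D) A B = aug_ten D A B"
  "TenA (Over_One D) (A, f, A') (B, g, B') = (aug_ten D A B, TenA D f g, aug_ten D A' B')"
  "One (Over_One D) = aug_one D"
  "Assoc (Over_One D) A B C = (aug_ten D (aug_ten D A B) C, Assoc D (fst A) (fst B) (fst C),
                aug_ten D A (aug_ten D B C))"
  "Lun (Over_One D) A = (aug_ten D (aug_one D) A, Lun D (fst A), A)"
  "Run (Over_One D) A = (aug_ten D A (aug_one D), Run D (fst A), A)"
  unfolding Over_One_def by (auto simp: case_prod_beta)

lemma category_Over_One:
  assumes "category D"
  shows "category (Over_One D)"
proof -
  interpret category D by fact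
  show ?thesis unfolding Over_One_def category_mk_moncat
  proof (rule category_struct_cat, goal_cases)
    case (2 X Y Z f g)
    then have "Cmp D (Cmp D (snd Z) g) f = snd X" by auto
    then show ?case using 2 by (auto simp: Hom_def)
  qed (auto simp: Hom_def)
qed

lemma tensored_category_Over_One:
  assumes "tensored_category D"
  shows "tensored_category (Over_One D)"
proof -
  interpret D: tensored_category D by fact
  interpret O: category "Over_One D" by (rule category_Over_One) (rule D.category_axioms)
  have isoI: "iso_arr (Over_One D) (A, f, B)" if "(A, f, B) \<in> Arr (Over_One D)" "iso_arr D f" for A f B
  proof -
    have "Cmp D (snd A) (inv_arr D f) = Cmp D (Cmp D (snd B) f) (inv_arr D f)"
      using that by (simp add: Over_One_simps del: D.Cmp_assoc)
    also have "\<dots> = Cmp D (snd B) (Cmp D f (inv_arr D f))"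
      using that by (intro D.Cmp_assoc) (auto simp: Over_One_simps Hom_def)
    also have "\<dots> = snd B" using that by (auto simp: Over_One_simps Hom_def)
    finally have "inverse_arrows (Over_One D) (A, f, B) (B, inv_arr D f, A)"
      using that by (auto simp: inverse_arrows_def Over_One_simps Hom_def)
    then show ?thesis unfolding iso_arr_def by blast
  qed
  have ten: "aug_ten D A B \<in> Obj (Over_One D)" if "A \<in> Obj (Over_One D)" "B \<in> Obj (Over_One D)" for A B
    using that by (auto simp: Over_One_simps aug_ten_def Hom_def)
  have one: "aug_one D \<in> Obj (Over_One D)"
    by (auto simp: Over_One_simps aug_one_def Hom_def)
  have fst_simps: "fst (aug_ten D A B) = Ten D (fst A) (fst B)" "fst (aug_one D) = One D" for A B
    by (simp_all add: aug_ten_def aug_one_def)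
  have tena: "(aug_ten D A B, TenA D f g, aug_ten D A' B') \<in> Arr (Over_One D)"
    if "(A, f, A') \<in> Arr (Over_One D)" "(B, g, B') \<in> Arr (Over_One D)" for A A' B B' f g
    using that ten by (auto simp: Over_One_simps(3)) (auto simp: Over_One_simps(1) aug_ten_def Hom_def)
  have as: "Assoc (Over_One D) A B C \<in> Arr (Over_One D)"
    if "A \<in> Obj (Over_One D)" "B \<in> Obj (Over_One D)" "C \<in> Obj (Over_One D)" for A B C
  proof -
    note * = that[unfolded Over_One_simps Hom_def, simplified]
    let ?l = "Lun D (One D)" and ?i = "Idt D (One D)"
    have "Cmp D (Cmp D ?l (TenA D (snd A) (Cmp D ?l (TenA D (snd B) (snd C))))) (Assoc D (fst A) (fst B) (fst C)) =
      Cmp D ?l (Cmp D (TenA D ?i ?l) (Cmp D (TenA D (snd A) (TenA D (snd B) (snd C))) (Assoc D (fst A) (fst B) (fst C))))"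
      using * by simp
    also have "\<dots> = Cmp D (Cmp D ?l (Cmp D (TenA D ?i ?l) (Assoc D (One D) (One D) (One D))))
        (TenA D (TenA D (snd A) (snd B)) (snd C))"
      using * D.Assoc_natural[of "snd A" "snd B" "snd C"] by simp
    also have "\<dots> = Cmp D ?l (TenA D (Cmp D ?l (TenA D (snd A) (snd B))) (snd C))"
      unfolding D.Lun_Assoc[symmetric] using * by simp
    finally show ?thesis
      using * that ten D.Assoc_Hom by (simp add: Over_One_simps(3,11)) (simp add: aug_ten_def)
  qed
  have lun: "Lun (Over_One D) A \<in> Arr (Over_One D)" if "A \<in> Obj (Over_One D)" for A
    using that ten[OF one that] D.Lun_Hom[of "fst A"] D.Lun_natural[of "snd A"]
    by (simp add: Over_One_simps(3,12)) (simp add: Over_One_simps Hom_def aug_ten_def aug_one_def)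
  have run: "Run (Over_One D) A \<in> Arr (Over_One D)" if "A \<in> Obj (Over_One D)" for A
    using that ten[OF that one] D.Run_Hom[of "fst A"] D.Run_natural[of "snd A"]
    by (simp add: Over_One_simps(3,13)) (simp add: Over_One_simps Hom_def aug_ten_def aug_one_def D.Lun_One)
  show ?thesis
  proof (unfold_locales, goal_cases)
    case (1 X Y) then show ?case using ten by (simp add: Over_One_simps(8))
  next
    case 2 then show ?case using one by (simp add: Over_One_simps(10))
  next
    case (3 f X Y g X' Y')
    then obtain f' g' where *: "f = (X, f', Y)" "g = (X', g', Y')" "f \<in> Arr (Over_One D)" "g \<in> Arr (Over_One D)"
      by (auto simp: Over_One_simps(2) dest: HomD(1))
         (auto simp: Over_One_simps)
    show ?case using tena[of X f' Y X' g' Y'] *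
      by (auto simp: Hom_def Over_One_simps(4,5,8,9))
  next
    case (4 X Y)
    then show ?case by (auto simp: Over_One_simps(6,8,9) fst_simps) (auto simp: Over_One_simps)
  next
    case (5 f X Y g Z f' X' Y' g' Z')
    then obtain k l k' l' where *: "f = (X, k, Y)" "g = (Y, l, Z)" "f' = (X', k', Y')" "g' = (Y', l', Z')"
      "k \<in> Hom D (fst X) (fst Y)" "l \<in> Hom D (fst Y) (fst Z)" "k' \<in> Hom D (fst X') (fst Y')" "l' \<in> Hom D (fst Y') (fst Z')"
      by (auto simp: Over_One_simps(2))
    then show ?case by (simp add: Over_One_simps(7,9) Hom_def)
  next
    case (6 X Y Z)
    then show ?case using as[of X Y Z] by (auto intro!: HomI simp: Over_One_simps(4,5,8,11))
  next
    case (7 X Y Z)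
    then show ?case using as[of X Y Z] unfolding Over_One_simps(11)
      by (intro isoI) (auto simp: Over_One_simps(1))
  next
    case (8 f X X' g Y Y' h Z Z')
    then obtain f' g' h' where *: "f = (X, f', X')" "g = (Y, g', Y')" "h = (Z, h', Z')"
      "f' \<in> Hom D (fst X) (fst X')" "g' \<in> Hom D (fst Y) (fst Y')" "h' \<in> Hom D (fst Z) (fst Z')"
      by (auto simp: Over_One_simps(2))
    then show ?case
      using D.Assoc_nat[OF *(4-6)] by (simp add: Over_One_simps(7,9,11))
  next
    case (9 X)
    then show ?case using lun[of X] by (auto intro!: HomI simp: Over_One_simps(4,5,8,10,12))
  next
    case (10 X)
    then show ?case using lun[of X] unfolding Over_One_simps(12)
      by (intro isoI) (auto simp: Over_One_simps(1))
  next
    case (11 f X Y)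
    then obtain f' where *: "f = (X, f', Y)" "f' \<in> Hom D (fst X) (fst Y)"
      by (auto simp: Over_One_simps(2))
    then show ?case
      using D.Lun_nat[OF *(2)] by (simp add: Over_One_simps(6,7,9,10,12) fst_simps)
  next
    case (12 X)
    then show ?case using run[of X] by (auto intro!: HomI simp: Over_One_simps(4,5,8,10,13))
  next
    case (13 X)
    then show ?case using run[of X] unfolding Over_One_simps(13)
      by (intro isoI) (auto simp: Over_One_simps(1))
  next
    case (14 f X Y)
    then obtain f' where *: "f = (X, f', Y)" "f' \<in> Hom D (fst X) (fst Y)"
      by (auto simp: Over_One_simps(2))
    then show ?case
      using D.Run_nat[OF *(2)] by (simp add: Over_One_simps(6,7,9,10,13) fst_simps)
  next
    case 15
    then show ?case by (simp add: Over_One_simps(10,12,13) fst_simps D.Lun_One)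
  next
    case 16
    show ?case
      by (simp add: Over_One_simps(6,7,9,10,11,12) fst_simps D.Lun_Assoc)
  qed
qed

section \<open>Sets and abelian groups\<close>

lemma inj_on_emb:
  fixes f :: "'a \<Rightarrow> 'u"
  assumes "inj_on f S"
  shows "inj_on (emb S :: 'a \<Rightarrow> 'u) S"
  unfolding emb_def using assms by (rule someI[of "\<lambda>f. inj_on f S"])

abbreviation ap :: "'o \<times> 'f \<times> 'p \<Rightarrow> 'f" where
  "ap F \<equiv> fst (snd F)"

locale infinite_universe =
  fixes univ :: "'u itself"
  assumes infinite_UNIV: "infinite (UNIV :: 'u set)"
begin

lemma Times_eqpoll: "(UNIV :: ('u \<times> 'u) set) \<approx> (UNIV :: 'u set)"
  using card_of_Times_same_infinite[OF infinite_UNIV] by (simp add: eqpoll_iff_card_of_ordIso)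

lemma ex_inj_pair: "\<exists>f :: 'u \<times> 'u \<Rightarrow> 'u. inj f"
  using Times_eqpoll by (auto simp: eqpoll_def bij_betw_def)

lemma ex_inj_frag: "\<exists>f :: ('u \<Rightarrow>\<^sub>0 int) \<Rightarrow> 'u. inj f"
proof -
  have "carrier (free_Abelian_group (UNIV :: 'u set)) \<approx> (UNIV :: 'u set)"
    by (rule eqpoll_free_Abelian_group_infinite) (rule infinite_UNIV)
  then show ?thesis by (auto simp: eqpoll_def bij_betw_def free_Abelian_group_def)
qed

lemma ex_inj_frag_pair: "\<exists>f :: ('u \<times> 'u \<Rightarrow>\<^sub>0 int) \<Rightarrow> 'u. inj f"
proof -
  have "infinite (UNIV :: ('u \<times> 'u) set)"
    using infinite_UNIV Times_eqpoll by (simp add: eqpoll_finite_iff)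
  then have "carrier (free_Abelian_group (UNIV :: ('u \<times> 'u) set)) \<approx> (UNIV :: ('u \<times> 'u) set)"
    by (rule eqpoll_free_Abelian_group_infinite)
  then have "carrier (free_Abelian_group (UNIV :: ('u \<times> 'u) set)) \<approx> (UNIV :: 'u set)"
    using Times_eqpoll by (rule eqpoll_trans)
  then show ?thesis by (auto simp: eqpoll_def bij_betw_def free_Abelian_group_def)
qed

lemma ex_inj_int: "\<exists>f :: int \<Rightarrow> 'u. inj f"
proof -
  obtain f :: "nat \<Rightarrow> 'u" where "inj f"
    using infinite_countable_subset[OF infinite_UNIV] by auto
  then have "inj (f \<circ> to_nat :: int \<Rightarrow> 'u)" by (intro inj_compose) auto
  then show ?thesis by blast
qed

subsection \<open>Sets\<close>

lemma pr_eq [simp]: "pr x y = (pr x' y' :: 'u) \<longleftrightarrow> x = x' \<and> y = y'"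
proof -
  have "inj (emb UNIV :: 'u \<times> 'u \<Rightarrow> 'u)" using ex_inj_pair inj_on_emb by blast
  from inj_eq[OF this, of "(x, y)" "(x', y')"] show ?thesis by (simp add: pr_def)
qed

lemma pr1_pr [simp]: "pr1 (pr x y :: 'u) = x"
  unfolding pr1_def by auto

lemma pr2_pr [simp]: "pr2 (pr x y :: 'u) = y"
  unfolding pr2_def by auto

lemma pr_in_set_prod [simp]: "pr x y \<in> set_prod X Y \<longleftrightarrow> (x :: 'u) \<in> X \<and> y \<in> Y"
  by (auto simp: set_prod_def)

lemma set_prodE:
  assumes "z \<in> set_prod X (Y :: 'u set)"
  obtains x y where "z = pr x y" "x \<in> X" "y \<in> Y"
  using assms by (auto simp: set_prod_def)

end

lemma Sets_simps:
  "X \<in> Obj Sets"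
  "F \<in> Hom Sets X Y \<longleftrightarrow> (\<exists>f. F = (X, f, Y) \<and> f \<in> X \<rightarrow>\<^sub>E Y)"
  "(X, f, Y) \<in> Arr Sets \<longleftrightarrow> f \<in> X \<rightarrow>\<^sub>E Y"
  "Dom Sets (X, f, Y) = X" "Cod Sets (X, f, Y) = Y"
  "Idt Sets X = (X, \<lambda>x\<in>X. x, X)"
  "Cmp Sets (Y, g, Z) (X, f, Y') = (X, compose X g f, Z)"
  "Ten Sets X Y = set_prod X Y"
  "TenA Sets (X, f, X') (Y, g, Y') =
     (set_prod X Y, \<lambda>z\<in>set_prod X Y. pr (f (pr1 z)) (g (pr2 z)), set_prod X' Y')"
  "One Sets = {pt}"
  "Assoc Sets X Y Z = (set_prod (set_prod X Y) Z,
        \<lambda>z\<in>set_prod (set_prod X Y) Z. pr (pr1 (pr1 z)) (pr (pr2 (pr1 z)) (pr2 z)),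
        set_prod X (set_prod Y Z))"
  "Lun Sets X = (set_prod {pt} X, \<lambda>z\<in>set_prod {pt} X. pr2 z, X)"
  "Run Sets X = (set_prod X {pt}, \<lambda>z\<in>set_prod X {pt}. pr1 z, X)"
  unfolding Sets_def by auto

lemma Sets_Hom_ap:
  assumes "F \<in> Hom Sets X Y"
  shows "F = (X, ap F, Y)" "ap F \<in> extensional X" "x \<in> X \<Longrightarrow> ap F x \<in> Y"
  using assms by (auto simp: Sets_simps PiE_def)

lemma Sets_Hom_eqI:
  assumes "F \<in> Hom Sets X Y" "G \<in> Hom Sets X Y" "\<And>x. x \<in> X \<Longrightarrow> ap F x = ap G x"
  shows "F = G"
  using assms by (auto simp: Sets_simps intro: PiE_ext)

lemma category_Sets: "category Sets"
  unfolding Sets_def category_mk_moncat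
  by (rule category_struct_cat) (auto simp: compose_def fun_eq_iff PiE_def extensional_def)

lemma (in infinite_universe) tensored_category_Sets: "tensored_category (Sets :: ('u set, 'u set_arr) moncat)"
proof -
  interpret category "Sets :: ('u set, 'u set_arr) moncat" by (rule category_Sets)
  have isoI: "iso_arr Sets (X, f, Y)" if "f \<in> X \<rightarrow>\<^sub>E Y" "g \<in> Y \<rightarrow>\<^sub>E X" "\<And>x. x \<in> X \<Longrightarrow> g (f x) = x"
    "\<And>y. y \<in> Y \<Longrightarrow> f (g y) = y" for X Y f and g :: "'u \<Rightarrow> 'u"
  proof -
    have "inverse_arrows Sets (X, f, Y) (Y, g, X)"
      using that by (auto simp: inverse_arrows_def Sets_simps compose_def fun_eq_iff)
    then show ?thesis unfolding iso_arr_def by blast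
  qed
  show ?thesis
  proof (unfold_locales, goal_cases)
    case (7 X Y Z)
    show ?case unfolding Sets_simps
      by (rule isoI[where g = "\<lambda>z\<in>set_prod X (set_prod Y Z). pr (pr (pr1 z) (pr1 (pr2 z))) (pr2 (pr2 z))"])
        (auto elim!: set_prodE)
  next
    case (10 X)
    show ?case unfolding Sets_simps
      by (rule isoI[where g = "\<lambda>x\<in>X. pr pt x"]) (auto elim!: set_prodE)
  next
    case (13 X)
    show ?case unfolding Sets_simps
      by (rule isoI[where g = "\<lambda>x\<in>X. pr x pt"]) (auto elim!: set_prodE)
  qed (auto simp: Sets_simps compose_def PiE_def Pi_def intro!: restrict_ext elim!: set_prodE)
qed

subsection \<open>Abelian groups transported into the universe\<close>

lemma trans_group:
  fixes f :: "'a \<Rightarrow> 'u"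
  assumes G: "comm_group G" and inj: "inj_on f (carrier G)"
  shows "comm_group (trans_group G :: 'u monoid)"
    and "(trans_el G :: 'a \<Rightarrow> 'u) \<in> iso G (trans_group G)"
proof -
  interpret G: comm_group G by fact
  have e: "inj_on (trans_el G :: 'a \<Rightarrow> 'u) (carrier G)" unfolding trans_el_def by (rule inj_on_emb[OF inj])
  have [simp]: "inv_into (carrier G) (trans_el G :: 'a \<Rightarrow> 'u) (trans_el G x) = x" if "x \<in> carrier G" for x
    using e that by simp
  let ?e = "trans_el G :: 'a \<Rightarrow> 'u"
  show "comm_group (trans_group G :: 'u monoid)"
  proof (rule comm_groupI)
    show "\<exists>y\<in>carrier (trans_group G). y \<otimes>\<^bsub>trans_group G\<^esub> x = \<one>\<^bsub>trans_group G\<^esub>"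
      if "x \<in> carrier (trans_group G)" for x :: 'u
      using that by (auto simp: trans_group_def Let_def intro!: bexI[of _ "inv\<^bsub>G\<^esub> _"])
  qed (auto simp: trans_group_def Let_def G.m_ac)
  show "?e \<in> iso G (trans_group G)"
    using e by (auto simp: iso_def hom_def bij_betw_def trans_group_def Let_def)
qed

lemma the_hom_eq:
  assumes "h \<in> hom A B" "h \<in> extensional (carrier A)" "P h"
    and "\<And>h'. h' \<in> hom A B \<Longrightarrow> h' \<in> extensional (carrier A) \<Longrightarrow> P h' \<Longrightarrow> h' = h"
  shows "the_hom A B P = (A, h, B)"
proof -
  have "(THE h. h \<in> hom A B \<and> h \<in> extensional (carrier A) \<and> P h) = h"
    by (rule the_equality) (use assms in blast)+
  then show ?thesis by (simp add: the_hom_def)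
qed

lemma free_Abelian_group_hom_eq:
  assumes "group C" and h: "h \<in> hom (free_Abelian_group S) C" and k: "k \<in> hom (free_Abelian_group S) C"
    and eq: "\<And>s. s \<in> S \<Longrightarrow> h (frag_of s) = k (frag_of s)" and x: "x \<in> carrier (free_Abelian_group S)"
  shows "h x = k x"
proof -
  interpret C: group C by fact
  interpret h: group_hom "free_Abelian_group S" C h using assms by (simp add: group_hom_def group_hom_axioms_def)
  interpret k: group_hom "free_Abelian_group S" C k using assms by (simp add: group_hom_def group_hom_axioms_def)
  have diff: "f (x - y) = f x \<otimes>\<^bsub>C\<^esub> inv\<^bsub>C\<^esub> (f y)"
    if "group_hom (free_Abelian_group S) C f" "Poly_Mapping.keys x \<subseteq> S" "Poly_Mapping.keys y \<subseteq> S" for f x y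
  proof -
    interpret f: group_hom "free_Abelian_group S" C f by fact
    have *: "x - y \<in> carrier (free_Abelian_group S)" "x \<in> carrier (free_Abelian_group S)"
      "y \<in> carrier (free_Abelian_group S)"
      using that keys_diff[of x y] by auto
    have "f x = f (x - y) \<otimes>\<^bsub>C\<^esub> f y"
      using f.hom_mult[OF *(1,3)] by simp
    then show ?thesis
      using *[THEN f.hom_closed] by (simp add: C.inv_solve_right)
  qed
  have "Poly_Mapping.keys x \<subseteq> S" using x by simp
  then show ?thesis
  proof (rule free_Abelian_group_induct)
    show "h 0 = k 0" using h.hom_one k.hom_one by simp
  next
    fix x y assume "Poly_Mapping.keys x \<subseteq> S" "Poly_Mapping.keys y \<subseteq> S" "h x = k x" "h y = k y"
    then show "h (x - y) = k (x - y)" by (simp add: diff h.group_hom_axioms k.group_hom_axioms)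
  qed (rule eq)
qed

context infinite_universe
begin

subsubsection \<open>Free abelian groups\<close>

lemma trans_free:
  "comm_group (Zfree (X :: 'u set))"
  "trans_el (free_Abelian_group X) \<in> iso (free_Abelian_group X) (Zfree X)"
proof -
  obtain f :: "('u \<Rightarrow>\<^sub>0 int) \<Rightarrow> 'u" where "inj f" using ex_inj_frag by blast
  then have f: "inj_on f (carrier (free_Abelian_group X))" by (rule inj_on_subset) simp
  show "comm_group (Zfree X)" "trans_el (free_Abelian_group X) \<in> iso (free_Abelian_group X) (Zfree X)"
    unfolding Zfree_def using trans_group[OF abelian_free_Abelian_group f] by blast+
qed

lemma zgen_closed [simp]: "x \<in> X \<Longrightarrow> zgen (X :: 'u set) x \<in> carrier (Zfree X)"
  using trans_free(2)[of X] by (auto simp: iso_def hom_def zgen_def)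

lemma Zfree_hom_eq:
  assumes "group C" "h \<in> hom (Zfree (X :: 'u set)) C" "k \<in> hom (Zfree X) C"
    and "\<And>x. x \<in> X \<Longrightarrow> h (zgen X x) = k (zgen X x)" "z \<in> carrier (Zfree X)"
  shows "h z = k z"
proof -
  let ?e = "trans_el (free_Abelian_group X) :: _ \<Rightarrow> 'u"
  have e: "?e \<in> hom (free_Abelian_group X) (Zfree X)" "?e ` carrier (free_Abelian_group X) = carrier (Zfree X)"
    using trans_free(2)[of X] by (auto simp: iso_def bij_betw_def)
  obtain w where w: "w \<in> carrier (free_Abelian_group X)" "z = ?e w"
    using e(2) assms(5) by (metis imageE)
  have "(h \<circ> ?e) w = (k \<circ> ?e) w"
    using assms(1) hom_compose[OF e(1) assms(2)] hom_compose[OF e(1) assms(3)] _ w(1)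
    by (rule free_Abelian_group_hom_eq) (use assms(4) in \<open>auto simp: zgen_def\<close>)
  then show ?thesis using w by simp
qed

lemma hom_from_trans:
  fixes e :: "'a \<Rightarrow> 'b"
  assumes "group G" "e \<in> iso G T" "h \<in> hom G C"
  obtains k where "k \<in> hom T C" "k \<in> extensional (carrier T)" "\<And>x. x \<in> carrier G \<Longrightarrow> k (e x) = h x"
proof
  interpret group G by fact
  let ?d = "inv_into (carrier G) e"
  have d: "?d \<in> hom T G" using iso_set_sym[OF assms(2)] by (simp add: iso_def)
  have k: "h \<circ> ?d \<in> hom T C" using Group.hom_compose[OF d assms(3)] .
  have T: "x \<otimes>\<^bsub>T\<^esub> y \<in> carrier T" if "x \<in> carrier T" "y \<in> carrier T" for x y
  proof -
    have T: "carrier T = e ` carrier G" and e: "e \<in> hom G T"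
      using assms(2) by (simp_all add: iso_def bij_betw_def)
    from that obtain x' y' where "x = e x'" "y = e y'" "x' \<in> carrier G" "y' \<in> carrier G"
      unfolding T by blast
    then have "x \<otimes>\<^bsub>T\<^esub> y = e (x' \<otimes>\<^bsub>G\<^esub> y')" "x' \<otimes>\<^bsub>G\<^esub> y' \<in> carrier G"
      using e by (simp_all add: hom_mult)
    then show ?thesis unfolding T by simp
  qed
  show "restrict (h \<circ> ?d) (carrier T) \<in> hom T C"
    using k T by (auto simp: hom_def Pi_def)
  show "restrict (h \<circ> ?d) (carrier T) (e x) = h x" if "x \<in> carrier G" for x
    using assms(2) that by (auto simp: iso_def bij_betw_def)
qed auto

lemma Zfree_universal:
  assumes "comm_group (C :: 'c monoid)" "\<And>x. x \<in> X \<Longrightarrow> f x \<in> carrier C"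
  obtains h where "h \<in> hom (Zfree (X :: 'u set)) C" "h \<in> extensional (carrier (Zfree X))"
    "\<And>x. x \<in> X \<Longrightarrow> h (zgen X x) = f x"
proof -
  interpret C: comm_group C by fact
  have "f ` X \<subseteq> carrier C" using assms(2) by auto
  then obtain k where k: "k \<in> hom (free_Abelian_group X) C" "\<And>x. x \<in> X \<Longrightarrow> k (frag_of x) = f x"
    by (rule C.free_Abelian_group_universal) blast
  obtain h where "h \<in> hom (Zfree X) C" "h \<in> extensional (carrier (Zfree X))"
    "\<And>x. x \<in> carrier (free_Abelian_group X) \<Longrightarrow> h (trans_el (free_Abelian_group X) x) = k x"
    using hom_from_trans[OF group_free_Abelian_group trans_free(2)[of X] k(1)] by blast
  then show ?thesis using that k(2) by (auto simp: zgen_def)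
qed

subsubsection \<open>The integers\<close>

lemma trans_ZZ:
  "comm_group (ZZ :: 'u monoid)" "(zz :: int \<Rightarrow> 'u) \<in> iso integer_group ZZ"
proof -
  obtain f :: "int \<Rightarrow> 'u" where "inj f" using ex_inj_int by blast
  then have f: "inj_on f (carrier integer_group)" by (rule inj_on_subset) simp
  show "comm_group (ZZ :: 'u monoid)" "(zz :: int \<Rightarrow> 'u) \<in> iso integer_group ZZ"
    unfolding ZZ_def zz_def using trans_group[OF abelian_integer_group f] by blast+
qed

lemma carrier_ZZ: "carrier (ZZ :: 'u monoid) = range zz"
  using trans_ZZ(2) by (auto simp: iso_def bij_betw_def)

lemma zz_closed [simp]: "(zz k :: 'u) \<in> carrier ZZ"
  by (simp add: carrier_ZZ)

lemma zz_mult [simp]: "(zz j :: 'u) \<otimes>\<^bsub>ZZ\<^esub> zz k = zz (j + k)"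
  using trans_ZZ(2) by (auto simp: iso_def hom_def)

lemma zz_eq [simp]: "(zz j :: 'u) = zz k \<longleftrightarrow> j = k"
  using trans_ZZ(2) inj_eq[of "zz :: int \<Rightarrow> 'u" j k] by (simp add: iso_def bij_betw_def)

lemma one_ZZ: "\<one>\<^bsub>ZZ\<^esub> = (zz 0 :: 'u)"
proof -
  interpret comm_group "ZZ :: 'u monoid" by (rule trans_ZZ)
  show ?thesis by (metis add_0 one_closed zz_closed zz_mult r_cancel_one)
qed

lemma zz_pow [simp]: "(zz j :: 'u) [^]\<^bsub>ZZ\<^esub> (k :: int) = zz (k * j)"
proof -
  interpret Z: comm_group "ZZ :: 'u monoid" by (rule trans_ZZ)
  have n: "(zz j :: 'u) [^]\<^bsub>ZZ\<^esub> (n :: nat) = zz (int n * j)" for n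
    by (induction n) (auto simp: one_ZZ algebra_simps)
  have i: "inv\<^bsub>ZZ\<^esub> (zz j) = (zz (- j) :: 'u)" for j
    by (rule Z.inv_equality) (auto simp: one_ZZ)
  show ?thesis
  proof (cases k)
    case (nonneg m)
    then show ?thesis by (simp add: int_pow_int n)
  next
    case (neg m)
    have "(zz j :: 'u) [^]\<^bsub>ZZ\<^esub> (- int (Suc m)) = inv\<^bsub>ZZ\<^esub> (zz j [^]\<^bsub>ZZ\<^esub> int (Suc m))"
      by (rule Z.int_pow_neg) simp
    also have "\<dots> = zz (- int (Suc m) * j)" by (simp only: int_pow_int n i mult_minus_left)
    finally show ?thesis by (simp only: neg)
  qed
qed

lemma zz_hom:
  assumes "group C" "h \<in> hom (ZZ :: 'u monoid) C"
  shows "h (zz k) = h (zz 1) [^]\<^bsub>C\<^esub> k"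
proof -
  interpret Z: comm_group "ZZ :: 'u monoid" by (rule trans_ZZ)
  interpret h: group_hom "ZZ :: 'u monoid" C h
    using assms by (simp add: group_hom_def group_hom_axioms_def)
  have "h ((zz 1 :: 'u) [^]\<^bsub>ZZ\<^esub> k) = h (zz 1) [^]\<^bsub>C\<^esub> k"
    by (rule h.hom_int_pow) auto
  then show ?thesis by simp
qed

lemma ZZ_universal:
  assumes "group (C :: 'c monoid)" "c \<in> carrier C"
  obtains h where "h \<in> hom (ZZ :: 'u monoid) C" "h \<in> extensional (carrier ZZ)" "\<And>k. h (zz k) = c [^]\<^bsub>C\<^esub> k"
proof -
  interpret C: group C by fact
  have "(\<lambda>k::int. c [^]\<^bsub>C\<^esub> k) \<in> hom integer_group C"
    using assms(2) by (auto simp: hom_def C.int_pow_mult)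
  then show ?thesis
    using hom_from_trans[OF group_integer_group trans_ZZ(2)] that by (metis UNIV_I carrier_integer_group)
qed

end

subsubsection \<open>Tensor products\<close>

definition bilinear_map :: "'a monoid \<Rightarrow> 'b monoid \<Rightarrow> 'c monoid \<Rightarrow> ('a \<Rightarrow> 'b \<Rightarrow> 'c) \<Rightarrow> bool" where
  "bilinear_map A B C \<beta> \<longleftrightarrow>
     (\<forall>a\<in>carrier A. \<forall>b\<in>carrier B. \<beta> a b \<in> carrier C) \<and>
     (\<forall>a\<in>carrier A. \<forall>a'\<in>carrier A. \<forall>b\<in>carrier B. \<beta> (a \<otimes>\<^bsub>A\<^esub> a') b = \<beta> a b \<otimes>\<^bsub>C\<^esub> \<beta> a' b) \<and>
     (\<forall>a\<in>carrier A. \<forall>b\<in>carrier B. \<forall>b'\<in>carrier B. \<beta> a (b \<otimes>\<^bsub>B\<^esub> b') = \<beta> a b \<otimes>\<^bsub>C\<^esub> \<beta> a b')"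

lemma bilinear_mapD:
  assumes "bilinear_map A B C \<beta>"
  shows "a \<in> carrier A \<Longrightarrow> b \<in> carrier B \<Longrightarrow> \<beta> a b \<in> carrier C"
    and "a \<in> carrier A \<Longrightarrow> a' \<in> carrier A \<Longrightarrow> b \<in> carrier B \<Longrightarrow> \<beta> (a \<otimes>\<^bsub>A\<^esub> a') b = \<beta> a b \<otimes>\<^bsub>C\<^esub> \<beta> a' b"
    and "a \<in> carrier A \<Longrightarrow> b \<in> carrier B \<Longrightarrow> b' \<in> carrier B \<Longrightarrow> \<beta> a (b \<otimes>\<^bsub>B\<^esub> b') = \<beta> a b \<otimes>\<^bsub>C\<^esub> \<beta> a b'"
  using assms by (auto simp: bilinear_map_def)

lemma hom_mult_apply: "h \<in> hom A B \<Longrightarrow> x \<in> carrier A \<Longrightarrow> y \<in> carrier A \<Longrightarrow> h (x \<otimes>\<^bsub>A\<^esub> y) = h x \<otimes>\<^bsub>B\<^esub> h y"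
  by (simp add: hom_def)

lemma hom_apply_closed: "h \<in> hom A B \<Longrightarrow> x \<in> carrier A \<Longrightarrow> h x \<in> carrier B"
  by (auto simp: hom_def)

lemma hom_mult_hom:
  assumes "comm_group C" "h \<in> hom A C" "k \<in> hom A C"
  shows "(\<lambda>x. h x \<otimes>\<^bsub>C\<^esub> k x) \<in> hom A C"
proof -
  interpret comm_group C by fact
  show ?thesis using assms(2,3) by (auto simp: hom_def Pi_def m_ac)
qed

lemma minus_closed_free_Abelian_group:
  "x \<in> carrier (free_Abelian_group S) \<Longrightarrow> y \<in> carrier (free_Abelian_group S) \<Longrightarrow>
    x - y \<in> carrier (free_Abelian_group S)"
  using keys_diff[of x y] by auto

lemma subgroup_bilin_subgroup:
  assumes "comm_group (A :: 'u monoid)" "comm_group B"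
  shows "bilin_rels A B \<subseteq> carrier (free_Abelian_group (carrier A \<times> carrier B))"
    and "subgroup (bilin_subgroup A B) (free_Abelian_group (carrier A \<times> carrier B))"
proof -
  interpret A: comm_group A by fact
  interpret B: comm_group B by fact
  let ?F = "free_Abelian_group (carrier A \<times> carrier B)"
  interpret F: comm_group ?F by (rule abelian_free_Abelian_group)
  show 1: "bilin_rels A B \<subseteq> carrier ?F"
    unfolding bilin_rels_def by (auto simp del: carrier_free_Abelian_group_iff intro!: minus_closed_free_Abelian_group)
  show "subgroup (bilin_subgroup A B) ?F"
    unfolding bilin_subgroup_def by (rule F.generate_is_subgroup[OF 1])
qed

context infinite_universe
begin

context
  fixes A B :: "'u monoid"
  assumes A: "comm_group A" and B: "comm_group B"
begin

lemma trans_tensor: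
  "comm_group (raw_tensor A B)" "comm_group (tensor A B)"
  "trans_el (raw_tensor A B) \<in> iso (raw_tensor A B) (tensor A B)"
proof -
  let ?F = "free_Abelian_group (carrier A \<times> carrier B)"
  interpret F: comm_group ?F by (rule abelian_free_Abelian_group)
  show raw: "comm_group (raw_tensor A B)"
    unfolding raw_tensor_def by (rule F.abelian_FactGroup[OF subgroup_bilin_subgroup(2)[OF A B]])
  obtain f :: "('u \<times> 'u \<Rightarrow>\<^sub>0 int) \<Rightarrow> 'u" where f: "inj f" using ex_inj_frag_pair by blast
  let ?g = "\<lambda>c. f (SOME x. c = bilin_subgroup A B #>\<^bsub>?F\<^esub> x)"
  have "inj_on ?g (carrier (raw_tensor A B))"
  proof (rule inj_onI)
    fix c d assume "c \<in> carrier (raw_tensor A B)" "d \<in> carrier (raw_tensor A B)"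
    then have "\<exists>x. c = bilin_subgroup A B #>\<^bsub>?F\<^esub> x" "\<exists>x. d = bilin_subgroup A B #>\<^bsub>?F\<^esub> x"
      unfolding raw_tensor_def carrier_FactGroup by blast+
    from someI_ex[OF this(1)] someI_ex[OF this(2)]
    have *: "c = bilin_subgroup A B #>\<^bsub>?F\<^esub> (SOME x. c = bilin_subgroup A B #>\<^bsub>?F\<^esub> x)"
      "d = bilin_subgroup A B #>\<^bsub>?F\<^esub> (SOME x. d = bilin_subgroup A B #>\<^bsub>?F\<^esub> x)" .
    assume "?g c = ?g d"
    then have "(SOME x. c = bilin_subgroup A B #>\<^bsub>?F\<^esub> x) = (SOME x. d = bilin_subgroup A B #>\<^bsub>?F\<^esub> x)"
      by (rule injD[OF f])
    then show "c = d" using * by simp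
  qed
  from trans_group[OF raw this] show "comm_group (tensor A B)"
    "trans_el (raw_tensor A B) \<in> iso (raw_tensor A B) (tensor A B)"
    unfolding tensor_def by blast+
qed

definition tensor_proj :: "('u \<times> 'u \<Rightarrow>\<^sub>0 int) \<Rightarrow> 'u" where
  "tensor_proj x = trans_el (raw_tensor A B)
     (bilin_subgroup A B #>\<^bsub>free_Abelian_group (carrier A \<times> carrier B)\<^esub> x)"

lemma tensor_proj_hom: "tensor_proj \<in> hom (free_Abelian_group (carrier A \<times> carrier B)) (tensor A B)"
proof -
  let ?F = "free_Abelian_group (carrier A \<times> carrier B)"
  interpret F: comm_group ?F by (rule abelian_free_Abelian_group)
  interpret N: normal "bilin_subgroup A B" ?F
    by (rule F.subgroup_imp_normal[OF subgroup_bilin_subgroup(2)[OF A B]])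
  have "trans_el (raw_tensor A B) \<in> hom (raw_tensor A B) (tensor A B)"
    using trans_tensor(3) by (simp add: iso_def)
  from Group.hom_compose[OF N.r_coset_hom_Mod this[unfolded raw_tensor_def]]
  show ?thesis by (simp add: tensor_proj_def[abs_def] raw_tensor_def comp_def)
qed

lemma tensor_proj_surj: "carrier (tensor A B) = tensor_proj ` carrier (free_Abelian_group (carrier A \<times> carrier B))"
proof -
  have "carrier (tensor A B) = trans_el (raw_tensor A B) ` carrier (raw_tensor A B)"
    using trans_tensor(3) by (simp add: iso_def bij_betw_def)
  then show ?thesis
    by (simp add: raw_tensor_def carrier_FactGroup tensor_proj_def[abs_def] image_image)
qed

lemma tens_eq: "tens A B a b = tensor_proj (frag_of (a, b))"
  by (simp add: tens_def tensor_proj_def)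

lemma tens_closed [simp]: "a \<in> carrier A \<Longrightarrow> b \<in> carrier B \<Longrightarrow> tens A B a b \<in> carrier (tensor A B)"
  unfolding tens_eq by (rule hom_apply_closed[OF tensor_proj_hom]) simp

lemma tensor_proj_rel:
  assumes "x - y - z \<in> bilin_rels A B" "y \<in> carrier (free_Abelian_group (carrier A \<times> carrier B))"
    "z \<in> carrier (free_Abelian_group (carrier A \<times> carrier B))"
  shows "tensor_proj x = tensor_proj y \<otimes>\<^bsub>tensor A B\<^esub> tensor_proj z"
proof -
  let ?F = "free_Abelian_group (carrier A \<times> carrier B)"
  interpret F: comm_group ?F by (rule abelian_free_Abelian_group)
  interpret T: comm_group "tensor A B" by (rule trans_tensor)
  have sub: "subgroup (bilin_subgroup A B) ?F" by (rule subgroup_bilin_subgroup(2)[OF A B])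
  define r where "r = x - y - z"
  have r: "r \<in> bilin_subgroup A B" "r \<in> carrier ?F"
    using generate.incl[OF assms(1)] subsetD[OF subgroup_bilin_subgroup(1)[OF A B] assms(1)]
    unfolding bilin_subgroup_def r_def by blast+
  have "tensor_proj r = tensor_proj \<one>\<^bsub>?F\<^esub>"
    using F.coset_join2[OF r(2) sub r(1)] F.coset_join2[OF F.one_closed sub subgroup.one_closed[OF sub]]
    by (simp add: tensor_proj_def)
  then have 1: "tensor_proj r = \<one>\<^bsub>tensor A B\<^esub>"
    using hom_one[OF tensor_proj_hom F.is_group T.is_group] by simp
  have yz: "y + z \<in> carrier ?F" using F.m_closed[OF assms(2,3)] by simp
  have "x = r + (y + z)" by (simp add: r_def)
  then have "tensor_proj x = tensor_proj r \<otimes>\<^bsub>tensor A B\<^esub> tensor_proj (y + z)"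
    using hom_mult_apply[OF tensor_proj_hom r(2) yz] by simp
  also have "tensor_proj (y + z) = tensor_proj y \<otimes>\<^bsub>tensor A B\<^esub> tensor_proj z"
    using hom_mult_apply[OF tensor_proj_hom assms(2,3)] by simp
  finally show ?thesis
    using 1 hom_apply_closed[OF tensor_proj_hom] assms(2,3) by simp
qed

lemma bilinear_tens: "bilinear_map A B (tensor A B) (tens A B)"
proof -
  interpret A: comm_group A by (rule A)
  interpret B: comm_group B by (rule B)
  have "tens A B (a \<otimes>\<^bsub>A\<^esub> a') b = tens A B a b \<otimes>\<^bsub>tensor A B\<^esub> tens A B a' b"
    if "a \<in> carrier A" "a' \<in> carrier A" "b \<in> carrier B" for a a' b
    unfolding tens_eq using that by (intro tensor_proj_rel) (auto simp: bilin_rels_def)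
  moreover have "tens A B a (b \<otimes>\<^bsub>B\<^esub> b') = tens A B a b \<otimes>\<^bsub>tensor A B\<^esub> tens A B a b'"
    if "a \<in> carrier A" "b \<in> carrier B" "b' \<in> carrier B" for a b b'
    unfolding tens_eq using that by (intro tensor_proj_rel) (auto simp: bilin_rels_def)
  ultimately show ?thesis by (simp add: bilinear_map_def)
qed

lemma tensor_hom_eq:
  assumes "group C" "h \<in> hom (tensor A B) C" "k \<in> hom (tensor A B) C"
    and "\<And>a b. a \<in> carrier A \<Longrightarrow> b \<in> carrier B \<Longrightarrow> h (tens A B a b) = k (tens A B a b)"
    and "x \<in> carrier (tensor A B)"
  shows "h x = k x"
proof -
  obtain y where y: "y \<in> carrier (free_Abelian_group (carrier A \<times> carrier B))" "x = tensor_proj y"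
    using assms(5) unfolding tensor_proj_surj by blast
  have "(h \<circ> tensor_proj) y = (k \<circ> tensor_proj) y"
    using assms(1) Group.hom_compose[OF tensor_proj_hom assms(2)] Group.hom_compose[OF tensor_proj_hom assms(3)] _ y(1)
    by (rule free_Abelian_group_hom_eq) (use assms(4) in \<open>auto simp: tens_eq\<close>)
  then show ?thesis using y by simp
qed

lemma tensor_universal:
  assumes C: "comm_group (C :: 'c monoid)" and \<beta>: "bilinear_map A B C \<beta>"
  obtains h where "h \<in> hom (tensor A B) C" "h \<in> extensional (carrier (tensor A B))"
    "\<And>a b. a \<in> carrier A \<Longrightarrow> b \<in> carrier B \<Longrightarrow> h (tens A B a b) = \<beta> a b"
proof -
  interpret A: comm_group A by (rule A)
  interpret B: comm_group B by (rule B)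
  interpret C: comm_group C by (rule C)
  let ?F = "free_Abelian_group (carrier A \<times> carrier B)"
  interpret F: comm_group ?F by (rule abelian_free_Abelian_group)
  have N: "subgroup (bilin_subgroup A B) ?F" by (rule subgroup_bilin_subgroup(2)[OF A B])
  note \<beta> = bilinear_mapD[OF \<beta>]
  have "case_prod \<beta> ` (carrier A \<times> carrier B) \<subseteq> carrier C" using \<beta>(1) by auto
  then obtain k where k: "k \<in> hom ?F C" "\<And>x. x \<in> carrier A \<times> carrier B \<Longrightarrow> k (frag_of x) = case_prod \<beta> x"
    by (rule C.free_Abelian_group_universal) blast
  interpret k: group_hom ?F C k using k(1) by (simp add: group_hom_def group_hom_axioms_def)
  have ker: "x - y - z \<in> kernel ?F C k"
    if "x \<in> carrier ?F" "y \<in> carrier ?F" "z \<in> carrier ?F" "k x = k y \<otimes>\<^bsub>C\<^esub> k z" for x y z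
  proof -
    have r: "x - y - z \<in> carrier ?F"
      using that by (intro minus_closed_free_Abelian_group)
    have yz: "y + z \<in> carrier ?F" using F.m_closed[OF that(2,3)] by simp
    have "k x = k (x - y - z) \<otimes>\<^bsub>C\<^esub> k (y + z)"
      using k.hom_mult[OF r yz] by simp
    also have "k (y + z) = k x" using k.hom_mult[OF that(2,3)] that(4) by simp
    finally show ?thesis using that r k.hom_closed[OF r] k.hom_closed[OF that(1)]
      unfolding kernel_def by (simp add: C.l_cancel_one' C.r_cancel_one')
  qed
  have "bilin_rels A B \<subseteq> kernel ?F C k"
    unfolding bilin_rels_def by (auto intro!: ker simp: k(2) \<beta>)
  then have "bilin_subgroup A B \<subseteq> kernel ?F C k"
    unfolding bilin_subgroup_def by (rule F.generate_subgroup_incl) (rule k.subgroup_kernel)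
  then obtain g where g: "g \<in> hom (raw_tensor A B) C"
    "\<And>x. x \<in> carrier ?F \<Longrightarrow> g (bilin_subgroup A B #>\<^bsub>?F\<^esub> x) = k x"
    unfolding raw_tensor_def using k.FactGroup_universal_kernel[OF F.subgroup_imp_normal[OF N]] by blast
  obtain h where h: "h \<in> hom (tensor A B) C" "h \<in> extensional (carrier (tensor A B))"
    "\<And>x. x \<in> carrier (raw_tensor A B) \<Longrightarrow> h (trans_el (raw_tensor A B) x) = g x"
    using hom_from_trans[OF comm_group.axioms(2)[OF trans_tensor(1)] trans_tensor(3) g(1)] by blast
  show thesis
  proof (rule that[OF h(1,2)])
    fix a b assume "a \<in> carrier A" "b \<in> carrier B"
    then show "h (tens A B a b) = \<beta> a b"
      unfolding tens_def by (subst h(3)) (auto simp: raw_tensor_def carrier_FactGroup g(2) k(2))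
  qed
qed

end

lemmas tensor_comm_group [simp] = trans_tensor(2)
lemmas tens_mult_left = bilinear_mapD(2)[OF bilinear_tens]
lemmas tens_mult_right = bilinear_mapD(3)[OF bilinear_tens]

lemma tens_hom_left: "comm_group (A :: 'u monoid) \<Longrightarrow> comm_group B \<Longrightarrow> b \<in> carrier B \<Longrightarrow> (\<lambda>a. tens A B a b) \<in> hom A (tensor A B)"
  by (auto simp: hom_def tens_mult_left)

lemma tens_hom_right: "comm_group (A :: 'u monoid) \<Longrightarrow> comm_group B \<Longrightarrow> a \<in> carrier A \<Longrightarrow> tens A B a \<in> hom B (tensor A B)"
  by (auto simp: hom_def tens_mult_right)

lemma tens_pow:
  assumes "comm_group (A :: 'u monoid)" "comm_group B" "a \<in> carrier A" "b \<in> carrier B"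
  shows "tens A B (a [^]\<^bsub>A\<^esub> (k :: int)) b = tens A B a (b [^]\<^bsub>B\<^esub> k)"
proof -
  interpret A: comm_group A by fact
  interpret B: comm_group B by fact
  interpret T: comm_group "tensor A B" using assms by simp
  interpret l: group_hom A "tensor A B" "\<lambda>a. tens A B a b"
    using assms tens_hom_left by unfold_locales
  interpret r: group_hom B "tensor A B" "tens A B a"
    using assms tens_hom_right by unfold_locales
  show ?thesis using l.hom_int_pow[OF assms(3), of k] r.hom_int_pow[OF assms(4), of k] by simp
qed

lemma tensor_hom_eq_left:
  assumes "comm_group (A :: 'u monoid)" "comm_group B" "comm_group C" "group E"
    and "h \<in> hom (tensor (tensor A B) C) E" "k \<in> hom (tensor (tensor A B) C) E"
    and "\<And>a b c. a \<in> carrier A \<Longrightarrow> b \<in> carrier B \<Longrightarrow> c \<in> carrier C \<Longrightarrow>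
      h (tens (tensor A B) C (tens A B a b) c) = k (tens (tensor A B) C (tens A B a b) c)"
    and "x \<in> carrier (tensor (tensor A B) C)"
  shows "h x = k x"
proof (rule tensor_hom_eq[OF _ assms(3,4,5,6) _ assms(8)])
  fix t c assume t: "t \<in> carrier (tensor A B)" and c: "c \<in> carrier C"
  have "(\<lambda>t. h (tens (tensor A B) C t c)) \<in> hom (tensor A B) E"
    "(\<lambda>t. k (tens (tensor A B) C t c)) \<in> hom (tensor A B) E"
    using Group.hom_compose[OF tens_hom_left[OF _ _ c] assms(5)] Group.hom_compose[OF tens_hom_left[OF _ _ c] assms(6)]
      assms(1-3) by (simp_all add: comp_def)
  then show "h (tens (tensor A B) C t c) = k (tens (tensor A B) C t c)"
    by (rule tensor_hom_eq[OF assms(1,2,4)]) (use assms(7) t c in auto)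
qed (use assms in simp)

lemma tensor_hom_eq_right:
  assumes "comm_group (A :: 'u monoid)" "comm_group B" "comm_group C" "group E"
    and "h \<in> hom (tensor A (tensor B C)) E" "k \<in> hom (tensor A (tensor B C)) E"
    and "\<And>a b c. a \<in> carrier A \<Longrightarrow> b \<in> carrier B \<Longrightarrow> c \<in> carrier C \<Longrightarrow>
      h (tens A (tensor B C) a (tens B C b c)) = k (tens A (tensor B C) a (tens B C b c))"
    and "x \<in> carrier (tensor A (tensor B C))"
  shows "h x = k x"
proof (rule tensor_hom_eq[OF assms(1) _ assms(4,5,6) _ assms(8)])
  fix a t assume t: "t \<in> carrier (tensor B C)" and a: "a \<in> carrier A"
  have "(\<lambda>t. h (tens A (tensor B C) a t)) \<in> hom (tensor B C) E"
    "(\<lambda>t. k (tens A (tensor B C) a t)) \<in> hom (tensor B C) E"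
    using Group.hom_compose[OF tens_hom_right[OF _ _ a] assms(5)] Group.hom_compose[OF tens_hom_right[OF _ _ a] assms(6)]
      assms(1-3) by (simp_all add: comp_def)
  then show "h (tens A (tensor B C) a t) = k (tens A (tensor B C) a t)"
    by (rule tensor_hom_eq[OF assms(2,3,4)]) (use assms(7) t a in auto)
qed (use assms in simp)

lemma tensor_universal_left:
  assumes ABC: "comm_group (A :: 'u monoid)" "comm_group B" "comm_group C" "comm_group (E :: 'e monoid)"
    and bil: "\<And>c. c \<in> carrier C \<Longrightarrow> bilinear_map A B E (\<lambda>a b. \<tau> a b c)"
    and lin: "\<And>a b c c'. a \<in> carrier A \<Longrightarrow> b \<in> carrier B \<Longrightarrow> c \<in> carrier C \<Longrightarrow> c' \<in> carrier C \<Longrightarrow>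
      \<tau> a b (c \<otimes>\<^bsub>C\<^esub> c') = \<tau> a b c \<otimes>\<^bsub>E\<^esub> \<tau> a b c'"
  obtains h where "h \<in> hom (tensor (tensor A B) C) E" "h \<in> extensional (carrier (tensor (tensor A B) C))"
    "\<And>a b c. a \<in> carrier A \<Longrightarrow> b \<in> carrier B \<Longrightarrow> c \<in> carrier C \<Longrightarrow>
      h (tens (tensor A B) C (tens A B a b) c) = \<tau> a b c"
proof -
  interpret C: comm_group C by fact
  interpret E: comm_group E by fact
  have "\<exists>f. f \<in> hom (tensor A B) E \<and> (\<forall>a\<in>carrier A. \<forall>b\<in>carrier B. f (tens A B a b) = \<tau> a b c)"
    if "c \<in> carrier C" for c
    using tensor_universal[OF ABC(1,2,4) bil[OF that]] by metis
  then obtain f where f: "\<And>c. c \<in> carrier C \<Longrightarrow> f c \<in> hom (tensor A B) E"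
    "\<And>c a b. c \<in> carrier C \<Longrightarrow> a \<in> carrier A \<Longrightarrow> b \<in> carrier B \<Longrightarrow> f c (tens A B a b) = \<tau> a b c"
    by metis
  have add: "f (c \<otimes>\<^bsub>C\<^esub> c') t = f c t \<otimes>\<^bsub>E\<^esub> f c' t"
    if "c \<in> carrier C" "c' \<in> carrier C" "t \<in> carrier (tensor A B)" for c c' t
    by (rule tensor_hom_eq[OF ABC(1,2) E.is_group f(1) hom_mult_hom[OF ABC(4) f(1) f(1)]])
      (use that f(2) lin in auto)
  have "bilinear_map (tensor A B) C E (\<lambda>t c. f c t)"
    unfolding bilinear_map_def using add by (auto simp: hom_mult_apply[OF f(1)] hom_apply_closed[OF f(1)])
  then obtain h where "h \<in> hom (tensor (tensor A B) C) E" "h \<in> extensional (carrier (tensor (tensor A B) C))"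
    "\<And>t c. t \<in> carrier (tensor A B) \<Longrightarrow> c \<in> carrier C \<Longrightarrow> h (tens (tensor A B) C t c) = f c t"
    using tensor_universal[OF _ ABC(3,4), of "tensor A B"] ABC by auto
  then show ?thesis using that f(2) ABC by auto
qed

lemma tensor_universal_right:
  assumes ABC: "comm_group (A :: 'u monoid)" "comm_group B" "comm_group C" "comm_group (E :: 'e monoid)"
    and bil: "\<And>a. a \<in> carrier A \<Longrightarrow> bilinear_map B C E (\<tau> a)"
    and lin: "\<And>a a' b c. a \<in> carrier A \<Longrightarrow> a' \<in> carrier A \<Longrightarrow> b \<in> carrier B \<Longrightarrow> c \<in> carrier C \<Longrightarrow>
      \<tau> (a \<otimes>\<^bsub>A\<^esub> a') b c = \<tau> a b c \<otimes>\<^bsub>E\<^esub> \<tau> a' b c"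
  obtains h where "h \<in> hom (tensor A (tensor B C)) E" "h \<in> extensional (carrier (tensor A (tensor B C)))"
    "\<And>a b c. a \<in> carrier A \<Longrightarrow> b \<in> carrier B \<Longrightarrow> c \<in> carrier C \<Longrightarrow>
      h (tens A (tensor B C) a (tens B C b c)) = \<tau> a b c"
proof -
  interpret A: comm_group A by fact
  interpret E: comm_group E by fact
  have "\<exists>f. f \<in> hom (tensor B C) E \<and> (\<forall>b\<in>carrier B. \<forall>c\<in>carrier C. f (tens B C b c) = \<tau> a b c)"
    if "a \<in> carrier A" for a
    using tensor_universal[OF ABC(2,3,4) bil[OF that]] by metis
  then obtain f where f: "\<And>a. a \<in> carrier A \<Longrightarrow> f a \<in> hom (tensor B C) E"
    "\<And>a b c. a \<in> carrier A \<Longrightarrow> b \<in> carrier B \<Longrightarrow> c \<in> carrier C \<Longrightarrow> f a (tens B C b c) = \<tau> a b c"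
    by metis
  have add: "f (a \<otimes>\<^bsub>A\<^esub> a') t = f a t \<otimes>\<^bsub>E\<^esub> f a' t"
    if "a \<in> carrier A" "a' \<in> carrier A" "t \<in> carrier (tensor B C)" for a a' t
    by (rule tensor_hom_eq[OF ABC(2,3) E.is_group f(1) hom_mult_hom[OF ABC(4) f(1) f(1)]])
      (use that f(2) lin in auto)
  have "bilinear_map A (tensor B C) E f"
    unfolding bilinear_map_def using add by (auto simp: hom_mult_apply[OF f(1)] hom_apply_closed[OF f(1)])
  then obtain h where "h \<in> hom (tensor A (tensor B C)) E" "h \<in> extensional (carrier (tensor A (tensor B C)))"
    "\<And>a t. a \<in> carrier A \<Longrightarrow> t \<in> carrier (tensor B C) \<Longrightarrow> h (tens A (tensor B C) a t) = f a t"
    using tensor_universal[OF ABC(1) _ ABC(4), of "tensor B C"] ABC by auto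
  then show ?thesis using that f(2) ABC by auto
qed

end

subsubsection \<open>The category of abelian groups\<close>

lemma Ab_simps:
  "A \<in> Obj Ab \<longleftrightarrow> comm_group A"
  "F \<in> Hom Ab A B \<longleftrightarrow> (\<exists>f. F = (A, f, B) \<and> comm_group A \<and> comm_group B \<and> f \<in> hom A B \<and> f \<in> extensional (carrier A))"
  "(A, f, B) \<in> Arr Ab \<longleftrightarrow> comm_group A \<and> comm_group B \<and> f \<in> hom A B \<and> f \<in> extensional (carrier A)"
  "Dom Ab (A, f, B) = A" "Cod Ab (A, f, B) = B"
  "Idt Ab A = (A, \<lambda>a\<in>carrier A. a, A)"
  "Cmp Ab (B, g, C) (A, f, B') = (A, compose (carrier A) g f, C)"
  "Ten Ab A B = tensor A B"
  "One Ab = ZZ"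
  unfolding Ab_def by auto

lemma TenA_Ab: "TenA Ab (A, f, A') (B, g, B') = the_hom (tensor A B) (tensor A' B')
    (\<lambda>h. \<forall>a\<in>carrier A. \<forall>b\<in>carrier B. h (tens A B a b) = tens A' B' (f a) (g b))"
  unfolding Ab_def by simp

lemma Assoc_Ab: "Assoc Ab A B C = the_hom (tensor (tensor A B) C) (tensor A (tensor B C))
    (\<lambda>h. \<forall>a\<in>carrier A. \<forall>b\<in>carrier B. \<forall>c\<in>carrier C.
       h (tens (tensor A B) C (tens A B a b) c) = tens A (tensor B C) a (tens B C b c))"
  unfolding Ab_def by simp

lemma Lun_Ab: "Lun Ab A = the_hom (tensor ZZ A) A
    (\<lambda>h. \<forall>k::int. \<forall>a\<in>carrier A. h (tens ZZ A (zz k) a) = a [^]\<^bsub>A\<^esub> k)"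
  unfolding Ab_def by simp

lemma Run_Ab: "Run Ab A = the_hom (tensor A ZZ) A
    (\<lambda>h. \<forall>a\<in>carrier A. \<forall>k::int. h (tens A ZZ a (zz k)) = a [^]\<^bsub>A\<^esub> k)"
  unfolding Ab_def by simp

lemma Ab_Hom_ap:
  assumes "F \<in> Hom Ab A B"
  shows "F = (A, ap F, B)" "comm_group A" "comm_group B" "ap F \<in> hom A B" "ap F \<in> extensional (carrier A)"
  using assms by (auto simp: Ab_simps)

lemma Ab_ap_closed: "F \<in> Hom Ab A B \<Longrightarrow> x \<in> carrier A \<Longrightarrow> ap F x \<in> carrier B"
  by (auto simp: Ab_simps intro: hom_apply_closed)

lemma Ab_Hom_eqI:
  assumes "F \<in> Hom Ab A B" "G \<in> Hom Ab A B" "\<And>x. x \<in> carrier A \<Longrightarrow> ap F x = ap G x"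
  shows "F = G"
  using assms by (auto simp: Ab_simps intro: extensionalityI)

lemma Ab_ap_Cmp:
  assumes "F \<in> Hom Ab A B" "G \<in> Hom Ab B C" "x \<in> carrier A"
  shows "ap (Cmp Ab G F) x = ap G (ap F x)"
  using assms by (auto simp: Ab_simps compose_def)

lemma Ab_ap_Idt: "x \<in> carrier A \<Longrightarrow> ap (Idt Ab A) x = x"
  by (simp add: Ab_simps)

lemma the_hom_Ab:
  assumes "comm_group A" "comm_group B" "h \<in> hom A B" "h \<in> extensional (carrier A)" "P h"
    and eq: "\<forall>k\<in>hom A B. P k \<longrightarrow> (\<forall>x\<in>carrier A. k x = h x)"
  shows "the_hom A B P \<in> Hom Ab A B" "P (ap (the_hom A B P))"
proof -
  have "the_hom A B P = (A, h, B)"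
  proof (rule the_hom_eq[of h A B P, OF assms(3-5)])
    fix k assume k: "k \<in> hom A B" "k \<in> extensional (carrier A)" "P k"
    have "\<forall>x\<in>carrier A. k x = h x" by (rule bspec[OF eq k(1), THEN mp, OF k(3)])
    then show "k = h" using k(2) assms(4) by (auto intro: extensionalityI)
  qed
  then show "the_hom A B P \<in> Hom Ab A B" "P (ap (the_hom A B P))" using assms by (auto simp: Ab_simps)
qed

lemma category_Ab: "category Ab"
  unfolding Ab_def category_mk_moncat
proof (rule category_struct_cat, goal_cases)
  case (1 A)
  then interpret comm_group A by simp
  show ?case by (auto simp: hom_def)
next
  case (2 A B C f g)
  then interpret comm_group A by simp
  show ?case using 2 by (auto simp: hom_def compose_def Pi_def)
qed (auto simp: compose_def fun_eq_iff extensional_def hom_def Pi_def)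

context infinite_universe
begin

lemma Ab_tensor_eqI:
  assumes "comm_group (A :: 'u monoid)" "comm_group B"
    and F: "F \<in> Hom Ab (tensor A B) C" and G: "G \<in> Hom Ab (tensor A B) C"
    and "\<And>a b. a \<in> carrier A \<Longrightarrow> b \<in> carrier B \<Longrightarrow> ap F (tens A B a b) = ap G (tens A B a b)"
  shows "F = G"
  using F G
proof (rule Ab_Hom_eqI)
  fix x assume "x \<in> carrier (tensor A B)"
  then show "ap F x = ap G x"
    using tensor_hom_eq[OF assms(1,2) comm_group.axioms(2)[OF Ab_Hom_ap(3)[OF F]] Ab_Hom_ap(4)[OF F] Ab_Hom_ap(4)[OF G]]
      assms(5) by blast
qed

lemma Ab_tensor_eqI_left:
  assumes "comm_group (A :: 'u monoid)" "comm_group B" "comm_group C"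
    and F: "F \<in> Hom Ab (tensor (tensor A B) C) E" and G: "G \<in> Hom Ab (tensor (tensor A B) C) E"
    and "\<And>a b c. a \<in> carrier A \<Longrightarrow> b \<in> carrier B \<Longrightarrow> c \<in> carrier C \<Longrightarrow>
      ap F (tens (tensor A B) C (tens A B a b) c) = ap G (tens (tensor A B) C (tens A B a b) c)"
  shows "F = G"
  using F G
proof (rule Ab_Hom_eqI)
  fix x assume "x \<in> carrier (tensor (tensor A B) C)"
  then show "ap F x = ap G x"
    using tensor_hom_eq_left[OF assms(1-3) comm_group.axioms(2)[OF Ab_Hom_ap(3)[OF F]] Ab_Hom_ap(4)[OF F] Ab_Hom_ap(4)[OF G]]
      assms(6) by blast
qed

lemma Ab_tensor_eqI_right:
  assumes "comm_group (A :: 'u monoid)" "comm_group B" "comm_group C"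
    and F: "F \<in> Hom Ab (tensor A (tensor B C)) E" and G: "G \<in> Hom Ab (tensor A (tensor B C)) E"
    and "\<And>a b c. a \<in> carrier A \<Longrightarrow> b \<in> carrier B \<Longrightarrow> c \<in> carrier C \<Longrightarrow>
      ap F (tens A (tensor B C) a (tens B C b c)) = ap G (tens A (tensor B C) a (tens B C b c))"
  shows "F = G"
  using F G
proof (rule Ab_Hom_eqI)
  fix x assume "x \<in> carrier (tensor A (tensor B C))"
  then show "ap F x = ap G x"
    using tensor_hom_eq_right[OF assms(1-3) comm_group.axioms(2)[OF Ab_Hom_ap(3)[OF F]] Ab_Hom_ap(4)[OF F] Ab_Hom_ap(4)[OF G]]
      assms(6) by blast
qed

lemma the_hom_tensor:
  assumes AB: "comm_group (A :: 'u monoid)" "comm_group B" "comm_group C" and \<beta>: "bilinear_map A B C \<beta>"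
    and P: "\<And>h. P h \<longleftrightarrow> (\<forall>a\<in>carrier A. \<forall>b\<in>carrier B. h (tens A B a b) = \<beta> a b)"
  shows "the_hom (tensor A B) C P \<in> Hom Ab (tensor A B) C"
    and "a \<in> carrier A \<Longrightarrow> b \<in> carrier B \<Longrightarrow> ap (the_hom (tensor A B) C P) (tens A B a b) = \<beta> a b"
proof -
  obtain h where h: "h \<in> hom (tensor A B) C" "h \<in> extensional (carrier (tensor A B))"
    "\<And>a b. a \<in> carrier A \<Longrightarrow> b \<in> carrier B \<Longrightarrow> h (tens A B a b) = \<beta> a b"
    using tensor_universal[OF AB \<beta>] by blast
  have eq: "\<forall>k\<in>hom (tensor A B) C. P k \<longrightarrow> (\<forall>x\<in>carrier (tensor A B). k x = h x)"
    using tensor_hom_eq[OF AB(1,2) comm_group.axioms(2)[OF AB(3)] _ h(1)] h(3) by (simp add: P)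
  have "P h" using h(3) by (simp add: P)
  note * = the_hom_Ab[OF trans_tensor(2)[OF AB(1,2)] AB(3) h(1,2), of P, OF this eq]
  show "the_hom (tensor A B) C P \<in> Hom Ab (tensor A B) C" by (rule *(1))
  show "a \<in> carrier A \<Longrightarrow> b \<in> carrier B \<Longrightarrow> ap (the_hom (tensor A B) C P) (tens A B a b) = \<beta> a b"
    using *(2) by (simp add: P)
qed

lemma TenA_Ab_Hom:
  assumes F: "F \<in> Hom Ab (A :: 'u monoid) A'" and G: "G \<in> Hom Ab B B'"
  shows "TenA Ab F G \<in> Hom Ab (tensor A B) (tensor A' B')"
    and "a \<in> carrier A \<Longrightarrow> b \<in> carrier B \<Longrightarrow> ap (TenA Ab F G) (tens A B a b) = tens A' B' (ap F a) (ap G b)"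
proof -
  note F' = Ab_Hom_ap[OF F] and G' = Ab_Hom_ap[OF G]
  have \<beta>: "bilinear_map A B (tensor A' B') (\<lambda>a b. tens A' B' (ap F a) (ap G b))"
    using F' G' by (auto simp: bilinear_map_def hom_mult_apply tens_mult_left tens_mult_right hom_apply_closed
        intro!: tens_closed)
  have eq: "TenA Ab F G = the_hom (tensor A B) (tensor A' B')
    (\<lambda>h. \<forall>a\<in>carrier A. \<forall>b\<in>carrier B. h (tens A B a b) = tens A' B' (ap F a) (ap G b))"
    by (subst F'(1), subst G'(1)) (rule TenA_Ab)
  show "TenA Ab F G \<in> Hom Ab (tensor A B) (tensor A' B')"
    unfolding eq by (rule the_hom_tensor(1)[OF F'(2) G'(2) _ \<beta>]) (use F' G' in auto)
  show "a \<in> carrier A \<Longrightarrow> b \<in> carrier B \<Longrightarrow> ap (TenA Ab F G) (tens A B a b) = tens A' B' (ap F a) (ap G b)"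
    unfolding eq by (rule the_hom_tensor(2)[OF F'(2) G'(2) _ \<beta>]) (use F' G' in auto)
qed

lemma carrier_ZZ_cases:
  assumes "x \<in> carrier (ZZ :: 'u monoid)"
  obtains k where "x = zz k"
  using assms by (auto simp: carrier_ZZ)

lemma Lun_Ab_Hom:
  assumes "comm_group (A :: 'u monoid)"
  shows "Lun Ab A \<in> Hom Ab (tensor ZZ A) A"
    and "a \<in> carrier A \<Longrightarrow> ap (Lun Ab A) (tens ZZ A (zz k) a) = a [^]\<^bsub>A\<^esub> k"
proof -
  interpret A: comm_group A by fact
  let ?P = "\<lambda>h. \<forall>k::int. \<forall>a\<in>carrier A. h (tens ZZ A (zz k) a) = a [^]\<^bsub>A\<^esub> k"
  let ?\<beta> = "\<lambda>x a. a [^]\<^bsub>A\<^esub> inv_into UNIV (zz :: int \<Rightarrow> 'u) x"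
  have inv: "inv_into UNIV zz (zz k :: 'u) = k" for k by (rule inv_into_f_f) (simp_all add: inj_def)
  have \<beta>: "bilinear_map ZZ A A ?\<beta>"
    by (auto simp: bilinear_map_def carrier_ZZ inv A.int_pow_mult A.int_pow_distrib)
  have P: "?P h \<longleftrightarrow> (\<forall>x\<in>carrier ZZ. \<forall>a\<in>carrier A. h (tens ZZ A x a) = ?\<beta> x a)" for h :: "'u \<Rightarrow> 'u"
    by (auto simp: carrier_ZZ inv)
  show "Lun Ab A \<in> Hom Ab (tensor ZZ A) A"
    unfolding Lun_Ab by (rule the_hom_tensor(1)[OF trans_ZZ(1) assms assms \<beta> P])
  show "a \<in> carrier A \<Longrightarrow> ap (Lun Ab A) (tens ZZ A (zz k) a) = a [^]\<^bsub>A\<^esub> k"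
    unfolding Lun_Ab using the_hom_tensor(2)[OF trans_ZZ(1) assms assms \<beta> P, of "zz k" a] by (simp add: inv)
qed

lemma Run_Ab_Hom:
  assumes "comm_group (A :: 'u monoid)"
  shows "Run Ab A \<in> Hom Ab (tensor A ZZ) A"
    and "a \<in> carrier A \<Longrightarrow> ap (Run Ab A) (tens A ZZ a (zz k)) = a [^]\<^bsub>A\<^esub> k"
proof -
  interpret A: comm_group A by fact
  let ?P = "\<lambda>h. \<forall>a\<in>carrier A. \<forall>k::int. h (tens A ZZ a (zz k)) = a [^]\<^bsub>A\<^esub> k"
  let ?\<beta> = "\<lambda>a x. a [^]\<^bsub>A\<^esub> inv_into UNIV (zz :: int \<Rightarrow> 'u) x"
  have inv: "inv_into UNIV zz (zz k :: 'u) = k" for k by (rule inv_into_f_f) (simp_all add: inj_def)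
  have \<beta>: "bilinear_map A ZZ A ?\<beta>"
    by (auto simp: bilinear_map_def carrier_ZZ inv A.int_pow_mult A.int_pow_distrib)
  have P: "?P h \<longleftrightarrow> (\<forall>a\<in>carrier A. \<forall>x\<in>carrier ZZ. h (tens A ZZ a x) = ?\<beta> a x)" for h :: "'u \<Rightarrow> 'u"
    by (auto simp: carrier_ZZ inv)
  show "Run Ab A \<in> Hom Ab (tensor A ZZ) A"
    unfolding Run_Ab by (rule the_hom_tensor(1)[OF assms trans_ZZ(1) assms \<beta> P])
  show "a \<in> carrier A \<Longrightarrow> ap (Run Ab A) (tens A ZZ a (zz k)) = a [^]\<^bsub>A\<^esub> k"
    unfolding Run_Ab using the_hom_tensor(2)[OF assms trans_ZZ(1) assms \<beta> P, of a "zz k"] by (simp add: inv)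
qed

lemma Assoc_Ab_Hom:
  assumes ABC: "comm_group (A :: 'u monoid)" "comm_group B" "comm_group C"
  shows "Assoc Ab A B C \<in> Hom Ab (tensor (tensor A B) C) (tensor A (tensor B C))"
    and "a \<in> carrier A \<Longrightarrow> b \<in> carrier B \<Longrightarrow> c \<in> carrier C \<Longrightarrow>
      ap (Assoc Ab A B C) (tens (tensor A B) C (tens A B a b) c) = tens A (tensor B C) a (tens B C b c)"
proof -
  let ?P = "\<lambda>h. \<forall>a\<in>carrier A. \<forall>b\<in>carrier B. \<forall>c\<in>carrier C.
       h (tens (tensor A B) C (tens A B a b) c) = tens A (tensor B C) a (tens B C b c)"
  let ?T = "tensor A (tensor B C)"
  have T: "comm_group ?T" "comm_group (tensor B C)" "comm_group (tensor A B)" "comm_group (tensor (tensor A B) C)"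
    using ABC by simp_all
  obtain h where h: "h \<in> hom (tensor (tensor A B) C) ?T" "h \<in> extensional (carrier (tensor (tensor A B) C))"
    "\<And>a b c. a \<in> carrier A \<Longrightarrow> b \<in> carrier B \<Longrightarrow> c \<in> carrier C \<Longrightarrow>
      h (tens (tensor A B) C (tens A B a b) c) = tens A (tensor B C) a (tens B C b c)"
    by (rule tensor_universal_left[OF ABC T(1), of "\<lambda>a b c. tens A (tensor B C) a (tens B C b c)"])
      (use ABC in \<open>auto simp: bilinear_map_def tens_mult_left tens_mult_right\<close>)
  have eq: "\<forall>k\<in>hom (tensor (tensor A B) C) ?T. ?P k \<longrightarrow> (\<forall>x\<in>carrier (tensor (tensor A B) C). k x = h x)"
    using tensor_hom_eq_left[OF ABC comm_group.axioms(2)[OF T(1)] _ h(1)] h(3) by simp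
  have "?P h" using h(3) by simp
  note * = the_hom_Ab[OF T(4,1) h(1,2), of ?P, OF this eq]
  show "Assoc Ab A B C \<in> Hom Ab (tensor (tensor A B) C) (tensor A (tensor B C))"
    unfolding Assoc_Ab by (rule *(1))
  show "a \<in> carrier A \<Longrightarrow> b \<in> carrier B \<Longrightarrow> c \<in> carrier C \<Longrightarrow>
      ap (Assoc Ab A B C) (tens (tensor A B) C (tens A B a b) c) = tens A (tensor B C) a (tens B C b c)"
    unfolding Assoc_Ab using *(2) by simp
qed

lemma tensored_category_Ab: "tensored_category (Ab :: ('u monoid, 'u ab_arr) moncat)"
proof -
  interpret category "Ab :: ('u monoid, 'u ab_arr) moncat" by (rule category_Ab)
  have isoI: "iso_arr Ab F" if "F \<in> Hom Ab A B" "G \<in> Hom Ab B A"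
    "Cmp Ab G F = Idt Ab A" "Cmp Ab F G = Idt Ab B" for A B :: "'u monoid" and F G
    unfolding iso_arr_def inverse_arrows_def
    using that HomD[OF that(1)] by blast
  have ZZ: "comm_group (ZZ :: 'u monoid)" by (rule trans_ZZ)
  show ?thesis
  proof (unfold_locales, goal_cases)
    case (1 X Y) then show ?case by (simp add: Ab_simps(1,8))
  next
    case 2 then show ?case using ZZ by (simp add: Ab_simps(1,9))
  next
    case (3 f X Y g X' Y') then show ?case by (simp add: TenA_Ab_Hom Ab_simps(8))
  next
    case (4 X Y)
    then have XY: "comm_group X" "comm_group Y" by (simp_all add: Ab_simps)
    note id = Idt[OF 4(1)] Idt[OF 4(2)]
    show ?case unfolding Ab_simps(8)
      by (rule Ab_tensor_eqI[OF XY TenA_Ab_Hom(1)[OF id] Idt])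
        (use XY in \<open>auto simp: TenA_Ab_Hom(2)[OF id] Ab_ap_Idt Ab_simps(1)\<close>)
  next
    case (5 f X Y g Z f' X' Y' g' Z')
    note ff = TenA_Ab_Hom[OF 5(1,3)] and gg = TenA_Ab_Hom[OF 5(2,4)]
      and fg = TenA_Ab_Hom[OF Cmp[OF 5(1,2)] Cmp[OF 5(3,4)]]
    show ?case
      by (rule Ab_tensor_eqI[OF Ab_Hom_ap(2)[OF 5(1)] Ab_Hom_ap(2)[OF 5(3)] Cmp[OF ff(1) gg(1)] fg(1)])
        (simp add: Ab_ap_Cmp[OF ff(1) gg(1)] ff(2) gg(2) fg(2) Ab_ap_closed[OF 5(1)] Ab_ap_closed[OF 5(3)]
          Ab_ap_Cmp[OF 5(1,2)] Ab_ap_Cmp[OF 5(3,4)] Ab_Hom_ap(2)[OF 5(1)] Ab_Hom_ap(2)[OF 5(3)])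
  next
    case (6 X Y Z) then show ?case by (simp add: Assoc_Ab_Hom Ab_simps(1,8))
  next
    case (7 X Y Z)
    then have XYZ: "comm_group X" "comm_group Y" "comm_group Z" by (simp_all add: Ab_simps)
    let ?L = "tensor (tensor X Y) Z" and ?R = "tensor X (tensor Y Z)"
    have T: "comm_group ?L" "comm_group ?R" using XYZ by simp_all
    obtain h where h: "h \<in> hom ?R ?L" "h \<in> extensional (carrier ?R)"
      "\<And>a b c. a \<in> carrier X \<Longrightarrow> b \<in> carrier Y \<Longrightarrow> c \<in> carrier Z \<Longrightarrow>
        h (tens X (tensor Y Z) a (tens Y Z b c)) = tens (tensor X Y) Z (tens X Y a b) c"
      by (rule tensor_universal_right[OF XYZ T(1), of "\<lambda>a b c. tens (tensor X Y) Z (tens X Y a b) c"])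
        (use XYZ in \<open>auto simp: bilinear_map_def tens_mult_left tens_mult_right\<close>)
    have H: "(?R, h, ?L) \<in> Hom Ab ?R ?L" using h T by (simp add: Ab_simps)
    note as = Assoc_Ab_Hom[OF XYZ]
    have L: "?L \<in> Obj Ab" "?R \<in> Obj Ab" using T by (simp_all add: Ab_simps)
    show ?case
    proof (rule isoI[OF as(1) H])
      show "Cmp Ab (?R, h, ?L) (Assoc Ab X Y Z) = Idt Ab ?L"
        by (rule Ab_tensor_eqI_left[OF XYZ Cmp[OF as(1) H] Idt[OF L(1)]])
          (use XYZ in \<open>simp add: Ab_ap_Cmp[OF as(1) H] as(2) h(3) Ab_ap_Idt\<close>)
      show "Cmp Ab (Assoc Ab X Y Z) (?R, h, ?L) = Idt Ab ?R"
        by (rule Ab_tensor_eqI_right[OF XYZ Cmp[OF H as(1)] Idt[OF L(2)]])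
          (use XYZ in \<open>simp add: Ab_ap_Cmp[OF H as(1)] as(2) h(3) Ab_ap_Idt\<close>)
    qed
  next
    case (8 f X X' g Y Y' h Z Z')
    note XYZ = Ab_Hom_ap(2)[OF 8(1)] Ab_Hom_ap(2)[OF 8(2)] Ab_Hom_ap(2)[OF 8(3)]
    note XYZ' = Ab_Hom_ap(3)[OF 8(1)] Ab_Hom_ap(3)[OF 8(2)] Ab_Hom_ap(3)[OF 8(3)]
    note as = Assoc_Ab_Hom[OF XYZ] and as' = Assoc_Ab_Hom[OF XYZ']
    note fg = TenA_Ab_Hom[OF 8(1,2)] and gh = TenA_Ab_Hom[OF 8(2,3)]
    note fg_h = TenA_Ab_Hom[OF fg(1) 8(3)] and f_gh = TenA_Ab_Hom[OF 8(1) gh(1)]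
    show ?case
      by (rule Ab_tensor_eqI_left[OF XYZ Cmp[OF fg_h(1) as'(1)] Cmp[OF as(1) f_gh(1)]])
        (use XYZ in \<open>simp add: Ab_ap_Cmp[OF fg_h(1) as'(1)] Ab_ap_Cmp[OF as(1) f_gh(1)] as(2) as'(2) fg_h(2) f_gh(2) fg(2) gh(2)
          Ab_ap_closed[OF 8(1)] Ab_ap_closed[OF 8(2)] Ab_ap_closed[OF 8(3)]\<close>)
  next
    case (9 X) then show ?case by (simp add: Lun_Ab_Hom Ab_simps(1,8,9))
  next
    case (10 X)
    then have X: "comm_group X" by (simp add: Ab_simps)
    interpret X: comm_group X by (rule X)
    have ext: "restrict (tens ZZ X (zz 1)) (carrier X) \<in> hom X (tensor ZZ X)"
      using tens_hom_right[OF ZZ X zz_closed[of 1]] by (auto simp: hom_def Pi_def)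
    then have H: "(X, restrict (tens ZZ X (zz 1)) (carrier X), tensor ZZ X) \<in> Hom Ab X (tensor ZZ X)"
      using X ZZ by (simp add: Ab_simps)
    note l = Lun_Ab_Hom[OF X]
    have T: "tensor ZZ X \<in> Obj Ab" using X ZZ by (simp add: Ab_simps)
    show ?case
    proof (rule isoI[OF l(1) H])
      show "Cmp Ab (X, restrict (tens ZZ X (zz 1)) (carrier X), tensor ZZ X) (Lun Ab X) = Idt Ab (tensor ZZ X)"
        by (rule Ab_tensor_eqI[OF ZZ X Cmp[OF l(1) H] Idt[OF T]])
          (use X ZZ in \<open>auto simp: Ab_ap_Cmp[OF l(1) H] l(2) Ab_ap_Idt tens_pow[symmetric] elim!: carrier_ZZ_cases\<close>)
      show "Cmp Ab (Lun Ab X) (X, restrict (tens ZZ X (zz 1)) (carrier X), tensor ZZ X) = Idt Ab X"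
        by (rule Ab_Hom_eqI[OF Cmp[OF H l(1)] Idt[OF 10]])
          (simp add: Ab_ap_Cmp[OF H l(1)] l(2) Ab_ap_Idt)
    qed
  next
    case (11 f X Y)
    note X = Ab_Hom_ap(2)[OF 11] and Y = Ab_Hom_ap(3)[OF 11]
    interpret f: group_hom X Y "ap f"
      using Ab_Hom_ap[OF 11] by (simp add: group_hom_def group_hom_axioms_def comm_group.axioms)
    note l = Lun_Ab_Hom[OF X] and l' = Lun_Ab_Hom[OF Y]
    have Z: "Idt Ab (ZZ :: 'u monoid) \<in> Hom Ab ZZ ZZ" using ZZ by (intro Idt) (simp add: Ab_simps)
    note zf = TenA_Ab_Hom[OF Z 11]
    show ?case unfolding Ab_simps(9)
      by (rule Ab_tensor_eqI[OF ZZ X Cmp[OF zf(1) l'(1)] Cmp[OF l(1) 11]])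
        (use X Y in \<open>auto simp: Ab_ap_Cmp[OF zf(1) l'(1)] Ab_ap_Cmp[OF l(1) 11] zf(2) l(2) l'(2) ZZ Ab_ap_Idt
           Ab_ap_closed[OF 11] f.hom_int_pow elim!: carrier_ZZ_cases\<close>)
  next
    case (12 X) then show ?case by (simp add: Run_Ab_Hom Ab_simps(1,8,9))
  next
    case (13 X)
    then have X: "comm_group X" by (simp add: Ab_simps)
    interpret X: comm_group X by (rule X)
    have ext: "restrict (\<lambda>x. tens X ZZ x (zz 1)) (carrier X) \<in> hom X (tensor X ZZ)"
      using tens_hom_left[OF X ZZ zz_closed[of 1]] by (auto simp: hom_def Pi_def)
    then have H: "(X, restrict (\<lambda>x. tens X ZZ x (zz 1)) (carrier X), tensor X ZZ) \<in> Hom Ab X (tensor X ZZ)"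
      using X ZZ by (simp add: Ab_simps)
    note l = Run_Ab_Hom[OF X]
    have T: "tensor X ZZ \<in> Obj Ab" using X ZZ by (simp add: Ab_simps)
    show ?case
    proof (rule isoI[OF l(1) H])
      show "Cmp Ab (X, restrict (\<lambda>x. tens X ZZ x (zz 1)) (carrier X), tensor X ZZ) (Run Ab X) = Idt Ab (tensor X ZZ)"
        by (rule Ab_tensor_eqI[OF X ZZ Cmp[OF l(1) H] Idt[OF T]])
          (use X ZZ in \<open>auto simp: Ab_ap_Cmp[OF l(1) H] l(2) Ab_ap_Idt tens_pow elim!: carrier_ZZ_cases\<close>)
      show "Cmp Ab (Run Ab X) (X, restrict (\<lambda>x. tens X ZZ x (zz 1)) (carrier X), tensor X ZZ) = Idt Ab X"
        by (rule Ab_Hom_eqI[OF Cmp[OF H l(1)] Idt[OF 13]])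
          (simp add: Ab_ap_Cmp[OF H l(1)] l(2) Ab_ap_Idt)
    qed
  next
    case (14 f X Y)
    note X = Ab_Hom_ap(2)[OF 14] and Y = Ab_Hom_ap(3)[OF 14]
    interpret f: group_hom X Y "ap f"
      using Ab_Hom_ap[OF 14] by (simp add: group_hom_def group_hom_axioms_def comm_group.axioms)
    note l = Run_Ab_Hom[OF X] and l' = Run_Ab_Hom[OF Y]
    have Z: "Idt Ab (ZZ :: 'u monoid) \<in> Hom Ab ZZ ZZ" using ZZ by (intro Idt) (simp add: Ab_simps)
    note zf = TenA_Ab_Hom[OF 14 Z]
    show ?case unfolding Ab_simps(9)
      by (rule Ab_tensor_eqI[OF X ZZ Cmp[OF zf(1) l'(1)] Cmp[OF l(1) 14]])
        (use X Y in \<open>auto simp: Ab_ap_Cmp[OF zf(1) l'(1)] Ab_ap_Cmp[OF l(1) 14] zf(2) l(2) l'(2) ZZ Ab_ap_Idt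
           Ab_ap_closed[OF 14] f.hom_int_pow elim!: carrier_ZZ_cases\<close>)
  next
    case 15
    show ?case unfolding Ab_simps(9)
      by (rule Ab_tensor_eqI[OF ZZ ZZ Lun_Ab_Hom(1)[OF ZZ] Run_Ab_Hom(1)[OF ZZ]])
        (auto simp: Lun_Ab_Hom(2)[OF ZZ] Run_Ab_Hom(2)[OF ZZ] elim!: carrier_ZZ_cases)
  next
    case 16
    have Z: "Idt Ab (ZZ :: 'u monoid) \<in> Hom Ab ZZ ZZ" using ZZ by (intro Idt) (simp add: Ab_simps)
    note l = Lun_Ab_Hom[OF ZZ] and as = Assoc_Ab_Hom[OF ZZ ZZ ZZ]
    note lz = TenA_Ab_Hom[OF l(1) Z] and zl = TenA_Ab_Hom[OF Z l(1)]
    show ?case unfolding Ab_simps(9)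
      by (rule Ab_tensor_eqI_left[OF ZZ ZZ ZZ Cmp[OF lz(1) l(1)] Cmp[OF Cmp[OF as(1) zl(1)] l(1)]])
        (auto simp: Ab_ap_Cmp[OF lz(1) l(1)] Ab_ap_Cmp[OF Cmp[OF as(1) zl(1)] l(1)] Ab_ap_Cmp[OF as(1) zl(1)]
          l(2) lz(2) zl(2) as(2) ZZ Ab_ap_Idt elim!: carrier_ZZ_cases)
  qed
qed

end

section \<open>The decalage\<close>

lemma Delta_simps:
  "(n, \<theta>, m) \<in> Arr Delta \<longleftrightarrow> \<theta> \<in> {..n} \<rightarrow>\<^sub>E {..m} \<and> mono_on {..n} \<theta>"
  "Dom Delta (n, \<theta>, m) = n" "Cod Delta (n, \<theta>, m) = m"
  "Idt Delta n = (n, \<lambda>i\<in>{..n}. i, n)"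
  "Cmp Delta (m, \<eta>, k) (n, \<theta>, m') = (n, compose {..n} \<eta> \<theta>, k)"
  unfolding Delta_def by auto

lemma category_Delta: "category Delta"
  unfolding Delta_def
proof (rule category_struct_cat, goal_cases)
  case (2 X Y Z f g)
  then show ?case by (auto simp: compose_def mono_on_def PiE_iff) 
qed (auto simp: compose_def fun_eq_iff PiE_def extensional_def mono_on_def Pi_def)

interpretation Delta: category Delta by (rule category_Delta)

lemma Delta_act_Delta:
  assumes "\<alpha> \<in> Arr Delta_act"
  shows "\<alpha> \<in> Arr Delta" "Dom Delta_act \<alpha> = Dom Delta \<alpha>" "Cod Delta_act \<alpha> = Cod Delta \<alpha>"
  using assms by (cases \<alpha>; simp add: Delta_act_simps Delta_simps)+

lemma Cmp_Delta_act: "Cmp Delta_act \<beta> \<alpha> = Cmp Delta \<beta> \<alpha>"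
  by (cases \<alpha>; cases \<beta>) (simp add: Delta_act_simps Delta_simps)

lemma Idt_Delta_act: "Idt Delta_act n = Idt Delta n"
  by (simp add: Delta_act_simps Delta_simps)

lemma is_functor_Delta_act:
  assumes "is_functor (op_cat Delta) D F"
  shows "is_functor (op_cat Delta_act) D F"
proof (rule functorI)
  fix f assume "f \<in> Arr (op_cat Delta_act)"
  then show "fa F f \<in> Hom D (fo F (Dom (op_cat Delta_act) f)) (fo F (Cod (op_cat Delta_act) f))"
    using functorD(3-5)[OF assms, of f] by (auto simp: Delta_act_Delta intro!: HomI)
next
  fix f g assume "f \<in> Arr (op_cat Delta_act)" "g \<in> Arr (op_cat Delta_act)"
    "Dom (op_cat Delta_act) g = Cod (op_cat Delta_act) f"
  then show "fa F (Cmp (op_cat Delta_act) g f) = Cmp D (fa F g) (fa F f)"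
    using functorD(6)[OF assms, of f g] by (simp add: Delta_act_Delta Cmp_Delta_act)
qed (use functorD(1,2)[OF assms] in \<open>auto simp: Idt_Delta_act\<close>)

lemma nat_trans_Delta_act:
  assumes "nat_trans (op_cat Delta) D F G t"
  shows "nat_trans (op_cat Delta_act) D F G t"
  using assms by (auto simp: nat_trans_def Delta_act_Delta)

lemma join_arr [simp]:
  assumes "\<alpha> \<in> Arr Delta" "\<beta> \<in> Arr Delta"
  shows "join \<alpha> \<beta> \<in> Arr Delta" "Dom Delta (join \<alpha> \<beta>) = Dom Delta \<alpha> + Dom Delta \<beta> + 1"
    "Cod Delta (join \<alpha> \<beta>) = Cod Delta \<alpha> + Cod Delta \<beta> + 1"
proof -
  obtain n f n' m g m' where *: "\<alpha> = (n, f, n')" "\<beta> = (m, g, m')" by (metis prod_cases3)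
  note f = assms(1)[unfolded *(1) Delta_simps] and g = assms(2)[unfolded *(2) Delta_simps]
  have f_le: "f i \<le> n'" if "i \<le> n" for i using f that by auto
  have g_le: "g i \<le> m'" if "i \<le> m" for i using g that by auto
  have "mono_on {..n + m + 1} (\<lambda>i\<in>{..n + m + 1}. if i \<le> n then f i else n' + 1 + g (i - (n + 1)))"
  proof (rule mono_onI)
    fix i j assume ij: "i \<in> {..n + m + 1}" "j \<in> {..n + m + 1}" "i \<le> j"
    have "f i \<le> f j" if "j \<le> n" using f ij that by (intro mono_onD[of "{..n}" f]) auto
    moreover have "g (i - (n + 1)) \<le> g (j - (n + 1))" if "\<not> i \<le> n"
      using g ij that by (intro mono_onD[of "{..m}" g]) auto
    ultimately show "(\<lambda>i\<in>{..n + m + 1}. if i \<le> n then f i else n' + 1 + g (i - (n + 1))) i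
      \<le> (\<lambda>i\<in>{..n + m + 1}. if i \<le> n then f i else n' + 1 + g (i - (n + 1))) j"
      using ij f_le[of i] by auto
  qed
  moreover have "f i \<le> Suc (n' + m')" if "i \<le> n" for i using f_le[OF that] by simp
  ultimately show "join \<alpha> \<beta> \<in> Arr Delta"
    using g_le by (auto simp: * join_def Delta_simps trans_le_add1)
  show "Dom Delta (join \<alpha> \<beta>) = Dom Delta \<alpha> + Dom Delta \<beta> + 1"
    "Cod Delta (join \<alpha> \<beta>) = Cod Delta \<alpha> + Cod Delta \<beta> + 1"
    by (simp_all add: * join_def Delta_simps)
qed

lemma join_Cmp [simp]:
  assumes "\<alpha> \<in> Arr Delta" "\<beta> \<in> Arr Delta" "\<alpha>' \<in> Arr Delta" "\<beta>' \<in> Arr Delta"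
    "Dom Delta \<alpha>' = Cod Delta \<alpha>" "Dom Delta \<beta>' = Cod Delta \<beta>"
  shows "Cmp Delta (join \<alpha>' \<beta>') (join \<alpha> \<beta>) = join (Cmp Delta \<alpha>' \<alpha>) (Cmp Delta \<beta>' \<beta>)"
proof -
  obtain n f n' m g m' where *: "\<alpha> = (n, f, n')" "\<beta> = (m, g, m')" by (metis prod_cases3)
  obtain h n'' k m'' where **: "\<alpha>' = (n', h, n'')" "\<beta>' = (m', k, m'')"
    using assms(5,6) by (cases \<alpha>'; cases \<beta>') (auto simp: * Delta_simps)
  note f = assms(1)[unfolded *(1) Delta_simps] and g = assms(2)[unfolded *(2) Delta_simps]
  have f_le: "f i \<le> n'" if "i \<le> n" for i using f that by auto
  have g_le: "g i \<le> m'" if "i \<le> m" for i using g that by auto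
  have "f i \<le> Suc (n' + m')" if "i \<le> n" for i using f_le[OF that] by simp
  then show ?thesis
    unfolding * ** join_def Delta_simps prod.case using f_le g_le
    by (auto simp: compose_def fun_eq_iff trans_le_add1)
qed

lemma join_Idt [simp]: "join (Idt Delta a) (Idt Delta b) = Idt Delta (a + b + 1)"
  by (auto simp: Delta_simps join_def fun_eq_iff)

definition front :: "nat \<Rightarrow> nat \<Rightarrow> darr" where
  "front n m = (n, \<lambda>i\<in>{..n}. i, n + m)"

definition rear :: "nat \<Rightarrow> nat \<Rightarrow> darr" where
  "rear n m = (m, \<lambda>i\<in>{..m}. n + i, n + m)"

lemma Delta_arrs [simp]:
  "front n m \<in> Arr Delta" "Dom Delta (front n m) = n" "Cod Delta (front n m) = n + m"
  "rear n m \<in> Arr Delta" "Dom Delta (rear n m) = m" "Cod Delta (rear n m) = n + m"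
  "join_inl n m \<in> Arr Delta" "Dom Delta (join_inl n m) = n" "Cod Delta (join_inl n m) = n + m + 1"
  "join_inr n m \<in> Arr Delta" "Dom Delta (join_inr n m) = m" "Cod Delta (join_inr n m) = n + m + 1"
  "join_collapse n m \<in> Arr Delta" "Dom Delta (join_collapse n m) = n + m + 1" "Cod Delta (join_collapse n m) = n + m"
  by (auto simp: front_def rear_def join_inl_def join_inr_def join_collapse_def Delta_simps mono_on_def)

lemma front_rear_simps:
  "Cmp Delta (join_collapse n m) (join_inl n m) = front n m"
  "Cmp Delta (join_collapse n m) (join_inr n m) = rear n m"
  "Cmp Delta (front (n + m) k) (front n m) = front n (m + k)"
  "Cmp Delta (front (n + m) k) (rear n m) = Cmp Delta (rear n (m + k)) (front m k)"
  "rear (n + m) k = Cmp Delta (rear n (m + k)) (rear m k)"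
  "front n 0 = Idt Delta n" "rear 0 n = Idt Delta n"
  by (auto simp: front_def rear_def join_inl_def join_inr_def join_collapse_def Delta_simps compose_def fun_eq_iff)

lemma join_act_front_rear:
  assumes "\<alpha> \<in> Arr Delta_act" "\<beta> \<in> Arr Delta_act"
  shows "Cmp Delta (join_act \<alpha> \<beta>) (front (Dom Delta \<alpha>) (Dom Delta \<beta>)) =
      Cmp Delta (front (Cod Delta \<alpha>) (Cod Delta \<beta>)) \<alpha>"
    and "Cmp Delta (join_act \<alpha> \<beta>) (rear (Dom Delta \<alpha>) (Dom Delta \<beta>)) =
      Cmp Delta (rear (Cod Delta \<alpha>) (Cod Delta \<beta>)) \<beta>"
proof -
  obtain n f n' m g m' where *: "\<alpha> = (n, f, n')" "\<beta> = (m, g, m')" by (metis prod_cases3)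
  note f = assms(1)[unfolded *(1) Delta_act_simps] and g = assms(2)[unfolded *(2) Delta_act_simps]
  have f_le: "f i \<le> n'" if "i \<le> n" for i using f that by auto
  have g_le: "g i \<le> m'" if "i \<le> m" for i using g that by auto
  show "Cmp Delta (join_act \<alpha> \<beta>) (front (Dom Delta \<alpha>) (Dom Delta \<beta>)) =
      Cmp Delta (front (Cod Delta \<alpha>) (Cod Delta \<beta>)) \<alpha>"
    using f_le by (auto simp: * join_act_def front_def Delta_simps compose_def fun_eq_iff)
  have "f n = n'" "g 0 = 0" using f g by auto
  then show "Cmp Delta (join_act \<alpha> \<beta>) (rear (Dom Delta \<alpha>) (Dom Delta \<beta>)) =
      Cmp Delta (rear (Cod Delta \<alpha>) (Cod Delta \<beta>)) \<beta>"
    using g_le by (auto simp: * join_act_def rear_def Delta_simps compose_def fun_eq_iff)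
qed

lemma is_functor_dec_col:
  assumes "is_functor (op_cat Delta) D X"
  shows "is_functor (op_cat Delta) D (dec_col X b)"
proof -
  note [simp] = functorD(1-5)[OF assms, simplified]
  show ?thesis
  proof (rule functorI)
  fix f g assume "f \<in> Arr (op_cat Delta)" "g \<in> Arr (op_cat Delta)" "Dom (op_cat Delta) g = Cod (op_cat Delta) f"
  then show "fa (dec_col X b) (Cmp (op_cat Delta) g f) = Cmp D (fa (dec_col X b) g) (fa (dec_col X b) f)"
    using functorD(6)[OF assms, of "join f (Idt Delta b)" "join g (Idt Delta b)"] by (simp add: dec_col_def)
  qed (auto simp: dec_col_def intro!: HomI)
qed

lemma dec_arr:
  assumes "is_functor (op_cat Delta) D X" "\<beta> \<in> Arr Delta"
  shows "nat_trans (op_cat Delta) D (dec_col X (Cod Delta \<beta>)) (dec_col X (Dom Delta \<beta>))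
    (\<lambda>a. fa X (join (Idt Delta a) \<beta>))"
proof -
  note [simp] = functorD(3-5)[OF assms(1)] assms(2)
  show ?thesis unfolding nat_trans_def
  proof (intro conjI ballI)
  fix \<alpha> assume "\<alpha> \<in> Arr (op_cat Delta)"
  then show "Cmp D (fa X (join (Idt Delta (Cod (op_cat Delta) \<alpha>)) \<beta>)) (fa (dec_col X (Cod Delta \<beta>)) \<alpha>) =
      Cmp D (fa (dec_col X (Dom Delta \<beta>)) \<alpha>) (fa X (join (Idt Delta (Dom (op_cat Delta) \<alpha>)) \<beta>))"
    using functorD(6)[OF assms(1), of "join \<alpha> (Idt Delta (Cod Delta \<beta>))" "join (Idt Delta (Dom Delta \<alpha>)) \<beta>"]
      functorD(6)[OF assms(1), of "join (Idt Delta (Cod Delta \<alpha>)) \<beta>" "join \<alpha> (Idt Delta (Dom Delta \<beta>))"] assms(2)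
    by (simp add: dec_col_def)
  qed (auto simp: dec_col_def intro!: HomI)
qed

lemma is_functor_dec:
  assumes "category D" "is_functor (op_cat Delta) D X"
  shows "is_functor (op_cat Delta) (Simp D) (dec X)"
proof (rule functorI)
  fix f g assume "f \<in> Arr (op_cat Delta)" "g \<in> Arr (op_cat Delta)" "Dom (op_cat Delta) g = Cod (op_cat Delta) f"
  then show "fa (dec X) (Cmp (op_cat Delta) g f) = Cmp (Simp D) (fa (dec X) g) (fa (dec X) f)"
    using functorD(6)[OF assms(2), of "join (Idt Delta _) f" "join (Idt Delta _) g"]
    by (simp add: dec_def Simp_simps)
qed (use assms is_functor_dec_col[OF assms(2)] dec_arr[OF assms(2)] functorD(2)[OF assms(2)]
    in \<open>auto simp: dec_def Simp_simps dec_col_def\<close>)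

section \<open>Evaluation of simplicial maps\<close>

lemma Simp_HomD:
  assumes "F \<in> Hom (Simp D) X Y"
  shows "F = (X, ap F, Y)" "is_functor (op_cat Delta) D X" "is_functor (op_cat Delta) D Y"
    "nat_trans (op_cat Delta) D X Y (ap F)" "ap F a \<in> Hom D (fo X a) (fo Y a)"
  using assms by (auto simp: Simp_simps nat_trans_def)

lemma Simp_Hom_eqI:
  assumes "F \<in> Hom (Simp D) X Y" "G \<in> Hom (Simp D) X Y" "\<And>a. ap F a = ap G a"
  shows "F = G"
  using assms by (auto simp: Simp_simps fun_eq_iff)

lemma ap_Cmp_Simp:
  assumes "F \<in> Hom (Simp D) X Y" "G \<in> Hom (Simp D) Y Z"
  shows "ap (Cmp (Simp D) G F) a = Cmp D (ap G a) (ap F a)"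
  using assms by (auto simp: Simp_simps)

lemma ap_TenA_Simp:
  assumes "F \<in> Hom (Simp D) X Y" "G \<in> Hom (Simp D) X' Y'"
  shows "ap (TenA (Simp D) F G) a = TenA D (ap F a) (ap G a)"
  using assms by (auto simp: Simp_simps)

lemma Over_One_HomD:
  assumes "F \<in> Hom (Over_One D) A B"
  shows "F = (A, ap F, B)" "ap F \<in> Hom D (fst A) (fst B)" "Cmp D (snd B) (ap F) = snd A"
    "A \<in> Obj (Over_One D)" "B \<in> Obj (Over_One D)"
proof -
  obtain f where f: "F = (A, f, B)" using assms unfolding Over_One_simps(2) by blast
  show "F = (A, ap F, B)" by (simp add: f)
  show "ap F \<in> Hom D (fst A) (fst B)" "Cmp D (snd B) (ap F) = snd A"
    "A \<in> Obj (Over_One D)" "B \<in> Obj (Over_One D)"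
    using assms unfolding Over_One_simps(2) f by simp_all
qed

lemma ap_Cmp_Over_One:
  assumes "F \<in> Hom (Over_One D) A B" "G \<in> Hom (Over_One D) B C"
  shows "ap (Cmp (Over_One D) G F) = Cmp D (ap G) (ap F)"
proof -
  obtain f g where "F = (A, f, B)" "G = (B, g, C)"
    using Over_One_HomD(1)[OF assms(1)] Over_One_HomD(1)[OF assms(2)] by blast
  then show ?thesis by (simp add: Over_One_simps(7))
qed

lemma ap_TenA_Over_One:
  assumes "F \<in> Hom (Over_One D) A B" "G \<in> Hom (Over_One D) A' B'"
  shows "ap (TenA (Over_One D) F G) = TenA D (ap F) (ap G)"
proof -
  obtain f g where "F = (A, f, B)" "G = (A', g, B')"
    using Over_One_HomD(1)[OF assms(1)] Over_One_HomD(1)[OF assms(2)] by blast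
  then show ?thesis by (simp add: Over_One_simps(9))
qed

abbreviation sap :: "'u sset_arr \<Rightarrow> nat \<Rightarrow> 'u \<Rightarrow> 'u" where
  "sap F a \<equiv> ap (ap F a)"

abbreviation zap :: "'u asab_arr \<Rightarrow> nat \<Rightarrow> 'u \<Rightarrow> 'u" where
  "zap F a \<equiv> ap (ap (ap F) a)"

abbreviation lcar :: "'u asab \<Rightarrow> nat \<Rightarrow> 'u monoid" where
  "lcar A a \<equiv> fo (fst A) a"

abbreviation aug :: "'u asab \<Rightarrow> nat \<Rightarrow> 'u \<Rightarrow> 'u" where
  "aug A a \<equiv> ap (ap (snd A) a)"

lemma Sets_ap_Cmp:
  assumes "F \<in> Hom Sets X Y" "G \<in> Hom Sets Y Z" "x \<in> X"
  shows "ap (Cmp Sets G F) x = ap G (ap F x)"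
  using assms by (auto simp: Sets_simps compose_def)

lemma sset_act:
  assumes "is_functor (op_cat Delta) Sets X"
  shows "\<alpha> \<in> Arr Delta \<Longrightarrow> fa X \<alpha> \<in> Hom Sets (fo X (Cod Delta \<alpha>)) (fo X (Dom Delta \<alpha>))"
    and "\<alpha> \<in> Arr Delta \<Longrightarrow> x \<in> fo X (Cod Delta \<alpha>) \<Longrightarrow> ap (fa X \<alpha>) x \<in> fo X (Dom Delta \<alpha>)"
    and "\<alpha> \<in> Arr Delta \<Longrightarrow> \<beta> \<in> Arr Delta \<Longrightarrow> Dom Delta \<beta> = Cod Delta \<alpha> \<Longrightarrow> x \<in> fo X (Cod Delta \<beta>) \<Longrightarrow>
      ap (fa X (Cmp Delta \<beta> \<alpha>)) x = ap (fa X \<alpha>) (ap (fa X \<beta>) x)"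
    and "x \<in> fo X n \<Longrightarrow> ap (fa X (Idt Delta n)) x = x"
proof -
  show 1: "fa X \<alpha> \<in> Hom Sets (fo X (Cod Delta \<alpha>)) (fo X (Dom Delta \<alpha>))" if "\<alpha> \<in> Arr Delta" for \<alpha>
    using functor_Hom[OF assms, of \<alpha> "Cod Delta \<alpha>" "Dom Delta \<alpha>"] that by (simp add: Hom_def)
  show "\<alpha> \<in> Arr Delta \<Longrightarrow> x \<in> fo X (Cod Delta \<alpha>) \<Longrightarrow> ap (fa X \<alpha>) x \<in> fo X (Dom Delta \<alpha>)"
    using Sets_Hom_ap(3)[OF 1] .
  show "ap (fa X (Cmp Delta \<beta> \<alpha>)) x = ap (fa X \<alpha>) (ap (fa X \<beta>) x)"
    if "\<alpha> \<in> Arr Delta" "\<beta> \<in> Arr Delta" "Dom Delta \<beta> = Cod Delta \<alpha>" "x \<in> fo X (Cod Delta \<beta>)"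
    using functorD(6)[OF assms, of \<beta> \<alpha>] that Sets_ap_Cmp[OF 1[of \<beta>], of "fa X \<alpha>" _ x] 1[of \<alpha>] by simp
  show "x \<in> fo X n \<Longrightarrow> ap (fa X (Idt Delta n)) x = x"
    using functorD(2)[OF assms, of n] by (simp add: Sets_simps)
qed

lemma SSet_Hom_sap:
  assumes "F \<in> Hom SSet X Y"
  shows "x \<in> fo X a \<Longrightarrow> sap F a x \<in> fo Y a"
    and "\<alpha> \<in> Arr Delta \<Longrightarrow> x \<in> fo X (Cod Delta \<alpha>) \<Longrightarrow>
      sap F (Dom Delta \<alpha>) (ap (fa X \<alpha>) x) = ap (fa Y \<alpha>) (sap F (Cod Delta \<alpha>) x)"
proof -
  note F = Simp_HomD[OF assms]
  show "x \<in> fo X a \<Longrightarrow> sap F a x \<in> fo Y a" using Sets_Hom_ap(3)[OF F(5)] .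
  assume \<alpha>: "\<alpha> \<in> Arr Delta" and x: "x \<in> fo X (Cod Delta \<alpha>)"
  have "Cmp Sets (ap F (Dom Delta \<alpha>)) (fa X \<alpha>) = Cmp Sets (fa Y \<alpha>) (ap F (Cod Delta \<alpha>))"
    using nat_transD(4)[OF F(4), of \<alpha>] \<alpha> by simp
  then show "sap F (Dom Delta \<alpha>) (ap (fa X \<alpha>) x) = ap (fa Y \<alpha>) (sap F (Cod Delta \<alpha>) x)"
    using Sets_ap_Cmp[OF sset_act(1)[OF F(2) \<alpha>] F(5) x] Sets_ap_Cmp[OF F(5) sset_act(1)[OF F(3) \<alpha>] x]
    by simp
qed

lemma SSet_HomI:
  assumes X: "is_functor (op_cat Delta) Sets X" and Y: "is_functor (op_cat Delta) Sets Y"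
    and t: "\<And>a. t a \<in> Hom Sets (fo X a) (fo Y a)"
    and nat: "\<And>\<alpha> x. \<alpha> \<in> Arr Delta \<Longrightarrow> x \<in> fo X (Cod Delta \<alpha>) \<Longrightarrow>
      ap (t (Dom Delta \<alpha>)) (ap (fa X \<alpha>) x) = ap (fa Y \<alpha>) (ap (t (Cod Delta \<alpha>)) x)"
  shows "(X, t, Y) \<in> Hom SSet X Y"
proof -
  interpret category Sets by (rule category_Sets)
  have "Cmp Sets (t (Dom Delta \<alpha>)) (fa X \<alpha>) = Cmp Sets (fa Y \<alpha>) (t (Cod Delta \<alpha>))" if \<alpha>: "\<alpha> \<in> Arr Delta" for \<alpha>
  proof (rule Sets_Hom_eqI)
    show "Cmp Sets (t (Dom Delta \<alpha>)) (fa X \<alpha>) \<in> Hom Sets (fo X (Cod Delta \<alpha>)) (fo Y (Dom Delta \<alpha>))"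
      "Cmp Sets (fa Y \<alpha>) (t (Cod Delta \<alpha>)) \<in> Hom Sets (fo X (Cod Delta \<alpha>)) (fo Y (Dom Delta \<alpha>))"
      by (rule Cmp[OF sset_act(1)[OF X \<alpha>] t], rule Cmp[OF t sset_act(1)[OF Y \<alpha>]])
    fix x assume x: "x \<in> fo X (Cod Delta \<alpha>)"
    show "ap (Cmp Sets (t (Dom Delta \<alpha>)) (fa X \<alpha>)) x = ap (Cmp Sets (fa Y \<alpha>) (t (Cod Delta \<alpha>))) x"
      using Sets_ap_Cmp[OF sset_act(1)[OF X \<alpha>] t x] Sets_ap_Cmp[OF t sset_act(1)[OF Y \<alpha>] x] nat[OF \<alpha> x] by simp
  qed
  then show ?thesis using X Y t by (auto simp: Simp_simps nat_trans_def)
qed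

lemma SSet_sap_Cmp:
  assumes "F \<in> Hom SSet X Y" "G \<in> Hom SSet Y Z" "x \<in> fo X a"
  shows "sap (Cmp SSet G F) a x = sap G a (sap F a x)"
  unfolding ap_Cmp_Simp[OF assms(1,2)]
  by (rule Sets_ap_Cmp[OF Simp_HomD(5)[OF assms(1)] Simp_HomD(5)[OF assms(2)] assms(3)])

lemma SSet_Hom_eqI:
  assumes "F \<in> Hom SSet X Y" "G \<in> Hom SSet X Y" "\<And>a x. x \<in> fo X a \<Longrightarrow> sap F a x = sap G a x"
  shows "F = G"
  using assms(1,2) by (rule Simp_Hom_eqI) (rule Sets_Hom_eqI[OF Simp_HomD(5)[OF assms(1)] Simp_HomD(5)[OF assms(2)] assms(3)])

lemma sab_act:
  assumes "is_functor (op_cat Delta) Ab X"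
  shows "comm_group (fo X n)"
    and "\<alpha> \<in> Arr Delta \<Longrightarrow> fa X \<alpha> \<in> Hom Ab (fo X (Cod Delta \<alpha>)) (fo X (Dom Delta \<alpha>))"
    and "\<alpha> \<in> Arr Delta \<Longrightarrow> x \<in> carrier (fo X (Cod Delta \<alpha>)) \<Longrightarrow> ap (fa X \<alpha>) x \<in> carrier (fo X (Dom Delta \<alpha>))"
proof -
  show "comm_group (fo X n)" using functorD(1)[OF assms, of n] by (simp add: Ab_simps)
  show 1: "fa X \<alpha> \<in> Hom Ab (fo X (Cod Delta \<alpha>)) (fo X (Dom Delta \<alpha>))" if "\<alpha> \<in> Arr Delta" for \<alpha>
    using functor_Hom[OF assms, of \<alpha> "Cod Delta \<alpha>" "Dom Delta \<alpha>"] that by (simp add: Hom_def)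
  show "\<alpha> \<in> Arr Delta \<Longrightarrow> x \<in> carrier (fo X (Cod Delta \<alpha>)) \<Longrightarrow> ap (fa X \<alpha>) x \<in> carrier (fo X (Dom Delta \<alpha>))"
    using Ab_ap_closed[OF 1] .
qed

lemma SAbZ_ObjD:
  assumes "A \<in> Obj SAbZ"
  shows "is_functor (op_cat Delta) Ab (fst A)" "snd A \<in> Hom SAb (fst A) (simp_one Ab)"
    "ap (snd A) a \<in> Hom Ab (lcar A a) ZZ" "comm_group (lcar A a)"
    "x \<in> carrier (lcar A a) \<Longrightarrow> aug A a x \<in> carrier ZZ"
    "\<alpha> \<in> Arr Delta \<Longrightarrow> x \<in> carrier (lcar A (Cod Delta \<alpha>)) \<Longrightarrow>
      aug A (Dom Delta \<alpha>) (ap (fa (fst A) \<alpha>) x) = aug A (Cod Delta \<alpha>) x"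
proof -
  show 1: "is_functor (op_cat Delta) Ab (fst A)" and 2: "snd A \<in> Hom SAb (fst A) (simp_one Ab)"
    using assms unfolding Over_One_simps(1) by (auto simp: Simp_simps)
  show 3: "ap (snd A) a \<in> Hom Ab (lcar A a) ZZ" for a
    using Simp_HomD(5)[OF 2, of a] by (simp add: simp_one_def Ab_simps(9))
  show "comm_group (lcar A a)" by (rule sab_act(1)[OF 1])
  show "x \<in> carrier (lcar A a) \<Longrightarrow> aug A a x \<in> carrier ZZ" using Ab_ap_closed[OF 3] .
  assume \<alpha>: "\<alpha> \<in> Arr Delta" and x: "x \<in> carrier (lcar A (Cod Delta \<alpha>))"
  have "Cmp Ab (ap (snd A) (Dom Delta \<alpha>)) (fa (fst A) \<alpha>) = Cmp Ab (Idt Ab ZZ) (ap (snd A) (Cod Delta \<alpha>))"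
    using nat_transD(4)[OF Simp_HomD(4)[OF 2], of \<alpha>] \<alpha> by (simp add: simp_one_def Ab_simps(9))
  also have "\<dots> = ap (snd A) (Cod Delta \<alpha>)"
    using category.left[OF category_Ab 3] .
  finally show "aug A (Dom Delta \<alpha>) (ap (fa (fst A) \<alpha>) x) = aug A (Cod Delta \<alpha>) x"
    using Ab_ap_Cmp[OF sab_act(2)[OF 1 \<alpha>] 3 x] by simp
qed

lemma SAbZ_Hom_zap:
  assumes "F \<in> Hom SAbZ A B"
  shows "ap (ap F) a \<in> Hom Ab (lcar A a) (lcar B a)"
    and "x \<in> carrier (lcar A a) \<Longrightarrow> zap F a x \<in> carrier (lcar B a)"
    and "\<alpha> \<in> Arr Delta \<Longrightarrow> x \<in> carrier (lcar A (Cod Delta \<alpha>)) \<Longrightarrow>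
      zap F (Dom Delta \<alpha>) (ap (fa (fst A) \<alpha>) x) = ap (fa (fst B) \<alpha>) (zap F (Cod Delta \<alpha>) x)"
    and "x \<in> carrier (lcar A a) \<Longrightarrow> aug B a (zap F a x) = aug A a x"
proof -
  note F = Over_One_HomD[OF assms]
  note F' = Simp_HomD[OF F(2)]
  show 1: "ap (ap F) a \<in> Hom Ab (lcar A a) (lcar B a)" for a by (rule F'(5))
  show "x \<in> carrier (lcar A a) \<Longrightarrow> zap F a x \<in> carrier (lcar B a)" using Ab_ap_closed[OF 1] .
  show "zap F (Dom Delta \<alpha>) (ap (fa (fst A) \<alpha>) x) = ap (fa (fst B) \<alpha>) (zap F (Cod Delta \<alpha>) x)"
    if \<alpha>: "\<alpha> \<in> Arr Delta" and x: "x \<in> carrier (lcar A (Cod Delta \<alpha>))" for \<alpha> x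
  proof -
    have "Cmp Ab (ap (ap F) (Dom Delta \<alpha>)) (fa (fst A) \<alpha>) = Cmp Ab (fa (fst B) \<alpha>) (ap (ap F) (Cod Delta \<alpha>))"
      using nat_transD(4)[OF F'(4), of \<alpha>] \<alpha> by simp
    then show ?thesis
      using Ab_ap_Cmp[OF sab_act(2)[OF F'(2) \<alpha>] 1 x] Ab_ap_Cmp[OF 1 sab_act(2)[OF F'(3) \<alpha>] x] by simp
  qed
  show "x \<in> carrier (lcar A a) \<Longrightarrow> aug B a (zap F a x) = aug A a x"
    using Ab_ap_Cmp[OF 1 SAbZ_ObjD(3)[OF F(5)]] ap_Cmp_Simp[OF F(2) SAbZ_ObjD(2)[OF F(5)], of a] F(3) by metis
qed

lemma SAbZ_HomI:
  assumes A: "A \<in> Obj SAbZ" and B: "B \<in> Obj SAbZ"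
    and t: "\<And>a. t a \<in> Hom Ab (lcar A a) (lcar B a)"
    and nat: "\<And>\<alpha>. \<alpha> \<in> Arr Delta \<Longrightarrow>
      Cmp Ab (t (Dom Delta \<alpha>)) (fa (fst A) \<alpha>) = Cmp Ab (fa (fst B) \<alpha>) (t (Cod Delta \<alpha>))"
    and aug: "\<And>a. Cmp Ab (ap (snd B) a) (t a) = ap (snd A) a"
  shows "(A, (fst A, t, fst B), B) \<in> Hom SAbZ A B"
proof -
  have 1: "(fst A, t, fst B) \<in> Hom SAb (fst A) (fst B)"
    using t nat SAbZ_ObjD(1)[OF A] SAbZ_ObjD(1)[OF B] by (auto simp: Simp_simps nat_trans_def)
  have "Cmp SAb (snd B) (fst A, t, fst B) = snd A"
    by (rule Simp_Hom_eqI[OF category.Cmp[OF category_Simp[OF category_Ab] 1 SAbZ_ObjD(2)[OF B]] SAbZ_ObjD(2)[OF A]])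
      (simp add: ap_Cmp_Simp[OF 1 SAbZ_ObjD(2)[OF B]] aug)
  then show ?thesis using A B 1 unfolding Over_One_simps(2) by auto
qed

lemma SAbZ_Hom_lev_eqI:
  assumes "F \<in> Hom SAbZ A B" "G \<in> Hom SAbZ A B" "\<And>a. ap (ap F) a = ap (ap G) a"
  shows "F = G"
proof -
  have "ap F = ap G"
    using Over_One_HomD(2)[OF assms(1)] Over_One_HomD(2)[OF assms(2)] assms(3) by (rule Simp_Hom_eqI)
  then show ?thesis using Over_One_HomD(1)[OF assms(1)] Over_One_HomD(1)[OF assms(2)] by metis
qed

lemma SAbZ_zap_Cmp:
  assumes "F \<in> Hom SAbZ A B" "G \<in> Hom SAbZ B C" "x \<in> carrier (lcar A a)"
  shows "zap (Cmp SAbZ G F) a x = zap G a (zap F a x)"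
  unfolding ap_Cmp_Over_One[OF assms(1,2)] ap_Cmp_Simp[OF Over_One_HomD(2)[OF assms(1)] Over_One_HomD(2)[OF assms(2)]]
  by (rule Ab_ap_Cmp[OF SAbZ_Hom_zap(1)[OF assms(1)] SAbZ_Hom_zap(1)[OF assms(2)] assms(3)])

context infinite_universe
begin

lemma tensored_category_SSet: "tensored_category (SSet :: ('u sset, 'u sset_arr) moncat)"
  by (rule tensored_category_Simp[OF tensored_category_Sets])

lemma tensored_category_SAb: "tensored_category (SAb :: ('u sab, 'u sab_arr) moncat)"
  by (rule tensored_category_Simp[OF tensored_category_Ab])

lemma tensored_category_SAbZ: "tensored_category (SAbZ :: ('u asab, 'u asab_arr) moncat)"
  by (rule tensored_category_Over_One[OF tensored_category_SAb])

sublocale SSet: tensored_category "SSet :: ('u sset, 'u sset_arr) moncat" by (rule tensored_category_SSet)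
sublocale SAb: tensored_category "SAb :: ('u sab, 'u sab_arr) moncat" by (rule tensored_category_SAb)
sublocale SAbZ: tensored_category "SAbZ :: ('u asab, 'u asab_arr) moncat" by (rule tensored_category_SAbZ)

lemma fo_Ten_SSet [simp]: "fo (Ten SSet X Y) a = set_prod (fo X a) (fo Y a)"
  by (simp add: Simp_simps simp_ten_def Sets_simps)

lemma fo_One_SSet [simp]: "fo (One SSet) a = {pt}"
  by (simp add: Simp_simps simp_one_def Sets_simps)

lemma ap_fa_Ten_SSet:
  assumes "is_functor (op_cat Delta) Sets (X :: 'u sset)" "is_functor (op_cat Delta) Sets Y" "\<alpha> \<in> Arr Delta"
    "x \<in> fo X (Cod Delta \<alpha>)" "y \<in> fo Y (Cod Delta \<alpha>)"
  shows "ap (fa (Ten SSet X Y) \<alpha>) (pr x y) = pr (ap (fa X \<alpha>) x) (ap (fa Y \<alpha>) y)"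
  using sset_act(1)[OF assms(1,3)] sset_act(1)[OF assms(2,3)] assms(4,5)
  by (auto simp: Simp_simps simp_ten_def Sets_simps)

lemma ap_fa_One_SSet: "ap (fa (One SSet) \<alpha>) (pt :: 'u) = pt"
  by (simp add: Simp_simps simp_one_def Sets_simps)

lemma SSet_sap_TenA:
  assumes "F \<in> Hom SSet (X :: 'u sset) X'" "G \<in> Hom SSet Y Y'" "x \<in> fo X a" "y \<in> fo Y a"
  shows "sap (TenA SSet F G) a (pr x y) = pr (sap F a x) (sap G a y)"
  unfolding ap_TenA_Simp[OF assms(1,2)]
  using Simp_HomD(5)[OF assms(1), of a] Simp_HomD(5)[OF assms(2), of a] assms(3,4) by (auto simp: Sets_simps)

lemma SSet_sap_canonical:
  fixes X Y Z :: "'u sset"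
  shows "x \<in> fo X a \<Longrightarrow> y \<in> fo Y a \<Longrightarrow> z \<in> fo Z a \<Longrightarrow> sap (Assoc SSet X Y Z) a (pr (pr x y) z) = pr x (pr y z)"
    and "x \<in> fo X a \<Longrightarrow> sap (Lun SSet X) a (pr pt x) = x"
    and "x \<in> fo X a \<Longrightarrow> sap (Run SSet X) a (pr x pt) = x"
    and "x \<in> fo X a \<Longrightarrow> sap (Idt SSet X) a x = x"
  by (simp_all add: Simp_simps Sets_simps)

lemma lcar_Ten [simp]: "lcar (Ten SAbZ A B) a = tensor (lcar A a) (lcar B a)"
  by (simp add: Over_One_simps aug_ten_def Simp_simps simp_ten_def Ab_simps)

lemma lcar_One [simp]: "lcar (One SAbZ) a = ZZ"
  by (simp add: Over_One_simps aug_one_def Simp_simps simp_one_def Ab_simps)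

lemma ap_fa_Ten_SAbZ:
  assumes "A \<in> Obj (SAbZ :: ('u asab, 'u asab_arr) moncat)" "B \<in> Obj SAbZ" "\<alpha> \<in> Arr Delta"
    "x \<in> carrier (lcar A (Cod Delta \<alpha>))" "y \<in> carrier (lcar B (Cod Delta \<alpha>))"
  shows "ap (fa (fst (Ten SAbZ A B)) \<alpha>) (tens (lcar A (Cod Delta \<alpha>)) (lcar B (Cod Delta \<alpha>)) x y) =
    tens (lcar A (Dom Delta \<alpha>)) (lcar B (Dom Delta \<alpha>)) (ap (fa (fst A) \<alpha>) x) (ap (fa (fst B) \<alpha>) y)"
  using TenA_Ab_Hom(2)[OF sab_act(2)[OF SAbZ_ObjD(1)[OF assms(1)] assms(3)]
      sab_act(2)[OF SAbZ_ObjD(1)[OF assms(2)] assms(3)] assms(4,5)]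
  by (simp add: Over_One_simps aug_ten_def Simp_simps simp_ten_def)

lemma ap_fa_One_SAbZ: "x \<in> carrier ZZ \<Longrightarrow> ap (fa (fst (One SAbZ)) \<alpha>) x = (x :: 'u)"
  by (simp add: Over_One_simps aug_one_def Simp_simps simp_one_def Ab_simps)

lemma aug_One: "x \<in> carrier ZZ \<Longrightarrow> aug (One SAbZ) a x = (x :: 'u)"
  by (simp add: Over_One_simps aug_one_def Simp_simps simp_one_def Ab_simps)

lemma aug_Ten:
  assumes "A \<in> Obj (SAbZ :: ('u asab, 'u asab_arr) moncat)" "B \<in> Obj SAbZ"
    "x \<in> carrier (lcar A a)" "y \<in> carrier (lcar B a)" "aug A a x = zz j" "aug B a y = zz k"
  shows "aug (Ten SAbZ A B) a (tens (lcar A a) (lcar B a) x y) = zz (j * k)"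
proof -
  note e = SAbZ_ObjD(3)[OF assms(1), of a] SAbZ_ObjD(3)[OF assms(2), of a]
  have ZZ: "comm_group (ZZ :: 'u monoid)" by (rule trans_ZZ)
  have A: "snd (Ten SAbZ A B) = Cmp SAb (Lun SAb (One SAb)) (TenA SAb (snd A) (snd B))"
    by (simp add: Over_One_simps aug_ten_def)
  have t: "TenA SAb (snd A) (snd B) \<in> Hom SAb (Ten SAb (fst A) (fst B)) (Ten SAb (One SAb) (One SAb))"
    using SAb.TenA_Hom[OF SAbZ_ObjD(2)[OF assms(1)] SAbZ_ObjD(2)[OF assms(2)]] by (simp only: Simp_simps(10))
  have "ap (Lun SAb (One SAb)) a = Lun Ab (ZZ :: 'u monoid)"
    by (simp add: Simp_simps simp_one_def Ab_simps)
  then have "ap (snd (Ten SAbZ A B)) a = Cmp Ab (Lun Ab ZZ) (TenA Ab (ap (snd A) a) (ap (snd B) a))"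
    unfolding A ap_Cmp_Simp[OF t SAb.Lun_Hom[OF SAb.One_Obj]]
      ap_TenA_Simp[OF SAbZ_ObjD(2)[OF assms(1)] SAbZ_ObjD(2)[OF assms(2)]] by simp
  then show ?thesis
    using Ab_ap_Cmp[OF TenA_Ab_Hom(1)[OF e] Lun_Ab_Hom(1)[OF ZZ]] TenA_Ab_Hom(2)[OF e assms(3,4)]
      Lun_Ab_Hom(2)[OF ZZ zz_closed[of k], of j] assms SAbZ_ObjD(4)[OF assms(1)] SAbZ_ObjD(4)[OF assms(2)]
    by simp
qed

lemma SAbZ_zap_TenA:
  assumes "F \<in> Hom SAbZ (A :: 'u asab) A'" "G \<in> Hom SAbZ B B'" "x \<in> carrier (lcar A a)" "y \<in> carrier (lcar B a)"
  shows "zap (TenA SAbZ F G) a (tens (lcar A a) (lcar B a) x y) =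
    tens (lcar A' a) (lcar B' a) (zap F a x) (zap G a y)"
  unfolding ap_TenA_Over_One[OF assms(1,2)] ap_TenA_Simp[OF Over_One_HomD(2)[OF assms(1)] Over_One_HomD(2)[OF assms(2)]]
  by (rule TenA_Ab_Hom(2)[OF SAbZ_Hom_zap(1)[OF assms(1)] SAbZ_Hom_zap(1)[OF assms(2)] assms(3,4)])

lemma SAbZ_zap_canonical:
  fixes A B C :: "'u asab"
  assumes "A \<in> Obj SAbZ" "B \<in> Obj SAbZ" "C \<in> Obj SAbZ"
  shows "x \<in> carrier (lcar A a) \<Longrightarrow> y \<in> carrier (lcar B a) \<Longrightarrow> z \<in> carrier (lcar C a) \<Longrightarrow>
      zap (Assoc SAbZ A B C) a (tens (tensor (lcar A a) (lcar B a)) (lcar C a) (tens (lcar A a) (lcar B a) x y) z) =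
      tens (lcar A a) (tensor (lcar B a) (lcar C a)) x (tens (lcar B a) (lcar C a) y z)"
    and "x \<in> carrier (lcar A a) \<Longrightarrow> zap (Lun SAbZ A) a (tens ZZ (lcar A a) (zz k) x) = x [^]\<^bsub>lcar A a\<^esub> k"
    and "x \<in> carrier (lcar A a) \<Longrightarrow> zap (Run SAbZ A) a (tens (lcar A a) ZZ x (zz k)) = x [^]\<^bsub>lcar A a\<^esub> k"
    and "x \<in> carrier (lcar A a) \<Longrightarrow> zap (Idt SAbZ A) a x = x"
  using Assoc_Ab_Hom(2)[OF SAbZ_ObjD(4)[OF assms(1)] SAbZ_ObjD(4)[OF assms(2)] SAbZ_ObjD(4)[OF assms(3)]]
    Lun_Ab_Hom(2)[OF SAbZ_ObjD(4)[OF assms(1)]] Run_Ab_Hom(2)[OF SAbZ_ObjD(4)[OF assms(1)]]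
  by (simp_all add: Over_One_simps Simp_simps Ab_ap_Idt)

section \<open>Free simplicial abelian groups\<close>

definition generated_by :: "'u monoid \<Rightarrow> 'u set \<Rightarrow> bool" where
  "generated_by A G \<longleftrightarrow> comm_group A \<and> G \<subseteq> carrier A \<and>
     (\<forall>C :: 'u monoid. \<forall>h k. comm_group C \<longrightarrow> h \<in> hom A C \<longrightarrow> k \<in> hom A C \<longrightarrow>
        (\<forall>g\<in>G. h g = k g) \<longrightarrow> (\<forall>x\<in>carrier A. h x = k x))"

lemma generated_byD:
  assumes "generated_by A G"
  shows "comm_group A" "g \<in> G \<Longrightarrow> g \<in> carrier A"
    and "comm_group (C :: 'u monoid) \<Longrightarrow> h \<in> hom A C \<Longrightarrow> k \<in> hom A C \<Longrightarrow> (\<And>g. g \<in> G \<Longrightarrow> h g = k g) \<Longrightarrow>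
      x \<in> carrier A \<Longrightarrow> h x = k x"
  using assms unfolding generated_by_def by blast+

lemma generated_by_Zfree: "generated_by (Zfree X) (zgen X ` X)"
  unfolding generated_by_def
proof (intro conjI allI impI ballI)
  fix C :: "'u monoid" and h k x assume *: "comm_group C" "h \<in> hom (Zfree X) C" "k \<in> hom (Zfree X) C"
    "\<forall>g\<in>zgen X ` X. h g = k g" "x \<in> carrier (Zfree X)"
  show "h x = k x"
    by (rule Zfree_hom_eq[OF comm_group.axioms(2)[OF *(1)] *(2,3) _ *(5)]) (use *(4) in simp)
qed (auto simp: trans_free)

lemma generated_by_ZZ: "generated_by ZZ {zz 1}"
  unfolding generated_by_def
proof (intro conjI allI impI ballI)
  fix C :: "'u monoid" and h k :: "'u \<Rightarrow> 'u" and x :: 'u assume *: "comm_group C" "h \<in> hom ZZ C" "k \<in> hom ZZ C" "\<forall>g\<in>{zz 1}. h g = k g"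
    "x \<in> carrier ZZ"
  then obtain j where "x = zz j" by (auto simp: carrier_ZZ)
  then show "h x = k x"
    using zz_hom[OF comm_group.axioms(2)[OF *(1)] *(2), of j] zz_hom[OF comm_group.axioms(2)[OF *(1)] *(3), of j] *(4)
    by simp
qed (simp_all add: trans_ZZ)

lemma generated_by_tensor:
  assumes A: "generated_by A G" and B: "generated_by B H"
  shows "generated_by (tensor A B) {tens A B a b |a b. a \<in> G \<and> b \<in> H}"
  unfolding generated_by_def
proof (intro conjI allI impI)
  note A' = generated_byD[OF A] and B' = generated_byD[OF B]
  show "comm_group (tensor A B)" using A'(1) B'(1) by simp
  show "{tens A B a b |a b. a \<in> G \<and> b \<in> H} \<subseteq> carrier (tensor A B)"
    using A' B' by (auto simp: tens_closed)
  fix C :: "'u monoid" and h k assume C: "comm_group C" and h: "h \<in> hom (tensor A B) C" and k: "k \<in> hom (tensor A B) C"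
    and eq: "\<forall>g\<in>{tens A B a b |a b. a \<in> G \<and> b \<in> H}. h g = k g"
  have 1: "h (tens A B a b) = k (tens A B a b)" if a: "a \<in> G" and b: "b \<in> carrier B" for a b
  proof -
    have "(\<lambda>b. h (tens A B a b)) \<in> hom B C" "(\<lambda>b. k (tens A B a b)) \<in> hom B C"
      using Group.hom_compose[OF tens_hom_right[OF A'(1) B'(1) A'(2)[OF a]] h]
        Group.hom_compose[OF tens_hom_right[OF A'(1) B'(1) A'(2)[OF a]] k] by (simp_all add: comp_def)
    from B'(3)[OF C this _ b] eq a show ?thesis by blast
  qed
  have 2: "h (tens A B a b) = k (tens A B a b)" if a: "a \<in> carrier A" and b: "b \<in> carrier B" for a b
  proof -
    have "(\<lambda>a. h (tens A B a b)) \<in> hom A C" "(\<lambda>a. k (tens A B a b)) \<in> hom A C"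
      using Group.hom_compose[OF tens_hom_left[OF A'(1) B'(1) b] h]
        Group.hom_compose[OF tens_hom_left[OF A'(1) B'(1) b] k] by (simp_all add: comp_def)
    from A'(3)[OF C this _ a] 1 b show ?thesis by blast
  qed
  show "\<forall>x\<in>carrier (tensor A B). h x = k x"
    using tensor_hom_eq[OF A'(1) B'(1) comm_group.axioms(2)[OF C] h k] 2 by blast
qed

lemma Ab_gen_eqI:
  assumes "generated_by A G" and F: "F \<in> Hom Ab A B" and F': "F' \<in> Hom Ab A B"
    and "\<And>g. g \<in> G \<Longrightarrow> ap F g = ap F' g"
  shows "F = F'"
  using F F' by (rule Ab_Hom_eqI)
    (rule generated_byD(3)[OF assms(1) Ab_Hom_ap(3)[OF F] Ab_Hom_ap(4)[OF F] Ab_Hom_ap(4)[OF F'] assms(4)])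

lemma SAbZ_gen_eqI:
  assumes "\<And>a. generated_by (lcar A a) (G a)" "F \<in> Hom SAbZ A B" "F' \<in> Hom SAbZ A B"
    and "\<And>a g. g \<in> G a \<Longrightarrow> zap F a g = zap F' a g"
  shows "F = F'"
  using assms(2,3) by (rule SAbZ_Hom_lev_eqI)
    (rule Ab_gen_eqI[OF assms(1) SAbZ_Hom_zap(1)[OF assms(2)] SAbZ_Hom_zap(1)[OF assms(3)] assms(4)])

lemma SAbZ_gen_HomI:
  assumes G: "\<And>a. generated_by (lcar A a) (G a)" and A: "A \<in> Obj SAbZ" and B: "B \<in> Obj SAbZ"
    and t: "\<And>a. t a \<in> Hom Ab (lcar A a) (lcar B a)"
    and nat: "\<And>\<alpha> g. \<alpha> \<in> Arr Delta \<Longrightarrow> g \<in> G (Cod Delta \<alpha>) \<Longrightarrow>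
      ap (t (Dom Delta \<alpha>)) (ap (fa (fst A) \<alpha>) g) = ap (fa (fst B) \<alpha>) (ap (t (Cod Delta \<alpha>)) g)"
    and aug: "\<And>a g. g \<in> G a \<Longrightarrow> aug B a (ap (t a) g) = aug A a g"
  shows "(A, (fst A, t, fst B), B) \<in> Hom SAbZ A B"
proof (rule SAbZ_HomI[OF A B t])
  interpret category "Ab :: ('u monoid, 'u ab_arr) moncat" by (rule category_Ab)
  fix \<alpha> assume \<alpha>: "\<alpha> \<in> Arr Delta"
  note Aa = sab_act(2)[OF SAbZ_ObjD(1)[OF A] \<alpha>] and Ba = sab_act(2)[OF SAbZ_ObjD(1)[OF B] \<alpha>]
  show "Cmp Ab (t (Dom Delta \<alpha>)) (fa (fst A) \<alpha>) = Cmp Ab (fa (fst B) \<alpha>) (t (Cod Delta \<alpha>))"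
    by (rule Ab_gen_eqI[OF G Cmp[OF Aa t] Cmp[OF t Ba]])
      (simp add: Ab_ap_Cmp[OF Aa t] Ab_ap_Cmp[OF t Ba] generated_byD(2)[OF G] nat[OF \<alpha>])
next
  interpret category "Ab :: ('u monoid, 'u ab_arr) moncat" by (rule category_Ab)
  fix a
  show "Cmp Ab (ap (snd B) a) (t a) = ap (snd A) a"
    by (rule Ab_gen_eqI[OF G Cmp[OF t SAbZ_ObjD(3)[OF B]] SAbZ_ObjD(3)[OF A]])
      (simp add: Ab_ap_Cmp[OF t SAbZ_ObjD(3)[OF B]] generated_byD(2)[OF G] aug)
qed

lemma the_hom_gen:
  assumes G: "generated_by A G" and C: "comm_group (C :: 'u monoid)"
    and h: "h \<in> hom A C" "h \<in> extensional (carrier A)"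
    and P: "\<And>k. P k \<longleftrightarrow> (\<forall>g\<in>G. k g = h g)"
  shows "the_hom A C P \<in> Hom Ab A C" "g \<in> G \<Longrightarrow> ap (the_hom A C P) g = h g"
proof -
  have "P h" by (simp add: P)
  moreover have "\<forall>k\<in>hom A C. P k \<longrightarrow> (\<forall>x\<in>carrier A. k x = h x)"
  proof (intro ballI impI)
    fix k x assume k: "k \<in> hom A C" "P k" and x: "x \<in> carrier A"
    have "\<forall>g\<in>G. k g = h g" using k(2) unfolding P .
    then show "k x = h x" by (intro generated_byD(3)[OF G C k(1) h(1) _ x]) (rule bspec)
  qed
  ultimately have *: "the_hom A C P \<in> Hom Ab A C" "P (ap (the_hom A C P))"
    using the_hom_Ab[OF generated_byD(1)[OF G] C h, of P] by simp_all
  show "the_hom A C P \<in> Hom Ab A C" by (rule *(1))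
  show "g \<in> G \<Longrightarrow> ap (the_hom A C P) g = h g" using *(2) by (simp add: P)
qed

lemma the_hom_Zfree:
  assumes C: "comm_group (C :: 'u monoid)" and f: "\<And>x. x \<in> X \<Longrightarrow> f x \<in> carrier C"
    and P: "\<And>h. P h \<longleftrightarrow> (\<forall>x\<in>X. h (zgen X x) = f x)"
  shows "the_hom (Zfree X) C P \<in> Hom Ab (Zfree X) C"
    "x \<in> X \<Longrightarrow> ap (the_hom (Zfree X) C P) (zgen X x) = f x"
proof -
  have "\<exists>h. h \<in> hom (Zfree X) C \<and> h \<in> extensional (carrier (Zfree X)) \<and> (\<forall>x\<in>X. h (zgen X x) = f x)"
    by (rule Zfree_universal[OF C, of X f, OF f]) auto
  then obtain h where h: "h \<in> hom (Zfree X) C" "h \<in> extensional (carrier (Zfree X))"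
    "\<And>x. x \<in> X \<Longrightarrow> h (zgen X x) = f x" by blast
  have *: "P k \<longleftrightarrow> (\<forall>g\<in>zgen X ` X. k g = h g)" for k using h(3) by (auto simp: P)
  show "the_hom (Zfree X) C P \<in> Hom Ab (Zfree X) C"
    by (rule the_hom_gen(1)[OF generated_by_Zfree C h(1,2) *])
  show "x \<in> X \<Longrightarrow> ap (the_hom (Zfree X) C P) (zgen X x) = f x"
    using the_hom_gen(2)[OF generated_by_Zfree C h(1,2) *, of "zgen X x"] h(3) by simp
qed

lemma the_hom_ZZ:
  assumes C: "comm_group (C :: 'u monoid)" "c \<in> carrier C"
  shows "the_hom ZZ C (\<lambda>h. h (zz 1) = c) \<in> Hom Ab ZZ C"
    "ap (the_hom ZZ C (\<lambda>h. h (zz 1) = c)) (zz 1) = c"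
proof -
  interpret comm_group C by fact
  obtain h where h: "h \<in> hom (ZZ :: 'u monoid) C" "h \<in> extensional (carrier ZZ)" "\<And>k. h (zz k) = c [^]\<^bsub>C\<^esub> k"
    using ZZ_universal[OF is_group C(2)] by blast
  have *: "k (zz 1) = c \<longleftrightarrow> (\<forall>g\<in>{zz 1}. k g = h g)" for k using h(3)[of 1] C(2) by auto
  show "the_hom ZZ C (\<lambda>h. h (zz 1) = c) \<in> Hom Ab ZZ C"
    "ap (the_hom ZZ C (\<lambda>h. h (zz 1) = c)) (zz 1) = c"
    using the_hom_gen[OF generated_by_ZZ C(1) h(1,2) *] h(3)[of 1] C(2) by auto
qed

lemma the_hom_tensor_Zfree:
  assumes C: "comm_group (C :: 'u monoid)" and f: "\<And>x y. x \<in> X \<Longrightarrow> y \<in> Y \<Longrightarrow> f x y \<in> carrier C"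
    and P: "\<And>h. P h \<longleftrightarrow> (\<forall>x\<in>X. \<forall>y\<in>Y. h (tens (Zfree X) (Zfree Y) (zgen X x) (zgen Y y)) = f x y)"
  shows "the_hom (tensor (Zfree X) (Zfree Y)) C P \<in> Hom Ab (tensor (Zfree X) (Zfree Y)) C"
    "x \<in> X \<Longrightarrow> y \<in> Y \<Longrightarrow> ap (the_hom (tensor (Zfree X) (Zfree Y)) C P)
      (tens (Zfree X) (Zfree Y) (zgen X x) (zgen Y y)) = f x y"
proof -
  interpret C: comm_group C by fact
  have "\<exists>r. r \<in> hom (Zfree Y) C \<and> (\<forall>y\<in>Y. r (zgen Y y) = f x y)" if "x \<in> X" for x
    by (rule Zfree_universal[OF C, of Y "f x", OF f[OF that]]) auto
  then obtain r where r: "\<And>x. x \<in> X \<Longrightarrow> r x \<in> hom (Zfree Y) C"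
    "\<And>x y. x \<in> X \<Longrightarrow> y \<in> Y \<Longrightarrow> r x (zgen Y y) = f x y" by metis
  have "\<exists>k. k \<in> hom (Zfree X) C \<and> (\<forall>x\<in>X. k (zgen X x) = r x t)" if "t \<in> carrier (Zfree Y)" for t
    by (rule Zfree_universal[OF C, of X "\<lambda>x. r x t", OF hom_apply_closed[OF r(1) that]]) auto
  then obtain k where k: "\<And>t. t \<in> carrier (Zfree Y) \<Longrightarrow> k t \<in> hom (Zfree X) C"
    "\<And>t x. t \<in> carrier (Zfree Y) \<Longrightarrow> x \<in> X \<Longrightarrow> k t (zgen X x) = r x t" by metis
  interpret Y: comm_group "Zfree Y" by (rule trans_free)
  have add: "k (t \<otimes>\<^bsub>Zfree Y\<^esub> t') s = k t s \<otimes>\<^bsub>C\<^esub> k t' s"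
    if "t \<in> carrier (Zfree Y)" "t' \<in> carrier (Zfree Y)" "s \<in> carrier (Zfree X)" for t t' s
    by (rule Zfree_hom_eq[OF C.is_group k(1) hom_mult_hom[OF C k(1) k(1)]])
      (use that k(2) hom_mult_apply[OF r(1)] in auto)
  have "bilinear_map (Zfree X) (Zfree Y) C (\<lambda>s t. k t s)"
    unfolding bilinear_map_def using add by (auto simp: hom_mult_apply[OF k(1)] hom_apply_closed[OF k(1)])
  then obtain h where h: "h \<in> hom (tensor (Zfree X) (Zfree Y)) C" "h \<in> extensional (carrier (tensor (Zfree X) (Zfree Y)))"
    "\<And>s t. s \<in> carrier (Zfree X) \<Longrightarrow> t \<in> carrier (Zfree Y) \<Longrightarrow> h (tens (Zfree X) (Zfree Y) s t) = k t s"
    using tensor_universal[OF trans_free(1)[of X] trans_free(1)[of Y] C] by blast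
  have hf: "h (tens (Zfree X) (Zfree Y) (zgen X x) (zgen Y y)) = f x y" if "x \<in> X" "y \<in> Y" for x y
    using that by (simp add: h(3) k(2) r(2))
  note G = generated_by_tensor[OF generated_by_Zfree[of X] generated_by_Zfree[of Y]]
  have *: "P k \<longleftrightarrow> (\<forall>g\<in>{tens (Zfree X) (Zfree Y) a b |a b. a \<in> zgen X ` X \<and> b \<in> zgen Y ` Y}. k g = h g)" for k
  proof -
    have "{tens (Zfree X) (Zfree Y) a b |a b. a \<in> zgen X ` X \<and> b \<in> zgen Y ` Y} =
        (\<lambda>(x, y). tens (Zfree X) (Zfree Y) (zgen X x) (zgen Y y)) ` (X \<times> Y)" by auto
    then show ?thesis by (simp add: P hf)
  qed
  show "the_hom (tensor (Zfree X) (Zfree Y)) C P \<in> Hom Ab (tensor (Zfree X) (Zfree Y)) C"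
    by (rule the_hom_gen(1)[OF G C h(1,2) *])
  show "x \<in> X \<Longrightarrow> y \<in> Y \<Longrightarrow> ap (the_hom (tensor (Zfree X) (Zfree Y)) C P)
      (tens (Zfree X) (Zfree Y) (zgen X x) (zgen Y y)) = f x y"
    by (subst the_hom_gen(2)[OF G C h(1,2) *]) (auto simp: hf)
qed

lemma Zfree_fun_Hom:
  assumes "f \<in> Hom Sets X (Y :: 'u set)"
  shows "fa Zfree_fun f \<in> Hom Ab (Zfree X) (Zfree Y)" "x \<in> X \<Longrightarrow> ap (fa Zfree_fun f) (zgen X x) = zgen Y (ap f x)"
proof -
  have eq: "fa Zfree_fun f = the_hom (Zfree X) (Zfree Y) (\<lambda>h. \<forall>x\<in>X. h (zgen X x) = zgen Y (ap f x))"
    by (subst Sets_Hom_ap(1)[OF assms]) (simp add: Zfree_fun_def)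
  show "fa Zfree_fun f \<in> Hom Ab (Zfree X) (Zfree Y)" "x \<in> X \<Longrightarrow> ap (fa Zfree_fun f) (zgen X x) = zgen Y (ap f x)"
    unfolding eq using the_hom_Zfree[OF trans_free(1)[of Y], of X "\<lambda>x. zgen Y (ap f x)"] Sets_Hom_ap(3)[OF assms]
    by auto
qed

lemma Zaug_Hom: "Zaug X \<in> Hom Ab (Zfree X) (ZZ :: 'u monoid)" "x \<in> X \<Longrightarrow> ap (Zaug X) (zgen X x) = (zz 1 :: 'u)"
  unfolding Zaug_def using the_hom_Zfree[OF trans_ZZ(1), of X "\<lambda>_. zz 1"] by auto

lemma Zdiag_Hom:
  "Zdiag X \<in> Hom Ab (Zfree X) (tensor (Zfree X) (Zfree (X :: 'u set)))"
  "x \<in> X \<Longrightarrow> ap (Zdiag X) (zgen X x) = tens (Zfree X) (Zfree X) (zgen X x) (zgen X x)"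
  unfolding Zdiag_def
  using the_hom_Zfree[of "tensor (Zfree X) (Zfree X)" X "\<lambda>x. tens (Zfree X) (Zfree X) (zgen X x) (zgen X x)"] trans_free(1)
  by auto

lemma Zmul_Hom:
  assumes "m \<in> Hom Sets (set_prod X X) (X :: 'u set)"
  shows "Zmul X m \<in> Hom Ab (tensor (Zfree X) (Zfree X)) (Zfree X)"
    "x \<in> X \<Longrightarrow> y \<in> X \<Longrightarrow> ap (Zmul X m) (tens (Zfree X) (Zfree X) (zgen X x) (zgen X y)) = zgen X (ap m (pr x y))"
  unfolding Zmul_def
  using the_hom_tensor_Zfree[OF trans_free(1)[of X], of X X "\<lambda>x y. zgen X (ap m (pr x y))"] Sets_Hom_ap(3)[OF assms]
  by auto

lemma Zunit_Hom:
  assumes "u \<in> Hom Sets {pt} (X :: 'u set)"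
  shows "Zunit X u \<in> Hom Ab ZZ (Zfree X)" "ap (Zunit X u) (zz 1) = zgen X (ap u pt)"
  unfolding Zunit_def
  using the_hom_ZZ[OF trans_free(1)[of X], of "zgen X (ap u pt)"] Sets_Hom_ap(3)[OF assms, of pt] by auto

lemma is_functor_Zfree_fun: "is_functor Sets Ab (Zfree_fun :: ('u set, 'u set_arr, 'u monoid, 'u ab_arr) fctr)"
proof -
  interpret Sets: category "Sets :: ('u set, 'u set_arr) moncat" by (rule category_Sets)
  interpret Ab: category "Ab :: ('u monoid, 'u ab_arr) moncat" by (rule category_Ab)
  have fo: "fo Zfree_fun X = Zfree X" for X :: "'u set" by (simp add: Zfree_fun_def)
  show ?thesis
  proof (rule functorI)
    fix X :: "'u set" assume X: "X \<in> Obj Sets"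
    show Z: "fo Zfree_fun X \<in> Obj Ab" using trans_free(1) by (simp add: fo Ab_simps)
    note i = Zfree_fun_Hom[OF Sets.Idt[OF X]]
    show "fa Zfree_fun (Idt Sets X) = Idt Ab (fo Zfree_fun X)"
      unfolding fo by (rule Ab_gen_eqI[OF generated_by_Zfree i(1) Ab.Idt[OF Z[unfolded fo]]])
        (auto simp: i(2) Ab_ap_Idt, simp add: Sets_simps)
  next
    fix f :: "'u set_arr" assume "f \<in> Arr Sets"
    from Zfree_fun_Hom(1)[OF Arr_Hom[OF this]]
    show "fa Zfree_fun f \<in> Hom Ab (fo Zfree_fun (Dom Sets f)) (fo Zfree_fun (Cod Sets f))" by (simp add: fo)
  next
    fix f g :: "'u set_arr" assume fg: "f \<in> Arr Sets" "g \<in> Arr Sets" "Dom Sets g = Cod Sets f"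
    define X Y Z where "X = Dom Sets f" and "Y = Cod Sets f" and "Z = Cod Sets g"
    have f: "f \<in> Hom Sets X Y" and g: "g \<in> Hom Sets Y Z"
      using fg by (auto simp: X_def Y_def Z_def Hom_def)
    note zf = Zfree_fun_Hom[OF f] and zg = Zfree_fun_Hom[OF g] and zfg = Zfree_fun_Hom[OF Sets.Cmp[OF f g]]
    show "fa Zfree_fun (Cmp Sets g f) = Cmp Ab (fa Zfree_fun g) (fa Zfree_fun f)"
      by (rule Ab_gen_eqI[OF generated_by_Zfree zfg(1) Ab.Cmp[OF zf(1) zg(1)]])
        (auto simp: zf(2) zg(2) zfg(2) Ab_ap_Cmp[OF zf(1) zg(1)] Sets_ap_Cmp[OF f g] Sets_Hom_ap(3)[OF f])
  qed
qed

definition ZA :: "'u sset \<Rightarrow> 'u asab" where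
  "ZA X = (Zs X, Zs_aug X)"

definition ZA_arr :: "'u sset_arr \<Rightarrow> 'u asab_arr" where
  "ZA_arr = (\<lambda>(X, t, Y). (ZA X, Zs_arr (X, t, Y), ZA Y))"

lemma lcar_ZA [simp]: "lcar (ZA X) a = Zfree (fo X a)"
  by (simp add: ZA_def simp_map_def Zfree_fun_def)

lemma generated_by_ZA: "generated_by (lcar (ZA X) a) (zgen (fo X a) ` fo X a)"
  using generated_by_Zfree by simp

lemma ap_fa_ZA:
  assumes "is_functor (op_cat Delta) Sets X" "\<alpha> \<in> Arr Delta" "x \<in> fo X (Cod Delta \<alpha>)"
  shows "ap (fa (fst (ZA X)) \<alpha>) (zgen (fo X (Cod Delta \<alpha>)) x) = zgen (fo X (Dom Delta \<alpha>)) (ap (fa X \<alpha>) x)"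
  using Zfree_fun_Hom(2)[OF sset_act(1)[OF assms(1,2)] assms(3)] by (simp add: ZA_def simp_map_def)

lemma aug_ZA: "x \<in> fo X a \<Longrightarrow> aug (ZA X) a (zgen (fo X a) x) = zz 1"
  using Zaug_Hom(2) by (simp add: ZA_def Zs_aug_def)

lemma ZA_Obj [simp]:
  assumes "is_functor (op_cat Delta) Sets X"
  shows "ZA X \<in> Obj SAbZ"
proof -
  interpret Ab: category "Ab :: ('u monoid, 'u ab_arr) moncat" by (rule category_Ab)
  have Zs: "is_functor (op_cat Delta) Ab (Zs X)"
    unfolding simp_map_def using is_functor_fcomp[OF assms is_functor_Zfree_fun] by simp
  have "nat_trans (op_cat Delta) Ab (Zs X) (simp_one Ab) (\<lambda>n. Zaug (fo X n))"
    unfolding nat_trans_def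
  proof (intro conjI ballI)
    show "Zaug (fo X n) \<in> Hom Ab (fo (Zs X) n) (fo (simp_one Ab) n)" for n
      using Zaug_Hom(1) by (simp add: simp_map_def Zfree_fun_def simp_one_def Ab_simps(9))
    fix \<alpha> assume "\<alpha> \<in> Arr (op_cat Delta)"
    then have \<alpha>: "\<alpha> \<in> Arr Delta" by simp
    note f = sset_act(1)[OF assms \<alpha>]
    note zf = Zfree_fun_Hom[OF f] and z = Zaug_Hom[where X = "fo X (Dom Delta \<alpha>)"] and z' = Zaug_Hom[where X = "fo X (Cod Delta \<alpha>)"]
    have ZZ: "Idt Ab (ZZ :: 'u monoid) \<in> Hom Ab ZZ ZZ" using trans_ZZ(1) by (intro Ab.Idt) (simp add: Ab_simps)
    have "Cmp Ab (Zaug (fo X (Dom Delta \<alpha>))) (fa Zfree_fun (fa X \<alpha>)) = Cmp Ab (Idt Ab ZZ) (Zaug (fo X (Cod Delta \<alpha>)))"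
      by (rule Ab_gen_eqI[OF generated_by_Zfree Ab.Cmp[OF zf(1) z(1)] Ab.Cmp[OF z'(1) ZZ]])
        (auto simp: Ab_ap_Cmp[OF zf(1) z(1)] Ab_ap_Cmp[OF z'(1) ZZ] zf(2) z(2) z'(2) Ab_ap_Idt Sets_Hom_ap(3)[OF f])
    then show "Cmp Ab (Zaug (fo X (Cod (op_cat Delta) \<alpha>))) (fa (Zs X) \<alpha>) =
        Cmp Ab (fa (simp_one Ab) \<alpha>) (Zaug (fo X (Dom (op_cat Delta) \<alpha>)))"
      by (simp add: simp_map_def simp_one_def Ab_simps(9))
  qed
  moreover have "is_functor (op_cat Delta) Ab (simp_one Ab :: 'u sab)"
    using SAb.One_Obj by (simp add: Simp_simps)
  ultimately show ?thesis
    using Zs unfolding Over_One_simps(1) by (simp add: ZA_def Zs_aug_def Simp_simps)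
qed

lemma ZA_arr_Hom:
  assumes F: "F \<in> Hom SSet X (Y :: 'u sset)"
  shows "ZA_arr F \<in> Hom SAbZ (ZA X) (ZA Y)"
    "x \<in> fo X a \<Longrightarrow> zap (ZA_arr F) a (zgen (fo X a) x) = zgen (fo Y a) (sap F a x)"
proof -
  note F' = Simp_HomD[OF F]
  have eq: "ZA_arr F = (ZA X, (fst (ZA X), \<lambda>a. fa Zfree_fun (ap F a), fst (ZA Y)), ZA Y)"
    by (subst F'(1)) (simp add: ZA_arr_def simp_map_def ZA_def)
  note zf = Zfree_fun_Hom[OF F'(5)]
  show "ZA_arr F \<in> Hom SAbZ (ZA X) (ZA Y)"
    unfolding eq
    by (rule SAbZ_gen_HomI[OF generated_by_ZA])
      (auto simp: F'(2,3) zf ap_fa_ZA aug_ZA sset_act SSet_Hom_sap[OF F])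
  show "x \<in> fo X a \<Longrightarrow> zap (ZA_arr F) a (zgen (fo X a) x) = zgen (fo Y a) (sap F a x)"
    unfolding eq by (simp add: zf)
qed

lemma SAbZ_ZA_eqI:
  assumes "F \<in> Hom SAbZ (ZA X) B" "F' \<in> Hom SAbZ (ZA X) B"
    "\<And>a x. x \<in> fo X a \<Longrightarrow> zap F a (zgen (fo X a) x) = zap F' a (zgen (fo X a) x)"
  shows "F = F'"
  by (rule SAbZ_gen_eqI[OF generated_by_ZA assms(1,2)]) (auto simp: assms(3))

lemma ZA_arr_Cmp:
  assumes "F \<in> Hom SSet X (Y :: 'u sset)" "G \<in> Hom SSet Y Z"
  shows "ZA_arr (Cmp SSet G F) = Cmp SAbZ (ZA_arr G) (ZA_arr F)"
  by (rule SAbZ_ZA_eqI[OF ZA_arr_Hom(1)[OF SSet.Cmp[OF assms]] SAbZ.Cmp[OF ZA_arr_Hom(1)[OF assms(1)] ZA_arr_Hom(1)[OF assms(2)]]])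
    (simp add: ZA_arr_Hom(2)[OF SSet.Cmp[OF assms]] SAbZ_zap_Cmp[OF ZA_arr_Hom(1)[OF assms(1)] ZA_arr_Hom(1)[OF assms(2)]]
      ZA_arr_Hom(2)[OF assms(1)] ZA_arr_Hom(2)[OF assms(2)] SSet_sap_Cmp[OF assms] SSet_Hom_sap[OF assms(1)])

lemma ZA_arr_Idt:
  assumes "X \<in> Obj SSet"
  shows "ZA_arr (Idt SSet X) = Idt SAbZ (ZA X)"
proof -
  have X: "ZA X \<in> Obj SAbZ" using assms by (intro ZA_Obj) (simp add: Simp_simps)
  show ?thesis
    by (rule SAbZ_ZA_eqI[OF ZA_arr_Hom(1)[OF SSet.Idt[OF assms]] SAbZ.Idt[OF X]])
      (simp add: ZA_arr_Hom(2)[OF SSet.Idt[OF assms]] SAbZ_zap_canonical(4)[OF X X X] SSet_sap_canonical(4))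
qed

section \<open>The two bar objects of a simplicial set\<close>

definition bob_set :: "'u sset \<Rightarrow> ('u sset, 'u sset_arr) bob" where
  "bob_set X = rho_ob SSet (dec_set_ob X)"

definition bob_ten :: "'u sset \<Rightarrow> ('u asab, 'u asab_arr) bob" where
  "bob_ten X = rho_ob SAbZ (dec_ten_ob (Zcoalg_ob X))"

lemma set_pair_Hom:
  assumes "F \<in> Hom Sets X Y" "G \<in> Hom Sets X (Z :: 'u set)"
  shows "set_pair F G \<in> Hom Sets X (set_prod Y Z)" "x \<in> X \<Longrightarrow> ap (set_pair F G) x = pr (ap F x) (ap G x)"
  using assms by (auto simp: Sets_simps set_pair_def PiE_def Pi_def)

context
  fixes X :: "'u sset"
  assumes X: "is_functor (op_cat Delta) Sets X"
begin

abbreviation "sh \<beta> a \<equiv> sap (fa (dec X) \<beta>) a"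

lemma dec_functor: "is_functor (op_cat Delta) SSet (dec X)"
  by (rule is_functor_dec[OF category_Sets X])

lemma dec_col_functor [simp]: "is_functor (op_cat Delta) Sets (dec_col X n)"
  by (rule is_functor_dec_col[OF X])

lemma dec_col_Obj [simp]: "dec_col X n \<in> Obj SSet"
  by (simp add: Simp_simps)

lemma dec_Hom: "\<beta> \<in> Arr Delta \<Longrightarrow> fa (dec X) \<beta> \<in> Hom SSet (dec_col X (Cod Delta \<beta>)) (dec_col X (Dom Delta \<beta>))"
  using functor_Hom[OF dec_functor, of \<beta> "Cod Delta \<beta>" "Dom Delta \<beta>"] by (simp add: Hom_def dec_def)

lemma sh_closed [simp]: "\<beta> \<in> Arr Delta \<Longrightarrow> n = Dom Delta \<beta> \<Longrightarrow> x \<in> fo (dec_col X (Cod Delta \<beta>)) a \<Longrightarrow> sh \<beta> a x \<in> fo (dec_col X n) a"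
  using SSet_Hom_sap(1)[OF dec_Hom] by simp

lemma sh_Cmp:
  assumes "\<beta> \<in> Arr Delta" "\<gamma> \<in> Arr Delta" "Dom Delta \<gamma> = Cod Delta \<beta>" "x \<in> fo (dec_col X (Cod Delta \<gamma>)) a"
  shows "sh (Cmp Delta \<gamma> \<beta>) a x = sh \<beta> a (sh \<gamma> a x)"
  using functorD(6)[OF dec_functor, of \<gamma> \<beta>] assms SSet_sap_Cmp[OF dec_Hom[of \<gamma>], of "fa (dec X) \<beta>" _ x a] dec_Hom[of \<beta>]
  by simp

lemma sh_Idt [simp]: "x \<in> fo (dec_col X n) a \<Longrightarrow> sh (Idt Delta n) a x = x"
  using functorD(2)[OF dec_functor, of n] SSet_sap_canonical(4)[of x "dec_col X n" a] by (simp add: dec_def)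

lemma smul_set:
  shows "smul (dec_set_ob X) n m \<in> Hom SSet (dec_col X (n + m + 1)) (Ten SSet (dec_col X n) (dec_col X m))"
    and "x \<in> fo (dec_col X (n + m + 1)) a \<Longrightarrow>
      sap (smul (dec_set_ob X) n m) a x = pr (sh (join_inl n m) a x) (sh (join_inr n m) a x)"
proof -
  note l = dec_Hom[of "join_inl n m", simplified] and r = dec_Hom[of "join_inr n m", simplified]
  note lr = set_pair_Hom[OF Simp_HomD(5)[OF l] Simp_HomD(5)[OF r]]
  have eq: "smul (dec_set_ob X) n m = (dec_col X (n + m + 1),
     \<lambda>a. set_pair (ap (fa (dec X) (join_inl n m)) a) (ap (fa (dec X) (join_inr n m)) a), Ten SSet (dec_col X n) (dec_col X m))"
    by (simp add: dec_set_ob_def dec_def)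
  have T: "is_functor (op_cat Delta) Sets (Ten SSet (dec_col X n) (dec_col X m))"
    using SSet.Ten_Obj[of "dec_col X n" "dec_col X m"] by (simp add: Simp_simps)
  show "smul (dec_set_ob X) n m \<in> Hom SSet (dec_col X (n + m + 1)) (Ten SSet (dec_col X n) (dec_col X m))"
    unfolding eq
  proof (rule SSet_HomI[OF dec_col_functor T])
    fix a show "set_pair (ap (fa (dec X) (join_inl n m)) a) (ap (fa (dec X) (join_inr n m)) a)
      \<in> Hom Sets (fo (dec_col X (n + m + 1)) a) (fo (Ten SSet (dec_col X n) (dec_col X m)) a)"
      using lr(1) by simp
  next
    fix \<alpha> x assume \<alpha>: "\<alpha> \<in> Arr Delta" and x: "x \<in> fo (dec_col X (n + m + 1)) (Cod Delta \<alpha>)"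
    then show "ap (set_pair (ap (fa (dec X) (join_inl n m)) (Dom Delta \<alpha>)) (ap (fa (dec X) (join_inr n m)) (Dom Delta \<alpha>)))
        (ap (fa (dec_col X (n + m + 1)) \<alpha>) x) = ap (fa (Ten SSet (dec_col X n) (dec_col X m)) \<alpha>)
        (ap (set_pair (ap (fa (dec X) (join_inl n m)) (Cod Delta \<alpha>)) (ap (fa (dec X) (join_inr n m)) (Cod Delta \<alpha>))) x)"
      using SSet_Hom_sap(2)[OF l \<alpha>] SSet_Hom_sap(2)[OF r \<alpha>] sset_act(2)[OF dec_col_functor \<alpha>]
      by (simp add: lr(2) ap_fa_Ten_SSet)
  qed
  show "x \<in> fo (dec_col X (n + m + 1)) a \<Longrightarrow>
      sap (smul (dec_set_ob X) n m) a x = pr (sh (join_inl n m) a x) (sh (join_inr n m) a x)"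
    unfolding eq by (simp add: lr(2))
qed

lemma sh_collapse:
  assumes "x \<in> fo (dec_col X (n + m)) a"
  shows "sh (join_inl n m) a (sh (join_collapse n m) a x) = sh (front n m) a x"
    "sh (join_inr n m) a (sh (join_collapse n m) a x) = sh (rear n m) a x"
  using sh_Cmp[of "join_inl n m" "join_collapse n m" x a] sh_Cmp[of "join_inr n m" "join_collapse n m" x a] assms
  by (simp_all add: front_rear_simps)

lemma bfun_set: "bfun (bob_set X) = dec X"
  by (simp add: bob_set_def rho_ob_def dec_set_ob_def)

lemma fo_bfun_set: "fo (bfun (bob_set X)) n = dec_col X n"
  by (simp add: bfun_set dec_def)

lemma bmul_set:
  shows "bmul (bob_set X) n m \<in> Hom SSet (dec_col X (n + m)) (Ten SSet (dec_col X n) (dec_col X m))"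
    and "x \<in> fo (dec_col X (n + m)) a \<Longrightarrow>
      sap (bmul (bob_set X) n m) a x = pr (sh (front n m) a x) (sh (rear n m) a x)"
proof -
  have eq: "bmul (bob_set X) n m = Cmp SSet (smul (dec_set_ob X) n m) (fa (dec X) (join_collapse n m))"
    by (simp add: bob_set_def rho_ob_def dec_set_ob_def)
  note c = dec_Hom[of "join_collapse n m", simplified]
  note s = smul_set[where n = n and m = m, simplified]
  show "bmul (bob_set X) n m \<in> Hom SSet (dec_col X (n + m)) (Ten SSet (dec_col X n) (dec_col X m))"
    unfolding eq by (rule SSet.Cmp[OF c s(1)])
  show "x \<in> fo (dec_col X (n + m)) a \<Longrightarrow>
      sap (bmul (bob_set X) n m) a x = pr (sh (front n m) a x) (sh (rear n m) a x)"
    unfolding eq by (simp add: SSet_sap_Cmp[OF c s(1)] s(2) sh_collapse)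
qed

lemma bone_set:
  shows "bone (bob_set X) \<in> Hom SSet (dec_col X 0) (One SSet)"
    and "x \<in> fo (dec_col X 0) a \<Longrightarrow> sap (bone (bob_set X)) a x = pt"
proof -
  have eq: "bone (bob_set X) = (dec_col X 0, \<lambda>a. (fo (dec_col X 0) a, \<lambda>x\<in>fo (dec_col X 0) a. pt, {pt}), One SSet)"
    by (simp add: bob_set_def rho_ob_def dec_set_ob_def dec_col_def)
  have O: "is_functor (op_cat Delta) Sets (One SSet :: 'u sset)" using SSet.One_Obj by (simp add: Simp_simps)
  show "bone (bob_set X) \<in> Hom SSet (dec_col X 0) (One SSet)"
    unfolding eq by (rule SSet_HomI[OF dec_col_functor O])
      (auto simp: Sets_simps ap_fa_One_SSet[unfolded Simp_simps] sset_act(2)[OF dec_col_functor] ap_fa_One_SSet)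
  show "x \<in> fo (dec_col X 0) a \<Longrightarrow> sap (bone (bob_set X)) a x = pt"
    unfolding eq by simp
qed

lemma sh_join_act:
  assumes "\<alpha> \<in> Arr Delta_act" "\<beta> \<in> Arr Delta_act" "x \<in> fo (dec_col X (Cod Delta \<alpha> + Cod Delta \<beta>)) a"
  shows "sh (front (Dom Delta \<alpha>) (Dom Delta \<beta>)) a (sh (join_act \<alpha> \<beta>) a x) =
      sh \<alpha> a (sh (front (Cod Delta \<alpha>) (Cod Delta \<beta>)) a x)"
    "sh (rear (Dom Delta \<alpha>) (Dom Delta \<beta>)) a (sh (join_act \<alpha> \<beta>) a x) =
      sh \<beta> a (sh (rear (Cod Delta \<alpha>) (Cod Delta \<beta>)) a x)"
  using sh_Cmp[of "front (Dom Delta \<alpha>) (Dom Delta \<beta>)" "join_act \<alpha> \<beta>" x a]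
    sh_Cmp[of \<alpha> "front (Cod Delta \<alpha>) (Cod Delta \<beta>)" x a]
    sh_Cmp[of "rear (Dom Delta \<alpha>) (Dom Delta \<beta>)" "join_act \<alpha> \<beta>" x a]
    sh_Cmp[of \<beta> "rear (Cod Delta \<alpha>) (Cod Delta \<beta>)" x a]
    join_act_front_rear[OF assms(1,2)] join_act_arr[OF assms(1,2)] assms
  by (simp_all add: Delta_act_Delta)

lemma sh_coassoc:
  assumes "x \<in> fo (dec_col X (n + m + k)) a"
  shows "sh (front n m) a (sh (front (n + m) k) a x) = sh (front n (m + k)) a x"
    "sh (rear n m) a (sh (front (n + m) k) a x) = sh (front m k) a (sh (rear n (m + k)) a x)"
    "sh (rear (n + m) k) a x = sh (rear m k) a (sh (rear n (m + k)) a x)"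
  using sh_Cmp[of "front n m" "front (n + m) k" x a] sh_Cmp[of "rear n m" "front (n + m) k" x a]
    sh_Cmp[of "front m k" "rear n (m + k)" x a] sh_Cmp[of "rear m k" "rear n (m + k)" x a] assms
  by (simp_all add: front_rear_simps add.assoc)

lemma is_bob_set: "is_bob SSet (bob_set X)"
  unfolding is_bob_def Let_def fo_bfun_set
proof (intro conjI allI ballI bmul_set(1) bone_set(1))
  show "is_functor (op_cat Delta_act) SSet (bfun (bob_set X))"
    unfolding bfun_set by (rule is_functor_Delta_act[OF dec_functor])
next
  fix \<alpha> \<beta> assume \<alpha>: "\<alpha> \<in> Arr Delta_act" and \<beta>: "\<beta> \<in> Arr Delta_act"
  note J = join_act_arr[OF \<alpha> \<beta>]
  note A = dec_Hom[OF Delta_act_Delta(1)[OF \<alpha>]] and B = dec_Hom[OF Delta_act_Delta(1)[OF \<beta>]]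
  have C: "fa (dec X) (join_act \<alpha> \<beta>) \<in> Hom SSet (dec_col X (Cod Delta \<alpha> + Cod Delta \<beta>)) (dec_col X (Dom Delta \<alpha> + Dom Delta \<beta>))"
    using dec_Hom[OF Delta_act_Delta(1)[OF J(1)]] J Delta_act_Delta[OF J(1)] \<alpha> \<beta> by (simp add: Delta_act_Delta)
  note AB = SSet.TenA_Hom[OF A B]
  note l = bmul_set[where n = "Dom Delta \<alpha>" and m = "Dom Delta \<beta>"] and r = bmul_set[where n = "Cod Delta \<alpha>" and m = "Cod Delta \<beta>"]
  show "Cmp SSet (bmul (bob_set X) (Dom Delta_act \<alpha>) (Dom Delta_act \<beta>)) (fa (bfun (bob_set X)) (join_act \<alpha> \<beta>)) =
      Cmp SSet (TenA SSet (fa (bfun (bob_set X)) \<alpha>) (fa (bfun (bob_set X)) \<beta>))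
       (bmul (bob_set X) (Cod Delta_act \<alpha>) (Cod Delta_act \<beta>))"
    unfolding bfun_set Delta_act_Delta(2,3)[OF \<alpha>] Delta_act_Delta(2,3)[OF \<beta>]
    by (rule SSet_Hom_eqI[OF SSet.Cmp[OF C l(1)] SSet.Cmp[OF r(1) AB]])
      (simp add: SSet_sap_Cmp[OF C l(1)] SSet_sap_Cmp[OF r(1) AB] l(2) r(2) SSet_Hom_sap(1)[OF C]
        SSet_sap_TenA[OF A B] sh_join_act[OF \<alpha> \<beta>])
next
  fix n m k
  note I = SSet.Idt[OF dec_col_Obj]
  note nm = bmul_set[where n = n and m = m] and nmk = bmul_set[where n = "n + m" and m = k] and mk = bmul_set[where n = m and m = k] and n_mk = bmul_set[where n = n and m = "m + k"]
  note as = SSet.Assoc_Hom[OF dec_col_Obj dec_col_Obj dec_col_Obj, of n m k]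
  note L = SSet.Cmp[OF SSet.Cmp[OF nmk(1) SSet.TenA_Hom[OF nm(1) I]] as]
  note R = SSet.Cmp[OF n_mk(1) SSet.TenA_Hom[OF I mk(1)]]
  show "Cmp SSet (Assoc SSet (dec_col X n) (dec_col X m) (dec_col X k))
           (Cmp SSet (TenA SSet (bmul (bob_set X) n m) (Idt SSet (dec_col X k))) (bmul (bob_set X) (n + m) k)) =
         Cmp SSet (TenA SSet (Idt SSet (dec_col X n)) (bmul (bob_set X) m k)) (bmul (bob_set X) n (m + k))"
  proof (rule SSet_Hom_eqI[OF L R[folded add.assoc]])
    fix a x assume x: "x \<in> fo (dec_col X (n + m + k)) a"
    then have x': "x \<in> fo (dec_col X (n + (m + k))) a" by (simp add: add.assoc)
    have "sap (Cmp SSet (Assoc SSet (dec_col X n) (dec_col X m) (dec_col X k))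
           (Cmp SSet (TenA SSet (bmul (bob_set X) n m) (Idt SSet (dec_col X k))) (bmul (bob_set X) (n + m) k))) a x =
        pr (sh (front n m) a (sh (front (n + m) k) a x)) (pr (sh (rear n m) a (sh (front (n + m) k) a x)) (sh (rear (n + m) k) a x))"
      using x by (simp add: SSet_sap_Cmp[OF SSet.Cmp[OF nmk(1) SSet.TenA_Hom[OF nm(1) I]] as]
          SSet_sap_Cmp[OF nmk(1) SSet.TenA_Hom[OF nm(1) I]] nmk(2) SSet_sap_TenA[OF nm(1) I] nm(2) SSet_sap_canonical)
    also have "\<dots> = sap (Cmp SSet (TenA SSet (Idt SSet (dec_col X n)) (bmul (bob_set X) m k)) (bmul (bob_set X) n (m + k))) a x"
      using x' unfolding sh_coassoc[OF x]
      by (simp add: SSet_sap_Cmp[OF n_mk(1) SSet.TenA_Hom[OF I mk(1)]] n_mk(2) SSet_sap_TenA[OF I mk(1)] mk(2) SSet_sap_canonical)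
    finally show "sap (Cmp SSet (Assoc SSet (dec_col X n) (dec_col X m) (dec_col X k))
           (Cmp SSet (TenA SSet (bmul (bob_set X) n m) (Idt SSet (dec_col X k))) (bmul (bob_set X) (n + m) k))) a x =
        sap (Cmp SSet (TenA SSet (Idt SSet (dec_col X n)) (bmul (bob_set X) m k)) (bmul (bob_set X) n (m + k))) a x" .
  qed
next
  fix n
  note I = SSet.Idt[OF dec_col_Obj[of n]] and b = bmul_set[where n = 0 and m = n, simplified] and b' = bmul_set[where n = n and m = 0, simplified]
  note T = SSet.TenA_Hom[OF bone_set(1) I] and T' = SSet.TenA_Hom[OF I bone_set(1)]
  note l = SSet.Lun_Hom[OF dec_col_Obj[of n]] and r = SSet.Run_Hom[OF dec_col_Obj[of n]]
  show "Cmp SSet (Lun SSet (dec_col X n)) (Cmp SSet (TenA SSet (bone (bob_set X)) (Idt SSet (dec_col X n))) (bmul (bob_set X) 0 n)) =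
      Idt SSet (dec_col X n)"
    by (rule SSet_Hom_eqI[OF SSet.Cmp[OF SSet.Cmp[OF b(1) T] l] I])
      (simp add: SSet_sap_Cmp[OF SSet.Cmp[OF b(1) T] l] SSet_sap_Cmp[OF b(1) T] b(2) SSet_sap_TenA[OF bone_set(1) I]
        bone_set(2) SSet_sap_canonical front_rear_simps)
  show "Cmp SSet (Run SSet (dec_col X n)) (Cmp SSet (TenA SSet (Idt SSet (dec_col X n)) (bone (bob_set X))) (bmul (bob_set X) n 0)) =
      Idt SSet (dec_col X n)"
    by (rule SSet_Hom_eqI[OF SSet.Cmp[OF SSet.Cmp[OF b'(1) T'] r] I])
      (simp add: SSet_sap_Cmp[OF SSet.Cmp[OF b'(1) T'] r] SSet_sap_Cmp[OF b'(1) T'] b'(2) SSet_sap_TenA[OF I bone_set(1)]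
        bone_set(2) SSet_sap_canonical front_rear_simps)
qed

abbreviation "zg n a \<equiv> zgen (fo (dec_col X n) a)"

lemma dec_ten_col_eq: "dec_ten_col (Zcoalg_ob X) n = ZA (dec_col X n)"
  by (simp add: dec_ten_col_def Zcoalg_ob_def ZA_def Zs_aug_def simp_map_def fcomp_def dec_col_def)

lemma fo_bfun_ten: "fo (bfun (bob_ten X)) n = ZA (dec_col X n)"
  by (simp add: bob_ten_def rho_ob_def dec_ten_ob_def Let_def dec_ten_col_eq)

lemma sfun_ten: "fa (sfun (dec_ten_ob (Zcoalg_ob X))) \<beta> = ZA_arr (fa (dec X) \<beta>)"
  by (simp add: dec_ten_ob_def Let_def dec_ten_col_eq ZA_arr_def dec_def)
    (simp add: Zcoalg_ob_def simp_map_def fcomp_def dec_col_def)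

lemma fa_bfun_ten: "fa (bfun (bob_ten X)) \<beta> = ZA_arr (fa (dec X) \<beta>)"
  using sfun_ten by (simp add: bob_ten_def rho_ob_def)

lemma ZA_dec_Hom:
  assumes "\<beta> \<in> Arr Delta"
  shows "ZA_arr (fa (dec X) \<beta>) \<in> Hom SAbZ (ZA (dec_col X (Cod Delta \<beta>))) (ZA (dec_col X (Dom Delta \<beta>)))"
    "x \<in> fo (dec_col X (Cod Delta \<beta>)) a \<Longrightarrow>
      zap (ZA_arr (fa (dec X) \<beta>)) a (zg (Cod Delta \<beta>) a x) = zg (Dom Delta \<beta>) a (sh \<beta> a x)"
  using ZA_arr_Hom[OF dec_Hom[OF assms]] by blast+

lemma smul_ten:
  shows "smul (dec_ten_ob (Zcoalg_ob X)) n m \<in>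
      Hom SAbZ (ZA (dec_col X (n + m + 1))) (Ten SAbZ (ZA (dec_col X n)) (ZA (dec_col X m)))"
    and "x \<in> fo (dec_col X (n + m + 1)) a \<Longrightarrow>
      zap (smul (dec_ten_ob (Zcoalg_ob X)) n m) a (zg (n + m + 1) a x) =
      tens (Zfree (fo (dec_col X n) a)) (Zfree (fo (dec_col X m) a)) (zg n a (sh (join_inl n m) a x)) (zg m a (sh (join_inr n m) a x))"
proof -
  let ?S = "\<lambda>n a. fo (dec_col X n) a"
  note l = dec_Hom[OF Delta_arrs(7)[of n m], unfolded Delta_arrs] and r = dec_Hom[OF Delta_arrs(10)[of n m], unfolded Delta_arrs]
  note zl = Zfree_fun_Hom[OF Simp_HomD(5)[OF l]] and zr = Zfree_fun_Hom[OF Simp_HomD(5)[OF r]]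
  let ?t = "\<lambda>a. Cmp Ab (TenA Ab (fa Zfree_fun (ap (fa (dec X) (join_inl n m)) a)) (fa Zfree_fun (ap (fa (dec X) (join_inr n m)) a)))
    (Zdiag (?S (n + m + 1) a))"
  have eq: "smul (dec_ten_ob (Zcoalg_ob X)) n m = (ZA (dec_col X (n + m + 1)),
     (fst (ZA (dec_col X (n + m + 1))), ?t, fst (Ten SAbZ (ZA (dec_col X n)) (ZA (dec_col X m)))),
     Ten SAbZ (ZA (dec_col X n)) (ZA (dec_col X m)))"
    by (simp add: dec_ten_ob_def Let_def dec_ten_col_eq dec_def)
      (simp add: ZA_def Zcoalg_ob_def simp_map_def fcomp_def dec_col_def Over_One_simps aug_ten_def)
  have A: "ZA (dec_col X k) \<in> Obj SAbZ" for k by simp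
  note T = SAbZ.Ten_Obj[OF A A, of n m]
  note d = Zdiag_Hom[where X = "?S (n + m + 1) _"]
  note t = TenA_Ab_Hom[OF zl(1) zr(1)]
  interpret Ab: category "Ab :: ('u monoid, 'u ab_arr) moncat" by (rule category_Ab)
  have tv: "ap (?t a) (zg (n + m + 1) a x) =
      tens (Zfree (?S n a)) (Zfree (?S m a)) (zg n a (sh (join_inl n m) a x)) (zg m a (sh (join_inr n m) a x))"
    if "x \<in> ?S (n + m + 1) a" for a x
  proof -
    let ?T = "TenA Ab (fa Zfree_fun (ap (fa (dec X) (join_inl n m)) a)) (fa Zfree_fun (ap (fa (dec X) (join_inr n m)) a))"
    have g: "zg (n + m + 1) a x \<in> carrier (Zfree (?S (n + m + 1) a))" using that by simp
    have "ap (?t a) (zg (n + m + 1) a x) = ap ?T (ap (Zdiag (?S (n + m + 1) a)) (zg (n + m + 1) a x))"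
      by (rule Ab_ap_Cmp[OF d(1) t(1) g])
    also have "\<dots> = tens (Zfree (?S n a)) (Zfree (?S m a)) (ap (fa Zfree_fun (ap (fa (dec X) (join_inl n m)) a)) (zg (n + m + 1) a x))
        (ap (fa Zfree_fun (ap (fa (dec X) (join_inr n m)) a)) (zg (n + m + 1) a x))"
      unfolding d(2)[OF that] by (rule t(2)[OF g g])
    finally show ?thesis unfolding zl(2)[OF that] zr(2)[OF that] .
  qed
  show "smul (dec_ten_ob (Zcoalg_ob X)) n m \<in>
      Hom SAbZ (ZA (dec_col X (n + m + 1))) (Ten SAbZ (ZA (dec_col X n)) (ZA (dec_col X m)))"
    unfolding eq
  proof (rule SAbZ_gen_HomI[OF generated_by_ZA A T])
    show "?t a \<in> Hom Ab (lcar (ZA (dec_col X (n + m + 1))) a) (lcar (Ten SAbZ (ZA (dec_col X n)) (ZA (dec_col X m))) a)" for a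
      using Ab.Cmp[OF d(1) t(1)] by simp
  next
    fix \<alpha> g assume \<alpha>: "\<alpha> \<in> Arr Delta" and "g \<in> zg (n + m + 1) (Cod Delta \<alpha>) ` ?S (n + m + 1) (Cod Delta \<alpha>)"
    then obtain x where x: "x \<in> ?S (n + m + 1) (Cod Delta \<alpha>)" "g = zg (n + m + 1) (Cod Delta \<alpha>) x" by blast
    have lx: "sh (join_inl n m) (Cod Delta \<alpha>) x \<in> ?S n (Cod Delta \<alpha>)" and rx: "sh (join_inr n m) (Cod Delta \<alpha>) x \<in> ?S m (Cod Delta \<alpha>)"
      using x by simp_all
    show "ap (?t (Dom Delta \<alpha>)) (ap (fa (fst (ZA (dec_col X (n + m + 1)))) \<alpha>) g) =
        ap (fa (fst (Ten SAbZ (ZA (dec_col X n)) (ZA (dec_col X m)))) \<alpha>) (ap (?t (Cod Delta \<alpha>)) g)"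
      unfolding x(2) ap_fa_ZA[OF dec_col_functor \<alpha> x(1)] tv[OF x(1)] tv[OF sset_act(2)[OF dec_col_functor \<alpha> x(1)]]
      using ap_fa_Ten_SAbZ[OF A A \<alpha>, of "zg n (Cod Delta \<alpha>) (sh (join_inl n m) (Cod Delta \<alpha>) x)" n
          "zg m (Cod Delta \<alpha>) (sh (join_inr n m) (Cod Delta \<alpha>) x)" m] lx rx
        SSet_Hom_sap(2)[OF l \<alpha>] SSet_Hom_sap(2)[OF r \<alpha>] x(1)
      by (simp add: ap_fa_ZA[OF dec_col_functor \<alpha> lx] ap_fa_ZA[OF dec_col_functor \<alpha> rx])
  next
    fix a g assume "g \<in> zg (n + m + 1) a ` ?S (n + m + 1) a"
    then obtain x where x: "x \<in> ?S (n + m + 1) a" "g = zg (n + m + 1) a x" by blast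
    then show "aug (Ten SAbZ (ZA (dec_col X n)) (ZA (dec_col X m))) a (ap (?t a) g) = aug (ZA (dec_col X (n + m + 1))) a g"
      unfolding x(2) tv[OF x(1)] aug_ZA[OF x(1)]
      using aug_Ten[OF A A, of "zg n a (sh (join_inl n m) a x)" n a "zg m a (sh (join_inr n m) a x)" m 1 1]
      by (simp add: aug_ZA)
  qed
  show "x \<in> ?S (n + m + 1) a \<Longrightarrow>
      zap (smul (dec_ten_ob (Zcoalg_ob X)) n m) a (zg (n + m + 1) a x) =
      tens (Zfree (?S n a)) (Zfree (?S m a)) (zg n a (sh (join_inl n m) a x)) (zg m a (sh (join_inr n m) a x))"
    unfolding eq fst_conv snd_conv by (rule tv)
qed

lemma bmul_ten:
  shows "bmul (bob_ten X) n m \<in> Hom SAbZ (ZA (dec_col X (n + m))) (Ten SAbZ (ZA (dec_col X n)) (ZA (dec_col X m)))"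
    and "x \<in> fo (dec_col X (n + m)) a \<Longrightarrow> zap (bmul (bob_ten X) n m) a (zg (n + m) a x) =
      tens (Zfree (fo (dec_col X n) a)) (Zfree (fo (dec_col X m) a)) (zg n a (sh (front n m) a x)) (zg m a (sh (rear n m) a x))"
proof -
  have eq: "bmul (bob_ten X) n m = Cmp SAbZ (smul (dec_ten_ob (Zcoalg_ob X)) n m) (ZA_arr (fa (dec X) (join_collapse n m)))"
    using sfun_ten by (simp add: bob_ten_def rho_ob_def)
  note c = ZA_dec_Hom[OF Delta_arrs(13)[of n m], unfolded Delta_arrs]
  note s = smul_ten[where n = n and m = m]
  show "bmul (bob_ten X) n m \<in> Hom SAbZ (ZA (dec_col X (n + m))) (Ten SAbZ (ZA (dec_col X n)) (ZA (dec_col X m)))"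
    unfolding eq by (rule SAbZ.Cmp[OF c(1) s(1)])
  show "zap (bmul (bob_ten X) n m) a (zg (n + m) a x) =
      tens (Zfree (fo (dec_col X n) a)) (Zfree (fo (dec_col X m) a)) (zg n a (sh (front n m) a x)) (zg m a (sh (rear n m) a x))"
    if x: "x \<in> fo (dec_col X (n + m)) a"
  proof -
    have g: "zg (n + m) a x \<in> carrier (lcar (ZA (dec_col X (n + m))) a)" using x by simp
    have y: "sh (join_collapse n m) a x \<in> fo (dec_col X (n + m + 1)) a" using x by simp
    show ?thesis unfolding eq SAbZ_zap_Cmp[OF c(1) s(1) g] c(2)[OF x] s(2)[OF y] sh_collapse[OF x] by (rule refl)
  qed
qed

lemma bone_ten:
  shows "bone (bob_ten X) \<in> Hom SAbZ (ZA (dec_col X 0)) (One SAbZ)"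
    and "x \<in> fo (dec_col X 0) a \<Longrightarrow> zap (bone (bob_ten X)) a (zg 0 a x) = zz 1"
proof -
  have A: "ZA (dec_col X 0) \<in> Obj SAbZ" by simp
  have eq: "bone (bob_ten X) = (ZA (dec_col X 0), snd (ZA (dec_col X 0)), One SAbZ)"
    by (simp add: bob_ten_def rho_ob_def dec_ten_ob_def Let_def dec_ten_col_eq)
  have 1: "One SAb = simp_one Ab" by (simp add: Simp_simps)
  have "Cmp SAb (snd (One SAbZ)) (snd (ZA (dec_col X 0))) = snd (ZA (dec_col X 0))"
    using SAb.left[OF SAbZ_ObjD(2)[OF A, folded 1]] by (simp add: Over_One_simps(10) aug_one_def)
  then show "bone (bob_ten X) \<in> Hom SAbZ (ZA (dec_col X 0)) (One SAbZ)"
    unfolding eq Over_One_simps(2) using A SAbZ.One_Obj SAbZ_ObjD(2)[OF A]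
    by (auto simp: Over_One_simps(10) aug_one_def 1)
  show "x \<in> fo (dec_col X 0) a \<Longrightarrow> zap (bone (bob_ten X)) a (zg 0 a x) = zz 1"
    unfolding eq by (simp add: aug_ZA)
qed

lemma is_bob_ten: "is_bob SAbZ (bob_ten X)"
  unfolding is_bob_def Let_def fo_bfun_ten
proof (intro conjI allI ballI bmul_ten(1) bone_ten(1))
  show "is_functor (op_cat Delta_act) SAbZ (bfun (bob_ten X))"
  proof (rule is_functor_Delta_act, rule functorI)
    fix f assume "f \<in> Arr (op_cat Delta)"
    then show "fa (bfun (bob_ten X)) f \<in> Hom SAbZ (fo (bfun (bob_ten X)) (Dom (op_cat Delta) f)) (fo (bfun (bob_ten X)) (Cod (op_cat Delta) f))"
      using ZA_dec_Hom(1)[of f] by (simp add: fo_bfun_ten fa_bfun_ten)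
  next
    fix f g assume fg: "f \<in> Arr (op_cat Delta)" "g \<in> Arr (op_cat Delta)" "Dom (op_cat Delta) g = Cod (op_cat Delta) f"
    have "fa (dec X) (Cmp Delta f g) = Cmp SSet (fa (dec X) g) (fa (dec X) f)"
      using functorD(6)[OF dec_functor fg] by simp
    then show "fa (bfun (bob_ten X)) (Cmp (op_cat Delta) g f) = Cmp SAbZ (fa (bfun (bob_ten X)) g) (fa (bfun (bob_ten X)) f)"
      using ZA_arr_Cmp[OF dec_Hom[of f], of "fa (dec X) g"] dec_Hom[of g] fg by (simp add: fa_bfun_ten)
  next
    show "fa (bfun (bob_ten X)) (Idt (op_cat Delta) n) = Idt SAbZ (fo (bfun (bob_ten X)) n)" for n
      using functorD(2)[OF dec_functor, of n] ZA_arr_Idt[OF dec_col_Obj[of n]]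
      by (simp add: fa_bfun_ten fo_bfun_ten dec_def)
  qed (simp add: fo_bfun_ten)
next
  fix \<alpha> \<beta> assume \<alpha>: "\<alpha> \<in> Arr Delta_act" and \<beta>: "\<beta> \<in> Arr Delta_act"
  note J = join_act_arr[OF \<alpha> \<beta>]
  have J': "Dom Delta (join_act \<alpha> \<beta>) = Dom Delta \<alpha> + Dom Delta \<beta>" "Cod Delta (join_act \<alpha> \<beta>) = Cod Delta \<alpha> + Cod Delta \<beta>"
    using J Delta_act_Delta[OF J(1)] \<alpha> \<beta> by (simp_all add: Delta_act_Delta)
  note A = ZA_dec_Hom[OF Delta_act_Delta(1)[OF \<alpha>]] and B = ZA_dec_Hom[OF Delta_act_Delta(1)[OF \<beta>]]
  note C = ZA_dec_Hom[OF Delta_act_Delta(1)[OF J(1)], unfolded J']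
  note AB = SAbZ.TenA_Hom[OF A(1) B(1)]
  note l = bmul_ten[where n = "Dom Delta \<alpha>" and m = "Dom Delta \<beta>"] and r = bmul_ten[where n = "Cod Delta \<alpha>" and m = "Cod Delta \<beta>"]
  show "Cmp SAbZ (bmul (bob_ten X) (Dom Delta_act \<alpha>) (Dom Delta_act \<beta>)) (fa (bfun (bob_ten X)) (join_act \<alpha> \<beta>)) =
      Cmp SAbZ (TenA SAbZ (fa (bfun (bob_ten X)) \<alpha>) (fa (bfun (bob_ten X)) \<beta>))
       (bmul (bob_ten X) (Cod Delta_act \<alpha>) (Cod Delta_act \<beta>))"
    unfolding fa_bfun_ten Delta_act_Delta(2,3)[OF \<alpha>] Delta_act_Delta(2,3)[OF \<beta>]
  proof (rule SAbZ_ZA_eqI[OF SAbZ.Cmp[OF C(1) l(1)] SAbZ.Cmp[OF r(1) AB]])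
    fix a x assume x: "x \<in> fo (dec_col X (Cod Delta \<alpha> + Cod Delta \<beta>)) a"
    have y: "sh (join_act \<alpha> \<beta>) a x \<in> fo (dec_col X (Dom Delta \<alpha> + Dom Delta \<beta>)) a"
      using x J J' by (intro sh_closed) (auto simp: Delta_act_Delta)
    have f: "sh (front (Cod Delta \<alpha>) (Cod Delta \<beta>)) a x \<in> fo (dec_col X (Cod Delta \<alpha>)) a"
      and b: "sh (rear (Cod Delta \<alpha>) (Cod Delta \<beta>)) a x \<in> fo (dec_col X (Cod Delta \<beta>)) a" using x by simp_all
    show "zap (Cmp SAbZ (bmul (bob_ten X) (Dom Delta \<alpha>) (Dom Delta \<beta>)) (ZA_arr (fa (dec X) (join_act \<alpha> \<beta>)))) a
        (zg (Cod Delta \<alpha> + Cod Delta \<beta>) a x) =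
      zap (Cmp SAbZ (TenA SAbZ (ZA_arr (fa (dec X) \<alpha>)) (ZA_arr (fa (dec X) \<beta>)))
        (bmul (bob_ten X) (Cod Delta \<alpha>) (Cod Delta \<beta>))) a (zg (Cod Delta \<alpha> + Cod Delta \<beta>) a x)"
      using x SAbZ_zap_TenA[OF A(1) B(1), of "zg (Cod Delta \<alpha>) a (sh (front (Cod Delta \<alpha>) (Cod Delta \<beta>)) a x)" a
          "zg (Cod Delta \<beta>) a (sh (rear (Cod Delta \<alpha>) (Cod Delta \<beta>)) a x)"] f b
      by (simp add: SAbZ_zap_Cmp[OF C(1) l(1)] SAbZ_zap_Cmp[OF r(1) AB] C(2) l(2)[OF y] r(2) A(2) B(2) sh_join_act[OF \<alpha> \<beta>])
  qed
next
  fix n m k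
  have Z: "ZA (dec_col X i) \<in> Obj SAbZ" for i by simp
  note I = SAbZ.Idt[OF Z]
  note nm = bmul_ten[where n = n and m = m] and nmk = bmul_ten[where n = "n + m" and m = k]
    and mk = bmul_ten[where n = m and m = k] and n_mk = bmul_ten[where n = n and m = "m + k"]
  note as = SAbZ.Assoc_Hom[OF Z Z Z, of n m k]
  note nmI = SAbZ.TenA_Hom[OF nm(1) I[of k]] and Imk = SAbZ.TenA_Hom[OF I[of n] mk(1)]
  note L = SAbZ.Cmp[OF SAbZ.Cmp[OF nmk(1) nmI] as]
  note R = SAbZ.Cmp[OF n_mk(1) Imk]
  let ?Z = "\<lambda>n a. Zfree (fo (dec_col X n) a)"
  show "Cmp SAbZ (Assoc SAbZ (ZA (dec_col X n)) (ZA (dec_col X m)) (ZA (dec_col X k)))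
           (Cmp SAbZ (TenA SAbZ (bmul (bob_ten X) n m) (Idt SAbZ (ZA (dec_col X k)))) (bmul (bob_ten X) (n + m) k)) =
         Cmp SAbZ (TenA SAbZ (Idt SAbZ (ZA (dec_col X n))) (bmul (bob_ten X) m k)) (bmul (bob_ten X) n (m + k))"
    (is "?L = ?R")
  proof (rule SAbZ_ZA_eqI[OF L R[folded add.assoc]])
    fix a x assume x: "x \<in> fo (dec_col X (n + m + k)) a"
    then have x': "x \<in> fo (dec_col X (n + (m + k))) a" by (simp add: add.assoc)
    let ?f = "sh (front (n + m) k) a x" and ?b = "sh (rear (n + m) k) a x"
    let ?f' = "sh (front n (m + k)) a x" and ?b' = "sh (rear n (m + k)) a x"
    have cl: "?f \<in> fo (dec_col X (n + m)) a" "?b \<in> fo (dec_col X k) a" "?f' \<in> fo (dec_col X n) a" "?b' \<in> fo (dec_col X (m + k)) a"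
      using x x' by simp_all
    then have cl': "sh (front n m) a ?f \<in> fo (dec_col X n) a" "sh (rear n m) a ?f \<in> fo (dec_col X m) a" by simp_all
    have g: "zg (n + m + k) a x \<in> carrier (?Z (n + m + k) a)" "zg (n + m) a ?f \<in> carrier (?Z (n + m) a)"
      "zg k a ?b \<in> carrier (?Z k a)" "zg n a ?f' \<in> carrier (?Z n a)" "zg (m + k) a ?b' \<in> carrier (?Z (m + k) a)"
      "zg n a (sh (front n m) a ?f) \<in> carrier (?Z n a)" "zg m a (sh (rear n m) a ?f) \<in> carrier (?Z m a)"
      using x cl cl' by simp_all
    have "zap ?L a (zg (n + m + k) a x) = tens (?Z n a) (tensor (?Z m a) (?Z k a)) (zg n a (sh (front n m) a ?f))
        (tens (?Z m a) (?Z k a) (zg m a (sh (rear n m) a ?f)) (zg k a ?b))"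
      using g SAbZ_zap_TenA[OF nm(1) I[of k], of "zg (n + m) a ?f" a "zg k a ?b"]
        SAbZ_zap_canonical(1)[OF Z Z Z, of _ n a _ m _ k] SAbZ_zap_canonical(4)[OF Z Z Z, of _ k]
      by (simp add: SAbZ_zap_Cmp[OF SAbZ.Cmp[OF nmk(1) nmI] as] SAbZ_zap_Cmp[OF nmk(1) nmI] nmk(2)[OF x] nm(2)[OF cl(1)])
    also have "\<dots> = zap ?R a (zg (n + (m + k)) a x)"
      using g SAbZ_zap_TenA[OF I[of n] mk(1), of "zg n a ?f'" a "zg (m + k) a ?b'"]
        SAbZ_zap_canonical(4)[OF Z Z Z, of _ n] unfolding sh_coassoc[OF x]
      by (simp add: SAbZ_zap_Cmp[OF n_mk(1) Imk] n_mk(2)[OF x'] mk(2)[OF cl(4)] add.assoc)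
    finally show "zap ?L a (zg (n + m + k) a x) = zap ?R a (zg (n + m + k) a x)" by (simp add: add.assoc)
  qed
next
  fix n
  have Z: "ZA (dec_col X i) \<in> Obj SAbZ" for i by simp
  note I = SAbZ.Idt[OF Z[of n]] and b = bmul_ten[where n = 0 and m = n, simplified] and b' = bmul_ten[where n = n and m = 0, simplified]
  note e = bone_ten
  note T = SAbZ.TenA_Hom[OF e(1) I] and T' = SAbZ.TenA_Hom[OF I e(1)]
  note l = SAbZ.Lun_Hom[OF Z[of n]] and r = SAbZ.Run_Hom[OF Z[of n]]
  note can = SAbZ_zap_canonical[OF Z[of n] Z[of n] Z[of n], unfolded lcar_ZA]
  have pow: "zg n a x [^]\<^bsub>Zfree (fo (dec_col X n) a)\<^esub> (1::int) = zg n a x" if "x \<in> fo (dec_col X n) a" for a x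
  proof -
    interpret comm_group "Zfree (fo (dec_col X n) a)" by (rule trans_free)
    show ?thesis using that by simp
  qed
  show "Cmp SAbZ (Lun SAbZ (ZA (dec_col X n))) (Cmp SAbZ (TenA SAbZ (bone (bob_ten X)) (Idt SAbZ (ZA (dec_col X n)))) (bmul (bob_ten X) 0 n)) =
      Idt SAbZ (ZA (dec_col X n))"
  proof (rule SAbZ_ZA_eqI[OF SAbZ.Cmp[OF SAbZ.Cmp[OF b(1) T] l] I])
    fix a x assume x: "x \<in> fo (dec_col X n) a"
    have "sh (front 0 n) a x \<in> fo (dec_col X 0) a" using x by simp
    then show "zap (Cmp SAbZ (Lun SAbZ (ZA (dec_col X n))) (Cmp SAbZ (TenA SAbZ (bone (bob_ten X)) (Idt SAbZ (ZA (dec_col X n)))) (bmul (bob_ten X) 0 n))) a (zg n a x) =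
      zap (Idt SAbZ (ZA (dec_col X n))) a (zg n a x)"
      using x SAbZ_zap_TenA[OF e(1) I, of "zg 0 a (sh (front 0 n) a x)" a "zg n a x"]
      by (simp add: SAbZ_zap_Cmp[OF SAbZ.Cmp[OF b(1) T] l] SAbZ_zap_Cmp[OF b(1) T] b(2) e(2) can(2,4) front_rear_simps pow)
  qed
  show "Cmp SAbZ (Run SAbZ (ZA (dec_col X n))) (Cmp SAbZ (TenA SAbZ (Idt SAbZ (ZA (dec_col X n))) (bone (bob_ten X))) (bmul (bob_ten X) n 0)) =
      Idt SAbZ (ZA (dec_col X n))"
  proof (rule SAbZ_ZA_eqI[OF SAbZ.Cmp[OF SAbZ.Cmp[OF b'(1) T'] r] I])
    fix a x assume x: "x \<in> fo (dec_col X n) a"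
    have "sh (rear n 0) a x \<in> fo (dec_col X 0) a" using x by simp
    then show "zap (Cmp SAbZ (Run SAbZ (ZA (dec_col X n))) (Cmp SAbZ (TenA SAbZ (Idt SAbZ (ZA (dec_col X n))) (bone (bob_ten X))) (bmul (bob_ten X) n 0))) a (zg n a x) =
      zap (Idt SAbZ (ZA (dec_col X n))) a (zg n a x)"
      using x SAbZ_zap_TenA[OF I e(1), of "zg n a x" a "zg 0 a (sh (rear n 0) a x)"]
      by (simp add: SAbZ_zap_Cmp[OF SAbZ.Cmp[OF b'(1) T'] r] SAbZ_zap_Cmp[OF b'(1) T'] b'(2) e(2) can(3,4) front_rear_simps pow)
  qed
qed

end

definition decm :: "'u sset_arr \<Rightarrow> nat \<Rightarrow> 'u sset_arr" where
  "decm = (\<lambda>(X, t, Y) b. (dec_col X b, \<lambda>a. t (a + b + 1), dec_col Y b))"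

lemma decm_Hom:
  assumes F: "F \<in> Hom SSet X (Y :: 'u sset)"
  shows "decm F b \<in> Hom SSet (dec_col X b) (dec_col Y b)"
    and "\<beta> \<in> Arr Delta \<Longrightarrow> x \<in> fo (dec_col X (Cod Delta \<beta>)) a \<Longrightarrow>
      sap (decm F (Dom Delta \<beta>)) a (sh X \<beta> a x) = sh Y \<beta> a (sap (decm F (Cod Delta \<beta>)) a x)"
proof -
  note F' = Simp_HomD[OF F]
  have eq: "decm F b = (dec_col X b, \<lambda>a. ap F (a + b + 1), dec_col Y b)" for b
    by (subst F'(1)) (simp add: decm_def)
  show "decm F b \<in> Hom SSet (dec_col X b) (dec_col Y b)"
    unfolding eq
  proof (rule SSet_HomI)
    show "is_functor (op_cat Delta) Sets (dec_col X b)" "is_functor (op_cat Delta) Sets (dec_col Y b)"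
      using F'(2,3) by (simp_all add: is_functor_dec_col)
    show "ap F (a + b + 1) \<in> Hom Sets (fo (dec_col X b) a) (fo (dec_col Y b) a)" for a
      using F'(5)[of "a + b + 1"] by (simp add: dec_col_def)
    fix \<alpha> x assume "\<alpha> \<in> Arr Delta" "x \<in> fo (dec_col X b) (Cod Delta \<alpha>)"
    then show "ap (ap F (Dom Delta \<alpha> + b + 1)) (ap (fa (dec_col X b) \<alpha>) x) =
        ap (fa (dec_col Y b) \<alpha>) (ap (ap F (Cod Delta \<alpha> + b + 1)) x)"
      using SSet_Hom_sap(2)[OF F, of "join \<alpha> (Idt Delta b)" x] by (simp add: dec_col_def)
  qed
  show "\<beta> \<in> Arr Delta \<Longrightarrow> x \<in> fo (dec_col X (Cod Delta \<beta>)) a \<Longrightarrow>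
      sap (decm F (Dom Delta \<beta>)) a (sh X \<beta> a x) = sh Y \<beta> a (sap (decm F (Cod Delta \<beta>)) a x)"
    unfolding eq using SSet_Hom_sap(2)[OF F, of "join (Idt Delta a) \<beta>" x] by (simp add: dec_def dec_col_def)
qed

lemma decm_closed:
  assumes "F \<in> Hom SSet X (Y :: 'u sset)" "x \<in> fo (dec_col X n) a"
  shows "sap (decm F n) a x \<in> fo (dec_col Y n) a"
  using SSet_Hom_sap(1)[OF decm_Hom(1)[OF assms(1)] assms(2)] .

lemma decm_Cmp:
  assumes F: "F \<in> Hom SSet X (Y :: 'u sset)" and G: "G \<in> Hom SSet Y Z"
  shows "decm (Cmp SSet G F) b = Cmp SSet (decm G b) (decm F b)"
proof -
  obtain t s where "F = (X, t, Y)" "G = (Y, s, Z)" using Simp_HomD(1)[OF F] Simp_HomD(1)[OF G] by blast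
  then show ?thesis by (simp add: decm_def Simp_simps)
qed

lemma decm_Idt: "decm (Idt SSet X) b = Idt SSet (dec_col X b)"
  by (simp add: decm_def Simp_simps dec_col_def)

lemma decm_natural:
  assumes F: "F \<in> Hom SSet X (Y :: 'u sset)" and \<beta>: "\<beta> \<in> Arr Delta"
  shows "Cmp SSet (decm F (Dom Delta \<beta>)) (fa (dec X) \<beta>) = Cmp SSet (fa (dec Y) \<beta>) (decm F (Cod Delta \<beta>))"
proof -
  note X = Simp_HomD(2)[OF F] and Y = Simp_HomD(3)[OF F]
  note d = dec_Hom[OF X \<beta>] and d' = dec_Hom[OF Y \<beta>] and f = decm_Hom(1)[OF F]
  show ?thesis
    by (rule SSet_Hom_eqI[OF SSet.Cmp[OF d f] SSet.Cmp[OF f d']])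
      (simp add: SSet_sap_Cmp[OF d f] SSet_sap_Cmp[OF f d'] decm_Hom(2)[OF F \<beta>])
qed

lemma decm_bob_set:
  assumes F: "F \<in> Hom SSet X (Y :: 'u sset)"
  shows "(bob_set X, decm F, bob_set Y) \<in> Hom (Bcat SSet) (bob_set X) (bob_set Y)"
proof -
  note X = Simp_HomD(2)[OF F] and Y = Simp_HomD(3)[OF F]
  note f = decm_Hom(1)[OF F]
  have "nat_trans (op_cat Delta) SSet (dec X) (dec Y) (decm F)"
    using f decm_natural[OF F] by (simp add: nat_trans_def dec_def)
  moreover have "Cmp SSet (bmul (bob_set Y) n m) (decm F (n + m)) =
      Cmp SSet (TenA SSet (decm F n) (decm F m)) (bmul (bob_set X) n m)" for n m
  proof -
    note b = bmul_set[OF X, where n = n and m = m] and b' = bmul_set[OF Y, where n = n and m = m]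
    note ff = SSet.TenA_Hom[OF f[of n] f[of m]]
    show ?thesis
      by (rule SSet_Hom_eqI[OF SSet.Cmp[OF f b'(1)] SSet.Cmp[OF b(1) ff]])
        (use X Y decm_Hom(2)[OF F Delta_arrs(1), of _ n m] decm_Hom(2)[OF F Delta_arrs(4), of _ n m]
         in \<open>simp add: SSet_sap_Cmp[OF f b'(1)] SSet_sap_Cmp[OF b(1) ff] b(2) b'(2) decm_closed[OF F]
          SSet_sap_TenA[OF f f]\<close>)
  qed
  moreover have "Cmp SSet (bone (bob_set Y)) (decm F 0) = bone (bob_set X)"
    by (rule SSet_Hom_eqI[OF SSet.Cmp[OF f bone_set(1)[OF Y]] bone_set(1)[OF X]])
      (simp add: SSet_sap_Cmp[OF f bone_set(1)[OF Y]] bone_set(2)[OF X] bone_set(2)[OF Y] decm_closed[OF F])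
  ultimately show ?thesis
    using is_bob_set[OF X] is_bob_set[OF Y] by (simp add: Bcat_def bfun_set[OF X] bfun_set[OF Y] nat_trans_Delta_act)
qed

lemma decm_bob_ten:
  assumes F: "F \<in> Hom SSet X (Y :: 'u sset)"
  shows "(bob_ten X, \<lambda>b. ZA_arr (decm F b), bob_ten Y) \<in> Hom (Bcat SAbZ) (bob_ten X) (bob_ten Y)"
proof -
  note X = Simp_HomD(2)[OF F] and Y = Simp_HomD(3)[OF F]
  note f = decm_Hom(1)[OF F] and z = ZA_arr_Hom[OF decm_Hom(1)[OF F]]
  have "nat_trans (op_cat Delta_act) SAbZ (bfun (bob_ten X)) (bfun (bob_ten Y)) (\<lambda>b. ZA_arr (decm F b))"
    unfolding nat_trans_def
  proof (intro conjI ballI)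
    show "ZA_arr (decm F n) \<in> Hom SAbZ (fo (bfun (bob_ten X)) n) (fo (bfun (bob_ten Y)) n)" for n
      using z(1)[of n] by (simp add: fo_bfun_ten[OF X] fo_bfun_ten[OF Y])
    fix \<alpha> assume "\<alpha> \<in> Arr (op_cat Delta_act)"
    then have \<alpha>: "\<alpha> \<in> Arr Delta_act" by simp
    note \<alpha>' = Delta_act_Delta[OF \<alpha>]
    show "Cmp SAbZ (ZA_arr (decm F (Cod (op_cat Delta_act) \<alpha>))) (fa (bfun (bob_ten X)) \<alpha>) =
        Cmp SAbZ (fa (bfun (bob_ten Y)) \<alpha>) (ZA_arr (decm F (Dom (op_cat Delta_act) \<alpha>)))"
      using ZA_arr_Cmp[OF dec_Hom[OF X \<alpha>'(1)] f] ZA_arr_Cmp[OF f dec_Hom[OF Y \<alpha>'(1)]] decm_natural[OF F \<alpha>'(1)] \<alpha>'(2,3)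
      by (simp add: fa_bfun_ten[OF X] fa_bfun_ten[OF Y])
  qed
  moreover have "Cmp SAbZ (bmul (bob_ten Y) n m) (ZA_arr (decm F (n + m))) =
      Cmp SAbZ (TenA SAbZ (ZA_arr (decm F n)) (ZA_arr (decm F m))) (bmul (bob_ten X) n m)" for n m
  proof -
    note b = bmul_ten[OF X, where n = n and m = m] and b' = bmul_ten[OF Y, where n = n and m = m]
    note ff = SAbZ.TenA_Hom[OF z(1)[of n] z(1)[of m]]
    show ?thesis
    proof (rule SAbZ_ZA_eqI[OF SAbZ.Cmp[OF z(1) b'(1)] SAbZ.Cmp[OF b(1) ff]])
      fix a x assume x: "x \<in> fo (dec_col X (n + m)) a"
      have fr: "sh X (front n m) a x \<in> fo (dec_col X n) a" "sh X (rear n m) a x \<in> fo (dec_col X m) a"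
        using x X by simp_all
      show "zap (Cmp SAbZ (bmul (bob_ten Y) n m) (ZA_arr (decm F (n + m)))) a (zg X (n + m) a x) =
        zap (Cmp SAbZ (TenA SAbZ (ZA_arr (decm F n)) (ZA_arr (decm F m))) (bmul (bob_ten X) n m)) a (zg X (n + m) a x)"
        using x fr decm_Hom(2)[OF F Delta_arrs(1)[of n m], of x a] decm_Hom(2)[OF F Delta_arrs(4)[of n m], of x a]
          SAbZ_zap_TenA[OF z(1)[of n] z(1)[of m], of "zg X n a (sh X (front n m) a x)" a "zg X m a (sh X (rear n m) a x)"]
        by (simp add: SAbZ_zap_Cmp[OF z(1) b'(1)] SAbZ_zap_Cmp[OF b(1) ff] b(2) b'(2) decm_closed[OF F] z(2))
    qed
  qed
  moreover have "Cmp SAbZ (bone (bob_ten Y)) (ZA_arr (decm F 0)) = bone (bob_ten X)"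
    by (rule SAbZ_ZA_eqI[OF SAbZ.Cmp[OF z(1) bone_ten(1)[OF Y]] bone_ten(1)[OF X]])
      (simp add: SAbZ_zap_Cmp[OF z(1) bone_ten(1)[OF Y]] z(2) bone_ten(2)[OF X] bone_ten(2)[OF Y] decm_closed[OF F])
  ultimately show ?thesis
    using is_bob_ten[OF X] is_bob_ten[OF Y] by (simp add: Bcat_def)
qed

lemma fo_rho_dec:
  "fo (rho SSet \<circ>\<^sub>F dec_set) X = bob_set X" "fo (rho SAbZ \<circ>\<^sub>F dec_ten \<circ>\<^sub>F Zcoalg) X = bob_ten X"
  by (simp_all add: rho_def dec_set_def bob_set_def dec_ten_def Zcoalg_def bob_ten_def)

lemma fa_rho_dec:
  assumes F: "F \<in> Hom SSet X (Y :: 'u sset)"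
  shows "fa (rho SSet \<circ>\<^sub>F dec_set) F = (bob_set X, decm F, bob_set Y)"
    "fa (rho SAbZ \<circ>\<^sub>F dec_ten \<circ>\<^sub>F Zcoalg) F = (bob_ten X, \<lambda>b. ZA_arr (decm F b), bob_ten Y)"
proof -
  note X = Simp_HomD(2)[OF F] and Y = Simp_HomD(3)[OF F]
  obtain t where t: "F = (X, t, Y)" using Simp_HomD(1)[OF F] by blast
  show "fa (rho SSet \<circ>\<^sub>F dec_set) F = (bob_set X, decm F, bob_set Y)"
    by (simp add: t rho_def dec_set_def bob_set_def decm_def fun_eq_iff)
  have "ccar (Zcoalg_ob X) = Zs X" for X :: "'u sset" by (simp add: Zcoalg_ob_def)
  then show "fa (rho SAbZ \<circ>\<^sub>F dec_ten \<circ>\<^sub>F Zcoalg) F = (bob_ten X, \<lambda>b. ZA_arr (decm F b), bob_ten Y)"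
    by (simp add: t rho_def dec_ten_def Zcoalg_def bob_ten_def decm_def fun_eq_iff Simp_simps dec_ten_col_eq[OF X]
        dec_ten_col_eq[OF Y] ZA_arr_def)
      (simp add: dec_ten_col_eq[OF X] dec_ten_col_eq[OF Y] simp_map_def fcomp_def dec_col_def)
qed

lemma functor_bob_set: "is_functor SSet (Bcat SSet) (rho SSet \<circ>\<^sub>F dec_set :: ('u sset, 'u sset_arr, _, _) fctr)"
proof (rule functorI)
  fix X :: "'u sset" assume X': "X \<in> Obj SSet"
  then have X: "is_functor (op_cat Delta) Sets X" by (simp add: Simp_simps)
  show "fo (rho SSet \<circ>\<^sub>F dec_set) X \<in> Obj (Bcat SSet)"
    unfolding fo_rho_dec using is_bob_set[OF X] by (simp add: Bcat_def)
  show "fa (rho SSet \<circ>\<^sub>F dec_set) (Idt SSet X) = Idt (Bcat SSet) (fo (rho SSet \<circ>\<^sub>F dec_set) X)"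
    unfolding fo_rho_dec fa_rho_dec[OF SSet.Idt[OF X']]
    by (simp add: Bcat_def fo_bfun_set[OF X] decm_Idt fun_eq_iff)
next
  fix F :: "'u sset_arr" assume "F \<in> Arr SSet"
  from Arr_Hom[OF this] show "fa (rho SSet \<circ>\<^sub>F dec_set) F \<in> Hom (Bcat SSet)
      (fo (rho SSet \<circ>\<^sub>F dec_set) (Dom SSet F)) (fo (rho SSet \<circ>\<^sub>F dec_set) (Cod SSet F))"
    unfolding fo_rho_dec by (subst fa_rho_dec) (auto intro: decm_bob_set)
next
  fix F G :: "'u sset_arr" assume FG: "F \<in> Arr SSet" "G \<in> Arr SSet" "Dom SSet G = Cod SSet F"
  have F: "F \<in> Hom SSet (Dom SSet F) (Cod SSet F)" and G: "G \<in> Hom SSet (Cod SSet F) (Cod SSet G)"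
    using FG Arr_Hom[of F SSet] Arr_Hom[of G SSet] by auto
  show "fa (rho SSet \<circ>\<^sub>F dec_set) (Cmp SSet G F) =
      Cmp (Bcat SSet) (fa (rho SSet \<circ>\<^sub>F dec_set) G) (fa (rho SSet \<circ>\<^sub>F dec_set) F)"
    unfolding fa_rho_dec[OF F] fa_rho_dec[OF G] fa_rho_dec[OF SSet.Cmp[OF F G]]
    by (simp add: Bcat_def fun_eq_iff decm_Cmp[OF F G])
qed

lemma functor_bob_ten:
  "is_functor SSet (Bcat SAbZ) (rho SAbZ \<circ>\<^sub>F dec_ten \<circ>\<^sub>F Zcoalg :: ('u sset, 'u sset_arr, _, _) fctr)"
proof (rule functorI)
  fix X :: "'u sset" assume X': "X \<in> Obj SSet"
  then have X: "is_functor (op_cat Delta) Sets X" by (simp add: Simp_simps)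
  show "fo (rho SAbZ \<circ>\<^sub>F dec_ten \<circ>\<^sub>F Zcoalg) X \<in> Obj (Bcat SAbZ)"
    unfolding fo_rho_dec using is_bob_ten[OF X] by (simp add: Bcat_def)
  show "fa (rho SAbZ \<circ>\<^sub>F dec_ten \<circ>\<^sub>F Zcoalg) (Idt SSet X) = Idt (Bcat SAbZ) (fo (rho SAbZ \<circ>\<^sub>F dec_ten \<circ>\<^sub>F Zcoalg) X)"
    unfolding fo_rho_dec fa_rho_dec[OF SSet.Idt[OF X']]
    by (simp add: Bcat_def fo_bfun_ten[OF X] decm_Idt fun_eq_iff ZA_arr_Idt dec_col_Obj[OF X])
next
  fix F :: "'u sset_arr" assume "F \<in> Arr SSet"
  from Arr_Hom[OF this] show "fa (rho SAbZ \<circ>\<^sub>F dec_ten \<circ>\<^sub>F Zcoalg) F \<in> Hom (Bcat SAbZ)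
      (fo (rho SAbZ \<circ>\<^sub>F dec_ten \<circ>\<^sub>F Zcoalg) (Dom SSet F)) (fo (rho SAbZ \<circ>\<^sub>F dec_ten \<circ>\<^sub>F Zcoalg) (Cod SSet F))"
    unfolding fo_rho_dec by (subst fa_rho_dec) (auto intro: decm_bob_ten)
next
  fix F G :: "'u sset_arr" assume FG: "F \<in> Arr SSet" "G \<in> Arr SSet" "Dom SSet G = Cod SSet F"
  have F: "F \<in> Hom SSet (Dom SSet F) (Cod SSet F)" and G: "G \<in> Hom SSet (Cod SSet F) (Cod SSet G)"
    using FG Arr_Hom[of F SSet] Arr_Hom[of G SSet] by auto
  show "fa (rho SAbZ \<circ>\<^sub>F dec_ten \<circ>\<^sub>F Zcoalg) (Cmp SSet G F) =
      Cmp (Bcat SAbZ) (fa (rho SAbZ \<circ>\<^sub>F dec_ten \<circ>\<^sub>F Zcoalg) G) (fa (rho SAbZ \<circ>\<^sub>F dec_ten \<circ>\<^sub>F Zcoalg) F)"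
    unfolding fa_rho_dec[OF F] fa_rho_dec[OF G] fa_rho_dec[OF SSet.Cmp[OF F G]]
    by (simp add: Bcat_def fun_eq_iff decm_Cmp[OF F G] ZA_arr_Cmp[OF decm_Hom(1)[OF F] decm_Hom(1)[OF G]])
qed

section \<open>The right adjoint of the monoid ring functor\<close>

definition Uc :: "'u asab \<Rightarrow> nat \<Rightarrow> 'u set" where
  "Uc A a = {x \<in> carrier (lcar A a). aug A a x = zz 1}"

definition U_ob :: "'u asab \<Rightarrow> 'u sset" where
  "U_ob A = \<lparr>fo = Uc A, fa = (\<lambda>\<alpha>. (Uc A (Cod Delta \<alpha>), restrict (ap (fa (fst A) \<alpha>)) (Uc A (Cod Delta \<alpha>)), Uc A (Dom Delta \<alpha>)))\<rparr>"

definition U_arr :: "'u asab_arr \<Rightarrow> 'u sset_arr" where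
  "U_arr = (\<lambda>(A, F, B). (U_ob A, \<lambda>a. (Uc A a, restrict (ap (ap F a)) (Uc A a), Uc B a), U_ob B))"

definition adj :: "'u sset \<Rightarrow> 'u asab \<Rightarrow> 'u asab_arr \<Rightarrow> 'u sset_arr" where
  "adj Y A F = (Y, \<lambda>a. (fo Y a, \<lambda>y\<in>fo Y a. zap F a (zgen (fo Y a) y), Uc A a), U_ob A)"

lemma fo_U_ob [simp]: "fo (U_ob A) a = Uc A a"
  by (simp add: U_ob_def)

lemma ap_fa_U_ob [simp]: "x \<in> Uc A (Cod Delta \<alpha>) \<Longrightarrow> ap (fa (U_ob A) \<alpha>) x = ap (fa (fst A) \<alpha>) x"
  by (simp add: U_ob_def)

lemma Uc_carrier: "x \<in> Uc A a \<Longrightarrow> x \<in> carrier (lcar A a)"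
  by (simp add: Uc_def)

lemma is_functor_U_ob:
  assumes A: "A \<in> Obj SAbZ"
  shows "is_functor (op_cat Delta) Sets (U_ob A)"
proof -
  note FA = SAbZ_ObjD(1)[OF A]
  have cl: "ap (fa (fst A) \<alpha>) x \<in> Uc A (Dom Delta \<alpha>)" if "\<alpha> \<in> Arr Delta" "x \<in> Uc A (Cod Delta \<alpha>)" for \<alpha> x
    using that sab_act(3)[OF FA] SAbZ_ObjD(6)[OF A] by (simp add: Uc_def)
  show ?thesis
  proof (rule functorI)
    fix \<alpha> assume "\<alpha> \<in> Arr (op_cat Delta)"
    then show "fa (U_ob A) \<alpha> \<in> Hom Sets (fo (U_ob A) (Dom (op_cat Delta) \<alpha>)) (fo (U_ob A) (Cod (op_cat Delta) \<alpha>))"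
      using cl by (simp add: U_ob_def Sets_simps)
  next
    fix n
    have "ap (fa (fst A) (Idt Delta n)) x = x" if "x \<in> Uc A n" for x
      using functorD(2)[OF FA, of n] that by (simp add: Ab_simps Uc_def)
    then show "fa (U_ob A) (Idt (op_cat Delta) n) = Idt Sets (fo (U_ob A) n)"
      by (simp add: U_ob_def Sets_simps cong: restrict_cong)
  next
    fix \<alpha> \<beta> assume *: "\<alpha> \<in> Arr (op_cat Delta)" "\<beta> \<in> Arr (op_cat Delta)" "Dom (op_cat Delta) \<beta> = Cod (op_cat Delta) \<alpha>"
    have "ap (fa (fst A) (Cmp Delta \<alpha> \<beta>)) x = ap (fa (fst A) \<beta>) (ap (fa (fst A) \<alpha>) x)" if "x \<in> Uc A (Cod Delta \<alpha>)" for x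
      using functorD(6)[OF FA *] Ab_ap_Cmp[OF sab_act(2)[OF FA, of \<alpha>], of "fa (fst A) \<beta>" _ x]
        sab_act(2)[OF FA, of \<beta>] * Uc_carrier[OF that] by simp
    then show "fa (U_ob A) (Cmp (op_cat Delta) \<beta> \<alpha>) = Cmp Sets (fa (U_ob A) \<beta>) (fa (U_ob A) \<alpha>)"
      using * cl[of \<alpha>] by (auto simp: U_ob_def Sets_simps compose_def intro!: restrict_ext)
  qed (simp add: Sets_simps)
qed

lemma U_arr_Hom:
  assumes F: "F \<in> Hom SAbZ A B"
  shows "U_arr F \<in> Hom SSet (U_ob A) (U_ob B)" "x \<in> Uc A a \<Longrightarrow> sap (U_arr F) a x = zap F a x"
    "x \<in> Uc A a \<Longrightarrow> zap F a x \<in> Uc B a"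
proof -
  note F' = Over_One_HomD[OF F]
  have eq: "U_arr F = (U_ob A, \<lambda>a. (Uc A a, restrict (zap F a) (Uc A a), Uc B a), U_ob B)"
    by (subst F'(1)) (simp add: U_arr_def)
  show cl: "x \<in> Uc A a \<Longrightarrow> zap F a x \<in> Uc B a" for x a
    using SAbZ_Hom_zap(2,4)[OF F] by (simp add: Uc_def)
  show "U_arr F \<in> Hom SSet (U_ob A) (U_ob B)"
    unfolding eq
  proof (rule SSet_HomI[OF is_functor_U_ob[OF F'(4)] is_functor_U_ob[OF F'(5)]])
    show "(Uc A a, restrict (zap F a) (Uc A a), Uc B a) \<in> Hom Sets (fo (U_ob A) a) (fo (U_ob B) a)" for a
      using cl by (simp add: Sets_simps)
    fix \<alpha> x assume "\<alpha> \<in> Arr Delta" "x \<in> fo (U_ob A) (Cod Delta \<alpha>)"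
    then show "ap (Uc A (Dom Delta \<alpha>), restrict (zap F (Dom Delta \<alpha>)) (Uc A (Dom Delta \<alpha>)), Uc B (Dom Delta \<alpha>))
         (ap (fa (U_ob A) \<alpha>) x) =
        ap (fa (U_ob B) \<alpha>) (ap (Uc A (Cod Delta \<alpha>), restrict (zap F (Cod Delta \<alpha>)) (Uc A (Cod Delta \<alpha>)), Uc B (Cod Delta \<alpha>)) x)"
      using sset_act(2)[OF is_functor_U_ob[OF F'(4)], of \<alpha> x] SAbZ_Hom_zap(3)[OF F] cl by (simp add: Uc_carrier)
  qed
  show "x \<in> Uc A a \<Longrightarrow> sap (U_arr F) a x = zap F a x"
    unfolding eq by simp
qed

lemma adj_Hom:
  assumes Y: "is_functor (op_cat Delta) Sets Y" and F: "F \<in> Hom SAbZ (ZA Y) A"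
  shows "adj Y A F \<in> Hom SSet Y (U_ob A)"
    and "y \<in> fo Y a \<Longrightarrow> sap (adj Y A F) a y = zap F a (zgen (fo Y a) y)"
    and "y \<in> fo Y a \<Longrightarrow> zap F a (zgen (fo Y a) y) \<in> Uc A a"
proof -
  note F' = Over_One_HomD[OF F]
  show cl: "y \<in> fo Y a \<Longrightarrow> zap F a (zgen (fo Y a) y) \<in> Uc A a" for y a
    using SAbZ_Hom_zap(2,4)[OF F] by (simp add: Uc_def aug_ZA)
  show "adj Y A F \<in> Hom SSet Y (U_ob A)"
    unfolding adj_def
  proof (rule SSet_HomI[OF Y is_functor_U_ob[OF F'(5)]])
    show "(fo Y a, \<lambda>y\<in>fo Y a. zap F a (zgen (fo Y a) y), Uc A a) \<in> Hom Sets (fo Y a) (fo (U_ob A) a)" for a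
      using cl by (simp add: Sets_simps)
    fix \<alpha> y assume \<alpha>: "\<alpha> \<in> Arr Delta" and y: "y \<in> fo Y (Cod Delta \<alpha>)"
    show "ap (fo Y (Dom Delta \<alpha>), \<lambda>y\<in>fo Y (Dom Delta \<alpha>). zap F (Dom Delta \<alpha>) (zgen (fo Y (Dom Delta \<alpha>)) y), Uc A (Dom Delta \<alpha>))
         (ap (fa Y \<alpha>) y) =
        ap (fa (U_ob A) \<alpha>) (ap (fo Y (Cod Delta \<alpha>), \<lambda>y\<in>fo Y (Cod Delta \<alpha>). zap F (Cod Delta \<alpha>) (zgen (fo Y (Cod Delta \<alpha>)) y),
          Uc A (Cod Delta \<alpha>)) y)"
      using SAbZ_Hom_zap(3)[OF F \<alpha>, of "zgen (fo Y (Cod Delta \<alpha>)) y"] sset_act(2)[OF Y \<alpha> y] y cl[OF y]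
      by (simp add: ap_fa_ZA[OF Y \<alpha> y])
  qed
  show "y \<in> fo Y a \<Longrightarrow> sap (adj Y A F) a y = zap F a (zgen (fo Y a) y)"
    by (simp add: adj_def)
qed

lemma bij_betw_adj:
  assumes Y: "is_functor (op_cat Delta) Sets Y" and A: "A \<in> Obj SAbZ"
  shows "bij_betw (adj Y A) (Hom SAbZ (ZA Y) A) (Hom SSet Y (U_ob A))"
  unfolding bij_betw_def
proof
  show "inj_on (adj Y A) (Hom SAbZ (ZA Y) A)"
  proof (rule inj_onI)
    fix F G assume F: "F \<in> Hom SAbZ (ZA Y) A" and G: "G \<in> Hom SAbZ (ZA Y) A" and eq: "adj Y A F = adj Y A G"
    show "F = G"
    proof (rule SAbZ_ZA_eqI[OF F G])
      fix a x assume "x \<in> fo Y a"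
      then show "zap F a (zgen (fo Y a) x) = zap G a (zgen (fo Y a) x)"
        using adj_Hom(2)[OF Y F, of x a] adj_Hom(2)[OF Y G, of x a] eq by simp
    qed
  qed
  show "adj Y A ` Hom SAbZ (ZA Y) A = Hom SSet Y (U_ob A)"
  proof
    show "adj Y A ` Hom SAbZ (ZA Y) A \<subseteq> Hom SSet Y (U_ob A)"
      using adj_Hom(1)[OF Y] by blast
    show "Hom SSet Y (U_ob A) \<subseteq> adj Y A ` Hom SAbZ (ZA Y) A"
    proof
      fix H assume H: "H \<in> Hom SSet Y (U_ob A)"
      have cl: "sap H a y \<in> Uc A a" if "y \<in> fo Y a" for y a
        using SSet_Hom_sap(1)[OF H that] by simp
      define t where "t a = the_hom (Zfree (fo Y a)) (lcar A a) (\<lambda>h. \<forall>y\<in>fo Y a. h (zgen (fo Y a) y) = sap H a y)" for a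
      have t: "t a \<in> Hom Ab (Zfree (fo Y a)) (lcar A a)" "y \<in> fo Y a \<Longrightarrow> ap (t a) (zgen (fo Y a) y) = sap H a y" for a y
        unfolding t_def using the_hom_Zfree[OF SAbZ_ObjD(4)[OF A], of "fo Y a" "sap H a" a] cl Uc_carrier by auto
      define F where "F = (ZA Y, (fst (ZA Y), t, fst A), A)"
      have F: "F \<in> Hom SAbZ (ZA Y) A"
        unfolding F_def
        by (rule SAbZ_gen_HomI[OF generated_by_ZA ZA_Obj[OF Y] A])
          (use t cl in \<open>auto simp: ap_fa_ZA[OF Y] aug_ZA sset_act(2)[OF Y] SSet_Hom_sap(2)[OF H] Uc_def\<close>)
      have "adj Y A F = H"
      proof (rule SSet_Hom_eqI[OF adj_Hom(1)[OF Y F] H])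
        fix a x assume x: "x \<in> fo Y a"
        show "sap (adj Y A F) a x = sap H a x"
          unfolding adj_Hom(2)[OF Y F x] using t(2)[OF x] by (simp add: F_def)
      qed
      then show "H \<in> adj Y A ` Hom SAbZ (ZA Y) A" using F by blast
    qed
  qed
qed

lemma adj_natural:
  assumes f: "f \<in> Hom SSet Y' Y" and h: "h \<in> Hom SAbZ (ZA Y) A" and g: "g \<in> Hom SAbZ A B"
  shows "adj Y' B (Cmp SAbZ g (Cmp SAbZ h (ZA_arr f))) = Cmp SSet (U_arr g) (Cmp SSet (adj Y A h) f)"
proof -
  note Y' = Simp_HomD(2)[OF f] and Y = Simp_HomD(3)[OF f]
  note zf = ZA_arr_Hom[OF f] and a = adj_Hom[OF Y h] and u = U_arr_Hom[OF g]
  note hf = SAbZ.Cmp[OF zf(1) h] and af = SSet.Cmp[OF f a(1)]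
  note ghf = SAbZ.Cmp[OF hf g]
  show ?thesis
    by (rule SSet_Hom_eqI[OF adj_Hom(1)[OF Y' ghf] SSet.Cmp[OF af u(1)]])
      (simp add: adj_Hom(2)[OF Y' ghf] SAbZ_zap_Cmp[OF hf g] SAbZ_zap_Cmp[OF zf(1) h] zf(2)
        SSet_sap_Cmp[OF af u(1)] SSet_sap_Cmp[OF f a(1)] a u SSet_Hom_sap(1)[OF f])
qed

definition U_alg :: "('u asab, 'u asab_arr) alg \<Rightarrow> ('u sset, 'u sset_arr) alg" where
  "U_alg R = (let A = acar R; U = U_ob A in
     \<lparr>acar = U,
      amul = (Ten SSet U U, \<lambda>a. (set_prod (Uc A a) (Uc A a),
        \<lambda>z\<in>set_prod (Uc A a) (Uc A a). zap (amul R) a (tens (lcar A a) (lcar A a) (pr1 z) (pr2 z)), Uc A a), U),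
      aone = (One SSet, \<lambda>a. ({pt}, \<lambda>_\<in>{pt}. zap (aone R) a (zz 1), Uc A a), U)\<rparr>)"

definition U_fun where
  "U_fun = \<lparr>fo = U_alg, fa = (\<lambda>(R, f, S). (U_alg R, U_arr f, U_alg S))\<rparr>"

lemma acar_U_alg [simp]: "acar (U_alg R) = U_ob (acar R)"
  by (simp add: U_alg_def Let_def)

context
  fixes R :: "('u asab, 'u asab_arr) alg"
  assumes R: "is_alg SAbZ R"
begin

lemma SAbZ_alg_Hom:
  "acar R \<in> Obj SAbZ" "amul R \<in> Hom SAbZ (Ten SAbZ (acar R) (acar R)) (acar R)" "aone R \<in> Hom SAbZ (One SAbZ) (acar R)"
  using SAbZ.is_algD[OF R] by (auto intro: HomI)

abbreviation "L a \<equiv> lcar (acar R) a"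
abbreviation "rmul a x y \<equiv> zap (amul R) a (tens (L a) (L a) x y)"
abbreviation "runit a \<equiv> zap (aone R) a (zz 1)"

lemma comm_group_L: "comm_group (L a)"
  by (rule SAbZ_ObjD(4)[OF SAbZ_alg_Hom(1)])

lemma rmul_carrier [simp]: "x \<in> carrier (L a) \<Longrightarrow> y \<in> carrier (L a) \<Longrightarrow> rmul a x y \<in> carrier (L a)"
  using SAbZ_Hom_zap(2)[OF SAbZ_alg_Hom(2)] comm_group_L by simp

lemma runit_carrier [simp]: "runit a \<in> carrier (L a)"
  using SAbZ_Hom_zap(2)[OF SAbZ_alg_Hom(3)] by simp

lemma rmul_assoc:
  assumes "x \<in> carrier (L a)" "y \<in> carrier (L a)" "z \<in> carrier (L a)"
  shows "rmul a (rmul a x y) z = rmul a x (rmul a y z)"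
proof -
  note A = SAbZ_alg_Hom(1) and m = SAbZ_alg_Hom(2)
  note I = SAbZ.Idt[OF A]
  note mI = SAbZ.TenA_Hom[OF m I] and Im = SAbZ.TenA_Hom[OF I m] and as = SAbZ.Assoc_Hom[OF A A A]
  let ?x = "tens (tensor (L a) (L a)) (L a) (tens (L a) (L a) x y) z"
  have g: "tens (L a) (L a) x y \<in> carrier (tensor (L a) (L a))" "tens (L a) (L a) y z \<in> carrier (tensor (L a) (L a))"
    "?x \<in> carrier (tensor (tensor (L a) (L a)) (L a))"
    using assms comm_group_L by simp_all
  have "zap (Cmp SAbZ (amul R) (TenA SAbZ (amul R) (Idt SAbZ (acar R)))) a ?x = rmul a (rmul a x y) z"
    using g assms SAbZ_zap_TenA[OF m I, of "tens (L a) (L a) x y" a z] SAbZ_zap_canonical(4)[OF A A A]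
    by (simp add: SAbZ_zap_Cmp[OF mI m])
  moreover have "zap (Cmp SAbZ (amul R) (Cmp SAbZ (TenA SAbZ (Idt SAbZ (acar R)) (amul R)) (Assoc SAbZ (acar R) (acar R) (acar R)))) a ?x =
      rmul a x (rmul a y z)"
    using g assms SAbZ_zap_TenA[OF I m, of x a "tens (L a) (L a) y z"] SAbZ_zap_canonical(1,4)[OF A A A]
    by (simp add: SAbZ_zap_Cmp[OF SAbZ.Cmp[OF as Im] m] SAbZ_zap_Cmp[OF as Im])
  ultimately show ?thesis using SAbZ.is_algD(8)[OF R] by simp
qed

lemma rmul_runit:
  assumes "x \<in> carrier (L a)"
  shows "rmul a (runit a) x = x" "rmul a x (runit a) = x"
proof -
  note A = SAbZ_alg_Hom(1) and m = SAbZ_alg_Hom(2) and e = SAbZ_alg_Hom(3)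
  note I = SAbZ.Idt[OF A]
  note eI = SAbZ.TenA_Hom[OF e I] and Ie = SAbZ.TenA_Hom[OF I e]
  interpret comm_group "L a" by (rule comm_group_L)
  have ZZ: "comm_group (ZZ :: 'u monoid)" by (rule trans_ZZ)
  have "zap (Cmp SAbZ (amul R) (TenA SAbZ (aone R) (Idt SAbZ (acar R)))) a (tens ZZ (L a) (zz 1) x) = rmul a (runit a) x"
    using assms SAbZ_zap_TenA[OF e I, of "zz 1" a x] SAbZ_zap_canonical(4)[OF A A A] comm_group_L ZZ
    by (simp add: SAbZ_zap_Cmp[OF eI m])
  then show "rmul a (runit a) x = x"
    using SAbZ.is_algD(9)[OF R] SAbZ_zap_canonical(2)[OF A A A assms, of 1] assms by simp
  have "zap (Cmp SAbZ (amul R) (TenA SAbZ (Idt SAbZ (acar R)) (aone R))) a (tens (L a) ZZ x (zz 1)) = rmul a x (runit a)"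
    using assms SAbZ_zap_TenA[OF I e, of x a "zz 1"] SAbZ_zap_canonical(4)[OF A A A] comm_group_L ZZ
    by (simp add: SAbZ_zap_Cmp[OF Ie m])
  then show "rmul a x (runit a) = x"
    using SAbZ.is_algD(10)[OF R] SAbZ_zap_canonical(3)[OF A A A assms, of 1] assms by simp
qed

lemma rmul_Uc [simp]: "x \<in> Uc (acar R) a \<Longrightarrow> y \<in> Uc (acar R) a \<Longrightarrow> rmul a x y \<in> Uc (acar R) a"
  using SAbZ_Hom_zap(4)[OF SAbZ_alg_Hom(2), of "tens (L a) (L a) x y" a] comm_group_L
    aug_Ten[OF SAbZ_alg_Hom(1) SAbZ_alg_Hom(1), of x a y 1 1] by (simp add: Uc_def)

lemma runit_Uc [simp]: "runit a \<in> Uc (acar R) a"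
  using SAbZ_Hom_zap(4)[OF SAbZ_alg_Hom(3), of "zz 1" a] by (simp add: Uc_def aug_One)

lemma rmul_natural:
  assumes "\<alpha> \<in> Arr Delta" "x \<in> carrier (L (Cod Delta \<alpha>))" "y \<in> carrier (L (Cod Delta \<alpha>))"
  shows "rmul (Dom Delta \<alpha>) (ap (fa (fst (acar R)) \<alpha>) x) (ap (fa (fst (acar R)) \<alpha>) y) =
    ap (fa (fst (acar R)) \<alpha>) (rmul (Cod Delta \<alpha>) x y)"
  using SAbZ_Hom_zap(3)[OF SAbZ_alg_Hom(2) assms(1), of "tens (L (Cod Delta \<alpha>)) (L (Cod Delta \<alpha>)) x y"] assms comm_group_L
    ap_fa_Ten_SAbZ[OF SAbZ_alg_Hom(1) SAbZ_alg_Hom(1) assms] by simp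

lemma runit_natural:
  assumes "\<alpha> \<in> Arr Delta"
  shows "runit (Dom Delta \<alpha>) = ap (fa (fst (acar R)) \<alpha>) (runit (Cod Delta \<alpha>))"
  using SAbZ_Hom_zap(3)[OF SAbZ_alg_Hom(3) assms, of "zz 1"] by (simp add: ap_fa_One_SAbZ)

lemma U_Obj: "U_ob (acar R) \<in> Obj SSet"
  using is_functor_U_ob[OF SAbZ_alg_Hom(1)] by (simp add: Simp_simps)

lemma amul_U:
  "amul (U_alg R) \<in> Hom SSet (Ten SSet (U_ob (acar R)) (U_ob (acar R))) (U_ob (acar R))"
  "x \<in> Uc (acar R) a \<Longrightarrow> y \<in> Uc (acar R) a \<Longrightarrow> sap (amul (U_alg R)) a (pr x y) = rmul a x y"
proof -
  let ?U = "U_ob (acar R)"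
  note U = is_functor_U_ob[OF SAbZ_alg_Hom(1)]
  have T: "is_functor (op_cat Delta) Sets (Ten SSet ?U ?U)"
    using SSet.Ten_Obj[OF U_Obj U_Obj] by (simp add: Simp_simps)
  have eq: "amul (U_alg R) = (Ten SSet ?U ?U, \<lambda>a. (set_prod (Uc (acar R) a) (Uc (acar R) a),
        \<lambda>z\<in>set_prod (Uc (acar R) a) (Uc (acar R) a). rmul a (pr1 z) (pr2 z), Uc (acar R) a), ?U)"
    by (simp add: U_alg_def Let_def)
  show "amul (U_alg R) \<in> Hom SSet (Ten SSet ?U ?U) ?U"
    unfolding eq
  proof (rule SSet_HomI[OF T U])
    show "(set_prod (Uc (acar R) a) (Uc (acar R) a), \<lambda>z\<in>set_prod (Uc (acar R) a) (Uc (acar R) a). rmul a (pr1 z) (pr2 z), Uc (acar R) a)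
      \<in> Hom Sets (fo (Ten SSet ?U ?U) a) (fo ?U a)" for a
      by (auto simp: Sets_simps elim!: set_prodE)
    fix \<alpha> z assume \<alpha>: "\<alpha> \<in> Arr Delta" and "z \<in> fo (Ten SSet ?U ?U) (Cod Delta \<alpha>)"
    then obtain x y where z: "z = pr x y" "x \<in> Uc (acar R) (Cod Delta \<alpha>)" "y \<in> Uc (acar R) (Cod Delta \<alpha>)"
      by (auto elim!: set_prodE)
    then show "ap (set_prod (Uc (acar R) (Dom Delta \<alpha>)) (Uc (acar R) (Dom Delta \<alpha>)),
          \<lambda>z\<in>set_prod (Uc (acar R) (Dom Delta \<alpha>)) (Uc (acar R) (Dom Delta \<alpha>)). rmul (Dom Delta \<alpha>) (pr1 z) (pr2 z),
          Uc (acar R) (Dom Delta \<alpha>)) (ap (fa (Ten SSet ?U ?U) \<alpha>) z) =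
        ap (fa ?U \<alpha>) (ap (set_prod (Uc (acar R) (Cod Delta \<alpha>)) (Uc (acar R) (Cod Delta \<alpha>)),
          \<lambda>z\<in>set_prod (Uc (acar R) (Cod Delta \<alpha>)) (Uc (acar R) (Cod Delta \<alpha>)). rmul (Cod Delta \<alpha>) (pr1 z) (pr2 z),
          Uc (acar R) (Cod Delta \<alpha>)) z)"
      using \<alpha> sset_act(2)[OF U \<alpha>, of x] sset_act(2)[OF U \<alpha>, of y]
      by (simp add: ap_fa_Ten_SSet[OF U U \<alpha>] rmul_natural Uc_carrier)
  qed
  show "x \<in> Uc (acar R) a \<Longrightarrow> y \<in> Uc (acar R) a \<Longrightarrow> sap (amul (U_alg R)) a (pr x y) = rmul a x y"
    unfolding eq by simp
qed

lemma aone_U: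
  "aone (U_alg R) \<in> Hom SSet (One SSet) (U_ob (acar R))" "sap (aone (U_alg R)) a pt = runit a"
proof -
  note U = is_functor_U_ob[OF SAbZ_alg_Hom(1)]
  have O: "is_functor (op_cat Delta) Sets (One SSet :: 'u sset)" using SSet.One_Obj by (simp add: Simp_simps)
  have eq: "aone (U_alg R) = (One SSet, \<lambda>a. ({pt}, \<lambda>_\<in>{pt}. runit a, Uc (acar R) a), U_ob (acar R))"
    by (simp add: U_alg_def Let_def)
  show "aone (U_alg R) \<in> Hom SSet (One SSet) (U_ob (acar R))"
    unfolding eq by (rule SSet_HomI[OF O U]) (simp_all add: Sets_simps ap_fa_One_SSet runit_natural)
  show "sap (aone (U_alg R)) a pt = runit a" unfolding eq by simp
qed

lemma is_alg_U: "is_alg SSet (U_alg R)"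
proof -
  let ?U = "U_ob (acar R)" and ?m = "amul (U_alg R)" and ?e = "aone (U_alg R)"
  note I = SSet.Idt[OF U_Obj] and as = SSet.Assoc_Hom[OF U_Obj U_Obj U_Obj] and m = amul_U and e = aone_U
  note mI = SSet.TenA_Hom[OF m(1) I] and Im = SSet.TenA_Hom[OF I m(1)]
  note eI = SSet.TenA_Hom[OF e(1) I] and Ie = SSet.TenA_Hom[OF I e(1)]
  note l = SSet.Lun_Hom[OF U_Obj] and r = SSet.Run_Hom[OF U_Obj]
  have "Cmp SSet ?m (TenA SSet ?m (Idt SSet ?U)) = Cmp SSet ?m (Cmp SSet (TenA SSet (Idt SSet ?U) ?m) (Assoc SSet ?U ?U ?U))"
    by (rule SSet_Hom_eqI[OF SSet.Cmp[OF mI m(1)] SSet.Cmp[OF SSet.Cmp[OF as Im] m(1)]])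
      (auto simp: SSet_sap_Cmp[OF mI m(1)] SSet_sap_Cmp[OF SSet.Cmp[OF as Im] m(1)] SSet_sap_Cmp[OF as Im]
        SSet_sap_TenA[OF m(1) I] SSet_sap_TenA[OF I m(1)] m(2) SSet_sap_canonical rmul_assoc Uc_carrier elim!: set_prodE)
  moreover have "Cmp SSet ?m (TenA SSet ?e (Idt SSet ?U)) = Lun SSet ?U"
    by (rule SSet_Hom_eqI[OF SSet.Cmp[OF eI m(1)] l])
      (auto simp: SSet_sap_Cmp[OF eI m(1)] SSet_sap_TenA[OF e(1) I] m(2) e(2) SSet_sap_canonical rmul_runit Uc_carrier elim!: set_prodE)
  moreover have "Cmp SSet ?m (TenA SSet (Idt SSet ?U) ?e) = Run SSet ?U"
    by (rule SSet_Hom_eqI[OF SSet.Cmp[OF Ie m(1)] r])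
      (auto simp: SSet_sap_Cmp[OF Ie m(1)] SSet_sap_TenA[OF I e(1)] m(2) e(2) SSet_sap_canonical rmul_runit Uc_carrier elim!: set_prodE)
  ultimately show ?thesis using m(1) e(1) U_Obj by (simp add: is_alg_def Let_def)
qed

end

end

lemma Alg_simps:
  "R \<in> Obj (Alg D) \<longleftrightarrow> is_alg D R"
  "F \<in> Hom (Alg D) R S \<longleftrightarrow> (\<exists>f. F = (R, f, S) \<and> is_alg D R \<and> is_alg D S \<and> f \<in> Hom D (acar R) (acar S) \<and>
     Cmp D f (amul R) = Cmp D (amul S) (TenA D f f) \<and> Cmp D f (aone R) = aone S)"
  "Dom (Alg D) (R, f, S) = R" "Cod (Alg D) (R, f, S) = S"
  "Idt (Alg D) R = (R, Idt D (acar R), R)"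
  "Cmp (Alg D) (S, g, T) (R, f, S') = (R, Cmp D g f, T)"
  by (auto simp: Alg_def)

context infinite_universe
begin

lemma U_arr_Cmp:
  assumes F: "F \<in> Hom SAbZ A B" and G: "G \<in> Hom SAbZ B C"
  shows "U_arr (Cmp SAbZ G F) = Cmp SSet (U_arr G) (U_arr F)"
proof -
  note u = U_arr_Hom[OF F] and v = U_arr_Hom[OF G] and w = U_arr_Hom[OF SAbZ.Cmp[OF F G]]
  show ?thesis
    by (rule SSet_Hom_eqI[OF w(1) SSet.Cmp[OF u(1) v(1)]])
      (simp add: SSet_sap_Cmp[OF u(1) v(1)] u v w SAbZ_zap_Cmp[OF F G] Uc_carrier)
qed

lemma U_arr_Idt:
  assumes A: "A \<in> Obj SAbZ"
  shows "U_arr (Idt SAbZ A) = Idt SSet (U_ob A)"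
proof -
  have U: "U_ob A \<in> Obj SSet" using is_functor_U_ob[OF A] by (simp add: Simp_simps)
  show ?thesis
    by (rule SSet_Hom_eqI[OF U_arr_Hom(1)[OF SAbZ.Idt[OF A]] SSet.Idt[OF U]])
      (simp add: U_arr_Hom(2)[OF SAbZ.Idt[OF A]] SSet_sap_canonical SAbZ_zap_canonical(4)[OF A A A] Uc_carrier)
qed

lemma alg_hom_zap:
  assumes R: "is_alg SAbZ R" and S: "is_alg SAbZ S" and f: "f \<in> Hom SAbZ (acar R) (acar S)"
  shows "Cmp SAbZ f (amul R) = Cmp SAbZ (amul S) (TenA SAbZ f f) \<Longrightarrow>
      x \<in> carrier (L R a) \<Longrightarrow> y \<in> carrier (L R a) \<Longrightarrow> zap f a (rmul R a x y) = rmul S a (zap f a x) (zap f a y)"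
    and "Cmp SAbZ f (aone R) = aone S \<Longrightarrow> zap f a (runit R a) = runit S a"
proof -
  note m = SAbZ_alg_Hom(2)[OF R] and m' = SAbZ_alg_Hom(2)[OF S] and ff = SAbZ.TenA_Hom[OF f f]
  assume xy: "x \<in> carrier (L R a)" "y \<in> carrier (L R a)"
  then have g: "tens (L R a) (L R a) x y \<in> carrier (tensor (L R a) (L R a))" using comm_group_L[OF R] by simp
  show "zap f a (rmul R a x y) = rmul S a (zap f a x) (zap f a y)"
    if "Cmp SAbZ f (amul R) = Cmp SAbZ (amul S) (TenA SAbZ f f)"
    using arg_cong[OF that, of "\<lambda>F. zap F a (tens (L R a) (L R a) x y)"] g
    by (simp add: SAbZ_zap_Cmp[OF m f] SAbZ_zap_Cmp[OF ff m'] SAbZ_zap_TenA[OF f f xy])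
next
  show "zap f a (runit R a) = runit S a" if "Cmp SAbZ f (aone R) = aone S"
    using arg_cong[OF that, of "\<lambda>F. zap F a (zz 1)"] by (simp add: SAbZ_zap_Cmp[OF SAbZ_alg_Hom(3)[OF R] f])
qed

lemma functor_U: "is_functor (Alg SAbZ) (Alg SSet) U_fun"
proof (rule functorI)
  fix R :: "('u asab, 'u asab_arr) alg" assume "R \<in> Obj (Alg SAbZ)"
  then have R: "is_alg SAbZ R" by (simp add: Alg_simps)
  show "fo U_fun R \<in> Obj (Alg SSet)" using is_alg_U[OF R] by (simp add: Alg_simps U_fun_def)
  show "fa U_fun (Idt (Alg SAbZ) R) = Idt (Alg SSet) (fo U_fun R)"
    using U_arr_Idt[OF SAbZ_alg_Hom(1)[OF R]] by (simp add: Alg_simps U_fun_def)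
next
  fix F :: "('u asab, 'u asab_arr) alg_arr" assume "F \<in> Arr (Alg SAbZ)"
  from Arr_Hom[OF this] obtain R f S where F: "F = (R, f, S)" and R: "is_alg SAbZ R" and S: "is_alg SAbZ S"
    and f: "f \<in> Hom SAbZ (acar R) (acar S)" and fm: "Cmp SAbZ f (amul R) = Cmp SAbZ (amul S) (TenA SAbZ f f)"
    and fe: "Cmp SAbZ f (aone R) = aone S" unfolding Alg_simps(2) by blast
  note u = U_arr_Hom[OF f] and m = amul_U[OF R] and m' = amul_U[OF S] and e = aone_U[OF R] and e' = aone_U[OF S]
  note uu = SSet.TenA_Hom[OF u(1) u(1)]
  have "Cmp SSet (U_arr f) (amul (U_alg R)) = Cmp SSet (amul (U_alg S)) (TenA SSet (U_arr f) (U_arr f))"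
    by (rule SSet_Hom_eqI[OF SSet.Cmp[OF m(1) u(1)] SSet.Cmp[OF uu m'(1)]])
      (auto simp: SSet_sap_Cmp[OF m(1) u(1)] SSet_sap_Cmp[OF uu m'(1)] SSet_sap_TenA[OF u(1) u(1)] m(2) m'(2) u(2,3)
        alg_hom_zap(1)[OF R S f fm] Uc_carrier R elim!: set_prodE)
  moreover have "Cmp SSet (U_arr f) (aone (U_alg R)) = aone (U_alg S)"
    by (rule SSet_Hom_eqI[OF SSet.Cmp[OF e(1) u(1)] e'(1)])
      (auto simp: SSet_sap_Cmp[OF e(1) u(1)] e(2) e'(2) u(2) alg_hom_zap(2)[OF R S f fe] R)
  ultimately show "fa U_fun F \<in> Hom (Alg SSet) (fo U_fun (Dom (Alg SAbZ) F)) (fo U_fun (Cod (Alg SAbZ) F))"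
    using u(1) is_alg_U[OF R] is_alg_U[OF S] by (simp add: F Alg_simps U_fun_def)
next
  fix F G :: "('u asab, 'u asab_arr) alg_arr"
  assume "F \<in> Arr (Alg SAbZ)" "G \<in> Arr (Alg SAbZ)" "Dom (Alg SAbZ) G = Cod (Alg SAbZ) F"
  then have "F \<in> Hom (Alg SAbZ) (Dom (Alg SAbZ) F) (Cod (Alg SAbZ) F)"
    "G \<in> Hom (Alg SAbZ) (Cod (Alg SAbZ) F) (Cod (Alg SAbZ) G)" by (simp_all add: Hom_def)
  then obtain R f S g T where "F = (R, f, S)" "G = (S, g, T)" and f: "f \<in> Hom SAbZ (acar R) (acar S)"
    and g: "g \<in> Hom SAbZ (acar S) (acar T)" unfolding Alg_simps(2) by auto
  then show "fa U_fun (Cmp (Alg SAbZ) G F) = Cmp (Alg SSet) (fa U_fun G) (fa U_fun F)"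
    using U_arr_Cmp[OF f g] by (simp add: U_fun_def Alg_simps)
qed

lemma SAbZ_ZA2_eqI:
  assumes "F \<in> Hom SAbZ (Ten SAbZ (ZA X) (ZA Y)) B" "F' \<in> Hom SAbZ (Ten SAbZ (ZA X) (ZA Y)) B"
    "\<And>a x y. x \<in> fo X a \<Longrightarrow> y \<in> fo Y a \<Longrightarrow> zap F a (tens (Zfree (fo X a)) (Zfree (fo Y a)) (zgen (fo X a) x) (zgen (fo Y a) y)) =
      zap F' a (tens (Zfree (fo X a)) (Zfree (fo Y a)) (zgen (fo X a) x) (zgen (fo Y a) y))"
  shows "F = F'"
proof (rule SAbZ_gen_eqI[OF _ assms(1,2)])
  show "generated_by (lcar (Ten SAbZ (ZA X) (ZA Y)) a)
      {tens (Zfree (fo X a)) (Zfree (fo Y a)) b c |b c. b \<in> zgen (fo X a) ` fo X a \<and> c \<in> zgen (fo Y a) ` fo Y a}" for a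
    using generated_by_tensor[OF generated_by_Zfree generated_by_Zfree] by simp
qed (auto simp: assms(3))

lemma SAbZ_ZA3_eqI:
  assumes "F \<in> Hom SAbZ (Ten SAbZ (Ten SAbZ (ZA X) (ZA Y)) (ZA W)) B" "F' \<in> Hom SAbZ (Ten SAbZ (Ten SAbZ (ZA X) (ZA Y)) (ZA W)) B"
    "\<And>a x y w. x \<in> fo X a \<Longrightarrow> y \<in> fo Y a \<Longrightarrow> w \<in> fo W a \<Longrightarrow>
      zap F a (tens (tensor (Zfree (fo X a)) (Zfree (fo Y a))) (Zfree (fo W a))
        (tens (Zfree (fo X a)) (Zfree (fo Y a)) (zgen (fo X a) x) (zgen (fo Y a) y)) (zgen (fo W a) w)) =
      zap F' a (tens (tensor (Zfree (fo X a)) (Zfree (fo Y a))) (Zfree (fo W a))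
        (tens (Zfree (fo X a)) (Zfree (fo Y a)) (zgen (fo X a) x) (zgen (fo Y a) y)) (zgen (fo W a) w))"
  shows "F = F'"
proof (rule SAbZ_gen_eqI[OF _ assms(1,2)])
  show "generated_by (lcar (Ten SAbZ (Ten SAbZ (ZA X) (ZA Y)) (ZA W)) a)
      {tens (tensor (Zfree (fo X a)) (Zfree (fo Y a))) (Zfree (fo W a)) b c |b c.
         b \<in> {tens (Zfree (fo X a)) (Zfree (fo Y a)) b c |b c. b \<in> zgen (fo X a) ` fo X a \<and> c \<in> zgen (fo Y a) ` fo Y a} \<and>
         c \<in> zgen (fo W a) ` fo W a}" for a
    using generated_by_tensor[OF generated_by_tensor[OF generated_by_Zfree generated_by_Zfree] generated_by_Zfree] by simp
qed (auto simp: assms(3))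

lemma SAbZ_One_ZA_eqI:
  assumes "F \<in> Hom SAbZ (Ten SAbZ (One SAbZ) (ZA X)) B" "F' \<in> Hom SAbZ (Ten SAbZ (One SAbZ) (ZA X)) B"
    "\<And>a x. x \<in> fo X a \<Longrightarrow> zap F a (tens ZZ (Zfree (fo X a)) (zz 1) (zgen (fo X a) x)) =
      zap F' a (tens ZZ (Zfree (fo X a)) (zz 1) (zgen (fo X a) x))"
  shows "F = F'"
proof (rule SAbZ_gen_eqI[OF _ assms(1,2)])
  show "generated_by (lcar (Ten SAbZ (One SAbZ) (ZA X)) a)
      {tens ZZ (Zfree (fo X a)) b c |b c. b \<in> {zz 1} \<and> c \<in> zgen (fo X a) ` fo X a}" for a
    using generated_by_tensor[OF generated_by_ZZ generated_by_Zfree] by simp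
qed (auto simp: assms(3))

lemma SAbZ_ZA_One_eqI:
  assumes "F \<in> Hom SAbZ (Ten SAbZ (ZA X) (One SAbZ)) B" "F' \<in> Hom SAbZ (Ten SAbZ (ZA X) (One SAbZ)) B"
    "\<And>a x. x \<in> fo X a \<Longrightarrow> zap F a (tens (Zfree (fo X a)) ZZ (zgen (fo X a) x) (zz 1)) =
      zap F' a (tens (Zfree (fo X a)) ZZ (zgen (fo X a) x) (zz 1))"
  shows "F = F'"
proof (rule SAbZ_gen_eqI[OF _ assms(1,2)])
  show "generated_by (lcar (Ten SAbZ (ZA X) (One SAbZ)) a)
      {tens (Zfree (fo X a)) ZZ b c |b c. b \<in> zgen (fo X a) ` fo X a \<and> c \<in> {zz 1}}" for a
    using generated_by_tensor[OF generated_by_Zfree generated_by_ZZ] by simp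
qed (auto simp: assms(3))

lemma SAbZ_One_eqI:
  assumes "F \<in> Hom SAbZ (One SAbZ) (B :: 'u asab)" "F' \<in> Hom SAbZ (One SAbZ) B" "\<And>a. zap F a (zz 1) = zap F' a (zz 1)"
  shows "F = F'"
proof (rule SAbZ_gen_eqI[OF _ assms(1,2)])
  show "generated_by (lcar (One SAbZ) a) {zz 1}" for a using generated_by_ZZ by simp
qed (auto simp: assms(3))

section \<open>Monoid rings\<close>

lemma acar_Zalg [simp]: "acar (Zalg_ob M) = ZA (acar M)"
  by (simp add: Zalg_ob_def Let_def ZA_def)

context
  fixes M :: "('u sset, 'u sset_arr) alg"
  assumes M: "is_alg SSet M"
begin

abbreviation "Ms \<equiv> acar M"
abbreviation "Zm a \<equiv> Zfree (fo Ms a)"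
abbreviation "gm a \<equiv> zgen (fo Ms a)"
abbreviation "mmul a x y \<equiv> sap (amul M) a (pr x y)"
abbreviation "munit a \<equiv> sap (aone M) a pt"

lemma SSet_alg_Hom:
  "Ms \<in> Obj SSet" "is_functor (op_cat Delta) Sets Ms" "amul M \<in> Hom SSet (Ten SSet Ms Ms) Ms"
  "aone M \<in> Hom SSet (One SSet) Ms"
  using SSet.is_algD[OF M] by (auto simp: Simp_simps(1) intro: HomI)

lemma mmul_closed [simp]: "x \<in> fo Ms a \<Longrightarrow> y \<in> fo Ms a \<Longrightarrow> mmul a x y \<in> fo Ms a"
  using SSet_Hom_sap(1)[OF SSet_alg_Hom(3), of "pr x y" a] by simp

lemma munit_closed [simp]: "munit a \<in> fo Ms a"
  using SSet_Hom_sap(1)[OF SSet_alg_Hom(4), of pt a] by simp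

lemma mmul_assoc:
  assumes "x \<in> fo Ms a" "y \<in> fo Ms a" "z \<in> fo Ms a"
  shows "mmul a (mmul a x y) z = mmul a x (mmul a y z)"
proof -
  note A = SSet_alg_Hom(1) and m = SSet_alg_Hom(3)
  note I = SSet.Idt[OF A]
  note mI = SSet.TenA_Hom[OF m I] and Im = SSet.TenA_Hom[OF I m] and as = SSet.Assoc_Hom[OF A A A]
  from arg_cong[OF SSet.is_algD(8)[OF M], of "\<lambda>F. sap F a (pr (pr x y) z)"] assms show ?thesis
    by (simp add: SSet_sap_Cmp[OF mI m] SSet_sap_Cmp[OF SSet.Cmp[OF as Im] m] SSet_sap_Cmp[OF as Im]
        SSet_sap_TenA[OF m I] SSet_sap_TenA[OF I m] SSet_sap_canonical)
qed

lemma mmul_unit: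
  assumes "x \<in> fo Ms a"
  shows "mmul a (munit a) x = x" "mmul a x (munit a) = x"
proof -
  note A = SSet_alg_Hom(1) and m = SSet_alg_Hom(3) and e = SSet_alg_Hom(4)
  note I = SSet.Idt[OF A]
  note eI = SSet.TenA_Hom[OF e I] and Ie = SSet.TenA_Hom[OF I e]
  from arg_cong[OF SSet.is_algD(9)[OF M], of "\<lambda>F. sap F a (pr pt x)"] assms show "mmul a (munit a) x = x"
    by (simp add: SSet_sap_Cmp[OF eI m] SSet_sap_TenA[OF e I] SSet_sap_canonical)
  from arg_cong[OF SSet.is_algD(10)[OF M], of "\<lambda>F. sap F a (pr x pt)"] assms show "mmul a x (munit a) = x"
    by (simp add: SSet_sap_Cmp[OF Ie m] SSet_sap_TenA[OF I e] SSet_sap_canonical)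
qed

lemma ZA_Ms [simp]: "ZA Ms \<in> Obj SAbZ"
  by (rule ZA_Obj[OF SSet_alg_Hom(2)])

lemma amul_Zalg:
  "amul (Zalg_ob M) \<in> Hom SAbZ (Ten SAbZ (ZA Ms) (ZA Ms)) (ZA Ms)"
  "x \<in> fo Ms a \<Longrightarrow> y \<in> fo Ms a \<Longrightarrow> zap (amul (Zalg_ob M)) a (tens (Zm a) (Zm a) (gm a x) (gm a y)) = gm a (mmul a x y)"
proof -
  note X = SSet_alg_Hom(2)
  have m: "ap (amul M) a \<in> Hom Sets (set_prod (fo Ms a) (fo Ms a)) (fo Ms a)" for a
    using Simp_HomD(5)[OF SSet_alg_Hom(3), of a] by simp
  note z = Zmul_Hom[OF m]
  have eq: "amul (Zalg_ob M) = (Ten SAbZ (ZA Ms) (ZA Ms),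
      (fst (Ten SAbZ (ZA Ms) (ZA Ms)), \<lambda>a. Zmul (fo Ms a) (ap (amul M) a), fst (ZA Ms)), ZA Ms)"
    by (simp add: Zalg_ob_def Let_def ZA_def Over_One_simps aug_ten_def)
  have G: "generated_by (lcar (Ten SAbZ (ZA Ms) (ZA Ms)) a)
      {tens (Zm a) (Zm a) b c |b c. b \<in> gm a ` fo Ms a \<and> c \<in> gm a ` fo Ms a}" for a
    using generated_by_tensor[OF generated_by_Zfree generated_by_Zfree] by simp
  show "amul (Zalg_ob M) \<in> Hom SAbZ (Ten SAbZ (ZA Ms) (ZA Ms)) (ZA Ms)"
    unfolding eq
  proof (rule SAbZ_gen_HomI[OF G SAbZ.Ten_Obj[OF ZA_Ms ZA_Ms] ZA_Ms])
    show "Zmul (fo Ms a) (ap (amul M) a) \<in> Hom Ab (lcar (Ten SAbZ (ZA Ms) (ZA Ms)) a) (lcar (ZA Ms) a)" for a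
      using z(1) by simp
  next
    fix \<alpha> g assume \<alpha>: "\<alpha> \<in> Arr Delta"
      and "g \<in> {tens (Zm (Cod Delta \<alpha>)) (Zm (Cod Delta \<alpha>)) b c |b c. b \<in> gm (Cod Delta \<alpha>) ` fo Ms (Cod Delta \<alpha>) \<and>
        c \<in> gm (Cod Delta \<alpha>) ` fo Ms (Cod Delta \<alpha>)}"
    then obtain x y where xy: "x \<in> fo Ms (Cod Delta \<alpha>)" "y \<in> fo Ms (Cod Delta \<alpha>)"
      and g: "g = tens (Zm (Cod Delta \<alpha>)) (Zm (Cod Delta \<alpha>)) (gm (Cod Delta \<alpha>) x) (gm (Cod Delta \<alpha>) y)" by blast
    show "ap (Zmul (fo Ms (Dom Delta \<alpha>)) (ap (amul M) (Dom Delta \<alpha>))) (ap (fa (fst (Ten SAbZ (ZA Ms) (ZA Ms))) \<alpha>) g) =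
        ap (fa (fst (ZA Ms)) \<alpha>) (ap (Zmul (fo Ms (Cod Delta \<alpha>)) (ap (amul M) (Cod Delta \<alpha>))) g)"
      using ap_fa_Ten_SAbZ[OF ZA_Ms ZA_Ms \<alpha>, of "gm (Cod Delta \<alpha>) x" "gm (Cod Delta \<alpha>) y"] xy
        SSet_Hom_sap(2)[OF SSet_alg_Hom(3) \<alpha>, of "pr x y"]
      by (simp add: g z(2) ap_fa_ZA[OF X \<alpha>] sset_act(2)[OF X \<alpha>] ap_fa_Ten_SSet[OF X X \<alpha>])
  next
    fix a g assume "g \<in> {tens (Zm a) (Zm a) b c |b c. b \<in> gm a ` fo Ms a \<and> c \<in> gm a ` fo Ms a}"
    then obtain x y where xy: "x \<in> fo Ms a" "y \<in> fo Ms a" and g: "g = tens (Zm a) (Zm a) (gm a x) (gm a y)" by blast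
    show "aug (ZA Ms) a (ap (Zmul (fo Ms a) (ap (amul M) a)) g) = aug (Ten SAbZ (ZA Ms) (ZA Ms)) a g"
      using aug_Ten[OF ZA_Ms ZA_Ms, of "gm a x" a "gm a y" 1 1] xy by (simp add: g z(2) aug_ZA)
  qed
  show "x \<in> fo Ms a \<Longrightarrow> y \<in> fo Ms a \<Longrightarrow> zap (amul (Zalg_ob M)) a (tens (Zm a) (Zm a) (gm a x) (gm a y)) = gm a (mmul a x y)"
    unfolding eq by (simp add: z(2))
qed

lemma aone_Zalg:
  "aone (Zalg_ob M) \<in> Hom SAbZ (One SAbZ) (ZA Ms)" "zap (aone (Zalg_ob M)) a (zz 1) = gm a (munit a)"
proof -
  note X = SSet_alg_Hom(2)
  have u: "ap (aone M) a \<in> Hom Sets {pt} (fo Ms a)" for a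
    using Simp_HomD(5)[OF SSet_alg_Hom(4), of a] by simp
  note z = Zunit_Hom[OF u]
  have eq: "aone (Zalg_ob M) = (One SAbZ, (fst (One SAbZ), \<lambda>a. Zunit (fo Ms a) (ap (aone M) a), fst (ZA Ms)), ZA Ms)"
    by (simp add: Zalg_ob_def Let_def ZA_def Over_One_simps aug_one_def)
  have G: "generated_by (lcar (One SAbZ) a) {zz 1}" for a using generated_by_ZZ by simp
  show "aone (Zalg_ob M) \<in> Hom SAbZ (One SAbZ) (ZA Ms)"
    unfolding eq
    by (rule SAbZ_gen_HomI[OF G SAbZ.One_Obj ZA_Ms])
      (use SSet_Hom_sap(2)[OF SSet_alg_Hom(4), of _ pt] in
        \<open>auto simp: z ap_fa_One_SAbZ ap_fa_ZA[OF X] aug_One aug_ZA ap_fa_One_SSet\<close>)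
  show "zap (aone (Zalg_ob M)) a (zz 1) = gm a (munit a)" unfolding eq by (simp add: z(2))
qed

lemma is_alg_Zalg: "is_alg SAbZ (Zalg_ob M)"
proof -
  let ?m = "amul (Zalg_ob M)" and ?e = "aone (Zalg_ob M)" and ?A = "ZA Ms"
  note A = ZA_Ms
  note I = SAbZ.Idt[OF A] and as = SAbZ.Assoc_Hom[OF A A A] and m = amul_Zalg and e = aone_Zalg
  note mI = SAbZ.TenA_Hom[OF m(1) I] and Im = SAbZ.TenA_Hom[OF I m(1)]
  note eI = SAbZ.TenA_Hom[OF e(1) I] and Ie = SAbZ.TenA_Hom[OF I e(1)]
  note l = SAbZ.Lun_Hom[OF A] and r = SAbZ.Run_Hom[OF A]
  note can = SAbZ_zap_canonical[OF A A A, unfolded lcar_ZA]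
  note mI' = SAbZ_zap_TenA[OF m(1) I, unfolded lcar_ZA lcar_Ten] and Im' = SAbZ_zap_TenA[OF I m(1), unfolded lcar_ZA lcar_Ten]
  note eI' = SAbZ_zap_TenA[OF e(1) I, unfolded lcar_ZA lcar_One] and Ie' = SAbZ_zap_TenA[OF I e(1), unfolded lcar_ZA lcar_One]
  have Z: "comm_group (Zfree S)" for S :: "'u set" by (rule trans_free)
  have pow: "gm a x [^]\<^bsub>Zm a\<^esub> (1::int) = gm a x" if "x \<in> fo Ms a" for a x
  proof -
    interpret comm_group "Zm a" by (rule trans_free)
    show ?thesis using that by simp
  qed
  have "Cmp SAbZ ?m (TenA SAbZ ?m (Idt SAbZ ?A)) = Cmp SAbZ ?m (Cmp SAbZ (TenA SAbZ (Idt SAbZ ?A) ?m) (Assoc SAbZ ?A ?A ?A))"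
    by (rule SAbZ_ZA3_eqI[OF SAbZ.Cmp[OF mI m(1)] SAbZ.Cmp[OF SAbZ.Cmp[OF as Im] m(1)]])
      (simp add: SAbZ_zap_Cmp[OF mI m(1)] SAbZ_zap_Cmp[OF SAbZ.Cmp[OF as Im] m(1)] SAbZ_zap_Cmp[OF as Im]
        mI' Im' m(2) can Z mmul_assoc)
  moreover have "Cmp SAbZ ?m (TenA SAbZ ?e (Idt SAbZ ?A)) = Lun SAbZ ?A"
    by (rule SAbZ_One_ZA_eqI[OF SAbZ.Cmp[OF eI m(1)] l])
      (simp add: SAbZ_zap_Cmp[OF eI m(1)] eI' m(2) e(2) can Z trans_ZZ(1) mmul_unit pow)
  moreover have "Cmp SAbZ ?m (TenA SAbZ (Idt SAbZ ?A) ?e) = Run SAbZ ?A"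
    by (rule SAbZ_ZA_One_eqI[OF SAbZ.Cmp[OF Ie m(1)] r])
      (simp add: SAbZ_zap_Cmp[OF Ie m(1)] Ie' m(2) e(2) can Z trans_ZZ(1) mmul_unit pow)
  ultimately show ?thesis using m(1) e(1) A by (simp add: is_alg_def Let_def)
qed

end

lemma Zalg_arr: "fa Zalg (M, f, N) = (Zalg_ob M, ZA_arr f, Zalg_ob N)" if "f \<in> Hom SSet (acar M) (acar (N :: ('u sset, 'u sset_arr) alg))"
  using Simp_HomD(1)[OF that] by (auto simp: Zalg_def ZA_arr_def split: prod.splits)

lemma functor_Zalg:
  "is_functor (Alg SSet) (Alg SAbZ) (Zalg :: (('u sset, 'u sset_arr) alg, ('u sset, 'u sset_arr) alg_arr, _, _) fctr)"
proof (rule functorI)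
  fix M :: "('u sset, 'u sset_arr) alg" assume "M \<in> Obj (Alg SSet)"
  then have M: "is_alg SSet M" by (simp add: Alg_simps)
  show "fo Zalg M \<in> Obj (Alg SAbZ)" using is_alg_Zalg[OF M] by (simp add: Alg_simps Zalg_def)
  show "fa Zalg (Idt (Alg SSet) M) = Idt (Alg SAbZ) (fo Zalg M)"
    using Zalg_arr[OF SSet.Idt[OF SSet_alg_Hom(1)[OF M]]] ZA_arr_Idt[OF SSet_alg_Hom(1)[OF M]]
    by (simp add: Alg_simps Zalg_def)
next
  fix F :: "('u sset, 'u sset_arr) alg_arr" assume "F \<in> Arr (Alg SSet)"
  from Arr_Hom[OF this] obtain M f N where F: "F = (M, f, N)" and M: "is_alg SSet M" and N: "is_alg SSet N"
    and f: "f \<in> Hom SSet (acar M) (acar N)" and fm: "Cmp SSet f (amul M) = Cmp SSet (amul N) (TenA SSet f f)"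
    and fe: "Cmp SSet f (aone M) = aone N" unfolding Alg_simps(2) by blast
  note z = ZA_arr_Hom[OF f] and m = amul_Zalg[OF M] and m' = amul_Zalg[OF N] and e = aone_Zalg[OF M] and e' = aone_Zalg[OF N]
  note ff = SSet.TenA_Hom[OF f f] and zz = SAbZ.TenA_Hom[OF z(1) z(1)]
  note zz' = SAbZ_zap_TenA[OF z(1) z(1), unfolded lcar_ZA]
  have fm': "sap f a (mmul M a x y) = mmul N a (sap f a x) (sap f a y)" if "x \<in> fo (acar M) a" "y \<in> fo (acar M) a" for a x y
    using arg_cong[OF fm, of "\<lambda>F. sap F a (pr x y)"] that
    by (simp add: SSet_sap_Cmp[OF SSet_alg_Hom(3)[OF M] f] SSet_sap_Cmp[OF ff SSet_alg_Hom(3)[OF N]] SSet_sap_TenA[OF f f])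
  have fe': "sap f a (munit M a) = munit N a" for a
    using arg_cong[OF fe, of "\<lambda>F. sap F a pt"] by (simp add: SSet_sap_Cmp[OF SSet_alg_Hom(4)[OF M] f])
  have Z: "comm_group (Zfree S)" for S :: "'u set" by (rule trans_free)
  have "Cmp SAbZ (ZA_arr f) (amul (Zalg_ob M)) = Cmp SAbZ (amul (Zalg_ob N)) (TenA SAbZ (ZA_arr f) (ZA_arr f))"
    by (rule SAbZ_ZA2_eqI[OF SAbZ.Cmp[OF m(1) z(1)] SAbZ.Cmp[OF zz m'(1)]])
      (simp add: SAbZ_zap_Cmp[OF m(1) z(1)] SAbZ_zap_Cmp[OF zz m'(1)] zz' m(2) m'(2) z(2) Z M SSet_Hom_sap(1)[OF f] fm')
  moreover have "Cmp SAbZ (ZA_arr f) (aone (Zalg_ob M)) = aone (Zalg_ob N)"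
    by (rule SAbZ_One_eqI[OF SAbZ.Cmp[OF e(1) z(1)] e'(1)])
      (simp add: SAbZ_zap_Cmp[OF e(1) z(1)] e(2) e'(2) z(2) M fe')
  ultimately show "fa Zalg F \<in> Hom (Alg SAbZ) (fo Zalg (Dom (Alg SSet) F)) (fo Zalg (Cod (Alg SSet) F))"
    using z(1) is_alg_Zalg[OF M] is_alg_Zalg[OF N] by (simp add: F Zalg_arr[OF f] Alg_simps) (simp add: Zalg_def)
next
  fix F G :: "('u sset, 'u sset_arr) alg_arr"
  assume "F \<in> Arr (Alg SSet)" "G \<in> Arr (Alg SSet)" "Dom (Alg SSet) G = Cod (Alg SSet) F"
  then have FG: "F \<in> Hom (Alg SSet) (Dom (Alg SSet) F) (Cod (Alg SSet) F)"
    "G \<in> Hom (Alg SSet) (Cod (Alg SSet) F) (Cod (Alg SSet) G)" by (simp_all add: Hom_def)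
  then obtain M f N g K where FG: "F = (M, f, N)" "G = (N, g, K)" and f: "f \<in> Hom SSet (acar M) (acar N)"
    and g: "g \<in> Hom SSet (acar N) (acar K)" unfolding Alg_simps(2) by auto
  show "fa Zalg (Cmp (Alg SSet) G F) = Cmp (Alg SAbZ) (fa Zalg G) (fa Zalg F)"
    using ZA_arr_Cmp[OF f g] by (simp add: FG Alg_simps Zalg_arr[OF f] Zalg_arr[OF g] Zalg_arr[OF SSet.Cmp[OF f g]])
qed

lemma adj_alg_iff:
  assumes M: "is_alg SSet M" and R: "is_alg SAbZ R" and h: "h \<in> Hom SAbZ (ZA (acar M)) (acar R)"
  defines "k \<equiv> adj (acar M) (acar R) h"
  shows "Cmp SAbZ h (amul (Zalg_ob M)) = Cmp SAbZ (amul R) (TenA SAbZ h h) \<longleftrightarrow>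
      Cmp SSet k (amul M) = Cmp SSet (amul (U_alg R)) (TenA SSet k k)" (is "?L1 = ?R1 \<longleftrightarrow> ?L2 = ?R2")
    and "Cmp SAbZ h (aone (Zalg_ob M)) = aone R \<longleftrightarrow> Cmp SSet k (aone M) = aone (U_alg R)"
proof -
  note X = SSet_alg_Hom(2)[OF M]
  note k = adj_Hom[OF X h, folded k_def]
  note m = amul_Zalg[OF M] and e = aone_Zalg[OF M] and m' = SAbZ_alg_Hom(2)[OF R] and e' = SAbZ_alg_Hom(3)[OF R]
  note n = SSet_alg_Hom(3)[OF M] and n' = amul_U[OF R] and u = SSet_alg_Hom(4)[OF M] and u' = aone_U[OF R]
  note hh = SAbZ.TenA_Hom[OF h h] and kk = SSet.TenA_Hom[OF k(1) k(1)]
  have Z: "comm_group (Zfree S)" for S :: "'u set" by (rule trans_free)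
  have L1: "zap ?L1 a (tens (Zm M a) (Zm M a) (gm M a x) (gm M a y)) = sap ?L2 a (pr x y)"
    and R1: "zap ?R1 a (tens (Zm M a) (Zm M a) (gm M a x) (gm M a y)) = sap ?R2 a (pr x y)"
    if "x \<in> fo (acar M) a" "y \<in> fo (acar M) a" for a x y
    using that SAbZ_zap_TenA[OF h h, of "gm M a x" a "gm M a y"]
    by (simp_all add: SAbZ_zap_Cmp[OF m(1) h] SAbZ_zap_Cmp[OF hh m'] SSet_sap_Cmp[OF n k(1)] SSet_sap_Cmp[OF kk n'(1)]
        SSet_sap_TenA[OF k(1) k(1)] n'(2) k(2,3) m(2) Z M)
  show "?L1 = ?R1 \<longleftrightarrow> ?L2 = ?R2"
  proof
    assume eq: "?L1 = ?R1"
    show "?L2 = ?R2"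
    proof (rule SSet_Hom_eqI[OF SSet.Cmp[OF n k(1)] SSet.Cmp[OF kk n'(1)]])
      fix a z assume "z \<in> fo (Ten SSet (acar M) (acar M)) a"
      then obtain x y where "z = pr x y" "x \<in> fo (acar M) a" "y \<in> fo (acar M) a" by (auto elim!: set_prodE)
      then show "sap ?L2 a z = sap ?R2 a z" using L1 R1 eq by metis
    qed
  next
    assume eq: "?L2 = ?R2"
    show "?L1 = ?R1"
      by (rule SAbZ_ZA2_eqI[OF SAbZ.Cmp[OF m(1) h] SAbZ.Cmp[OF hh m']]) (simp only: L1 R1 eq)
  qed
  have L: "zap (Cmp SAbZ h (aone (Zalg_ob M))) a (zz 1) = sap (Cmp SSet k (aone M)) a pt" for a
    using M by (simp add: SAbZ_zap_Cmp[OF e(1) h] SSet_sap_Cmp[OF u k(1)] e(2) k(2))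
  show "Cmp SAbZ h (aone (Zalg_ob M)) = aone R \<longleftrightarrow> Cmp SSet k (aone M) = aone (U_alg R)"
  proof
    assume eq: "Cmp SAbZ h (aone (Zalg_ob M)) = aone R"
    show "Cmp SSet k (aone M) = aone (U_alg R)"
      by (rule SSet_Hom_eqI[OF SSet.Cmp[OF u k(1)] u'(1)]) (use L eq u'(2) in auto)
  next
    assume eq: "Cmp SSet k (aone M) = aone (U_alg R)"
    show "Cmp SAbZ h (aone (Zalg_ob M)) = aone R"
      by (rule SAbZ_One_eqI[OF SAbZ.Cmp[OF e(1) h] e']) (simp only: L eq u'(2))
  qed
qed

lemma represents_Zalg:
  "represents (Alg SSet) (Alg SAbZ) Zalg (\<lambda>M R. Hom (Alg SSet) M (fo U_fun R))
     (\<lambda>f g k. Cmp (Alg SSet) (fa U_fun g) (Cmp (Alg SSet) k f))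
     (\<lambda>(M :: ('u sset, 'u sset_arr) alg) R h. (M, adj (acar M) (acar R) (fst (snd h)), U_alg R))"
  unfolding represents_def
proof (intro conjI ballI)
  show "is_functor (Alg SSet) (Alg SAbZ) (Zalg :: (('u sset, 'u sset_arr) alg, ('u sset, 'u sset_arr) alg_arr, _, _) fctr)"
    by (rule functor_Zalg)
next
  fix M :: "('u sset, 'u sset_arr) alg" and R :: "('u asab, 'u asab_arr) alg"
  assume "M \<in> Obj (Alg SSet)" "R \<in> Obj (Alg SAbZ)"
  then have M: "is_alg SSet M" and R: "is_alg SAbZ R" by (simp_all add: Alg_simps)
  let ?adj = "adj (acar M) (acar R)"
  note bij = bij_betw_adj[OF SSet_alg_Hom(2)[OF M] SAbZ_alg_Hom(1)[OF R]]
  note iff = adj_alg_iff[OF M R]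
  have fo: "fo Zalg M = Zalg_ob M" "fo U_fun R = U_alg R" by (simp_all add: Zalg_def U_fun_def)
  have mem: "(Zalg_ob M, h, R) \<in> Hom (Alg SAbZ) (Zalg_ob M) R \<longleftrightarrow> (M, ?adj h, U_alg R) \<in> Hom (Alg SSet) M (U_alg R)"
    if "h \<in> Hom SAbZ (ZA (acar M)) (acar R)" for h
    using that iff[OF that] adj_Hom(1)[OF SSet_alg_Hom(2)[OF M] that] M R is_alg_U[OF R] is_alg_Zalg[OF M]
    by (simp add: Alg_simps)
  show "bij_betw (\<lambda>h. (M, ?adj (fst (snd h)), U_alg R)) (Hom (Alg SAbZ) (fo Zalg M) R) (Hom (Alg SSet) M (fo U_fun R))"
    unfolding fo bij_betw_def
  proof
    have H: "\<exists>f. h = (Zalg_ob M, f, R) \<and> f \<in> Hom SAbZ (ZA (acar M)) (acar R)" if "h \<in> Hom (Alg SAbZ) (Zalg_ob M) R" for h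
      using that unfolding Alg_simps(2) by auto
    show "inj_on (\<lambda>h. (M, ?adj (fst (snd h)), U_alg R)) (Hom (Alg SAbZ) (Zalg_ob M) R)"
    proof (rule inj_onI)
      fix h h' assume h: "h \<in> Hom (Alg SAbZ) (Zalg_ob M) R" and h': "h' \<in> Hom (Alg SAbZ) (Zalg_ob M) R"
        and eq: "(M, ?adj (fst (snd h)), U_alg R) = (M, ?adj (fst (snd h')), U_alg R)"
      obtain f f' where f: "h = (Zalg_ob M, f, R)" "f \<in> Hom SAbZ (ZA (acar M)) (acar R)"
        "h' = (Zalg_ob M, f', R)" "f' \<in> Hom SAbZ (ZA (acar M)) (acar R)" using H[OF h] H[OF h'] by blast
      have "?adj f = ?adj f'" using eq by (simp add: f(1,3))
      then show "h = h'" using inj_onD[OF bij_betw_imp_inj_on[OF bij] _ f(2,4)] f(1,3) by simp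
    qed
    show "(\<lambda>h. (M, ?adj (fst (snd h)), U_alg R)) ` Hom (Alg SAbZ) (Zalg_ob M) R = Hom (Alg SSet) M (U_alg R)"
    proof (intro equalityI subsetI)
      fix k assume "k \<in> (\<lambda>h. (M, ?adj (fst (snd h)), U_alg R)) ` Hom (Alg SAbZ) (Zalg_ob M) R"
      then obtain h where h: "h \<in> Hom (Alg SAbZ) (Zalg_ob M) R" "k = (M, ?adj (fst (snd h)), U_alg R)" by blast
      obtain f where f: "h = (Zalg_ob M, f, R)" "f \<in> Hom SAbZ (ZA (acar M)) (acar R)" using H[OF h(1)] by blast
      show "k \<in> Hom (Alg SSet) M (U_alg R)" using mem[OF f(2)] h f(1) by simp
    next
      fix k assume k: "k \<in> Hom (Alg SSet) M (U_alg R)"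
      then obtain k' where k': "k = (M, k', U_alg R)" "k' \<in> Hom SSet (acar M) (U_ob (acar R))"
        unfolding Alg_simps(2) by auto
      then have "k' \<in> ?adj ` Hom SAbZ (ZA (acar M)) (acar R)"
        using bij unfolding bij_betw_def by blast
      then obtain f where f: "f \<in> Hom SAbZ (ZA (acar M)) (acar R)" "k' = ?adj f" by blast
      then have "(Zalg_ob M, f, R) \<in> Hom (Alg SAbZ) (Zalg_ob M) R" using mem[OF f(1)] k k' by simp
      then show "k \<in> (\<lambda>h. (M, ?adj (fst (snd h)), U_alg R)) ` Hom (Alg SAbZ) (Zalg_ob M) R"
        by (rule rev_image_eqI) (simp add: k'(1) f(2))
    qed
  qed
next
  fix F :: "('u sset, 'u sset_arr) alg_arr" and G H :: "('u asab, 'u asab_arr) alg_arr"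
  assume F: "F \<in> Arr (Alg SSet)" and G: "G \<in> Arr (Alg SAbZ)" and H: "H \<in> Hom (Alg SAbZ) (fo Zalg (Cod (Alg SSet) F)) (Dom (Alg SAbZ) G)"
  obtain M' f M where f: "F = (M', f, M)" "f \<in> Hom SSet (acar M') (acar M)"
    using Arr_Hom[OF F] unfolding Alg_simps(2) by blast
  obtain R g R' where g: "G = (R, g, R')" "g \<in> Hom SAbZ (acar R) (acar R')"
    using Arr_Hom[OF G] unfolding Alg_simps(2) by blast
  have "H \<in> Hom (Alg SAbZ) (Zalg_ob M) R" using H by (simp add: f(1) g(1) Alg_simps(3,4) Zalg_def)
  then obtain h where h: "H = (Zalg_ob M, h, R)" "h \<in> Hom SAbZ (ZA (acar M)) (acar R)"
    unfolding Alg_simps(2) by auto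
  show "(Dom (Alg SSet) F, adj (acar (Dom (Alg SSet) F)) (acar (Cod (Alg SAbZ) G)) (fst (snd (Cmp (Alg SAbZ) G (Cmp (Alg SAbZ) H (fa Zalg F))))),
        U_alg (Cod (Alg SAbZ) G)) =
      Cmp (Alg SSet) (fa U_fun G) (Cmp (Alg SSet) (Cod (Alg SSet) F,
        adj (acar (Cod (Alg SSet) F)) (acar (Dom (Alg SAbZ) G)) (fst (snd H)), U_alg (Dom (Alg SAbZ) G)) F)"
    using adj_natural[OF f(2) h(2) g(2)]
    by (simp add: f(1) g(1) h(1) Zalg_arr[OF f(2)] Alg_simps U_fun_def)
qed

section \<open>Twisting maps into a ring and into its monoid\<close>

lemma adj_twist_iff:
  assumes X: "is_functor (op_cat Delta) Sets (X :: 'u sset)" and R: "is_alg SAbZ R"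
    and h: "h \<in> Hom SAbZ (ZA (dec_col X 1)) (acar R)"
  shows "h \<in> twist SAbZ (bob_ten X) R \<longleftrightarrow> adj (dec_col X 1) (acar R) h \<in> twist SSet (bob_set X) (U_alg R)"
proof -
  define k where "k = adj (dec_col X 1) (acar R) h"
  note Y = dec_col_functor[OF X]
  note k = adj_Hom[OF Y h, folded k_def]
  have act: "act_end 2 \<in> Arr Delta" "Dom Delta (act_end 2) = 1" "Cod Delta (act_end 2) = 1 + 1"
    "act_end 0 \<in> Arr Delta" "Dom Delta (act_end 0) = 1" "Cod Delta (act_end 0) = 0"
    using Delta_act_Delta[OF act_end_arr(1)] act_end_arr(2,3) by (metis one_add_one)+
  note d = dec_Hom[OF X act(1), unfolded act(2,3)] and s = dec_Hom[OF X act(4), unfolded act(5,6)]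
  note zd = ZA_dec_Hom[OF X act(1), unfolded act(2,3)] and zs = ZA_dec_Hom[OF X act(4), unfolded act(5,6)]
  note b = bmul_set[OF X, where n = 1 and m = 1] and zb = bmul_ten[OF X, where n = 1 and m = 1]
  note c = bone_set[OF X] and zc = bone_ten[OF X]
  note m' = SAbZ_alg_Hom(2)[OF R] and e' = SAbZ_alg_Hom(3)[OF R] and n' = amul_U[OF R] and u' = aone_U[OF R]
  note hh = SAbZ.TenA_Hom[OF h h] and kk = SSet.TenA_Hom[OF k(1) k(1)]
  let ?L1 = "Cmp SAbZ h (ZA_arr (fa (dec X) (act_end 2)))"
  let ?R1 = "Cmp SAbZ (amul R) (Cmp SAbZ (TenA SAbZ h h) (bmul (bob_ten X) 1 1))"
  let ?L2 = "Cmp SSet k (fa (dec X) (act_end 2))"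
  let ?R2 = "Cmp SSet (amul (U_alg R)) (Cmp SSet (TenA SSet k k) (bmul (bob_set X) 1 1))"
  let ?L3 = "Cmp SAbZ h (ZA_arr (fa (dec X) (act_end 0)))"
  let ?R3 = "Cmp SAbZ (aone R) (bone (bob_ten X))"
  let ?L4 = "Cmp SSet k (fa (dec X) (act_end 0))"
  let ?R4 = "Cmp SSet (aone (U_alg R)) (bone (bob_set X))"
  have eq12: "zap ?L1 a (zg X (1 + 1) a x) = sap ?L2 a x" "zap ?R1 a (zg X (1 + 1) a x) = sap ?R2 a x"
    if x: "x \<in> fo (dec_col X (1 + 1)) a" for a x
  proof -
    have g: "zg X (1 + 1) a x \<in> carrier (lcar (ZA (dec_col X (1 + 1))) a)" using x by simp
    have cl: "sh X (act_end 2) a x \<in> fo (dec_col X 1) a" "sh X (front 1 1) a x \<in> fo (dec_col X 1) a"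
      "sh X (rear 1 1) a x \<in> fo (dec_col X 1) a"
      using X act x by (auto intro: sh_closed)
    show "zap ?L1 a (zg X (1 + 1) a x) = sap ?L2 a x"
      unfolding SAbZ_zap_Cmp[OF zd(1) h g] zd(2)[OF x] SSet_sap_Cmp[OF d k(1) x] k(2)[OF cl(1)] by (rule refl)
    show "zap ?R1 a (zg X (1 + 1) a x) = sap ?R2 a x"
      unfolding SAbZ_zap_Cmp[OF SAbZ.Cmp[OF zb(1) hh] m' g] SAbZ_zap_Cmp[OF zb(1) hh g] zb(2)[OF x]
        SSet_sap_Cmp[OF SSet.Cmp[OF b(1) kk] n'(1) x] SSet_sap_Cmp[OF b(1) kk x] b(2)[OF x]
      using SAbZ_zap_TenA[OF h h, of "zg X 1 a (sh X (front 1 1) a x)" a "zg X 1 a (sh X (rear 1 1) a x)"] cl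
        k(2)[OF cl(2)] k(2)[OF cl(3)] k(3)[OF cl(2)] k(3)[OF cl(3)]
      by (simp add: SSet_sap_TenA[OF k(1) k(1)] n'(2))
  qed
  have eq34: "zap ?L3 a (zg X 0 a x) = sap ?L4 a x" "zap ?R3 a (zg X 0 a x) = sap ?R4 a x"
    if x: "x \<in> fo (dec_col X 0) a" for a x
  proof -
    have g: "zg X 0 a x \<in> carrier (lcar (ZA (dec_col X 0)) a)" using x by simp
    have cl: "sh X (act_end 0) a x \<in> fo (dec_col X 1) a"
      using X act x by (auto intro: sh_closed)
    show "zap ?L3 a (zg X 0 a x) = sap ?L4 a x"
      unfolding SAbZ_zap_Cmp[OF zs(1) h g] zs(2)[OF x] SSet_sap_Cmp[OF s k(1) x] k(2)[OF cl] by (rule refl)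
    show "zap ?R3 a (zg X 0 a x) = sap ?R4 a x"
      unfolding SAbZ_zap_Cmp[OF zc(1) e' g] zc(2)[OF x] SSet_sap_Cmp[OF c(1) u'(1) x] c(2)[OF x] u'(2) by (rule refl)
  qed
  have 1: "?L1 = ?R1 \<longleftrightarrow> ?L2 = ?R2"
  proof
    assume eq: "?L1 = ?R1"
    show "?L2 = ?R2"
      by (rule SSet_Hom_eqI[OF SSet.Cmp[OF d k(1)] SSet.Cmp[OF SSet.Cmp[OF b(1) kk] n'(1)]]) (metis eq eq12)
  next
    assume eq: "?L2 = ?R2"
    show "?L1 = ?R1"
      by (rule SAbZ_ZA_eqI[OF SAbZ.Cmp[OF zd(1) h] SAbZ.Cmp[OF SAbZ.Cmp[OF zb(1) hh] m']]) (simp only: eq12 eq)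
  qed
  have 2: "?L3 = ?R3 \<longleftrightarrow> ?L4 = ?R4"
  proof
    assume eq: "?L3 = ?R3"
    show "?L4 = ?R4"
      by (rule SSet_Hom_eqI[OF SSet.Cmp[OF s k(1)] SSet.Cmp[OF c(1) u'(1)]]) (metis eq eq34)
  next
    assume eq: "?L4 = ?R4"
    show "?L3 = ?R3"
      by (rule SAbZ_ZA_eqI[OF SAbZ.Cmp[OF zs(1) h] SAbZ.Cmp[OF zc(1) e']]) (simp only: eq34 eq)
  qed
  show ?thesis
    unfolding twist_def fo_bfun_ten[OF X] fo_bfun_set[OF X] fa_bfun_ten[OF X] bfun_set[OF X] k_def[symmetric] mem_Collect_eq
      acar_U_alg 1 2 using h k(1) by (simp add: dec_def)
qed

lemma bij_betw_adj_twist: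
  assumes X: "is_functor (op_cat Delta) Sets (X :: 'u sset)" and R: "is_alg SAbZ R"
  shows "bij_betw (adj (dec_col X 1) (acar R)) (twist SAbZ (bob_ten X) R) (twist SSet (bob_set X) (U_alg R))"
proof -
  let ?adj = "adj (dec_col X 1) (acar R)"
  have bij: "bij_betw ?adj (Hom SAbZ (ZA (dec_col X 1)) (acar R)) (Hom SSet (dec_col X 1) (U_ob (acar R)))"
    by (rule bij_betw_adj[OF dec_col_functor[OF X] SAbZ_alg_Hom(1)[OF R]])
  have sub: "twist SAbZ (bob_ten X) R \<subseteq> Hom SAbZ (ZA (dec_col X 1)) (acar R)"
    "twist SSet (bob_set X) (U_alg R) \<subseteq> Hom SSet (dec_col X 1) (U_ob (acar R))"
    unfolding twist_def fo_bfun_ten[OF X] fo_bfun_set[OF X] acar_U_alg by blast+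
  show ?thesis unfolding bij_betw_def
  proof
    show "inj_on ?adj (twist SAbZ (bob_ten X) R)"
      using bij sub(1) by (auto simp: bij_betw_def intro: inj_on_subset)
    show "?adj ` twist SAbZ (bob_ten X) R = twist SSet (bob_set X) (U_alg R)"
    proof (intro equalityI subsetI)
      fix k assume "k \<in> ?adj ` twist SAbZ (bob_ten X) R"
      then show "k \<in> twist SSet (bob_set X) (U_alg R)" using adj_twist_iff[OF X R] sub(1) by blast
    next
      fix k assume k: "k \<in> twist SSet (bob_set X) (U_alg R)"
      then have "k \<in> ?adj ` Hom SAbZ (ZA (dec_col X 1)) (acar R)"
        using sub(2) bij unfolding bij_betw_def by blast
      then obtain h where "h \<in> Hom SAbZ (ZA (dec_col X 1)) (acar R)" "k = ?adj h" by blast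
      then show "k \<in> ?adj ` twist SAbZ (bob_ten X) R" using adj_twist_iff[OF X R] k by blast
    qed
  qed
qed

lemma cobar_free:
  fixes cobar :: "(('u sset, 'u sset_arr) bob, ('u sset, 'u sset_arr) bob_arr,
                   ('u sset, 'u sset_arr) alg, ('u sset, 'u sset_arr) alg_arr) fctr"
    and cobar_ten :: "(('u asab, 'u asab_arr) bob, ('u asab, 'u asab_arr) bob_arr,
                       ('u asab, 'u asab_arr) alg, ('u asab, 'u asab_arr) alg_arr) fctr"
  assumes "is_cobar SSet cobar" "is_cobar SAbZ cobar_ten"
  shows "naturally_isomorphic SSet (Alg SAbZ)
           (cobar_ten \<circ>\<^sub>F rho SAbZ \<circ>\<^sub>F dec_ten \<circ>\<^sub>F Zcoalg)
           (Zalg \<circ>\<^sub>F cobar \<circ>\<^sub>F rho SSet \<circ>\<^sub>F dec_set)"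
proof -
  let ?V = "rho SSet \<circ>\<^sub>F dec_set :: ('u sset, 'u sset_arr, _, _) fctr"
  let ?W = "rho SAbZ \<circ>\<^sub>F dec_ten \<circ>\<^sub>F Zcoalg :: ('u sset, 'u sset_arr, _, _) fctr"
  let ?P = "\<lambda>X R. twist SSet (fo ?V X) (fo U_fun R)"
  let ?act = "\<lambda>f g k. Cmp SSet (fst (snd (fa U_fun g))) (Cmp SSet k (fst (snd (fa ?V f)) 1))"
  have C: "category (SSet :: ('u sset, 'u sset_arr) moncat)" by (rule SSet.category_axioms)
  obtain \<Phi> where "represents (Bcat SSet) (Alg SSet) cobar (twist SSet)
      (\<lambda>f g k. Cmp SSet (fst (snd g)) (Cmp SSet k (fst (snd f) 1))) \<Phi>"
    using SSet.represents_twist[OF assms(1)] by blast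
  from represents_left_adjoint[OF represents_fcomp[OF this functor_bob_set C] functor_U represents_Zalg C
      SSet.category_Alg SAbZ.category_Alg]
  obtain \<Phi>1 where 1: "represents SSet (Alg SAbZ) (Zalg \<circ>\<^sub>F cobar \<circ>\<^sub>F ?V) ?P ?act \<Phi>1" by blast
  obtain \<Phi>' where "represents (Bcat SAbZ) (Alg SAbZ) cobar_ten (twist SAbZ)
      (\<lambda>f g k. Cmp SAbZ (fst (snd g)) (Cmp SAbZ k (fst (snd f) 1))) \<Phi>'"
    using SAbZ.represents_twist[OF assms(2)] by blast
  note 2 = represents_fcomp[OF this functor_bob_ten C]
  have "represents SSet (Alg SAbZ) (cobar_ten \<circ>\<^sub>F ?W) ?P ?act
      (\<lambda>X R. adj (dec_col X 1) (acar R) \<circ> \<Phi>' (fo ?W X) R)"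
  proof (rule represents_transfer[OF 2 _ _ C SAbZ.category_Alg])
    fix X :: "'u sset" and R :: "('u asab, 'u asab_arr) alg" assume "X \<in> Obj SSet" "R \<in> Obj (Alg SAbZ)"
    then show "bij_betw (adj (dec_col X 1) (acar R)) (twist SAbZ (fo ?W X) R) (twist SSet (fo ?V X) (fo U_fun R))"
      using bij_betw_adj_twist[of X R] unfolding fo_rho_dec by (simp add: Simp_simps(1) Alg_simps(1) U_fun_def)
  next
    fix F :: "'u sset_arr" and G :: "('u asab, 'u asab_arr) alg_arr" and k assume F: "F \<in> Arr SSet" and G: "G \<in> Arr (Alg SAbZ)"
      and k: "k \<in> twist SAbZ (fo ?W (Cod SSet F)) (Dom (Alg SAbZ) G)"
    obtain X Y where F': "F \<in> Hom SSet X Y" "Dom SSet F = X" "Cod SSet F = Y" using F by (simp add: Hom_def)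
    obtain R g S where G': "G = (R, g, S)" "g \<in> Hom SAbZ (acar R) (acar S)"
      using Arr_Hom[OF G] unfolding Alg_simps(2) by blast
    have "k \<in> Hom SAbZ (ZA (dec_col Y 1)) (acar R)"
      using k unfolding fo_rho_dec twist_def F'(3) G'(1) Alg_simps(3) fo_bfun_ten[OF Simp_HomD(3)[OF F'(1)]] by blast
    from adj_natural[OF decm_Hom(1)[OF F'(1), of 1] this G'(2)]
    show "adj (dec_col (Dom SSet F) 1) (acar (Cod (Alg SAbZ) G))
        (Cmp SAbZ (fst (snd G)) (Cmp SAbZ k (fst (snd (fa ?W F)) 1))) =
      ?act F G (adj (dec_col (Cod SSet F) 1) (acar (Dom (Alg SAbZ) G)) k)"
      unfolding F'(2,3) fa_rho_dec[OF F'(1)] by (simp add: G'(1) U_fun_def Alg_simps(3,4))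
  qed
  from naturally_isomorphic_if_represents[OF this 1 C SAbZ.category_Alg] show ?thesis .
qed

end

theorem lemma6p38:
  fixes cobar :: "(('u sset, 'u sset_arr) bob, ('u sset, 'u sset_arr) bob_arr,
                   ('u sset, 'u sset_arr) alg, ('u sset, 'u sset_arr) alg_arr) fctr"
    and cobar_ten :: "(('u asab, 'u asab_arr) bob, ('u asab, 'u asab_arr) bob_arr,
                       ('u asab, 'u asab_arr) alg, ('u asab, 'u asab_arr) alg_arr) fctr"
  assumes "infinite (UNIV :: 'u set)"
    and "is_cobar SSet cobar"
    and "is_cobar SAbZ cobar_ten"
  shows "naturally_isomorphic SSet (Alg SAbZ)
           (cobar_ten \<circ>\<^sub>F rho SAbZ \<circ>\<^sub>F dec_ten \<circ>\<^sub>F Zcoalg)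
           (Zalg \<circ>\<^sub>F cobar \<circ>\<^sub>F rho SSet \<circ>\<^sub>F dec_set)"
proof -
  interpret infinite_universe "TYPE('u)" by unfold_locales (rule assms(1))
  show ?thesis by (rule cobar_free[OF assms(2,3)])
qed

end
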